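(* Let $G$ be an amenable, unimodular, locally compact group. Then $\mathrm{PF}_p(G)$ is directly finite for all $1<p<\infty$.
   Context: Algebras need not be commutative nor have an identity. For $a,b$ in an algebra (or ring) $R$ put $a\bullet b := a+b-ab$. $R$ is called directly finite if for all $a,b\in R$, $a\bullet b=0$ implies $b\bullet a=0$. Fix a left Haar measure on $G$. $C_c(G)$ is the space of continuous compactly supported functions $G\to\mathbb{C}$, an algebra under convolution. For $p\in(1,\infty)$, $\lambda_p: C_c(G)\to\mathcal{B}(L^p(G))$ is the homomorphism $\lambda_p(f)(h)=f*h$. The algebra of $p$-pseudofunctions $\mathrm{PF}_p(G)$ is the operator-norm closure of $\lambda_p(C_c(G))$ in $\mathcal{B}(L^p(G))$. *)

theory Defs
  imports "HOL-Analysis.Analysis" "HOL-Algebra.Ring"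
begin

text \<open>
  Groups are types of class \<open>topological_group_add\<close>. This class does not assume commutativity,
  so the group law of \<open>G\<close>, although written \<open>+\<close>, is an arbitrary one: \<open>x + y\<close> stands for \<open>x y\<close> and
  \<open>- x\<close> for the inverse of \<open>x\<close>.
\<close>

subsection \<open>Direct finiteness\<close>

definition bullet :: "('r, 'm) ring_scheme \<Rightarrow> 'r \<Rightarrow> 'r \<Rightarrow> 'r" where
  "bullet R a b = a \<oplus>\<^bsub>R\<^esub> b \<ominus>\<^bsub>R\<^esub> a \<otimes>\<^bsub>R\<^esub> b"

text \<open>
  The field \<open>one\<close> of the record is not used, so that \<open>R\<close> may be a ring without identity.
\<close>

definition directly_finite :: "('r, 'm) ring_scheme \<Rightarrow> bool" where
  "directly_finite R \<longleftrightarrow>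
     (\<forall>a\<in>carrier R. \<forall>b\<in>carrier R. bullet R a b = \<zero>\<^bsub>R\<^esub> \<longrightarrow> bullet R b a = \<zero>\<^bsub>R\<^esub>)"

subsection \<open>Haar measure\<close>

definition radon_measure :: "'a::topological_space measure \<Rightarrow> bool" where
  "radon_measure \<mu> \<longleftrightarrow>
     sets \<mu> = sets borel \<and>
     (\<forall>K. compact K \<longrightarrow> emeasure \<mu> K < \<infinity>) \<and>
     (\<forall>E\<in>sets borel. emeasure \<mu> E = (INF U\<in>{U. open U \<and> E \<subseteq> U}. emeasure \<mu> U)) \<and>
     (\<forall>U. open U \<longrightarrow> emeasure \<mu> U = (SUP K\<in>{K. compact K \<and> K \<subseteq> U}. emeasure \<mu> K))"

definition left_haar_measure :: "'a::topological_group_add measure \<Rightarrow> bool" where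
  "left_haar_measure \<mu> \<longleftrightarrow>
     radon_measure \<mu> \<and> emeasure \<mu> UNIV \<noteq> 0 \<and>
     (\<forall>a. \<forall>E\<in>sets borel. emeasure \<mu> ((\<lambda>x. a + x) ` E) = emeasure \<mu> E)"

text \<open>
  Unimodularity of the group, expressed through a left Haar measure \<open>\<mu>\<close>; by uniqueness of Haar
  measure the choice of \<open>\<mu>\<close> does not matter.
\<close>

definition unimodular :: "'a::topological_group_add measure \<Rightarrow> bool" where
  "unimodular \<mu> \<longleftrightarrow> (\<forall>a. \<forall>E\<in>sets borel. emeasure \<mu> ((\<lambda>x. x + a) ` E) = emeasure \<mu> E)"

subsection \<open>Amenability\<close>

text \<open>
  As usual for groups that need not be \<open>\<sigma>\<close>-compact, \<open>L\<^sup>\<infinity>(G)\<close> consists of the locally measurable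
  functions that are bounded off a locally null set, modulo equality off a locally null set.
\<close>

definition locally_AE :: "'a measure \<Rightarrow> ('a \<Rightarrow> bool) \<Rightarrow> bool" where
  "locally_AE \<mu> P \<longleftrightarrow> (\<forall>E\<in>sets \<mu>. emeasure \<mu> E < \<infinity> \<longrightarrow> (AE x in \<mu>. x \<in> E \<longrightarrow> P x))"

definition Linf_fun :: "'a measure \<Rightarrow> ('a \<Rightarrow> complex) set" where
  "Linf_fun \<mu> =
     {f. (\<forall>E\<in>sets \<mu>. emeasure \<mu> E < \<infinity> \<longrightarrow> set_borel_measurable \<mu> E f) \<and>
         (\<exists>C. locally_AE \<mu> (\<lambda>x. norm (f x) \<le> C))}"

definition Linf_norm :: "'a measure \<Rightarrow> ('a \<Rightarrow> complex) \<Rightarrow> real" where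
  "Linf_norm \<mu> f = Inf {C. 0 \<le> C \<and> locally_AE \<mu> (\<lambda>x. norm (f x) \<le> C)}"

text \<open>
  A mean is a linear functional \<open>m\<close> on \<open>L\<^sup>\<infinity>(G)\<close> with \<open>\<parallel>m\<parallel> = m(1) = 1\<close>. It is represented by a functional
  on functions; the norm bound forces it to agree on functions that are equal locally
  almost everywhere.
\<close>

definition left_invariant_mean ::
    "'a::topological_group_add measure \<Rightarrow> (('a \<Rightarrow> complex) \<Rightarrow> complex) \<Rightarrow> bool" where
  "left_invariant_mean \<mu> m \<longleftrightarrow>
     (\<forall>f\<in>Linf_fun \<mu>. \<forall>g\<in>Linf_fun \<mu>. m (\<lambda>x. f x + g x) = m f + m g) \<and>
     (\<forall>c. \<forall>f\<in>Linf_fun \<mu>. m (\<lambda>x. c * f x) = c * m f) \<and>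
     (\<forall>f\<in>Linf_fun \<mu>. norm (m f) \<le> Linf_norm \<mu> f) \<and>
     m (\<lambda>x. 1) = 1 \<and>
     (\<forall>a. \<forall>f\<in>Linf_fun \<mu>. m (\<lambda>x. f (- a + x)) = m f)"

definition amenable :: "'a::topological_group_add measure \<Rightarrow> bool" where
  "amenable \<mu> \<longleftrightarrow> (\<exists>m. left_invariant_mean \<mu> m)"

subsection \<open>The space \<open>L\<^sup>p(G)\<close> and its bounded operators\<close>

definition Lp_fun :: "'a measure \<Rightarrow> real \<Rightarrow> ('a \<Rightarrow> complex) set" where
  "Lp_fun \<mu> p = {f \<in> borel_measurable \<mu>. integrable \<mu> (\<lambda>x. norm (f x) powr p)}"

definition Lp_rel :: "'a measure \<Rightarrow> real \<Rightarrow> (('a \<Rightarrow> complex) \<times> ('a \<Rightarrow> complex)) set" where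
  "Lp_rel \<mu> p = {(f, g). f \<in> Lp_fun \<mu> p \<and> g \<in> Lp_fun \<mu> p \<and> (AE x in \<mu>. f x = g x)}"

definition Lp :: "'a measure \<Rightarrow> real \<Rightarrow> ('a \<Rightarrow> complex) set set" where
  "Lp \<mu> p = Lp_fun \<mu> p // Lp_rel \<mu> p"

abbreviation Lp_class :: "'a measure \<Rightarrow> real \<Rightarrow> ('a \<Rightarrow> complex) \<Rightarrow> ('a \<Rightarrow> complex) set" where
  "Lp_class \<mu> p f \<equiv> Lp_rel \<mu> p `` {f}"

text \<open>
  As in \<^theory>\<open>HOL.Equiv_Relations\<close>, operations on classes are defined as the union of the
  (identical) classes obtained from all representatives.
\<close>

definition Lp_add ::
    "'a measure \<Rightarrow> real \<Rightarrow> ('a \<Rightarrow> complex) set \<Rightarrow> ('a \<Rightarrow> complex) set \<Rightarrow> ('a \<Rightarrow> complex) set" where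
  "Lp_add \<mu> p F G = (\<Union>f\<in>F. \<Union>g\<in>G. Lp_class \<mu> p (\<lambda>x. f x + g x))"

definition Lp_scale ::
    "'a measure \<Rightarrow> real \<Rightarrow> complex \<Rightarrow> ('a \<Rightarrow> complex) set \<Rightarrow> ('a \<Rightarrow> complex) set" where
  "Lp_scale \<mu> p c F = (\<Union>f\<in>F. Lp_class \<mu> p (\<lambda>x. c * f x))"

definition Lp_norm :: "'a measure \<Rightarrow> real \<Rightarrow> ('a \<Rightarrow> complex) set \<Rightarrow> real" where
  "Lp_norm \<mu> p F = the_elem ((\<lambda>f. (LINT x|\<mu>. norm (f x) powr p) powr (1 / p)) ` F)"

definition Lp_bounded_op ::
    "'a measure \<Rightarrow> real \<Rightarrow> (('a \<Rightarrow> complex) set \<Rightarrow> ('a \<Rightarrow> complex) set) \<Rightarrow> bool" where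
  "Lp_bounded_op \<mu> p T \<longleftrightarrow>
     T \<in> Lp \<mu> p \<rightarrow>\<^sub>E Lp \<mu> p \<and>
     (\<forall>F\<in>Lp \<mu> p. \<forall>G\<in>Lp \<mu> p. T (Lp_add \<mu> p F G) = Lp_add \<mu> p (T F) (T G)) \<and>
     (\<forall>c. \<forall>F\<in>Lp \<mu> p. T (Lp_scale \<mu> p c F) = Lp_scale \<mu> p c (T F)) \<and>
     (\<exists>C. \<forall>F\<in>Lp \<mu> p. Lp_norm \<mu> p (T F) \<le> C * Lp_norm \<mu> p F)"

definition bounded_ops ::
    "'a measure \<Rightarrow> real \<Rightarrow> (('a \<Rightarrow> complex) set \<Rightarrow> ('a \<Rightarrow> complex) set) ring" where
  "bounded_ops \<mu> p =
     \<lparr>carrier = {T. Lp_bounded_op \<mu> p T},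
      mult = (\<lambda>S T. compose (Lp \<mu> p) S T),
      one = (\<lambda>F\<in>Lp \<mu> p. F),
      zero = (\<lambda>F\<in>Lp \<mu> p. Lp_class \<mu> p (\<lambda>x. 0)),
      add = (\<lambda>S T. \<lambda>F\<in>Lp \<mu> p. Lp_add \<mu> p (S F) (T F))\<rparr>"

definition op_norm ::
    "'a measure \<Rightarrow> real \<Rightarrow> (('a \<Rightarrow> complex) set \<Rightarrow> ('a \<Rightarrow> complex) set) \<Rightarrow> real" where
  "op_norm \<mu> p T =
     Inf {C. 0 \<le> C \<and> (\<forall>F\<in>Lp \<mu> p. Lp_norm \<mu> p (T F) \<le> C * Lp_norm \<mu> p F)}"

subsection \<open>Pseudofunctions\<close>

definition Cc :: "('a::topological_space \<Rightarrow> complex) set" where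
  "Cc = {f. continuous_on UNIV f \<and> compact (closure {x. f x \<noteq> 0})}"

text \<open>
  For \<open>f \<in> C\<^sub>c(G)\<close> and \<open>h \<in> L\<^sup>p(G)\<close> the integrand is integrable for every \<open>x\<close>, since \<open>h\<close> is locally integrable
  and the modular function is bounded on compact sets.
\<close>

definition convolution ::
    "'a::topological_group_add measure \<Rightarrow> ('a \<Rightarrow> complex) \<Rightarrow> ('a \<Rightarrow> complex) \<Rightarrow> 'a \<Rightarrow> complex" where
  "convolution \<mu> f h x = (LINT y|\<mu>. f y * h (- y + x))"

definition lambda_p ::
    "'a::topological_group_add measure \<Rightarrow> real \<Rightarrow> ('a \<Rightarrow> complex) \<Rightarrow>
     ('a \<Rightarrow> complex) set \<Rightarrow> ('a \<Rightarrow> complex) set" where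
  "lambda_p \<mu> p f = (\<lambda>H\<in>Lp \<mu> p. \<Union>h\<in>H. Lp_class \<mu> p (convolution \<mu> f h))"

text \<open>
  The operations are those of the algebra of bounded operators; its identity, left in the
  field \<open>one\<close>, need not belong to the carrier.
\<close>

definition PF ::
    "'a::topological_group_add measure \<Rightarrow> real \<Rightarrow>
     (('a \<Rightarrow> complex) set \<Rightarrow> ('a \<Rightarrow> complex) set) ring" where
  "PF \<mu> p = bounded_ops \<mu> p
     \<lparr>carrier := {T \<in> carrier (bounded_ops \<mu> p).
        \<forall>\<epsilon>>0. \<exists>f\<in>Cc. op_norm \<mu> p (T \<ominus>\<^bsub>bounded_ops \<mu> p\<^esub> lambda_p \<mu> p f) < \<epsilon>}\<rparr>"

end

theory Submission
  imports Defs
begin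

text \<open>
  For amenable \<open>G\<close>, a theorem of Herz bounds the norm of \<open>h \<mapsto> f * h\<close> on \<open>L\<^sup>2\<close> by a constant times its norm on \<open>L\<^sup>p\<close>:
  the coefficients \<open>x \<mapsto> \<integral>u(x\<^sup>-\<^sup>1s)v(s)ds\<close> of the regular representation are multiplied by \<open>\<integral>\<psi>(x\<^sup>-\<^sup>1t)\<^sup>1\<^sup>/\<^sup>p\<psi>(t)\<^sup>1\<^sup>/\<^sup>q dt\<close>, which
  is close to \<open>1\<close> on compact sets by Reiter's condition, and Khintchine's inequality compares the products with
  pairings of \<open>L\<^sup>p\<close> and \<open>L\<^sup>q\<close>. So one may argue with convolution operators on \<open>L\<^sup>2\<close>, where unimodularity makes
  \<open>C\<^sub>c(G)\<close> a Hilbert algebra with the trace \<open>f \<mapsto> f(0)\<close>. If \<open>a \<bullet> b = 0\<close> then \<open>b \<bullet> a\<close> is an idempotent, and its trace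
  vanishes because \<open>ab\<close> and \<open>ba\<close> have the same trace; but the trace of an idempotent \<open>e\<close> dominates a multiple of the
  squared norm of \<open>e\<close>, so \<open>b \<bullet> a = 0\<close>. Since elements of the closure need not have a trace, the argument is carried
  out with sequences in \<open>C\<^sub>c(G)\<close> and with errors that tend to zero.
\<close>

section \<open>The Hahn-Banach theorem\<close>

text \<open>The involution of C_c exchanges L^p with the conjugate exponent and is not estimated in
  the L^p operator norm; elements of the closure have neither a Hilbert norm nor a trace. Hence the
  abstract part works with two norms. In \<open>N\<close>, which dominates the operator norms,
  sequences are Cauchy and errors are small; in the Hilbert norm \<open>nrm\<close> traces make
  sense. The involution enters only through \<open>nrm\<close>, and right multiplication is bounded
  there by passing to adjoints. Errors that are small in \<open>N\<close> alone become small in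
  \<open>nrm\<close> after multiplication by a fixed element of C_c, so the abstract conclusion
  concerns vectors. This is also the way back to L^p: for h in C_c the functions e_n * h converge in
  L^p to the value of the limit operator at h and in L^2 to 0, and the two limits agree almost
  everywhere. The Haar measure may fail to be sigma-finite, so product measures are avoided.
  Integrals are exchanged only for functions in C_c, by Riemann sums over finite Borel partitions of
  compact sets, and the results reach L^p by density, pointwise limits and Fatou's lemma.\<close>

definition sublinear :: "('v::real_vector \<Rightarrow> real) \<Rightarrow> bool" where
  "sublinear p \<longleftrightarrow> (\<forall>x y. p (x + y) \<le> p x + p y) \<and> (\<forall>t x. 0 \<le> t \<longrightarrow> p (t *\<^sub>R x) = t * p x)"

lemma sublinear_add: "sublinear p \<Longrightarrow> p (x + y) \<le> p x + p y"
  by (simp add: sublinear_def)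

lemma sublinear_scale: "sublinear p \<Longrightarrow> 0 \<le> t \<Longrightarrow> p (t *\<^sub>R x) = t * p x"
  by (simp add: sublinear_def)

lemma sublinear_zero: "sublinear p \<Longrightarrow> p 0 = 0"
  using sublinear_scale[of p 0 0] by simp

lemma sublinear_minus: "sublinear p \<Longrightarrow> - p (- x) \<le> p x"
  using sublinear_add[of p x "- x"] sublinear_zero[of p] by simp

text \<open>Any such \<open>P\<close> satisfies \<open>P z \<le> P (z + t *\<^sub>R c) + t * P (- c)
  \<le> q (z + t *\<^sub>R c) - t * \<delta>\<close>, and the infimum of the right-hand sides is
  taken as \<open>P\<close>. It is finite because \<open>\<delta> \<le> q c\<close>. Convexity of
  \<open>C\<close> gives subadditivity: t c + s d is t + s times a single point of
  \<open>C\<close>.\<close>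

lemma sublinear_decrease:
  fixes q :: "'v::real_vector \<Rightarrow> real"
  assumes q: "sublinear q" and C: "convex C" "C \<noteq> {}" and \<delta>: "\<And>c. c \<in> C \<Longrightarrow> \<delta> \<le> q c"
  obtains P where "sublinear P" "\<And>x. P x \<le> q x" "\<And>c. c \<in> C \<Longrightarrow> P (- c) \<le> - \<delta>"
proof
  define A where "A z = {q (z + t *\<^sub>R c) - t * \<delta> | t c. 0 \<le> t \<and> c \<in> C}" for z
  define P where "P z = Inf (A z)" for z
  have low: "- q (- z) \<le> v" if v: "v \<in> A z" for v z
  proof -
    obtain t c where tc: "v = q (z + t *\<^sub>R c) - t * \<delta>" "0 \<le> t" "c \<in> C"
      using v unfolding A_def by blast
    have "q (t *\<^sub>R c) \<le> q (z + t *\<^sub>R c) + q (- z)"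
      using sublinear_add[OF q, of "z + t *\<^sub>R c" "- z"] by simp
    moreover have "t * \<delta> \<le> q (t *\<^sub>R c)"
      using sublinear_scale[OF q tc(2)] \<delta>[OF tc(3)] tc(2) by (simp add: mult_left_mono)
    ultimately show ?thesis using tc by linarith
  qed
  have bdd: "bdd_below (A z)" for z using low by (meson bdd_belowI)
  have AI: "q (z + t *\<^sub>R c) - t * \<delta> \<in> A z" if "0 \<le> t" "c \<in> C" for z t c
    using that unfolding A_def by blast
  have ne: "A z \<noteq> {}" for z
  proof -
    obtain c where "c \<in> C" using C(2) by blast
    then show ?thesis using AI[of 0 c z] by blast
  qed
  have Ple: "P z \<le> q (z + t *\<^sub>R c) - t * \<delta>" if "0 \<le> t" "c \<in> C" for z t c
    unfolding P_def by (rule cInf_lower[OF AI[OF that] bdd])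
  show Pq: "P x \<le> q x" for x
  proof -
    obtain c where "c \<in> C" using C(2) by blast
    then show ?thesis using Ple[of 0 c x] by simp
  qed
  show "P (- c) \<le> - \<delta>" if "c \<in> C" for c
    using Ple[of 1 c "- c"] that sublinear_zero[OF q] by simp
  have PgeI: "m \<le> P z" if "\<And>t c. 0 \<le> t \<Longrightarrow> c \<in> C \<Longrightarrow> m \<le> q (z + t *\<^sub>R c) - t * \<delta>" for m z
    unfolding P_def by (rule cInf_greatest[OF ne]) (use that in \<open>auto simp: A_def\<close>)
  have add: "P (x + y) \<le> P x + P y" for x y
  proof -
    have "P (x + y) - (q (y + s *\<^sub>R d) - s * \<delta>) \<le> P x" if sd: "0 \<le> s" "d \<in> C" for s d
    proof (rule PgeI)
      fix t c assume tc: "0 \<le> (t::real)" "c \<in> C"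
      obtain e where e: "e \<in> C" "t *\<^sub>R c + s *\<^sub>R d = (t + s) *\<^sub>R e"
      proof (cases "t + s = 0")
        case True
        then have "t = 0" "s = 0" using tc sd by auto
        then show ?thesis using that[OF tc(2)] by simp
      next
        case False
        then have pos: "t + s > 0" using tc sd by linarith
        have "(t / (t + s)) *\<^sub>R c + (s / (t + s)) *\<^sub>R d \<in> C"
          by (rule convexD[OF C(1) tc(2) sd(2)]) (use tc sd pos in \<open>auto simp flip: add_divide_distrib\<close>)
        then show ?thesis
          by (rule that) (use pos in \<open>simp add: scaleR_add_right\<close>)
      qed
      have "P (x + y) \<le> q ((x + y) + (t + s) *\<^sub>R e) - (t + s) * \<delta>"
        using Ple e(1) tc sd by simp
      also have "(x + y) + (t + s) *\<^sub>R e = (x + t *\<^sub>R c) + (y + s *\<^sub>R d)"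
        using e(2) by (simp add: algebra_simps)
      also have "q \<dots> \<le> q (x + t *\<^sub>R c) + q (y + s *\<^sub>R d)"
        by (rule sublinear_add[OF q])
      finally show "P (x + y) - (q (y + s *\<^sub>R d) - s * \<delta>) \<le> q (x + t *\<^sub>R c) - t * \<delta>"
        by (simp add: algebra_simps)
    qed
    then have "P (x + y) - P x \<le> P y"
      by (intro PgeI) (smt (verit))
    then show ?thesis by simp
  qed
  have scale1: "P (t *\<^sub>R x) \<le> t * P x" if t: "0 < t" for t x
  proof -
    have "P (t *\<^sub>R x) / t \<le> P x"
    proof (rule PgeI)
      fix s c assume sc: "0 \<le> (s::real)" "c \<in> C"
      have "P (t *\<^sub>R x) \<le> q (t *\<^sub>R x + (t * s) *\<^sub>R c) - (t * s) * \<delta>"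
        using Ple sc t by simp
      also have "t *\<^sub>R x + (t * s) *\<^sub>R c = t *\<^sub>R (x + s *\<^sub>R c)"
        by (simp add: scaleR_add_right)
      also have "q \<dots> = t * q (x + s *\<^sub>R c)" using sublinear_scale[OF q] t by simp
      finally show "P (t *\<^sub>R x) / t \<le> q (x + s *\<^sub>R c) - s * \<delta>"
        using t by (simp add: field_simps)
    qed
    then show ?thesis using t by (simp add: field_simps)
  qed
  have scale: "P (t *\<^sub>R x) = t * P x" if t: "0 \<le> t" for t x
  proof (cases "t = 0")
    case True
    have "P 0 \<le> 0" using Pq[of 0] sublinear_zero[OF q] by simp
    moreover have "P 0 \<ge> 0" using add[of 0 0] by simp
    ultimately show ?thesis using True by simp
  next
    case False
    then have t: "0 < t" using t by simp
    have "P x \<le> (1 / t) * P (t *\<^sub>R x)" using scale1[of "1 / t" "t *\<^sub>R x"] t by simp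
    then have "t * P x \<le> P (t *\<^sub>R x)" using t by (simp add: field_simps)
    with scale1[OF t] show ?thesis by (simp add: antisym)
  qed
  show "sublinear P" using add scale by (simp add: sublinear_def)
qed

text \<open>A minimal sublinear functional is linear: otherwise \<open>sublinear_decrease\<close> would make it smaller.\<close>

theorem Hahn_Banach_dominated:
  fixes p :: "'v::real_vector \<Rightarrow> real"
  assumes p: "sublinear p"
  obtains L where "linear L" "\<And>x. L x \<le> p x"
proof -
  define S where "S = {q. sublinear q \<and> q \<le> p}"
  have pS: "p \<in> S" using p by (simp add: S_def)
  \<comment> \<open>The order is reversed, so that a maximal element in Zorn's lemma is a minimal
    functional.\<close>
  have po: "partial_order_on S (relation_of (\<lambda>x y. y \<le> x) S)"
    by (rule partial_order_on_relation_ofI) auto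
  have "\<exists>m\<in>S. \<forall>a\<in>S. a \<le> m \<longrightarrow> a = m"
  proof -
    have "\<exists>u\<in>S. \<forall>a\<in>C. u \<le> a" if C: "C \<in> Chains (relation_of (\<lambda>x y. y \<le> x) S)" for C
    proof (cases "C = {}")
      case True then show ?thesis using pS by blast
    next
      case False
      have CS: "C \<subseteq> S" and ch: "\<And>a b. a \<in> C \<Longrightarrow> b \<in> C \<Longrightarrow> a \<le> b \<or> b \<le> a"
        using C unfolding Chains_def relation_of_def by auto
      define u where "u x = (INF q\<in>C. q x)" for x
      \<comment> \<open>All members of the chain are at least - p (- x) at x, so the pointwise
        infimum is finite.\<close>
      have bdd: "bdd_below ((\<lambda>q. q x) ` C)" for x
      proof (rule bdd_belowI2)
        fix q assume "q \<in> C"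
        then have q: "sublinear q" "q (- x) \<le> p (- x)" using CS by (auto simp: S_def le_fun_def)
        show "- p (- x) \<le> q x" using sublinear_minus[OF q(1), of x] q(2) by linarith
      qed
      have ule: "u x \<le> q x" if "q \<in> C" for q x
        unfolding u_def by (rule cINF_lower[OF bdd that])
      have uge: "m \<le> u x" if "\<And>q. q \<in> C \<Longrightarrow> m \<le> q x" for m x
        unfolding u_def by (rule cINF_greatest[OF False that])
      have add: "u (x + y) \<le> u x + u y" for x y
      proof -
        have "u (x + y) - q y \<le> u x" if q: "q \<in> C" for q
        proof (rule uge)
          fix r assume r: "r \<in> C"
          \<comment> \<open>Subadditivity of the infimum mixes the values of two members of the
            chain; the smaller of the two serves for both.\<close>
          have "\<exists>s\<in>C. s \<le> q \<and> s \<le> r" using ch[OF q r] q r by auto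
          then obtain s where s: "s \<in> C" "s \<le> q" "s \<le> r" by blast
          have "u (x + y) \<le> s (x + y)" using ule s by blast
          also have "\<dots> \<le> s x + s y" using s CS by (auto simp: S_def intro: sublinear_add)
          also have "\<dots> \<le> r x + q y" using s by (auto simp: le_fun_def intro: add_mono)
          finally show "u (x + y) - q y \<le> r x" by simp
        qed
        then have "u (x + y) - u x \<le> u y" by (intro uge) (smt (verit))
        then show ?thesis by simp
      qed
      have scale: "u (t *\<^sub>R x) = t * u x" if t: "0 \<le> t" for t x
      proof -
        have eq: "(\<lambda>q. q (t *\<^sub>R x)) ` C = (\<lambda>q. t * q x) ` C"
          using CS t by (intro image_cong) (auto simp: S_def sublinear_scale)
        show ?thesis
        proof (cases "t = 0")
          case True
          then show ?thesis using False eq by (simp add: u_def)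
        next
          case False
          then have t: "0 < t" using t by simp
          have "u (t *\<^sub>R x) \<le> t * u x"
          proof -
            have "u (t *\<^sub>R x) / t \<le> u x"
            proof (rule uge)
              fix q assume q: "q \<in> C"
              have "u (t *\<^sub>R x) \<le> t * q x"
                using ule[OF q, of "t *\<^sub>R x"] q CS t by (auto simp: S_def sublinear_scale)
              then show "u (t *\<^sub>R x) / t \<le> q x" using t by (simp add: field_simps)
            qed
            then show ?thesis using t by (simp add: field_simps)
          qed
          moreover have "t * u x \<le> u (t *\<^sub>R x)"
          proof (rule uge)
            fix q assume q: "q \<in> C"
            then show "t * u x \<le> q (t *\<^sub>R x)"
              using ule[OF q, of x] CS t by (auto simp: S_def sublinear_scale)
          qed
          ultimately show ?thesis by simp
        qed
      qed
      have "u \<le> p"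
      proof (rule le_funI)
        fix x
        obtain q where q: "q \<in> C" using False by blast
        have "q x \<le> p x" using q CS by (auto simp: S_def le_fun_def)
        with ule[OF q, of x] show "u x \<le> p x" by linarith
      qed
      then have "u \<in> S"
        using add scale by (simp add: S_def sublinear_def)
      then show ?thesis using ule by (auto simp: le_fun_def)
    qed
    then show ?thesis
      using predicate_Zorn[OF po] by blast
  qed
  then obtain m where m: "sublinear m" "m \<le> p" and min: "\<And>a. sublinear a \<Longrightarrow> a \<le> m \<Longrightarrow> a = m"
  proof -
    assume *: "\<And>m. sublinear m \<Longrightarrow> m \<le> p \<Longrightarrow> (\<And>a. sublinear a \<Longrightarrow> a \<le> m \<Longrightarrow> a = m) \<Longrightarrow> thesis"
    assume "\<exists>m\<in>S. \<forall>a\<in>S. a \<le> m \<longrightarrow> a = m"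
    then obtain m where "m \<in> S" "\<forall>a\<in>S. a \<le> m \<longrightarrow> a = m" by blast
    then show thesis using *[of m] order_trans[of _ m p] by (simp add: S_def)
  qed
  have add: "m (x + y) = m x + m y" for x y
  proof -
    \<comment> \<open>Decreasing \<open>m\<close> at the single point y, with the value
      \<open>m y\<close> as \<open>\<delta>\<close>, must give back \<open>m\<close> by
      minimality.\<close>
    obtain P where P: "sublinear P" "\<And>x. P x \<le> m x" "P (- y) \<le> - m y"
      by (rule sublinear_decrease[OF m(1), of "{y}" "m y"]) auto
    have "P = m" using min P by (simp add: le_fun_def)
    then have my: "m (- y) \<le> - m y" using P(3) by simp
    have "m x \<le> m (x + y) + m (- y)" using sublinear_add[OF m(1), of "x + y" "- y"] by simp
    then have "m x + m y \<le> m (x + y)" using my by simp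
    then show ?thesis using sublinear_add[OF m(1), of x y] by linarith
  qed
  have neg: "m (- x) = - m x" for x using add[of x "- x"] sublinear_zero[OF m(1)] by simp
  have "m (t *\<^sub>R x) = t * m x" for t x
  proof (cases "0 \<le> t")
    case True then show ?thesis by (rule sublinear_scale[OF m(1)])
  next
    case False
    then have "m (t *\<^sub>R x) = - m ((- t) *\<^sub>R x)" using neg[of "t *\<^sub>R x"] by simp
    also have "\<dots> = t * m x" using False sublinear_scale[OF m(1), of "- t" x] by simp
    finally show ?thesis .
  qed
  then have "linear m" using add by (intro linearI) auto
  then show ?thesis using that m(2) by (auto simp: le_fun_def)
qed

text \<open>The linear functional is placed below the decreased functional; linearity turns the
  bound at - c into a lower bound at c.\<close>

corollary Hahn_Banach_separation:
  fixes q :: "'v::real_vector \<Rightarrow> real"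
  assumes "sublinear q" "convex C" "C \<noteq> {}" "\<And>c. c \<in> C \<Longrightarrow> \<delta> \<le> q c"
  obtains L where "linear L" "\<And>x. L x \<le> q x" "\<And>c. c \<in> C \<Longrightarrow> \<delta> \<le> L c"
proof -
  obtain P where P: "sublinear P" "\<And>x. P x \<le> q x" "\<And>c. c \<in> C \<Longrightarrow> P (- c) \<le> - \<delta>"
    using sublinear_decrease[OF assms] by blast
  obtain L where L: "linear L" "\<And>x. L x \<le> P x"
    using Hahn_Banach_dominated[OF P(1)] by blast
  have "\<delta> \<le> L c" if "c \<in> C" for c
    using L(2)[of "- c"] P(3)[OF that] linear_neg[OF L(1), of c] by linarith
  moreover have "L x \<le> q x" for x using L(2)[of x] P(2)[of x] by linarith
  ultimately show ?thesis using that L(1) by blast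
qed

section \<open>Hilbert algebras\<close>

lemma LIMSEQ_zero_le:
  fixes F G :: "nat \<Rightarrow> real"
  assumes "G \<longlonglongrightarrow> 0" "\<And>n. 0 \<le> F n" "\<And>n. F n \<le> G n"
  shows "F \<longlonglongrightarrow> 0"
  by (rule tendsto_sandwich[OF _ _ tendsto_const assms(1)]) (use assms in auto)

text \<open>For functions on the group, \<open>ip\<close> is the real part of the complex inner
  product: taking real parts makes it symmetric and lets \<open>ip_st\<close> hold without
  exchanging the arguments. \<open>N\<close> stands for a submultiplicative bound on the operators
  of left and right multiplication in the Hilbert norm.\<close>

locale hilbert_algebra =
  fixes tms :: "'v::real_vector \<Rightarrow> 'v \<Rightarrow> 'v" (infixl "\<star>" 70)
    and st :: "'v \<Rightarrow> 'v"
    and ip :: "'v \<Rightarrow> 'v \<Rightarrow> real"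
    and N :: "'v \<Rightarrow> real"
  assumes assoc: "(x \<star> y) \<star> z = x \<star> (y \<star> z)"
    and add_left: "(x + y) \<star> z = x \<star> z + y \<star> z"
    and add_right: "x \<star> (y + z) = x \<star> y + x \<star> z"
    and scale_left: "(c *\<^sub>R x) \<star> y = c *\<^sub>R (x \<star> y)"
    and scale_right: "x \<star> (c *\<^sub>R y) = c *\<^sub>R (x \<star> y)"
    and st_mult: "st (x \<star> y) = st y \<star> st x"
    and st_st: "st (st x) = x"
    and ip_sym: "ip x y = ip y x"
    and ip_add_left: "ip (x + y) z = ip x z + ip y z"
    and ip_scale_left: "ip (c *\<^sub>R x) z = c * ip x z"
    and ip_nonneg: "0 \<le> ip x x"
    and ip_mult: "ip (x \<star> y) z = ip y (st x \<star> z)"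
    and ip_st: "ip (st x) (st y) = ip x y"
    and N_nonneg: "0 \<le> N x"
    and N_add: "N (x + y) \<le> N x + N y"
    and N_minus: "N (- x) = N x"
    and N_mult: "N (x \<star> y) \<le> N x * N y"
    and bound_left: "sqrt (ip (x \<star> y) (x \<star> y)) \<le> N x * sqrt (ip y y)"
    and bound_right: "sqrt (ip (x \<star> y) (x \<star> y)) \<le> N y * sqrt (ip x x)"
begin

definition nrm :: "'v \<Rightarrow> real" where "nrm x = sqrt (ip x x)"

lemma minus_left: "(- x) \<star> y = - (x \<star> y)"
  using scale_left[of "-1" x y] by simp

lemma minus_right: "x \<star> (- y) = - (x \<star> y)"
  using scale_right[of x "-1" y] by simp

lemma diff_left: "(x - y) \<star> z = x \<star> z - y \<star> z"
  using add_left[of x "- y" z] by (simp add: minus_left)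

lemma diff_right: "x \<star> (y - z) = x \<star> y - x \<star> z"
  using add_right[of x y "- z"] by (simp add: minus_right)

lemmas expand = assoc add_left add_right diff_left diff_right minus_left minus_right
  scale_left scale_right algebra_simps

lemma ip_add_right: "ip z (x + y) = ip z x + ip z y"
  by (metis ip_add_left ip_sym)

lemma ip_scale_right: "ip z (c *\<^sub>R x) = c * ip z x"
  by (metis ip_scale_left ip_sym)

lemma ip_minus_left: "ip (- x) z = - ip x z"
  using ip_scale_left[of "-1" x z] by simp

lemma ip_diff_left: "ip (x - y) z = ip x z - ip y z"
  using ip_add_left[of x "- y" z] by (simp add: ip_minus_left)

lemma ip_diff_right: "ip z (x - y) = ip z x - ip z y"
  by (metis ip_diff_left ip_sym)

lemma nrm_nonneg: "0 \<le> nrm x"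
  by (simp add: nrm_def ip_nonneg)

lemma nrm_sq: "(nrm x)\<^sup>2 = ip x x"
  by (simp add: nrm_def ip_nonneg)

lemma nrm_scale: "nrm (c *\<^sub>R x) = \<bar>c\<bar> * nrm x"
  by (simp add: nrm_def ip_scale_left ip_scale_right real_sqrt_mult flip: mult.assoc)

lemma nrm_minus: "nrm (- x) = nrm x"
  using nrm_scale[of "-1" x] by simp

lemma nrm_st: "nrm (st x) = nrm x"
  by (simp add: nrm_def ip_st)

lemma ip_le: "\<bar>ip x y\<bar> \<le> nrm x * nrm y"
proof -
  have *: "(ip x y)\<^sup>2 \<le> ip x x * ip y y"
  proof (cases "ip y y = 0")
    case True
    have "ip x y = 0"
    proof (rule ccontr)
      assume ne: "ip x y \<noteq> 0"
      \<comment> \<open>When y has norm 0 the square of the norm of x + t y is affine in t, and this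
        t gives it the value -1.\<close>
      define t where "t = - (ip x x + 1) / (2 * ip x y)"
      have "0 \<le> ip (x + t *\<^sub>R y) (x + t *\<^sub>R y)" by (rule ip_nonneg)
      also have "\<dots> = ip x x + 2 * t * ip x y"
        by (simp add: ip_add_left ip_add_right ip_scale_left ip_scale_right True ip_sym[of y x])
      also have "\<dots> = - 1" using ne by (simp add: t_def field_simps)
      finally show False by simp
    qed
    then show ?thesis by (simp add: ip_nonneg True)
  next
    case False
    then have pos: "ip y y > 0" using ip_nonneg[of y] by simp
    define t where "t = - ip x y / ip y y"
    have "0 \<le> ip (x + t *\<^sub>R y) (x + t *\<^sub>R y)" by (rule ip_nonneg)
    also have "\<dots> = ip x x + 2 * t * ip x y + t\<^sup>2 * ip y y"
      by (simp add: ip_add_left ip_add_right ip_scale_left ip_scale_right ip_sym[of y x] algebra_simps power2_eq_square)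
    also have "\<dots> = ip x x - (ip x y)\<^sup>2 / ip y y"
      using pos by (simp add: t_def field_simps power2_eq_square)
    finally show ?thesis using pos by (simp add: field_simps)
  qed
  have "\<bar>ip x y\<bar> = sqrt ((ip x y)\<^sup>2)" by simp
  also have "\<dots> \<le> sqrt (ip x x * ip y y)" using * by (rule real_sqrt_le_mono)
  finally show ?thesis by (simp add: nrm_def real_sqrt_mult)
qed

lemma nrm_add: "nrm (x + y) \<le> nrm x + nrm y"
proof (rule power2_le_imp_le)
  have "(nrm (x + y))\<^sup>2 = (nrm x)\<^sup>2 + 2 * ip x y + (nrm y)\<^sup>2"
    by (simp add: nrm_sq ip_add_left ip_add_right ip_sym[of y x])
  also have "\<dots> \<le> (nrm x + nrm y)\<^sup>2"
    using ip_le[of x y] by (simp add: power2_eq_square algebra_simps)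
  finally show "(nrm (x + y))\<^sup>2 \<le> (nrm x + nrm y)\<^sup>2" .
qed (simp add: nrm_nonneg)

lemma nrm_diff: "nrm (x - y) \<le> nrm x + nrm y"
  using nrm_add[of x "- y"] by (simp add: nrm_minus)

lemma N_diff: "N (x - y) \<le> N x + N y"
  using N_add[of x "- y"] by (simp add: N_minus)

lemma nrm_left: "nrm (x \<star> y) \<le> N x * nrm y"
  and nrm_right: "nrm (x \<star> y) \<le> N y * nrm x"
  using bound_left bound_right by (auto simp: nrm_def)

text \<open>The involution preserves \<open>nrm\<close> and turns left multiplication by
  \<open>st x\<close> into right multiplication by x. This bounds the adjoint by \<open>N x\<close>,
  without any estimate of \<open>N (st x)\<close>.\<close>

lemma nrm_st_mult: "nrm (st x \<star> y) \<le> N x * nrm y"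
  using nrm_right[of "st y" x] by (metis nrm_st st_mult st_st)

text \<open>The trace of the product x y; for convolution this is the real part of the value of x *
  y at the neutral element.\<close>

definition tr2 :: "'v \<Rightarrow> 'v \<Rightarrow> real" where "tr2 x y = ip x (st y)"

lemma tr2_sym: "tr2 x y = tr2 y x"
  unfolding tr2_def by (metis ip_st ip_sym st_st)

lemma tr2_cyclic: "tr2 (x \<star> y) z = tr2 y (z \<star> x)"
  unfolding tr2_def by (simp add: ip_mult st_mult)

lemma tr2_diff_left: "tr2 (x - y) z = tr2 x z - tr2 y z"
  and tr2_scale_left: "tr2 (c *\<^sub>R x) z = c * tr2 x z"
  by (simp_all add: tr2_def ip_diff_left ip_scale_left)

lemma tr2_diff_right: "tr2 z (x - y) = tr2 z x - tr2 z y"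
  by (simp add: tr2_sym[of z] tr2_diff_left)

lemma tr2_le: "\<bar>tr2 x y\<bar> \<le> nrm x * nrm y"
  unfolding tr2_def using ip_le[of x "st y"] by (simp add: nrm_st)

text \<open>
  For an idempotent \<open>e\<close> the operator \<open>1 - c e e\<^sup>*\<close> contracts the range of \<open>e\<close>, so its powers applied to \<open>e\<close>
  tend to \<open>0\<close>. The trace of these powers decreases in each step by \<open>c\<close> times a nonnegative number,
  which is the squared norm of \<open>e\<close> in the first step. So the trace of \<open>e\<close> dominates a multiple of
  the squared norm of \<open>e\<close>. All of this is stable under small errors in \<open>e\<^sup>2 = e\<close>.
\<close>

lemma idempotent_trace_zero:
  fixes e :: "nat \<Rightarrow> 'v"
  assumes K: "\<And>n. nrm (e n) \<le> K" and M: "\<And>n. N (e n) \<le> M" and M1: "1 \<le> M"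
    and idN: "(\<lambda>n. N (e n \<star> e n - e n)) \<longlonglongrightarrow> 0" and idn: "(\<lambda>n. nrm (e n \<star> e n - e n)) \<longlonglongrightarrow> 0"
    and tr: "(\<lambda>n. tr2 (e n) (e n)) \<longlonglongrightarrow> 0"
  shows "(\<lambda>n. nrm (e n)) \<longlonglongrightarrow> 0"
proof -
  \<comment> \<open>Multiplication by e and by its adjoint has norm at most M, so for this c the
    operator \<open>B n\<close>, formally 1 - c e e^*, lies between 0 and 1.\<close>
  define c where "c = 1 / M\<^sup>2"
  have M2: "1 \<le> M\<^sup>2" using M1 by simp
  have c: "0 < c" "c \<le> 1" "c * M\<^sup>2 = 1" using M2 M1 by (auto simp: c_def)
  define B where "B n x = x - c *\<^sub>R (e n \<star> (st (e n) \<star> x))" for n x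
  define \<xi> where "\<xi> j n = ((B n) ^^ j) (e n)" for j n
  define D where "D n = e n \<star> e n - e n" for n
  have xi_Suc: "\<xi> (Suc j) n = B n (\<xi> j n)" for j n by (simp add: \<xi>_def)
  have ipB: "ip (B n x) y = ip x y - c * ip (st (e n) \<star> x) (st (e n) \<star> y)" for n x y
    by (simp add: B_def ip_diff_left ip_scale_left ip_mult)
  have ipB_sym: "ip (B n x) y = ip x (B n y)" for n x y
    by (metis ipB ip_sym)
  have e_le: "nrm (e n \<star> x) \<le> M * nrm x" for n x
    by (rule order_trans[OF nrm_left]) (simp add: M mult_right_mono nrm_nonneg)
  have st_le: "nrm (st (e n) \<star> x) \<le> M * nrm x" for n x
    by (rule order_trans[OF nrm_st_mult]) (simp add: M mult_right_mono nrm_nonneg)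
  \<comment> \<open>Expanding the square gives -2 c |e^* x|^2 plus a quadratic term; since c M^2 =
    1, the latter uses up only half of the gain.\<close>
  have contr2: "(nrm (B n x))\<^sup>2 \<le> (nrm x)\<^sup>2 - c * (nrm (st (e n) \<star> x))\<^sup>2" for n x
  proof -
    let ?w = "st (e n) \<star> x"
    have "(nrm (B n x))\<^sup>2 = (nrm x)\<^sup>2 - 2 * c * ip x (e n \<star> ?w) + c\<^sup>2 * (nrm (e n \<star> ?w))\<^sup>2"
      unfolding nrm_sq B_def
      by (simp add: ip_diff_left ip_diff_right ip_scale_left ip_scale_right
            ip_sym[of "e n \<star> ?w" x] algebra_simps power2_eq_square)
    moreover have "2 * c * ip x (e n \<star> ?w) = 2 * c * (nrm ?w)\<^sup>2"
      using ip_mult[of "e n" ?w x] by (simp add: nrm_sq ip_sym)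
    moreover have "c\<^sup>2 * (nrm (e n \<star> ?w))\<^sup>2 \<le> c\<^sup>2 * (M * nrm ?w)\<^sup>2"
      by (intro mult_left_mono power_mono e_le nrm_nonneg) simp
    moreover have "c\<^sup>2 * (M * nrm ?w)\<^sup>2 = c * (nrm ?w)\<^sup>2"
      using c(3) by (simp add: power_mult_distrib power2_eq_square)
    ultimately show ?thesis by linarith
  qed
  have contr: "nrm (B n x) \<le> nrm x" for n x
  proof (rule power2_le_imp_le)
    show "(nrm (B n x))\<^sup>2 \<le> (nrm x)\<^sup>2" using contr2[of n x] c(1)
      by (smt (verit) mult_nonneg_nonneg zero_le_power2)
  qed (rule nrm_nonneg)
  have Bpos: "0 \<le> ip (B n x) x" for n x
  proof -
    have "(nrm (st (e n) \<star> x))\<^sup>2 \<le> (M * nrm x)\<^sup>2"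
      by (intro power_mono st_le nrm_nonneg)
    then have "c * (nrm (st (e n) \<star> x))\<^sup>2 \<le> c * (M * nrm x)\<^sup>2"
      using c(1) by simp
    also have "\<dots> = (nrm x)\<^sup>2" using c(3) by (simp add: power_mult_distrib flip: mult.assoc)
    finally show ?thesis using ipB[of n x x] by (simp add: nrm_sq)
  qed
  have xi_le: "nrm (\<xi> j n) \<le> nrm (e n)" for j n
    by (induction j) (auto simp: \<xi>_def intro: order_trans[OF contr])
  have xi_K: "nrm (\<xi> j n) \<le> K" for j n using xi_le K order_trans by blast
  have xi_split: "ip (\<xi> (i + j) n) (e n) = ip (\<xi> i n) (\<xi> j n)" for i j n
  proof (induction j arbitrary: i)
    case 0 then show ?case by (simp add: \<xi>_def)
  next
    case (Suc j)
    have "ip (\<xi> (i + Suc j) n) (e n) = ip (\<xi> (Suc i) n) (\<xi> j n)" using Suc[of "Suc i"] by simp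
    then show ?case by (simp add: xi_Suc ipB_sym)
  qed
  \<comment> \<open>\<open>B n\<close> is symmetric, so this is the square of a norm for even j, and
    a value of the positive form of \<open>B n\<close> for odd j.\<close>
  have xi_pos: "0 \<le> ip (\<xi> j n) (e n)" for j n
  proof (cases "even j")
    case True
    then obtain i where "j = i + i" by (metis evenE mult_2)
    then show ?thesis by (simp add: xi_split ip_nonneg)
  next
    case False
    then obtain i where "j = Suc i + i" by (metis Suc_eq_plus1 add.commute add_Suc_right mult_2 oddE)
    then have "ip (\<xi> j n) (e n) = ip (B n (\<xi> i n)) (\<xi> i n)" by (metis xi_Suc xi_split)
    then show ?thesis using Bpos by simp
  qed
  have Dn: "(\<lambda>n. nrm (D n)) \<longlonglongrightarrow> 0" and DN: "(\<lambda>n. N (D n)) \<longlonglongrightarrow> 0"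
    using idn idN by (simp_all add: D_def)
  \<comment> \<open>For fixed j the iterate stays almost in the range of e: each step subtracts a
    multiple of e w, and e (e w) - e w equals \<open>D n\<close> times w.\<close>
  have eta: "(\<lambda>n. nrm (e n \<star> \<xi> j n - \<xi> j n)) \<longlonglongrightarrow> 0" for j
  proof (induction j)
    case 0 then show ?case using idn by (simp add: \<xi>_def)
  next
    case (Suc j)
    let ?w = "\<lambda>n. st (e n) \<star> \<xi> j n"
    have eq: "e n \<star> \<xi> (Suc j) n - \<xi> (Suc j) n = (e n \<star> \<xi> j n - \<xi> j n) - c *\<^sub>R (D n \<star> ?w n)" for n
      by (simp add: xi_Suc B_def D_def expand)
    have "nrm (e n \<star> \<xi> (Suc j) n - \<xi> (Suc j) n) \<le> nrm (e n \<star> \<xi> j n - \<xi> j n) + c * (N (D n) * (M * K))" for n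
    proof -
      have "nrm (D n \<star> ?w n) \<le> N (D n) * nrm (?w n)" by (rule nrm_left)
      also have "\<dots> \<le> N (D n) * (M * K)"
        using st_le[of n "\<xi> j n"] mult_left_mono[OF xi_K[of j n], of M] M1
        by (intro mult_left_mono N_nonneg) linarith
      finally have "c * nrm (D n \<star> ?w n) \<le> c * (N (D n) * (M * K))" using c(1) by simp
      then show ?thesis
        unfolding eq using nrm_diff[of "e n \<star> \<xi> j n - \<xi> j n" "c *\<^sub>R (D n \<star> ?w n)"] c(1)
          nrm_scale[of c "D n \<star> ?w n"] by linarith
    qed
    moreover have "(\<lambda>n. nrm (e n \<star> \<xi> j n - \<xi> j n) + c * (N (D n) * (M * K))) \<longlonglongrightarrow> 0 + c * (0 * (M * K))"
      by (intro tendsto_intros Suc DN)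
    then have "(\<lambda>n. nrm (e n \<star> \<xi> j n - \<xi> j n) + c * (N (D n) * (M * K))) \<longlonglongrightarrow> 0" by simp
    ultimately show ?case by (rule LIMSEQ_zero_le[OF _ nrm_nonneg, rotated])
  qed
  \<comment> \<open>On the range of e one has |x|^2 = <e x, x> = <x, e^* x>, hence |x| is at most
    |e^* x|, and \<open>contr2\<close> yields the factor 1 - c. The null sequence h collects the
    defects measured in \<open>eta\<close>.\<close>
  have decay: "\<exists>h. h \<longlonglongrightarrow> 0 \<and> (\<forall>n. (nrm (\<xi> j n))\<^sup>2 \<le> (1 - c) ^ j * K\<^sup>2 + h n)" for j
  proof (induction j)
    case 0
    show ?case by (rule exI[of _ "\<lambda>_. 0"]) (simp add: \<xi>_def K nrm_nonneg power_mono)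
  next
    case (Suc j)
    then obtain h where h: "h \<longlonglongrightarrow> 0" "\<And>n. (nrm (\<xi> j n))\<^sup>2 \<le> (1 - c) ^ j * K\<^sup>2 + h n" by blast
    define \<eta> where "\<eta> n = nrm (e n \<star> \<xi> j n - \<xi> j n)" for n
    have "(nrm (\<xi> (Suc j) n))\<^sup>2 \<le> (1 - c) ^ Suc j * K\<^sup>2 + ((1 - c) * h n + 2 * c * K * \<eta> n)" for n
    proof -
      let ?x = "\<xi> j n" and ?w = "st (e n) \<star> \<xi> j n"
      have eta0: "0 \<le> \<eta> n" by (simp add: \<eta>_def nrm_nonneg)
      have low: "nrm ?x - \<eta> n \<le> nrm ?w"
      proof (cases "nrm ?x = 0")
        case True then show ?thesis using eta0 nrm_nonneg[of ?w] by linarith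
      next
        case False
        then have pos: "nrm ?x > 0" using nrm_nonneg[of ?x] by linarith
        have "(nrm ?x)\<^sup>2 = ip (e n \<star> ?x) ?x - ip (e n \<star> ?x - ?x) ?x"
          by (simp add: nrm_sq ip_diff_left)
        also have "\<dots> \<le> nrm ?x * nrm ?w + \<eta> n * nrm ?x"
          using ip_le[of ?x ?w] ip_le[of "e n \<star> ?x - ?x" ?x] by (simp add: ip_mult \<eta>_def)
        finally have "nrm ?x * nrm ?x \<le> nrm ?x * (nrm ?w + \<eta> n)" by (simp add: power2_eq_square algebra_simps)
        then show ?thesis using pos by simp
      qed
      have "(nrm ?x)\<^sup>2 - 2 * nrm ?x * \<eta> n \<le> (nrm ?w)\<^sup>2"
      proof (cases "nrm ?x \<ge> \<eta> n")
        case True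
        then have "(nrm ?x - \<eta> n)\<^sup>2 \<le> (nrm ?w)\<^sup>2" using low by (intro power_mono) auto
        moreover have "(nrm ?x - \<eta> n)\<^sup>2 = (nrm ?x)\<^sup>2 - 2 * nrm ?x * \<eta> n + (\<eta> n)\<^sup>2" by (simp add: power2_diff)
        ultimately show ?thesis using zero_le_power2[of "\<eta> n"] by linarith
      next
        case False
        then have "nrm ?x * nrm ?x \<le> nrm ?x * \<eta> n" using nrm_nonneg[of ?x] by (intro mult_left_mono) auto
        moreover have "0 \<le> nrm ?x * \<eta> n" using nrm_nonneg[of ?x] eta0 by simp
        ultimately have "(nrm ?x)\<^sup>2 - 2 * (nrm ?x * \<eta> n) \<le> 0" unfolding power2_eq_square by linarith
        then show ?thesis using zero_le_power2[of "nrm ?w"] by (simp only: mult.assoc)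
      qed
      then have "c * ((nrm ?x)\<^sup>2 - 2 * nrm ?x * \<eta> n) \<le> c * (nrm ?w)\<^sup>2" using c(1) by simp
      moreover have "c * (2 * nrm ?x * \<eta> n) \<le> c * (2 * K * \<eta> n)"
        using c(1) xi_K[of j n] eta0 by (simp add: mult_right_mono)
      moreover have "(1 - c) * (nrm ?x)\<^sup>2 \<le> (1 - c) * ((1 - c) ^ j * K\<^sup>2 + h n)"
        using h(2)[of n] c(2) by (intro mult_left_mono) auto
      ultimately show ?thesis using contr2[of n ?x] unfolding xi_Suc
        by (simp add: algebra_simps)
    qed
    moreover have "(\<lambda>n. (1 - c) * h n + 2 * c * K * \<eta> n) \<longlonglongrightarrow> (1 - c) * 0 + 2 * c * K * 0"
      unfolding \<eta>_def by (intro tendsto_intros h(1) eta)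
    ultimately show ?case by (intro exI[of _ "\<lambda>n. (1 - c) * h n + 2 * c * K * \<eta> n"]) simp
  qed
  \<comment> \<open>This error does not grow with j: \<open>B n\<close> contracts and commutes with
    multiplication from the right, so the error is an iterate of \<open>B n\<close> applied to
    \<open>D n\<close>.\<close>
  have xi_e: "nrm (\<xi> j n \<star> e n - \<xi> j n) \<le> nrm (D n)" for j n
  proof (induction j)
    case 0 then show ?case by (simp add: \<xi>_def D_def)
  next
    case (Suc j)
    have "\<xi> (Suc j) n \<star> e n - \<xi> (Suc j) n = B n (\<xi> j n \<star> e n - \<xi> j n)"
      by (simp add: xi_Suc B_def expand)
    then show ?case using order_trans[OF contr Suc] by simp
  qed
  \<comment> \<open>The drop of the trace is c tr(e e^* x e) with x the j-th iterate. By cyclicity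
    and e e ~ e it is close to c tr(e^* x e) = c <x e, e>, and x e is close to x.\<close>
  have step: "tr2 (\<xi> j n) (e n) - tr2 (\<xi> (Suc j) n) (e n) \<ge> c * ip (\<xi> j n) (e n) - c * (M * K + K) * nrm (D n)" for j n
  proof -
    let ?w = "st (e n) \<star> \<xi> j n"
    have "tr2 (\<xi> j n) (e n) - tr2 (\<xi> (Suc j) n) (e n) = c * tr2 (e n \<star> ?w) (e n)"
      by (simp add: xi_Suc B_def tr2_diff_left tr2_scale_left)
    moreover have "tr2 (e n \<star> ?w) (e n) = tr2 ?w (e n) + tr2 ?w (D n)"
      by (simp add: tr2_cyclic D_def tr2_diff_right)
    moreover have "tr2 ?w (e n) = ip (\<xi> j n \<star> e n) (e n)"
      unfolding tr2_def by (metis ip_mult ip_st ip_sym st_mult st_st)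
    moreover have "ip (\<xi> j n \<star> e n) (e n) = ip (\<xi> j n) (e n) + ip (\<xi> j n \<star> e n - \<xi> j n) (e n)"
      by (simp add: ip_diff_left)
    moreover have "\<bar>ip (\<xi> j n \<star> e n - \<xi> j n) (e n)\<bar> \<le> nrm (D n) * K"
      by (rule order_trans[OF ip_le]) (intro mult_mono xi_e K nrm_nonneg)
    moreover have "\<bar>tr2 ?w (D n)\<bar> \<le> (M * K) * nrm (D n)"
    proof -
      have "nrm ?w \<le> M * K"
        using st_le[of n "\<xi> j n"] mult_left_mono[OF xi_K[of j n], of M] M1 by linarith
      then show ?thesis by (intro order_trans[OF tr2_le] mult_right_mono nrm_nonneg)
    qed
    ultimately have eq: "tr2 (\<xi> j n) (e n) - tr2 (\<xi> (Suc j) n) (e n) = c * (ip (\<xi> j n) (e n) + ip (\<xi> j n \<star> e n - \<xi> j n) (e n) + tr2 ?w (D n))"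
      and le: "ip (\<xi> j n) (e n) - (M * K + K) * nrm (D n) \<le> ip (\<xi> j n) (e n) + ip (\<xi> j n \<star> e n - \<xi> j n) (e n) + tr2 ?w (D n)"
      by (auto simp: algebra_simps)
    show ?thesis unfolding eq using mult_left_mono[OF le, of c] c(1) by (simp add: algebra_simps)
  qed
  \<comment> \<open>Summing \<open>step\<close>, only the first term c <e, e> is kept; the others
    are nonnegative by \<open>xi_pos\<close>.\<close>
  have sum_le: "c * (nrm (e n))\<^sup>2 \<le> tr2 (e n) (e n) - tr2 (\<xi> (Suc k) n) (e n) + Suc k * (c * (M * K + K) * nrm (D n))" for k n
  proof (induction k)
    case 0
    show ?case using step[of 0 n] by (simp add: \<xi>_def nrm_sq)
  next
    case (Suc k)
    have "0 \<le> c * ip (\<xi> (Suc k) n) (e n)" using xi_pos c(1) by simp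
    then show ?case using Suc step[of "Suc k" n] by (simp add: algebra_simps)
  qed
  have "(\<lambda>n. (nrm (e n))\<^sup>2) \<longlonglongrightarrow> 0"
  proof (rule LIMSEQ_I)
    fix r :: real assume r: "0 < r"
    \<comment> \<open>The number k of steps is fixed first, from the geometric decay; n tends to
      infinity afterwards, because the error in \<open>sum_le\<close> grows with k.\<close>
    have "(\<lambda>k. K * sqrt ((1 - c) ^ Suc k * K\<^sup>2)) \<longlonglongrightarrow> K * sqrt (0 * K\<^sup>2)"
      by (intro tendsto_intros LIMSEQ_Suc LIMSEQ_realpow_zero) (use c in auto)
    then have "(\<lambda>k. K * sqrt ((1 - c) ^ Suc k * K\<^sup>2)) \<longlonglongrightarrow> 0" by simp
    then have "eventually (\<lambda>k. K * sqrt ((1 - c) ^ Suc k * K\<^sup>2) < c * r) sequentially"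
      using r c(1) by (intro order_tendstoD(2)) auto
    then obtain k where k: "K * sqrt ((1 - c) ^ Suc k * K\<^sup>2) < c * r"
      by (meson eventually_sequentially order_refl)
    obtain h where h: "h \<longlonglongrightarrow> 0" "\<And>n. (nrm (\<xi> (Suc k) n))\<^sup>2 \<le> (1 - c) ^ (Suc k) * K\<^sup>2 + h n"
      using decay[of "Suc k"] by blast
    define F where "F n = tr2 (e n) (e n) + K * sqrt ((1 - c) ^ Suc k * K\<^sup>2 + h n) + Suc k * (c * (M * K + K) * nrm (D n))" for n
    have "F \<longlonglongrightarrow> 0 + K * sqrt ((1 - c) ^ Suc k * K\<^sup>2 + 0) + Suc k * (c * (M * K + K) * 0)"
      unfolding F_def by (intro tendsto_intros tr h(1) Dn)
    then have "eventually (\<lambda>n. F n < c * r) sequentially" using k by (intro order_tendstoD(2)) auto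
    then obtain n0 where n0: "\<And>n. n \<ge> n0 \<Longrightarrow> F n < c * r" by (auto simp: eventually_sequentially)
    have "(nrm (e n))\<^sup>2 < r" if "n \<ge> n0" for n
    proof -
      have "\<bar>tr2 (\<xi> (Suc k) n) (e n)\<bar> \<le> K * sqrt ((1 - c) ^ Suc k * K\<^sup>2 + h n)"
      proof -
        have le: "nrm (\<xi> (Suc k) n) \<le> sqrt ((1 - c) ^ Suc k * K\<^sup>2 + h n)"
          by (rule real_le_rsqrt[OF h(2)])
        have "nrm (\<xi> (Suc k) n) * nrm (e n) \<le> sqrt ((1 - c) ^ Suc k * K\<^sup>2 + h n) * K"
          by (rule mult_mono[OF le K order_trans[OF nrm_nonneg le] nrm_nonneg])
        then show ?thesis using tr2_le[of "\<xi> (Suc k) n" "e n"] by (simp add: mult.commute)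
      qed
      then have "c * (nrm (e n))\<^sup>2 \<le> F n" using sum_le[of n k] unfolding F_def by linarith
      then have "c * (nrm (e n))\<^sup>2 < c * r" using n0[OF that] by linarith
      then show ?thesis using c(1) by simp
    qed
    then show "\<exists>n0. \<forall>n\<ge>n0. norm ((nrm (e n))\<^sup>2 - 0) < r" by (auto intro!: exI[of _ n0])
  qed
  then have "(\<lambda>n. sqrt ((nrm (e n))\<^sup>2)) \<longlonglongrightarrow> sqrt 0" by (rule tendsto_real_sqrt)
  then show ?thesis by (simp add: nrm_nonneg)
qed

text \<open>
  Formally \<open>e = 1 - (1 - b) (1 - a)\<close> is idempotent with \<open>e = a e\<close>, and its trace is that of
  \<open>a e = a (a \<bullet> b)\<close> by cyclicity, hence zero.
\<close>

lemma bullet_swap_null: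
  fixes a b :: "nat \<Rightarrow> 'v"
  defines "r \<equiv> \<lambda>n. a n + b n - a n \<star> b n" and "e \<equiv> \<lambda>n. a n + b n - b n \<star> a n"
  assumes nK: "\<And>n. nrm (a n) \<le> K" "\<And>n. nrm (b n) \<le> K"
    and NK: "\<And>n. N (a n) \<le> K" "\<And>n. N (b n) \<le> K"
    and rn: "(\<lambda>n. nrm (r n)) \<longlonglongrightarrow> 0" and rN: "(\<lambda>n. N (r n)) \<longlonglongrightarrow> 0"
  shows "(\<lambda>n. nrm (e n)) \<longlonglongrightarrow> 0"
proof -
  have K0: "0 \<le> K" using NK(1)[of 0] N_nonneg[of "a 0"] by linarith
  \<comment> \<open>Formally 1 - e = (1 - b)(1 - a) and 1 - r = (1 - a)(1 - b). Hence (1 - e)^2 = (1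
    - b)(1 - r)(1 - a), so that e e - e = - (1 - b) r (1 - a), and in the same way (1 - a) e = r (1
    - a).\<close>
  have ee: "e n \<star> e n - e n = - (r n - b n \<star> r n - r n \<star> a n + b n \<star> (r n \<star> a n))" for n
    by (simp add: e_def r_def expand)
  have ae: "a n \<star> e n - e n = - (r n - r n \<star> a n)" for n
    by (simp add: e_def r_def expand)
  have null: "F \<longlonglongrightarrow> 0" if "G \<longlonglongrightarrow> 0" "\<And>n. \<bar>F n\<bar> \<le> C * G n" for F G :: "nat \<Rightarrow> real" and C
    by (rule Lim_null_comparison[of _ "\<lambda>n. C * G n"])
      (use that tendsto_mult_right_zero[OF that(1)] in auto)
  have eK: "nrm (e n) \<le> K + K + K * K" for n
  proof -
    have "nrm (b n \<star> a n) \<le> K * K"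
      by (rule order_trans[OF nrm_left]) (intro mult_mono NK nK nrm_nonneg K0)
    then show ?thesis
      using nrm_diff[of "a n + b n" "b n \<star> a n"] nrm_add[of "a n" "b n"] nK[of n] by (simp add: e_def)
  qed
  \<comment> \<open>The summand 1 secures the hypothesis 1 \<le> M of
    \<open>idempotent_trace_zero\<close>.\<close>
  have eN: "N (e n) \<le> 1 + K + K + K * K" for n
  proof -
    have "N (b n \<star> a n) \<le> K * K"
      by (rule order_trans[OF N_mult]) (intro mult_mono NK N_nonneg K0)
    then show ?thesis
      using N_diff[of "a n + b n" "b n \<star> a n"] N_add[of "a n" "b n"] NK[of n] by (simp add: e_def)
  qed
  have een: "nrm (e n \<star> e n - e n) \<le> (1 + K + K + K * K) * nrm (r n)" for n
  proof -
    have 1: "nrm (b n \<star> r n) \<le> K * nrm (r n)"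
      by (rule order_trans[OF nrm_left]) (intro mult_right_mono NK nrm_nonneg)
    have 2: "nrm (r n \<star> a n) \<le> K * nrm (r n)"
      by (rule order_trans[OF nrm_right]) (intro mult_right_mono NK nrm_nonneg)
    have "nrm (b n \<star> (r n \<star> a n)) \<le> K * (K * nrm (r n))"
      by (rule order_trans[OF nrm_left]) (intro mult_mono NK nrm_nonneg 2 K0)
    then show ?thesis
      using 1 2 nrm_add[of "r n - b n \<star> r n - r n \<star> a n" "b n \<star> (r n \<star> a n)"]
        nrm_diff[of "r n - b n \<star> r n" "r n \<star> a n"] nrm_diff[of "r n" "b n \<star> r n"]
      unfolding ee nrm_minus by (simp add: algebra_simps)
  qed
  have eeN: "N (e n \<star> e n - e n) \<le> (1 + K + K + K * K) * N (r n)" for n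
  proof -
    have 1: "N (b n \<star> r n) \<le> K * N (r n)"
      by (rule order_trans[OF N_mult]) (intro mult_right_mono NK N_nonneg)
    have 2: "N (r n \<star> a n) \<le> K * N (r n)"
      using order_trans[OF N_mult mult_left_mono[OF NK(1) N_nonneg]] by (simp add: mult.commute)
    have "N (b n \<star> (r n \<star> a n)) \<le> K * (K * N (r n))"
      by (rule order_trans[OF N_mult]) (intro mult_mono NK N_nonneg 2 K0)
    then show ?thesis
      using 1 2 N_add[of "r n - b n \<star> r n - r n \<star> a n" "b n \<star> (r n \<star> a n)"]
        N_diff[of "r n - b n \<star> r n" "r n \<star> a n"] N_diff[of "r n" "b n \<star> r n"]
      unfolding ee N_minus by (simp add: algebra_simps)
  qed
  have aen: "nrm (a n \<star> e n - e n) \<le> (1 + K) * nrm (r n)" for n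
  proof -
    have "nrm (r n \<star> a n) \<le> K * nrm (r n)"
      by (rule order_trans[OF nrm_right]) (intro mult_right_mono NK nrm_nonneg)
    then show ?thesis
      using nrm_diff[of "r n" "r n \<star> a n"] unfolding ae nrm_minus by (simp add: algebra_simps)
  qed
  have tr_ae: "tr2 (a n) (e n) = tr2 (a n) (r n)" for n
  proof -
    have "tr2 (a n) (b n \<star> a n) = tr2 (b n \<star> a n) (a n)" by (rule tr2_sym)
    also have "\<dots> = tr2 (a n) (a n \<star> b n)" by (rule tr2_cyclic)
    finally show ?thesis by (simp add: e_def r_def tr2_diff_right)
  qed
  \<comment> \<open>Since a e ~ e and e e ~ e, the chain is tr(e e) ~ tr((a e) e) = tr(a (e e)) ~
    tr(a e) = tr(a r).\<close>
  have tr_ee: "tr2 (e n) (e n) = tr2 (a n) (r n) + tr2 (a n) (e n \<star> e n - e n) - tr2 (a n \<star> e n - e n) (e n)" for n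
  proof -
    have "tr2 (a n \<star> e n) (e n) = tr2 (a n) (e n \<star> e n)" by (metis tr2_cyclic tr2_sym)
    then show ?thesis by (simp add: tr2_diff_left tr2_diff_right flip: tr_ae)
  qed
  define M where "M = 1 + K + K + K * K"
  have "\<bar>tr2 (e n) (e n)\<bar> \<le> (K + K * M + (1 + K) * M) * nrm (r n)" for n
  proof -
    have "\<bar>tr2 (a n) (r n)\<bar> \<le> K * nrm (r n)"
      by (rule order_trans[OF tr2_le]) (intro mult_right_mono nK nrm_nonneg)
    moreover have "\<bar>tr2 (a n) (e n \<star> e n - e n)\<bar> \<le> K * (M * nrm (r n))"
      by (rule order_trans[OF tr2_le]) (use een in \<open>intro mult_mono nK nrm_nonneg K0, simp add: M_def\<close>)
    moreover have "\<bar>tr2 (a n \<star> e n - e n) (e n)\<bar> \<le> ((1 + K) * nrm (r n)) * M"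
    proof (rule order_trans[OF tr2_le], intro mult_mono aen nrm_nonneg)
      show "nrm (e n) \<le> M" using eK[of n] by (simp add: M_def)
      show "0 \<le> (1 + K) * nrm (r n)" using K0 nrm_nonneg by simp
    qed
    ultimately show ?thesis unfolding tr_ee by (simp add: algebra_simps)
  qed
  then have "(\<lambda>n. tr2 (e n) (e n)) \<longlonglongrightarrow> 0" by (rule null[OF rn])
  moreover have "(\<lambda>n. nrm (e n \<star> e n - e n)) \<longlonglongrightarrow> 0"
    by (rule null[OF rn]) (use een nrm_nonneg in auto)
  moreover have "(\<lambda>n. N (e n \<star> e n - e n)) \<longlonglongrightarrow> 0"
    by (rule null[OF rN]) (use eeN N_nonneg in auto)
  ultimately show ?thesis
    using idempotent_trace_zero[of e "K + K + K * K" "1 + K + K + K * K"] eK eN K0 by simp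
qed

text \<open>
  Replacing \<open>1 - a\<close> by \<open>(1 - d)\<^sup>-\<^sup>1 (1 - a)\<close> and \<open>1 - b\<close> by \<open>(1 - b) (1 - d)\<close>, where \<open>d = a - a\<^sub>0\<close> is small, does not
  change \<open>(1 - b) (1 - a)\<close>, and the new \<open>a\<close> is \<open>(1 - d)\<^sup>-\<^sup>1 a\<^sub>0\<close>, which is also bounded in the Hilbert norm.
\<close>

theorem bullet_swap:
  fixes a b :: "nat \<Rightarrow> 'v"
  assumes Cauchy: "\<And>\<epsilon>. 0 < \<epsilon> \<Longrightarrow> \<exists>n0. \<forall>m\<ge>n0. \<forall>n\<ge>n0. N (a m - a n) \<le> \<epsilon>"
    and bK: "\<And>n. N (b n) \<le> K"
    and rN: "(\<lambda>n. N (a n + b n - a n \<star> b n)) \<longlonglongrightarrow> 0"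
  shows "(\<lambda>n. nrm ((a n + b n - b n \<star> a n) \<star> g)) \<longlonglongrightarrow> 0"
proof -
  obtain n0 where n0: "\<And>n. n \<ge> n0 \<Longrightarrow> N (a n - a n0) \<le> 1 / 2"
    using Cauchy[of "1 / 2"] by auto
  \<comment> \<open>One fixed element, whose Hilbert norm is therefore a constant; the numbers
    \<open>nrm (a n)\<close> may be unbounded, as the limit need not have a Hilbert norm.\<close>
  define a0 where "a0 = a n0"
  define a1 where "a1 n = a (n + n0)" for n
  define b1 where "b1 n = b (n + n0)" for n
  define d where "d n = a1 n - a0" for n
  have dN: "N (d n) \<le> 1 / 2" for n using n0 by (simp add: d_def a0_def a1_def)
  \<comment> \<open>Partial sums of the Neumann series of (1 - d)^-1 a0. The algebra need not be
    complete, so the inverse is replaced by n steps of the iteration at index n, with a defect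
    \<open>\<rho> n\<close> that tends to 0 in \<open>N\<close>.\<close>
  define it where "it n k = ((\<lambda>z. a0 + d n \<star> z) ^^ k) 0" for n k
  define \<alpha> where "\<alpha> n = it n n" for n
  define \<rho> where "\<rho> n = \<alpha> n - a0 - d n \<star> \<alpha> n" for n
  have d_nrm: "nrm (d n \<star> z) \<le> nrm z / 2" for n z
    using order_trans[OF nrm_left mult_right_mono[OF dN nrm_nonneg]] by simp
  have d_N: "N (d n \<star> z) \<le> N z / 2" for n z
    using order_trans[OF N_mult mult_right_mono[OF dN N_nonneg]] by simp
  have it_Suc: "it n (Suc k) = a0 + d n \<star> it n k" for n k by (simp add: it_def)
  have zero_norms: "N 0 = 0" "nrm 0 = 0"
    using d_N[of 0 0] N_nonneg[of 0] d_nrm[of 0 0] nrm_nonneg[of 0] N_nonneg[of "d 0 \<star> 0"] nrm_nonneg[of "d 0 \<star> 0"]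
    using scale_right[of _ 0 0] nrm_scale[of 0 0] by auto
  have it_nrm: "nrm (it n k) \<le> 2 * nrm a0" for n k
  proof (induction k)
    case 0 then show ?case by (simp add: it_def zero_norms nrm_nonneg)
  next
    case (Suc k)
    then show ?case using nrm_add[of a0 "d n \<star> it n k"] d_nrm[of n "it n k"] by (simp add: it_Suc)
  qed
  have it_N: "N (it n k) \<le> 2 * N a0" for n k
  proof (induction k)
    case 0 then show ?case by (simp add: it_def zero_norms N_nonneg)
  next
    case (Suc k)
    then show ?case using N_add[of a0 "d n \<star> it n k"] d_N[of n "it n k"] by (simp add: it_Suc)
  qed
  have it_step: "N (it n (Suc k) - it n k) \<le> (1 / 2) ^ k * N a0" for n k
  proof (induction k)
    case 0 then show ?case using scale_right[of "d n" 0 0] by (simp add: it_def)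
  next
    case (Suc k)
    have "it n (Suc (Suc k)) - it n (Suc k) = d n \<star> (it n (Suc k) - it n k)"
      by (simp add: it_Suc expand)
    then show ?case using Suc d_N[of n "it n (Suc k) - it n k"] by simp
  qed
  have rhoN: "(\<lambda>n. N (\<rho> n)) \<longlonglongrightarrow> 0"
  proof (rule tendsto_sandwich[OF _ _ tendsto_const])
    have "\<rho> n = - (it n (Suc n) - it n n)" for n by (simp add: \<rho>_def \<alpha>_def it_Suc algebra_simps)
    then have "N (\<rho> n) \<le> (1 / 2) ^ n * N a0" for n using it_step by (simp only: N_minus)
    then show "\<forall>\<^sub>F n in sequentially. N (\<rho> n) \<le> (1 / 2) ^ n * N a0" by simp
    show "(\<lambda>n. (1 / 2) ^ n * N a0) \<longlonglongrightarrow> 0"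
      by (intro tendsto_mult_left_zero LIMSEQ_realpow_zero) auto
  qed (simp add: N_nonneg)
  define r where "r n = a1 n + b1 n - a1 n \<star> b1 n" for n
  have rN: "(\<lambda>n. N (r n)) \<longlonglongrightarrow> 0"
    unfolding r_def a1_def b1_def using LIMSEQ_ignore_initial_segment[OF rN, of n0] by simp
  define \<beta> where "\<beta> n = b1 n + d n - b1 n \<star> d n" for n
  define z where "z n = \<alpha> n + \<beta> n - \<alpha> n \<star> \<beta> n" for n
  define w where "w n = r n + \<rho> n - \<rho> n \<star> b1 n" for n
  have K0: "0 \<le> K" using bK[of 0] N_nonneg[of "b 0"] by linarith
  have b1K: "N (b1 n) \<le> K" for n by (simp add: b1_def bK)
  have a1_eq: "a1 n = \<alpha> n - \<rho> n + d n - d n \<star> \<alpha> n" for n by (simp add: \<rho>_def d_def)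
  \<comment> \<open>Formally (1 - d)(1 - \<alpha>) = 1 - a - \<rho>, so (1 - d)(1 - z) = (1 - a -
    \<rho>)(1 - b)(1 - d) = (1 - w)(1 - d). As N(d) is at most 1/2, this can be solved for the size
    of z.\<close>
  have z_eq: "z n = d n \<star> z n + (w n - w n \<star> d n)" for n
    unfolding w_def r_def a1_eq z_def \<beta>_def by (simp add: expand)
  have wN: "(\<lambda>n. N (w n)) \<longlonglongrightarrow> 0"
  proof (rule tendsto_sandwich[OF _ _ tendsto_const])
    have "N (w n) \<le> N (r n) + N (\<rho> n) + N (\<rho> n) * K" for n
    proof -
      have "N (\<rho> n \<star> b1 n) \<le> N (\<rho> n) * K"
        by (rule order_trans[OF N_mult]) (intro mult_left_mono b1K N_nonneg)
      then show ?thesis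
        using N_diff[of "r n + \<rho> n" "\<rho> n \<star> b1 n"] N_add[of "r n" "\<rho> n"] by (simp add: w_def)
    qed
    then show "\<forall>\<^sub>F n in sequentially. N (w n) \<le> N (r n) + N (\<rho> n) + N (\<rho> n) * K" by simp
    have "(\<lambda>n. N (r n) + N (\<rho> n) + N (\<rho> n) * K) \<longlonglongrightarrow> 0 + 0 + 0 * K"
      by (intro tendsto_intros rN rhoN)
    then show "(\<lambda>n. N (r n) + N (\<rho> n) + N (\<rho> n) * K) \<longlonglongrightarrow> 0" by simp
  qed (simp add: N_nonneg)
  have zw: "N (z n) \<le> 3 * N (w n)" for n
  proof -
    have "N (w n \<star> d n) \<le> N (w n) * (1 / 2)"
      by (rule order_trans[OF N_mult]) (intro mult_left_mono dN N_nonneg)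
    then have "N (w n - w n \<star> d n) \<le> 3 / 2 * N (w n)" using N_diff[of "w n" "w n \<star> d n"] by simp
    moreover have "N (z n) \<le> N (d n \<star> z n) + N (w n - w n \<star> d n)"
      using N_add[of "d n \<star> z n" "w n - w n \<star> d n"] z_eq[of n] by simp
    ultimately show ?thesis using d_N[of n "z n"] by linarith
  qed
  have zN: "(\<lambda>n. N (z n)) \<longlonglongrightarrow> 0"
    by (rule tendsto_sandwich[OF _ _ tendsto_const tendsto_mult_right_zero[OF wN, of 3]]) (simp_all add: N_nonneg zw)
  \<comment> \<open>\<open>\<beta>\<close> has no bound in the Hilbert norm. Its perturbation
    \<open>\<beta> - z\<close> has one, because it equals - \<alpha> (1 - \<beta>), a multiple of
    \<open>\<alpha>\<close>.\<close>
  define b' where "b' n = - \<alpha> n + \<alpha> n \<star> \<beta> n" for n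
  have b'_eq: "b' n = \<beta> n - z n" for n by (simp add: b'_def z_def)
  have r'_eq: "\<alpha> n + b' n - \<alpha> n \<star> b' n = \<alpha> n \<star> z n" for n
    by (simp add: b'_def z_def expand)
  \<comment> \<open>The total error, formally (1 - b) \<rho> - z (1 - \<alpha>). It is small in
    \<open>N\<close> only, which is why the conclusion is multiplied by a fixed g: then
    \<open>nrm (\<delta> n \<star> g)\<close> is small.\<close>
  define \<delta> where "\<delta> n = \<rho> n - b1 n \<star> \<rho> n - z n + z n \<star> \<alpha> n" for n
  have e_eq: "a1 n + b1 n - b1 n \<star> a1 n = (\<alpha> n + b' n - b' n \<star> \<alpha> n) - \<delta> n" for n
    unfolding a1_eq \<delta>_def b'_eq \<beta>_def by (simp add: expand)
  have alphaN: "N (\<alpha> n) \<le> 2 * N a0" and alphan: "nrm (\<alpha> n) \<le> 2 * nrm a0" for n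
    using it_N it_nrm by (simp_all add: \<alpha>_def)
  define L where "L = K + 1 / 2 + K / 2"
  have betaN: "N (\<beta> n) \<le> L" for n
  proof -
    have "N (b1 n \<star> d n) \<le> K * (1 / 2)"
      by (rule order_trans[OF N_mult]) (intro mult_mono b1K dN N_nonneg K0)
    then show ?thesis
      using N_diff[of "b1 n + d n" "b1 n \<star> d n"] N_add[of "b1 n" "d n"] b1K[of n] dN[of n]
      by (simp add: \<beta>_def L_def)
  qed
  have L0: "0 \<le> L" using K0 by (simp add: L_def)
  have prod_null: "(\<lambda>n. N (\<alpha> n \<star> z n)) \<longlonglongrightarrow> 0" "(\<lambda>n. N (z n \<star> \<alpha> n)) \<longlonglongrightarrow> 0" "(\<lambda>n. nrm (\<alpha> n \<star> z n)) \<longlonglongrightarrow> 0"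
  proof -
    have 1: "N (\<alpha> n \<star> z n) \<le> (2 * N a0) * N (z n)" for n
      by (rule order_trans[OF N_mult]) (intro mult_right_mono alphaN N_nonneg)
    have 2: "N (z n \<star> \<alpha> n) \<le> (2 * N a0) * N (z n)" for n
      using order_trans[OF N_mult mult_left_mono[OF alphaN N_nonneg]] by (simp add: mult.commute)
    have 3: "nrm (\<alpha> n \<star> z n) \<le> (2 * nrm a0) * N (z n)" for n
      using order_trans[OF nrm_right mult_left_mono[OF alphan N_nonneg]] by (simp add: mult.commute)
    show "(\<lambda>n. N (\<alpha> n \<star> z n)) \<longlonglongrightarrow> 0"
      by (rule LIMSEQ_zero_le[OF tendsto_mult_right_zero[OF zN] N_nonneg 1])
    show "(\<lambda>n. N (z n \<star> \<alpha> n)) \<longlonglongrightarrow> 0"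
      by (rule LIMSEQ_zero_le[OF tendsto_mult_right_zero[OF zN] N_nonneg 2])
    show "(\<lambda>n. nrm (\<alpha> n \<star> z n)) \<longlonglongrightarrow> 0"
      by (rule LIMSEQ_zero_le[OF tendsto_mult_right_zero[OF zN] nrm_nonneg 3])
  qed
  obtain Z where Z: "\<And>n. N (z n) \<le> Z"
    using convergent_imp_Bseq[OF convergentI[OF zN]] unfolding Bseq_def by (auto simp: N_nonneg)
  define B where "B = 2 * N a0 + 2 * nrm a0 + (L + Z) + (2 * nrm a0 + L * (2 * nrm a0))"
  have Z0: "0 \<le> Z" using Z[of 0] N_nonneg[of "z 0"] by linarith
  have pos: "0 \<le> 2 * N a0" "0 \<le> 2 * nrm a0" "0 \<le> L * (2 * nrm a0)" using N_nonneg nrm_nonneg L0 by auto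
  have "(\<lambda>n. nrm (\<alpha> n + b' n - b' n \<star> \<alpha> n)) \<longlonglongrightarrow> 0"
  proof (rule bullet_swap_null[where K = B])
    show "nrm (\<alpha> n) \<le> B" "N (\<alpha> n) \<le> B" for n
      using alphan[of n] alphaN[of n] pos L0 Z0 unfolding B_def by linarith+
    have "nrm (\<alpha> n \<star> \<beta> n) \<le> L * (2 * nrm a0)" for n
      by (rule order_trans[OF nrm_right]) (intro mult_mono betaN alphan nrm_nonneg L0)
    then have "nrm (b' n) \<le> 2 * nrm a0 + L * (2 * nrm a0)" for n
      using nrm_add[of "- \<alpha> n" "\<alpha> n \<star> \<beta> n"] alphan[of n] unfolding b'_def nrm_minus
      by (meson add_mono order_trans)
    then show "nrm (b' n) \<le> B" for n
      using pos L0 Z0 unfolding B_def by (smt (verit))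
    have "N (b' n) \<le> L + Z" for n
      using N_diff[of "\<beta> n" "z n"] betaN[of n] Z[of n] by (simp add: b'_eq)
    then show "N (b' n) \<le> B" for n
      using pos unfolding B_def by (smt (verit))
    show "(\<lambda>n. nrm (\<alpha> n + b' n - \<alpha> n \<star> b' n)) \<longlonglongrightarrow> 0" "(\<lambda>n. N (\<alpha> n + b' n - \<alpha> n \<star> b' n)) \<longlonglongrightarrow> 0"
      unfolding r'_eq by (rule prod_null)+
  qed
  then have main: "(\<lambda>n. nrm (\<alpha> n + b' n - b' n \<star> \<alpha> n)) \<longlonglongrightarrow> 0" .
  have deltaN: "(\<lambda>n. N (\<delta> n)) \<longlonglongrightarrow> 0"
  proof (rule tendsto_sandwich[OF _ _ tendsto_const])
    let ?F = "\<lambda>n. N (\<rho> n) + K * N (\<rho> n) + N (z n) + N (z n \<star> \<alpha> n)"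
    have "N (\<delta> n) \<le> ?F n" for n
    proof -
      have "N (b1 n \<star> \<rho> n) \<le> K * N (\<rho> n)"
        by (rule order_trans[OF N_mult]) (intro mult_right_mono b1K N_nonneg)
      then show ?thesis unfolding \<delta>_def
        using N_add[of "\<rho> n - b1 n \<star> \<rho> n - z n" "z n \<star> \<alpha> n"] N_diff[of "\<rho> n - b1 n \<star> \<rho> n" "z n"]
          N_diff[of "\<rho> n" "b1 n \<star> \<rho> n"] by linarith
    qed
    then show "\<forall>\<^sub>F n in sequentially. N (\<delta> n) \<le> ?F n" by simp
    have "?F \<longlonglongrightarrow> 0 + K * 0 + 0 + 0" by (intro tendsto_intros rhoN zN prod_null)
    then show "?F \<longlonglongrightarrow> 0" by simp
  qed (simp add: N_nonneg)
  have "(\<lambda>n. nrm ((a1 n + b1 n - b1 n \<star> a1 n) \<star> g)) \<longlonglongrightarrow> 0"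
  proof (rule tendsto_sandwich[OF _ _ tendsto_const])
    let ?F = "\<lambda>n. N g * nrm (\<alpha> n + b' n - b' n \<star> \<alpha> n) + N (\<delta> n) * nrm g"
    have "nrm ((a1 n + b1 n - b1 n \<star> a1 n) \<star> g) \<le> ?F n" for n
      unfolding e_eq diff_left[of _ "\<delta> n"]
      by (rule order_trans[OF nrm_diff]) (intro add_mono nrm_left nrm_right)
    then show "\<forall>\<^sub>F n in sequentially. nrm ((a1 n + b1 n - b1 n \<star> a1 n) \<star> g) \<le> ?F n" by simp
    have "?F \<longlonglongrightarrow> N g * 0 + 0 * nrm g" by (intro tendsto_intros main deltaN)
    then show "?F \<longlonglongrightarrow> 0" by simp
  qed (simp add: nrm_nonneg)
  then show ?thesis unfolding a1_def b1_def by (rule LIMSEQ_offset)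
qed

end

section \<open>Continuous functions with compact support\<close>

text \<open>Vanishing off some compact set passes to sums, products and translates without computing
  closures of supports. \<open>Cc_eq_cc\<close> identifies this with \<open>Cc\<close> in Hausdorff
  spaces.\<close>

definition cc :: "('a::topological_space \<Rightarrow> 'b::real_normed_vector) set" where
  "cc = {f. continuous_on UNIV f \<and> (\<exists>K. compact K \<and> (\<forall>x. x \<notin> K \<longrightarrow> f x = 0))}"

lemma ccI: "continuous_on UNIV f \<Longrightarrow> compact K \<Longrightarrow> (\<And>x. x \<notin> K \<Longrightarrow> f x = 0) \<Longrightarrow> f \<in> cc"
  by (auto simp: cc_def)

lemma cc_cont: "f \<in> cc \<Longrightarrow> continuous_on UNIV f"
  by (simp add: cc_def)

lemma Cc_eq_cc: "Cc = (cc :: ('a::t2_space \<Rightarrow> complex) set)"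
proof (rule subset_antisym; rule subsetI)
  fix f :: "'a \<Rightarrow> complex"
  assume "f \<in> Cc"
  then show "f \<in> cc"
    by (intro ccI[of f "closure {x. f x \<noteq> 0}"]) (use closure_subset[of "{x. f x \<noteq> 0}"] in \<open>auto simp: Cc_def\<close>)
next
  fix f :: "'a \<Rightarrow> complex"
  assume "f \<in> cc"
  then obtain K where K: "continuous_on UNIV f" "compact K" "\<And>x. x \<notin> K \<Longrightarrow> f x = 0" by (auto simp: cc_def)
  have "closure {x. f x \<noteq> 0} \<subseteq> K"
    using K by (intro closure_minimal compact_imp_closed) auto
  then have "compact (closure {x. f x \<noteq> 0})"
    using K(2) by (metis closed_closure compact_Int_closed inf.absorb2)
  then show "f \<in> Cc" using K(1) by (simp add: Cc_def)
qed

lemma cc_zero: "(\<lambda>x. 0) \<in> cc"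
  by (rule ccI[of _ "{}"]) auto

lemma cc_add: assumes "f \<in> cc" "g \<in> cc" shows "(\<lambda>x. f x + g x) \<in> cc"
proof -
  from assms obtain K L where "compact K" "compact L" "\<And>x. x \<notin> K \<Longrightarrow> f x = 0" "\<And>x. x \<notin> L \<Longrightarrow> g x = 0"
    by (auto simp: cc_def)
  then show ?thesis using assms
    by (intro ccI[of _ "K \<union> L"]) (auto intro!: continuous_on_add dest: cc_cont)
qed

lemma cc_comp:
  assumes "f \<in> cc" "continuous_on UNIV \<phi>" "\<phi> 0 = 0" shows "(\<lambda>x. \<phi> (f x)) \<in> cc"
proof -
  from assms(1) obtain K where "continuous_on UNIV f" "compact K" "\<And>x. x \<notin> K \<Longrightarrow> f x = 0" by (auto simp: cc_def)
  then show ?thesis using assms(2,3)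
    by (intro ccI[of _ K] continuous_on_compose2[OF assms(2)]) auto
qed

lemma cc_scaleR: "f \<in> cc \<Longrightarrow> (\<lambda>x. c *\<^sub>R f x) \<in> cc"
  by (rule cc_comp) (auto intro!: continuous_intros)

lemma cc_uminus: "f \<in> cc \<Longrightarrow> (\<lambda>x. - f x) \<in> cc"
  by (rule cc_comp) (auto intro!: continuous_intros)

lemma cc_diff: "f \<in> cc \<Longrightarrow> g \<in> cc \<Longrightarrow> (\<lambda>x. f x - g x) \<in> cc"
  using cc_add[OF _ cc_uminus, of f g] by simp

lemma cc_norm: "f \<in> cc \<Longrightarrow> (\<lambda>x. norm (f x)) \<in> cc"
  by (rule cc_comp) (auto intro!: continuous_intros)

lemma cc_cmult: "f \<in> cc \<Longrightarrow> (\<lambda>x. c * f x) \<in> cc" for c :: "'b::real_normed_algebra"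
  by (rule cc_comp) (auto intro!: continuous_intros)

lemma cc_sum: "(\<And>i. i \<in> I \<Longrightarrow> f i \<in> cc) \<Longrightarrow> (\<lambda>x. \<Sum>i\<in>I. f i x) \<in> cc"
  by (induction I rule: infinite_finite_induct) (auto intro: cc_zero cc_add)

lemma cc_mult_cont:
  fixes f g :: "'a::topological_space \<Rightarrow> 'b::real_normed_algebra"
  assumes "f \<in> cc" "continuous_on UNIV g" shows "(\<lambda>x. f x * g x) \<in> cc" "(\<lambda>x. g x * f x) \<in> cc"
proof -
  from assms(1) obtain K where "continuous_on UNIV f" "compact K" "\<And>x. x \<notin> K \<Longrightarrow> f x = 0" by (auto simp: cc_def)
  then show "(\<lambda>x. f x * g x) \<in> cc" "(\<lambda>x. g x * f x) \<in> cc" using assms(2)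
    by (intro ccI[of _ K] continuous_on_mult; simp)+
qed

lemma cc_mult: "f \<in> cc \<Longrightarrow> g \<in> cc \<Longrightarrow> (\<lambda>x. f x * g x) \<in> cc" for f g :: "'a::topological_space \<Rightarrow> 'b::real_normed_algebra"
  by (simp add: cc_mult_cont cc_cont)

lemma cc_norm_powr: assumes "f \<in> cc" "0 < (p::real)" shows "(\<lambda>x. norm (f x) powr p) \<in> cc"
proof -
  have "continuous_on UNIV (\<lambda>z::'b. norm z powr p)"
    by (rule continuous_on_powr') (use assms(2) in \<open>auto intro!: continuous_intros\<close>)
  then show ?thesis using cc_comp[OF assms(1)] assms(2) by fastforce
qed

lemma cc_homeo:
  assumes "f \<in> cc" "continuous_on UNIV T" "continuous_on UNIV S" "\<And>x. S (T x) = x"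
  shows "(\<lambda>x. f (T x)) \<in> cc"
proof -
  from assms(1) obtain K where K: "continuous_on UNIV f" "compact K" "\<And>x. x \<notin> K \<Longrightarrow> f x = 0" by (auto simp: cc_def)
  have "compact (S ` K)" using K(2) assms(3) by (intro compact_continuous_image) (auto intro: continuous_on_subset)
  then show ?thesis
  proof (rule ccI[rotated])
    show "continuous_on UNIV (\<lambda>x. f (T x))" by (rule continuous_on_compose2[OF K(1) assms(2)]) auto
    show "f (T x) = 0" if "x \<notin> S ` K" for x using that K(3) assms(4) by (metis imageI)
  qed
qed

lemma cc_left: "f \<in> cc \<Longrightarrow> (\<lambda>x. f (a + x)) \<in> cc" for a :: "'a::topological_group_add"
  by (rule cc_homeo[where S = "\<lambda>x. - a + x"]) (auto intro!: continuous_intros simp flip: add.assoc)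

lemma cc_right: "f \<in> cc \<Longrightarrow> (\<lambda>x. f (x + a)) \<in> cc" for a :: "'a::topological_group_add"
  by (rule cc_homeo[where S = "\<lambda>x. x + - a"]) (auto intro!: continuous_intros simp: add.assoc)

lemma cc_inv: "f \<in> cc \<Longrightarrow> (\<lambda>x. f (- x)) \<in> cc" for f :: "'a::topological_group_add \<Rightarrow> _"
  by (rule cc_homeo[where S = "\<lambda>x. - x"]) (auto intro!: continuous_intros)

lemma cc_bounded: assumes "f \<in> cc" obtains B where "0 \<le> B" "\<And>x. norm (f x) \<le> B"
proof -
  from assms obtain K where K: "continuous_on UNIV f" "compact K" "\<And>x. x \<notin> K \<Longrightarrow> f x = 0" by (auto simp: cc_def)
  then have "bounded (f ` K)"
    by (intro compact_imp_bounded compact_continuous_image) (auto intro: continuous_on_subset)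
  then obtain B where B: "\<And>x. x \<in> K \<Longrightarrow> norm (f x) \<le> B" by (auto simp: bounded_iff)
  have "norm (f x) \<le> max B 0" for x using B[of x] K(3)[of x] by (cases "x \<in> K") auto
  then show ?thesis by (intro that[of "max B 0"]) auto
qed

section \<open>Partitions of compact sets\<close>

lemma borel_disjointify:
  assumes "finite R" "K \<in> sets borel" "\<And>r. r \<in> R \<Longrightarrow> open (U r)" "K \<subseteq> (\<Union>r\<in>R. U r)"
  shows "\<exists>E. (\<forall>r\<in>R. E r \<in> sets borel \<and> E r \<subseteq> U r) \<and> disjoint_family_on E R \<and> (\<Union>r\<in>R. E r) = K"
  using assms
proof (induction R arbitrary: K rule: finite_induct)
  case empty
  then show ?case by (auto simp: disjoint_family_on_def)
next
  case (insert r R)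
  have "K - U r \<in> sets borel" using insert.prems by auto
  then obtain E where E: "\<forall>s\<in>R. E s \<in> sets borel \<and> E s \<subseteq> U s" "disjoint_family_on E R" "(\<Union>s\<in>R. E s) = K - U r"
  proof -
    have "K - U r \<subseteq> (\<Union>s\<in>R. U s)" using insert.prems(3) by auto
    from insert.IH[OF \<open>K - U r \<in> sets borel\<close> insert.prems(2) this] show ?thesis using that by auto
  qed
  define E' where "E' = E(r := K \<inter> U r)"
  have E'R: "E' s = E s" if "s \<in> R" for s using that insert.hyps(2) by (auto simp: E'_def)
  have "disjoint_family_on E' (insert r R)"
    using E(2,3) insert.hyps(2) unfolding disjoint_family_on_def
    by (auto simp: E'_def)
  moreover have "(\<Union>s\<in>insert r R. E' s) = K"
  proof -
    have "(\<Union>s\<in>R. E' s) = (\<Union>s\<in>R. E s)" using E'R by simp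
    then show ?thesis using E(3) by (auto simp: E'_def)
  qed
  moreover have "\<forall>s\<in>insert r R. E' s \<in> sets borel \<and> E' s \<subseteq> U s"
    using E(1) E'R insert.prems by (auto simp: E'_def)
  ultimately show ?case by blast
qed

text \<open>The cells of the Riemann sums below. A node r lies in K but possibly outside its own
  cell \<open>E r\<close>; what matters is that the cell lies in the neighbourhood
  \<open>U r\<close>, where the integrand is close to its value at r.\<close>

lemma compact_partition:
  fixes K :: "'a::t2_space set"
  assumes K: "compact K" and U: "\<And>y. y \<in> K \<Longrightarrow> open (U y) \<and> y \<in> U y"
  obtains R E where "finite R" "R \<subseteq> K" "\<And>r. r \<in> R \<Longrightarrow> E r \<in> sets borel" "\<And>r. r \<in> R \<Longrightarrow> E r \<subseteq> U r"
    "disjoint_family_on E R" "(\<Union>r\<in>R. E r) = K"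
proof -
  obtain R where R: "R \<subseteq> K" "finite R" "K \<subseteq> (\<Union>r\<in>R. U r)"
    by (rule compactE_image[OF K, of K U]) (use U in blast)+
  have "K \<in> sets borel" using K by (simp add: borel_closed compact_imp_closed)
  then show ?thesis
    using borel_disjointify[OF R(2) _ _ R(3)] U R that by (metis subsetD)
qed

text \<open>A form of the tube lemma: uniform closeness of slices over a compact set, with
  neighbourhoods in place of a modulus of continuity.\<close>

lemma continuous_on_uniform:
  fixes F :: "'a::topological_space \<Rightarrow> 'b::topological_space \<Rightarrow> 'c::metric_space"
  assumes "continuous_on UNIV (\<lambda>(y, x). F y x)" "compact K" "0 < \<epsilon>"
  obtains U where "open U" "y0 \<in> U" "\<And>y x. y \<in> U \<Longrightarrow> x \<in> K \<Longrightarrow> dist (F y x) (F y0 x) \<le> \<epsilon>"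
proof -
  have "continuous_on (UNIV \<times> K) (\<lambda>(y, x). F y x)" using assms(1) by (rule continuous_on_subset) auto
  from continuous_on_prod_compactE[OF this assms(2) UNIV_I assms(3), of y0]
  obtain U where "y0 \<in> U" "open U" "\<forall>x\<in>U \<inter> UNIV. \<forall>t\<in>K. dist (case (x, t) of (y, x) \<Rightarrow> F y x) (case (y0, t) of (y, x) \<Rightarrow> F y x) \<le> \<epsilon>"
    by blast
  then show ?thesis using that by simp
qed

lemma continuous_on_slice:
  assumes "continuous_on UNIV (\<lambda>(y, x). F y x)" shows "continuous_on UNIV (F y)" "continuous_on UNIV (\<lambda>y. F y x)"
proof -
  have "continuous_on UNIV ((\<lambda>(y, x). F y x) \<circ> (\<lambda>x. (y, x)))"
    by (intro continuous_on_compose continuous_intros) (rule continuous_on_subset[OF assms], auto)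
  then show "continuous_on UNIV (F y)" by (simp add: o_def)
  have "continuous_on UNIV ((\<lambda>(y, x). F y x) \<circ> (\<lambda>y. (y, x)))"
    by (intro continuous_on_compose continuous_intros) (rule continuous_on_subset[OF assms], auto)
  then show "continuous_on UNIV (\<lambda>y. F y x)" by (simp add: o_def)
qed

lemma continuous_on_UNIV_metricI:
  fixes f :: "'a::topological_space \<Rightarrow> 'b::metric_space"
  assumes "\<And>y0 \<epsilon>. 0 < \<epsilon> \<Longrightarrow> \<exists>U. open U \<and> y0 \<in> U \<and> (\<forall>y\<in>U. dist (f y) (f y0) \<le> \<epsilon>)"
  shows "continuous_on UNIV f"
proof -
  have "(f \<longlongrightarrow> f y0) (at y0)" for y0
  proof (rule tendstoI)
    fix e :: real assume "0 < e"
    then obtain U where U: "open U" "y0 \<in> U" "\<forall>y\<in>U. dist (f y) (f y0) \<le> e / 2"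
      using assms[of "e / 2" y0] by auto
    then show "\<forall>\<^sub>F x in at y0. dist (f x) (f y0) < e"
      unfolding eventually_at_topological using \<open>0 < e\<close> by (intro exI[of _ U]) fastforce
  qed
  then show ?thesis by (simp add: continuous_on_def)
qed

section \<open>Haar integration\<close>

locale unimodular_group =
  fixes \<mu> :: "'a::{topological_group_add, t2_space} measure"
  assumes lc: "locally_compact_space (euclidean :: 'a topology)"
    and haar: "left_haar_measure \<mu>"
    and unim: "unimodular \<mu>"
begin

lemma radon: "radon_measure \<mu>" using haar by (simp add: left_haar_measure_def)

lemma sets_mu[measurable_cong, simp]: "sets \<mu> = sets borel"
  using radon by (simp add: radon_measure_def)

lemma space_mu[simp]: "space \<mu> = UNIV"
  using sets_eq_imp_space_eq[OF sets_mu] by simp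

lemma compact_finite: "compact K \<Longrightarrow> emeasure \<mu> K < \<infinity>"
  using radon by (simp add: radon_measure_def)

lemma compact_sets: "compact K \<Longrightarrow> K \<in> sets \<mu>"
  by (simp add: borel_closed compact_imp_closed)

lemma cont_measurable: "continuous_on UNIV f \<Longrightarrow> f \<in> borel_measurable \<mu>"
  using borel_measurable_continuous_onI by (simp add: measurable_cong_sets[OF sets_mu refl])

lemma cc_measurable: "f \<in> cc \<Longrightarrow> f \<in> borel_measurable \<mu>"
  by (simp add: cont_measurable cc_cont)

lemma integrable_support:
  fixes f :: "'a \<Rightarrow> 'b::{banach, second_countable_topology}"
  assumes "f \<in> borel_measurable \<mu>" "compact K" "\<And>x. x \<notin> K \<Longrightarrow> f x = 0" "\<And>x. norm (f x) \<le> B"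
  shows "integrable \<mu> f" "norm (integral\<^sup>L \<mu> f) \<le> B * measure \<mu> K"
proof -
  have B: "integrable \<mu> (\<lambda>x. B * indicator K x :: real)"
    using compact_finite[OF assms(2)] compact_sets[OF assms(2)] by simp
  show int: "integrable \<mu> f"
    by (rule Bochner_Integration.integrable_bound[OF B]) (use assms in \<open>auto simp: indicator_def intro!: AE_I2 order_trans[OF _ abs_ge_self]\<close>)
  have "norm (integral\<^sup>L \<mu> f) \<le> (\<integral>x. norm (f x) \<partial>\<mu>)" by (rule integral_norm_bound)
  also have "\<dots> \<le> (\<integral>x. B * indicator K x \<partial>\<mu>)"
    by (rule integral_mono) (use int B assms in \<open>auto simp: indicator_def\<close>)
  also have "\<dots> = B * measure \<mu> K" by simp
  finally show "norm (integral\<^sup>L \<mu> f) \<le> B * measure \<mu> K" .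
qed

lemma cc_integrable: 
  fixes f :: "'a \<Rightarrow> 'b::{banach, second_countable_topology}"
  assumes "f \<in> cc" shows "integrable \<mu> f"
proof -
  obtain B where "\<And>x. norm (f x) \<le> B" using cc_bounded[OF assms] by blast
  moreover obtain K where "compact K" "\<And>x. x \<notin> K \<Longrightarrow> f x = 0" using assms by (auto simp: cc_def)
  ultimately show ?thesis using integrable_support(1)[OF cc_measurable[OF assms]] by blast
qed

text \<open>The error of a Riemann sum: the step function with the values \<open>v r\<close> is
  within \<epsilon> of h on K, and both vanish elsewhere.\<close>

lemma integral_simple_approx:
  fixes h :: "'a \<Rightarrow> 'b::{banach, second_countable_topology}"
  assumes h: "h \<in> borel_measurable \<mu>" and K: "compact K" "\<And>x. x \<notin> K \<Longrightarrow> h x = 0"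
    and E: "finite R" "\<And>r. r \<in> R \<Longrightarrow> E r \<in> sets borel" "disjoint_family_on E R" "(\<Union>r\<in>R. E r) = K"
    and v: "\<And>r y. r \<in> R \<Longrightarrow> y \<in> E r \<Longrightarrow> norm (h y - v r) \<le> \<epsilon>" and \<epsilon>: "0 \<le> \<epsilon>"
  shows "norm (integral\<^sup>L \<mu> h - (\<Sum>r\<in>R. measure \<mu> (E r) *\<^sub>R v r)) \<le> \<epsilon> * measure \<mu> K"
proof -
  define s where "s y = (\<Sum>r\<in>R. indicator (E r) y *\<^sub>R v r)" for y
  have s_eq: "s y = v r" if "r \<in> R" "y \<in> E r" for y r
  proof -
    have "s y = (\<Sum>q\<in>R. if q = r then v r else 0)"
      unfolding s_def using E(3) that by (intro sum.cong refl) (auto simp: disjoint_family_on_def indicator_def)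
    then show ?thesis using that E(1) by simp
  qed
  have s0: "s y = 0" if "y \<notin> K" for y
    unfolding s_def using that E(4) by (intro sum.neutral) (auto simp: indicator_def)
  have Efin: "emeasure \<mu> (E r) < \<infinity>" if "r \<in> R" for r
    using emeasure_mono[of "E r" K \<mu>] compact_finite[OF K(1)] compact_sets[OF K(1)] E(4) that
    by (auto intro: le_less_trans)
  have s_int: "has_bochner_integral \<mu> s (\<Sum>r\<in>R. measure \<mu> (E r) *\<^sub>R v r)"
    unfolding s_def using E(2) Efin by (intro has_bochner_integral_sum has_bochner_integral_indicator) auto
  have bd: "norm (h y - s y) \<le> \<epsilon>" for y
  proof (cases "y \<in> K")
    case True
    then obtain r where "r \<in> R" "y \<in> E r" using E(4) by blast
    then show ?thesis using s_eq v by simp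
  next
    case False then show ?thesis using K(2) s0 \<epsilon> by simp
  qed
  have sm: "s \<in> borel_measurable \<mu>" using s_int by (auto simp: has_bochner_integral_iff)
  have dm: "(\<lambda>y. h y - s y) \<in> borel_measurable \<mu>" using h sm by measurable
  note bound = integrable_support[OF dm K(1) _ bd]
  have "integrable \<mu> (\<lambda>y. h y - s y)" "norm (\<integral>y. h y - s y \<partial>\<mu>) \<le> \<epsilon> * measure \<mu> K"
    using bound K(2) s0 by auto
  moreover have "integrable \<mu> h"
    using Bochner_Integration.integrable_add[OF calculation(1), of s] s_int by (simp add: has_bochner_integral_iff)
  ultimately show ?thesis using s_int by (simp add: has_bochner_integral_iff)
qed

lemma continuous_on_param_integral:
  fixes F :: "'c::topological_space \<Rightarrow> 'a \<Rightarrow> 'b::{banach, second_countable_topology}"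
  assumes F: "continuous_on UNIV (\<lambda>(y, x). F y x)" and K: "compact K" "\<And>y x. x \<notin> K \<Longrightarrow> F y x = 0"
  shows "continuous_on UNIV (\<lambda>y. \<integral>x. F y x \<partial>\<mu>)"
proof (rule continuous_on_UNIV_metricI)
  fix y0 and \<epsilon> :: real assume \<epsilon>: "0 < \<epsilon>"
  define \<delta> where "\<delta> = \<epsilon> / (1 + measure \<mu> K)"
  have M: "0 < 1 + measure \<mu> K" using measure_nonneg[of \<mu> K] by linarith
  have \<delta>: "0 < \<delta>" using \<epsilon> M by (simp add: \<delta>_def)
  obtain U where U: "open U" "y0 \<in> U" "\<And>y x. y \<in> U \<Longrightarrow> x \<in> K \<Longrightarrow> dist (F y x) (F y0 x) \<le> \<delta>"
    using continuous_on_uniform[OF F K(1) \<delta>] by metis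
  have Fcc: "F y \<in> cc" for y using continuous_on_slice(1)[OF F] K by (intro ccI[of _ K]) auto
  have "dist (\<integral>x. F y x \<partial>\<mu>) (\<integral>x. F y0 x \<partial>\<mu>) \<le> \<epsilon>" if "y \<in> U" for y
  proof -
    have "norm (\<integral>x. F y x - F y0 x \<partial>\<mu>) \<le> \<delta> * measure \<mu> K"
    proof (rule integrable_support(2)[OF _ K(1)])
      show "(\<lambda>x. F y x - F y0 x) \<in> borel_measurable \<mu>" using Fcc by (intro cc_measurable cc_diff)
      show "norm (F y x - F y0 x) \<le> \<delta>" for x
        using U(3)[OF that, of x] K(2)[of x] \<delta> by (cases "x \<in> K") (auto simp: dist_norm)
    qed (use K in auto)
    also have "\<dots> \<le> \<delta> * (1 + measure \<mu> K)" using \<delta> by simp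
    also have "\<dots> = \<epsilon>" using M by (simp add: \<delta>_def)
    finally show ?thesis using Fcc by (simp add: dist_norm cc_integrable)
  qed
  with U show "\<exists>U. open U \<and> y0 \<in> U \<and> (\<forall>y\<in>U. dist (\<integral>x. F y x \<partial>\<mu>) (\<integral>x. F y0 x \<partial>\<mu>) \<le> \<epsilon>)" by blast
qed

text \<open>
  The measure \<open>\<mu>\<close> need not be \<open>\<sigma>\<close>-finite and the Borel sets of \<open>G \<times> G\<close> need not be generated by rectangles,
  so Fubini's theorem is proved for continuous functions with compact support only. The outer
  functional is allowed to be any that is continuous on functions with a fixed compact support.
\<close>

lemma integral_functional_swap:
  fixes F :: "'a \<Rightarrow> 'c::topological_space \<Rightarrow> 'b::{banach, second_countable_topology}"
    and M :: "('c \<Rightarrow> 'b) \<Rightarrow> 'd::{banach, second_countable_topology}"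
  assumes F: "continuous_on UNIV (\<lambda>(y, x). F y x)" and K: "compact K" "compact L"
    and F0: "\<And>y x. y \<notin> K \<Longrightarrow> F y x = 0" "\<And>y x. x \<notin> L \<Longrightarrow> F y x = 0"
    and M_add: "\<And>f g. f \<in> cc \<Longrightarrow> g \<in> cc \<Longrightarrow> M (\<lambda>x. f x + g x) = M f + M g"
    and M_scale: "\<And>c f. f \<in> cc \<Longrightarrow> M (\<lambda>x. c *\<^sub>R f x) = c *\<^sub>R M f"
    and M_bound: "\<And>f s. f \<in> cc \<Longrightarrow> (\<And>x. x \<notin> L \<Longrightarrow> f x = 0) \<Longrightarrow> (\<And>x. norm (f x) \<le> s) \<Longrightarrow> norm (M f) \<le> B * s"
  shows "M (\<lambda>x. \<integral>y. F y x \<partial>\<mu>) = (\<integral>y. M (F y) \<partial>\<mu>)" "continuous_on UNIV (\<lambda>y. M (F y))"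
proof -
  have Fcc: "F y \<in> cc" for y using continuous_on_slice(1)[OF F] K F0 by (intro ccI[of _ L]) auto
  have M_diff: "M (\<lambda>x. f x - g x) = M f - M g" if "f \<in> cc" "g \<in> cc" for f g
    using M_add[OF that(1) cc_scaleR[OF that(2), of "-1"]] M_scale[OF that(2), of "-1"] by simp
  have M_zero: "M (\<lambda>x. 0) = 0" using M_scale[OF cc_zero, of 0] by simp
  have M_sum: "M (\<lambda>x. \<Sum>i\<in>I. f i x) = (\<Sum>i\<in>I. M (f i))" if "finite I" "\<And>i. i \<in> I \<Longrightarrow> f i \<in> cc" for I :: "'a set" and f
    using that by (induction I rule: finite_induct) (auto simp: M_zero M_add cc_sum)
  have B0: "0 \<le> B"
    using order_trans[OF norm_ge_zero M_bound[OF cc_zero, of 1]] by simp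
  have M_close: "norm (M (F y) - M (F y')) \<le> B * \<delta>" if "\<And>x. x \<in> L \<Longrightarrow> dist (F y x) (F y' x) \<le> \<delta>" "0 \<le> \<delta>" for y y' \<delta>
  proof -
    have "norm (F y x - F y' x) \<le> \<delta>" for x
      using that F0(2)[of x] by (cases "x \<in> L") (auto simp: dist_norm)
    then show ?thesis
      using M_bound[OF cc_diff[OF Fcc[of y] Fcc[of y']], of \<delta>] F0(2) M_diff[OF Fcc Fcc] by simp
  qed
  show cont: "continuous_on UNIV (\<lambda>y. M (F y))"
  proof (rule continuous_on_UNIV_metricI)
    fix y0 and \<epsilon> :: real assume \<epsilon>: "0 < \<epsilon>"
    define \<delta> where "\<delta> = \<epsilon> / (1 + B)"
    have \<delta>: "0 < \<delta>" "B * \<delta> \<le> \<epsilon>" using \<epsilon> B0 by (auto simp: \<delta>_def field_simps)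
    obtain U where U: "open U" "y0 \<in> U" "\<And>y x. y \<in> U \<Longrightarrow> x \<in> L \<Longrightarrow> dist (F y x) (F y0 x) \<le> \<delta>"
      using continuous_on_uniform[OF F K(2) \<delta>(1)] by metis
    have "dist (M (F y)) (M (F y0)) \<le> \<epsilon>" if "y \<in> U" for y
      using M_close[of y y0 \<delta>] U(3)[OF that] \<delta> by (simp add: dist_norm)
    then show "\<exists>U. open U \<and> y0 \<in> U \<and> (\<forall>y\<in>U. dist (M (F y)) (M (F y0)) \<le> \<epsilon>)"
      using U by blast
  qed
  define G where "G x = (\<integral>y. F y x \<partial>\<mu>)" for x
  have Gcc: "G \<in> cc"
  proof (rule ccI[OF _ K(2)])
    have "continuous_on UNIV ((\<lambda>(y, x). F y x) \<circ> (\<lambda>(x, y). (y, x)))"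
      by (intro continuous_on_compose continuous_on_subset[OF F]) (auto simp: split_beta intro!: continuous_intros)
    then have "continuous_on UNIV (\<lambda>(x, y). F y x)" by (simp add: o_def split_beta)
    then show "continuous_on UNIV G"
      unfolding G_def by (rule continuous_on_param_integral[OF _ K(1)]) (use F0 in auto)
  qed (use F0 in \<open>simp add: G_def\<close>)
  have "norm (M G - (\<integral>y. M (F y) \<partial>\<mu>)) \<le> 2 * B * measure \<mu> K * \<epsilon>" if \<epsilon>: "0 < \<epsilon>" for \<epsilon>
  proof -
    have "\<exists>U. open U \<and> y0 \<in> U \<and> (\<forall>y\<in>U. \<forall>x\<in>L. dist (F y x) (F y0 x) \<le> \<epsilon>)" for y0
      by (rule continuous_on_uniform[OF F K(2) \<epsilon>]) blast
    then obtain U where U: "\<And>y0. open (U y0) \<and> y0 \<in> U y0" "\<And>y0 y x. y \<in> U y0 \<Longrightarrow> x \<in> L \<Longrightarrow> dist (F y x) (F y0 x) \<le> \<epsilon>"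
      by metis
    obtain R E where R: "finite R" "R \<subseteq> K" "\<And>r. r \<in> R \<Longrightarrow> E r \<in> sets borel" "\<And>r. r \<in> R \<Longrightarrow> E r \<subseteq> U r"
      "disjoint_family_on E R" "(\<Union>r\<in>R. E r) = K"
      using compact_partition[OF K(1), of U] U(1) by metis
    \<comment> \<open>\<open>M\<close> commutes with this finite sum, so \<open>M S\<close> is a
      Riemann sum of \<open>M (F y)\<close> over the same partition; both sides of the claim are
      within a multiple of \<epsilon> of it.\<close>
    define S where "S x = (\<Sum>r\<in>R. measure \<mu> (E r) *\<^sub>R F r x)" for x
    have Scc: "S \<in> cc" unfolding S_def by (intro cc_sum cc_scaleR Fcc)
    have GS: "norm (G x - S x) \<le> \<epsilon> * measure \<mu> K" for x
      unfolding G_def S_def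
    proof (rule integral_simple_approx[OF _ K(1) _ R(1,3,5,6)])
      show "(\<lambda>y. F y x) \<in> borel_measurable \<mu>" by (rule cont_measurable[OF continuous_on_slice(2)[OF F]])
      show "norm (F y x - F r x) \<le> \<epsilon>" if "r \<in> R" "y \<in> E r" for r y
        using U(2)[of y r x] F0(2)[of x] R(4) that \<epsilon> by (cases "x \<in> L") (auto simp: dist_norm)
    qed (use F0 \<epsilon> in auto)
    have "norm (M G - M S) \<le> B * (\<epsilon> * measure \<mu> K)"
      unfolding M_diff[OF Gcc Scc, symmetric]
      by (rule M_bound[OF cc_diff[OF Gcc Scc]]) (use F0 GS in \<open>auto simp: G_def S_def\<close>)
    moreover have "M S = (\<Sum>r\<in>R. measure \<mu> (E r) *\<^sub>R M (F r))"
      unfolding S_def by (subst M_sum) (auto simp: M_scale Fcc cc_scaleR R)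
    moreover have "norm ((\<integral>y. M (F y) \<partial>\<mu>) - (\<Sum>r\<in>R. measure \<mu> (E r) *\<^sub>R M (F r))) \<le> (B * \<epsilon>) * measure \<mu> K"
    proof (rule integral_simple_approx[OF _ K(1) _ R(1,3,5,6)])
      show "M (F y) = 0" if "y \<notin> K" for y
      proof -
        have "F y = (\<lambda>x. 0)" using F0(1) that by auto
        then show ?thesis by (simp add: M_zero)
      qed
      show "norm (M (F y) - M (F r)) \<le> B * \<epsilon>" if "r \<in> R" "y \<in> E r" for r y
      proof (rule M_close)
        have "y \<in> U r" using R(4) that by blast
        then show "dist (F y x) (F r x) \<le> \<epsilon>" if "x \<in> L" for x using U(2) that by blast
      qed (use \<epsilon> in simp)
    qed (use cont_measurable[OF cont] B0 \<epsilon> in auto)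
    ultimately have "norm (M G - (\<integral>y. M (F y) \<partial>\<mu>)) \<le> B * (\<epsilon> * measure \<mu> K) + B * \<epsilon> * measure \<mu> K"
      using norm_diff_triangle_le norm_minus_commute by metis
    then show ?thesis by (simp add: algebra_simps)
  qed
  note close = this
  have "norm (M G - (\<integral>y. M (F y) \<partial>\<mu>)) \<le> 0"
  proof (rule field_le_epsilon)
    fix e :: real assume e: "0 < e"
    define C where "C = 2 * B * measure \<mu> K"
    have C: "0 \<le> C" using B0 by (simp add: C_def)
    have "norm (M G - (\<integral>y. M (F y) \<partial>\<mu>)) \<le> C * (e / (1 + C))"
      unfolding C_def[symmetric] using close[of "e / (1 + C)"] e C by (simp add: C_def)
    also have "\<dots> \<le> e" using e C by (simp add: field_simps)
    finally show "norm (M G - (\<integral>y. M (F y) \<partial>\<mu>)) \<le> 0 + e" by simp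
  qed
  then show "M (\<lambda>x. \<integral>y. F y x \<partial>\<mu>) = (\<integral>y. M (F y) \<partial>\<mu>)" by (simp add: G_def[abs_def])
qed

lemma Fubini_cc:
  fixes F :: "'a \<Rightarrow> 'a \<Rightarrow> 'b::{banach, second_countable_topology}"
  assumes F: "continuous_on UNIV (\<lambda>(y, x). F y x)" and K: "compact K" "compact L"
    and F0: "\<And>y x. y \<notin> K \<Longrightarrow> F y x = 0" "\<And>y x. x \<notin> L \<Longrightarrow> F y x = 0"
  shows "(\<integral>x. \<integral>y. F y x \<partial>\<mu> \<partial>\<mu>) = (\<integral>y. \<integral>x. F y x \<partial>\<mu> \<partial>\<mu>)"
proof (rule integral_functional_swap(1)[OF F K F0, where M = "integral\<^sup>L \<mu>" and B = "measure \<mu> L"])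
  fix f :: "'a \<Rightarrow> 'b" and s assume "f \<in> cc" "\<And>x. x \<notin> L \<Longrightarrow> f x = 0" "\<And>x. norm (f x) \<le> s"
  then show "norm (integral\<^sup>L \<mu> f) \<le> measure \<mu> L * s"
    using integrable_support(2)[OF cc_measurable K(2)] by (metis mult.commute)
qed (auto simp: cc_integrable)

end

section \<open>Urysohn functions and translation invariance of the integral\<close>

lemma Hausdorff_space_euclidean_t2: "Hausdorff_space (euclidean :: 'a::t2_space topology)"
  unfolding Hausdorff_space_def using hausdorff by (fastforce simp: disjnt_def)

context unimodular_group
begin

lemma outer_regular: "E \<in> sets borel \<Longrightarrow> emeasure \<mu> E = (INF U\<in>{U. open U \<and> E \<subseteq> U}. emeasure \<mu> U)"
  using radon unfolding radon_measure_def by blast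

lemma inner_regular: "open U \<Longrightarrow> emeasure \<mu> U = (SUP K\<in>{K. compact K \<and> K \<subseteq> U}. emeasure \<mu> K)"
  using radon unfolding radon_measure_def by blast

text \<open>Compact support is obtained by making the Urysohn function vanish off U \<inter> V,
  where V is an open neighbourhood of K inside a compact set.\<close>

lemma Urysohn_cc:
  assumes K: "compact K" and U: "open U" "K \<subseteq> U"
  obtains g :: "'a \<Rightarrow> real" where "g \<in> cc" "\<And>x. 0 \<le> g x" "\<And>x. g x \<le> 1" "\<And>x. x \<in> K \<Longrightarrow> g x = 1" "\<And>x. x \<notin> U \<Longrightarrow> g x = 0"
proof -
  note H = Hausdorff_space_euclidean_t2[where 'a = 'a]
  have "completely_regular_space (euclidean :: 'a topology)"
    using locally_compact_regular_imp_completely_regular_space lc H by blast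
  moreover obtain V L where V: "open V" "compact L" "K \<subseteq> V" "V \<subseteq> L"
    using locally_compact_space_compact_closed_compact[of "euclidean :: 'a topology"] lc H K
    by (auto simp flip: open_openin)
  moreover have "closedin euclidean (- (U \<inter> V))" "disjnt K (- (U \<inter> V))" "compactin euclidean K"
    using U V K by (auto simp: disjnt_def simp flip: closed_closedin)
  ultimately obtain g where g: "continuous_map euclidean (subtopology euclidean {0..1::real}) g"
      "g ` (- (U \<inter> V)) \<subseteq> {0}" "g ` K \<subseteq> {1}"
    using Urysohn_completely_regular_compact_closed[of 0 1 euclidean K "- (U \<inter> V)"] by auto
  have cont: "continuous_on UNIV g" and g01: "\<And>x. g x \<in> {0..1}"
    using g(1) by (auto simp: continuous_map_in_subtopology)
  show ?thesis
  proof
    show "g \<in> cc" using g(2) V by (intro ccI[OF cont V(2)]) blast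
    show "0 \<le> g x" "g x \<le> 1" for x using g01[of x] by auto
    show "g x = 1" if "x \<in> K" for x using g(3) that by blast
    show "g x = 0" if "x \<notin> U" for x using g(2) that by blast
  qed
qed

lemma measurable_homeo:
  assumes "continuous_on UNIV (T :: 'a \<Rightarrow> 'a)" shows "T \<in> measurable \<mu> \<mu>"
  using borel_measurable_continuous_onI[OF assms] by (simp add: measurable_cong_sets[OF sets_mu sets_mu])

lemma distr_homeo:
  assumes T: "continuous_on UNIV T" "continuous_on UNIV S" "\<And>x. S (T x) = x" "\<And>x. T (S x) = x"
    and inv: "\<And>E. E \<in> sets borel \<Longrightarrow> emeasure \<mu> (S ` E) = emeasure \<mu> E"
  shows "distr \<mu> \<mu> T = \<mu>"
proof (rule measure_eqI)
  fix E assume "E \<in> sets (distr \<mu> \<mu> T)"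
  then have E: "E \<in> sets borel" by simp
  have "T -` E = S ` E"
  proof (intro subset_antisym subsetI)
    fix x assume "x \<in> T -` E"
    then show "x \<in> S ` E" using T(3)[of x] by (metis image_eqI vimageD)
  next
    fix x assume "x \<in> S ` E"
    then show "x \<in> T -` E" using T(4) by auto
  qed
  then show "emeasure (distr \<mu> \<mu> T) E = emeasure \<mu> E"
    using E inv measurable_homeo[OF T(1)] by (simp add: emeasure_distr)
qed simp

lemma distr_left: "distr \<mu> \<mu> (\<lambda>x. a + x) = \<mu>"
  by (rule distr_homeo[where S = "\<lambda>x. - a + x"])
    (use haar in \<open>auto intro!: continuous_intros simp: left_haar_measure_def simp flip: add.assoc\<close>)

lemma distr_right: "distr \<mu> \<mu> (\<lambda>x. x + a) = \<mu>"
  by (rule distr_homeo[where S = "\<lambda>x. x + - a"])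
    (use unim[unfolded unimodular_def, rule_format, of _ "- a"] in \<open>auto intro!: continuous_intros simp: add.assoc\<close>)

lemma integral_left:
  fixes f :: "'a \<Rightarrow> 'b::{banach, second_countable_topology}"
  assumes "f \<in> borel_measurable \<mu>" shows "(\<integral>x. f (a + x) \<partial>\<mu>) = integral\<^sup>L \<mu> f"
  using integral_distr[of "\<lambda>x. a + x" \<mu> \<mu> f] assms measurable_homeo[of "\<lambda>x. a + x"]
  by (simp add: distr_left continuous_on_add)

lemma integral_right:
  fixes f :: "'a \<Rightarrow> 'b::{banach, second_countable_topology}"
  assumes "f \<in> borel_measurable \<mu>" shows "(\<integral>x. f (x + a) \<partial>\<mu>) = integral\<^sup>L \<mu> f"
  using integral_distr[of "\<lambda>x. x + a" \<mu> \<mu> f] assms measurable_homeo[of "\<lambda>x. x + a"]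
  by (simp add: distr_right continuous_on_add)

text \<open>Inner regularity of the whole group yields a compact set of positive measure, and a
  Urysohn function above its indicator can be normalised.\<close>

lemma cc_integral_pos: obtains \<phi> :: "'a \<Rightarrow> real" where "\<phi> \<in> cc" "\<And>x. 0 \<le> \<phi> x" "integral\<^sup>L \<mu> \<phi> = 1"
proof -
  have "emeasure \<mu> UNIV = (SUP K\<in>{K. compact K \<and> K \<subseteq> UNIV}. emeasure \<mu> K)"
    by (rule inner_regular[OF open_UNIV])
  then have "(SUP K\<in>{K. compact K \<and> K \<subseteq> UNIV}. emeasure \<mu> K) \<noteq> 0"
    using haar by (simp add: left_haar_measure_def)
  then obtain K where K: "compact K" "emeasure \<mu> K \<noteq> 0"
    by (metis (mono_tags, lifting) SUP_bot_conv(2) bot_ennreal mem_Collect_eq)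
  obtain g :: "'a \<Rightarrow> real" where g: "g \<in> cc" "\<And>x. 0 \<le> g x" "\<And>x. x \<in> K \<Longrightarrow> g x = 1"
    using Urysohn_cc[OF K(1) open_UNIV subset_UNIV] by metis
  have "measure \<mu> K = (\<integral>x. indicator K x \<partial>\<mu>)" by simp
  also have "\<dots> \<le> integral\<^sup>L \<mu> g"
  proof (rule integral_mono)
    show "integrable \<mu> (indicator K :: 'a \<Rightarrow> real)"
      by (rule integrable_real_indicator[OF compact_sets[OF K(1)] compact_finite[OF K(1)]])
  qed (use g in \<open>auto simp: cc_integrable indicator_def\<close>)
  finally have "measure \<mu> K \<le> integral\<^sup>L \<mu> g" .
  moreover have "measure \<mu> K > 0"
    using K compact_finite[OF K(1)] by (simp add: measure_def enn2real_positive_iff zero_less_iff_neq_zero)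
  ultimately have pos: "0 < integral\<^sup>L \<mu> g" by linarith
  show ?thesis
  proof
    show "(\<lambda>x. g x / integral\<^sup>L \<mu> g) \<in> cc" using cc_scaleR[OF g(1), of "1 / integral\<^sup>L \<mu> g"] by simp
    show "0 \<le> g x / integral\<^sup>L \<mu> g" for x using g(2) pos by simp
    show "(\<integral>x. g x / integral\<^sup>L \<mu> g \<partial>\<mu>) = 1" using pos by simp
  qed
qed

section \<open>Invariance under inversion\<close>

lemma compact_sum: "compact K \<Longrightarrow> compact L \<Longrightarrow> compact {x + y | x y. x \<in> K \<and> y \<in> L}" for K L :: "'a set"
proof -
  assume "compact K" "compact L"
  then have "compact ((\<lambda>(x, y). x + y) ` (K \<times> L))"
    by (intro compact_continuous_image compact_Times) (auto simp: split_beta intro!: continuous_intros)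
  moreover have "(\<lambda>(x, y). x + y) ` (K \<times> L) = {x + y | x y. x \<in> K \<and> y \<in> L}" by auto
  ultimately show ?thesis by simp
qed

lemma compact_minus: "compact K \<Longrightarrow> compact (uminus ` K)" for K :: "'a set"
  by (intro compact_continuous_image) (auto intro!: continuous_intros)

text \<open>With \<open>\<integral>g = 1\<close>: \<open>\<integral>f(x\<^sup>-\<^sup>1) dx = \<integral>\<integral>f(x\<^sup>-\<^sup>1) g(yx) dy dx = \<integral>\<integral>f(x\<^sup>-\<^sup>1y) g(x) dx dy = \<integral>f\<close>.\<close>

lemma integral_cc_minus:
  fixes f :: "'a \<Rightarrow> 'b::{banach, second_countable_topology}"
  assumes f: "f \<in> cc" shows "(\<integral>x. f (- x) \<partial>\<mu>) = integral\<^sup>L \<mu> f"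
proof -
  obtain g :: "'a \<Rightarrow> real" where g: "g \<in> cc" "integral\<^sup>L \<mu> g = 1" using cc_integral_pos by blast
  obtain K where K: "compact K" "\<And>x. x \<notin> K \<Longrightarrow> f x = 0" using f by (auto simp: cc_def)
  obtain L where L: "compact L" "\<And>x. x \<notin> L \<Longrightarrow> g x = 0" using g by (auto simp: cc_def)
  note cf = cc_cont[OF f] and cg = cc_cont[OF g(1)]
  have "(\<integral>x. f (- x) \<partial>\<mu>) = (\<integral>x. \<integral>y. g (y + x) *\<^sub>R f (- x) \<partial>\<mu> \<partial>\<mu>)"
  proof (rule Bochner_Integration.integral_cong[OF refl])
    fix x
    have "(\<integral>y. g (y + x) *\<^sub>R f (- x) \<partial>\<mu>) = (\<integral>y. g (y + x) \<partial>\<mu>) *\<^sub>R f (- x)"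
      by (rule integral_scaleR_left) (simp add: cc_integrable cc_right g)
    then show "f (- x) = (\<integral>y. g (y + x) *\<^sub>R f (- x) \<partial>\<mu>)"
      using integral_right[OF cc_measurable[OF g(1)]] g(2) by simp
  qed
  also have "\<dots> = (\<integral>y. \<integral>x. g (y + x) *\<^sub>R f (- x) \<partial>\<mu> \<partial>\<mu>)"
  proof (rule Fubini_cc[OF _ compact_sum[OF L(1) K(1)] compact_minus[OF K(1)]])
    show "continuous_on UNIV (\<lambda>(y, x). g (y + x) *\<^sub>R f (- x))"
      unfolding split_beta
      by (intro continuous_intros continuous_on_compose2[OF cg] continuous_on_compose2[OF cf]) auto
    show "g (y + x) *\<^sub>R f (- x) = 0" if "x \<notin> uminus ` K" for y x
    proof -
      have "- x \<notin> K" using that by force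
      then show ?thesis using K(2) by simp
    qed
    show "g (y + x) *\<^sub>R f (- x) = 0" if y: "y \<notin> {x + y | x y. x \<in> L \<and> y \<in> K}" for y x
    proof (cases "y + x \<in> L \<and> - x \<in> K")
      case True
      have "y = (y + x) + - x" by (simp add: add.assoc)
      with True y show ?thesis by blast
    next
      case False then show ?thesis using K(2) L(2) by auto
    qed
  qed
  also have "\<dots> = (\<integral>y. \<integral>x. g x *\<^sub>R f (- x + y) \<partial>\<mu> \<partial>\<mu>)"
  proof (rule Bochner_Integration.integral_cong[OF refl])
    fix y
    have "(\<lambda>x. g x *\<^sub>R f (- x + y)) \<in> borel_measurable \<mu>"
      by (intro cont_measurable continuous_intros cg continuous_on_compose2[OF cf]) auto
    from integral_left[OF this, of y] show "(\<integral>x. g (y + x) *\<^sub>R f (- x) \<partial>\<mu>) = (\<integral>x. g x *\<^sub>R f (- x + y) \<partial>\<mu>)"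
      by (simp add: minus_add add.assoc)
  qed
  also have "\<dots> = (\<integral>x. \<integral>y. g x *\<^sub>R f (- x + y) \<partial>\<mu> \<partial>\<mu>)"
  proof (rule Fubini_cc[OF _ L(1) compact_sum[OF L(1) K(1)]])
    show "continuous_on UNIV (\<lambda>(x, y). g x *\<^sub>R f (- x + y))"
      unfolding split_beta
      by (intro continuous_intros continuous_on_compose2[OF cg] continuous_on_compose2[OF cf]) auto
    show "g x *\<^sub>R f (- x + y) = 0" if "x \<notin> L" for x y using L(2)[OF that] by simp
    show "g x *\<^sub>R f (- x + y) = 0" if y: "y \<notin> {x + y | x y. x \<in> L \<and> y \<in> K}" for x y
    proof (cases "x \<in> L \<and> - x + y \<in> K")
      case True
      have "y = x + (- x + y)" by (simp flip: add.assoc)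
      with True y show ?thesis by blast
    next
      case False then show ?thesis using K(2) L(2) by auto
    qed
  qed
  also have "\<dots> = (\<integral>x. g x *\<^sub>R integral\<^sup>L \<mu> f \<partial>\<mu>)"
    by (simp add: integral_left[OF cc_measurable[OF f]])
  also have "\<dots> = integral\<^sup>L \<mu> f" using g by (simp add: cc_integrable)
  finally show ?thesis .
qed

text \<open>A compact subset of the reflected open set carries a Urysohn function supported there;
  its integral does not change under reflection, where it lies below the indicator of U. Inner
  regularity concludes.\<close>

lemma emeasure_minus_le:
  assumes U: "open U" shows "emeasure \<mu> (uminus ` U) \<le> emeasure \<mu> U"
proof -
  have image: "uminus ` U = uminus -` U" by force
  have oU: "open (uminus ` U)"
    unfolding image by (rule open_vimage[OF U]) (auto intro!: continuous_intros)
  have "emeasure \<mu> K \<le> emeasure \<mu> U" if K: "compact K" "K \<subseteq> uminus ` U" for K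
  proof -
    obtain g :: "'a \<Rightarrow> real" where g: "g \<in> cc" "\<And>x. 0 \<le> g x" "\<And>x. g x \<le> 1" "\<And>x. x \<in> K \<Longrightarrow> g x = 1" "\<And>x. x \<notin> uminus ` U \<Longrightarrow> g x = 0"
      using Urysohn_cc[OF K(1) oU K(2)] by blast
    have "emeasure \<mu> K = (\<integral>\<^sup>+x. indicator K x \<partial>\<mu>)" using compact_sets[OF K(1)] by simp
    also have "\<dots> \<le> (\<integral>\<^sup>+x. ennreal (g x) \<partial>\<mu>)"
      by (intro nn_integral_mono) (use g in \<open>auto simp: indicator_def\<close>)
    also have "\<dots> = ennreal (integral\<^sup>L \<mu> g)"
      using g by (intro nn_integral_eq_integral cc_integrable) auto
    also have "\<dots> = ennreal (\<integral>x. g (- x) \<partial>\<mu>)" by (simp add: integral_cc_minus g)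
    also have "\<dots> = (\<integral>\<^sup>+x. ennreal (g (- x)) \<partial>\<mu>)"
      using g by (intro nn_integral_eq_integral[symmetric] cc_integrable cc_inv) auto
    also have "\<dots> \<le> (\<integral>\<^sup>+x. indicator U x \<partial>\<mu>)"
    proof (intro nn_integral_mono)
      fix x show "ennreal (g (- x)) \<le> indicator U x"
        using g(3)[of "- x"] g(5)[of "- x"] by (auto simp: indicator_def image ennreal_le_1)
    qed
    also have "\<dots> = emeasure \<mu> U" using U by simp
    finally show ?thesis .
  qed
  then show ?thesis unfolding inner_regular[OF oU] by (intro SUP_least) auto
qed

text \<open>Outer regularity extends the inequality from open sets to Borel sets, and applying it
  twice gives equality.\<close>

lemma emeasure_minus:
  assumes E: "E \<in> sets borel" shows "emeasure \<mu> (uminus ` E) = emeasure \<mu> E"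
proof -
  have image: "uminus ` X = uminus -` X" for X :: "'a set" by force
  have m: "uminus ` X \<in> sets borel" if "X \<in> sets borel" for X :: "'a set"
  proof -
    have "uminus \<in> borel_measurable (borel :: 'a measure)"
      by (intro borel_measurable_continuous_onI continuous_intros)
    from measurable_sets[OF this that] show ?thesis by (simp add: image)
  qed
  have le: "emeasure \<mu> (uminus ` X) \<le> emeasure \<mu> X" if X: "X \<in> sets borel" for X
  proof -
    have "emeasure \<mu> (uminus ` X) \<le> emeasure \<mu> U" if "open U" "X \<subseteq> U" for U
    proof -
      have "emeasure \<mu> (uminus ` X) \<le> emeasure \<mu> (uminus ` U)"
        using that m[of U] by (intro emeasure_mono) auto
      also have "\<dots> \<le> emeasure \<mu> U" by (rule emeasure_minus_le[OF that(1)])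
      finally show ?thesis .
    qed
    moreover have "emeasure \<mu> X = (INF U\<in>{U. open U \<and> X \<subseteq> U}. emeasure \<mu> U)"
      by (rule outer_regular[OF X])
    ultimately show ?thesis by (simp only:) (intro INF_greatest, auto)
  qed
  have "emeasure \<mu> E = emeasure \<mu> (uminus ` uminus ` E)" by (simp add: image_comp o_def)
  also have "\<dots> \<le> emeasure \<mu> (uminus ` E)" by (rule le[OF m[OF E]])
  finally show ?thesis using le[OF E] by simp
qed

lemma distr_minus: "distr \<mu> \<mu> uminus = \<mu>"
  by (rule distr_homeo[where S = uminus]) (auto intro!: continuous_intros emeasure_minus)

lemma integral_minus:
  fixes f :: "'a \<Rightarrow> 'b::{banach, second_countable_topology}"
  assumes "f \<in> borel_measurable \<mu>" shows "(\<integral>x. f (- x) \<partial>\<mu>) = integral\<^sup>L \<mu> f"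
proof -
  have "uminus \<in> measurable \<mu> \<mu>" by (intro measurable_homeo continuous_intros)
  then show ?thesis using integral_distr[of uminus \<mu> \<mu> f] assms by (simp add: distr_minus)
qed

lemma distr_reflect: "distr \<mu> \<mu> (\<lambda>y. - y + x) = \<mu>"
proof -
  have m: "uminus \<in> measurable \<mu> \<mu>" "(\<lambda>y. y + x) \<in> measurable \<mu> \<mu>" for x
    by (intro measurable_homeo continuous_intros)+
  have "distr \<mu> \<mu> (\<lambda>y. - y + x) = distr (distr \<mu> \<mu> uminus) \<mu> (\<lambda>y. y + x)"
    by (subst distr_distr[OF m(2,1)]) (simp add: o_def)
  then show ?thesis by (simp add: distr_minus distr_right)
qed

lemma integral_reflect:
  fixes f :: "'a \<Rightarrow> 'b::{banach, second_countable_topology}"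
  assumes "f \<in> borel_measurable \<mu>" shows "(\<integral>y. f (- y + x) \<partial>\<mu>) = integral\<^sup>L \<mu> f"
proof -
  have "(\<lambda>y. - y + x) \<in> measurable \<mu> \<mu>" by (intro measurable_homeo continuous_intros)
  then show ?thesis using integral_distr[of "\<lambda>y. - y + x" \<mu> \<mu> f] assms by (simp add: distr_reflect)
qed

end

section \<open>The inequalities of Hoelder and Minkowski\<close>

text \<open>The Bochner integral of a non-integrable function is 0, so the value is 0 off L^p;
  bounds on it are informative only together with membership in \<open>Lp_fun\<close>.\<close>

definition pnorm :: "'a measure \<Rightarrow> real \<Rightarrow> ('a \<Rightarrow> 'b::real_normed_vector) \<Rightarrow> real" where
  "pnorm M p f = (\<integral>x. norm (f x) powr p \<partial>M) powr (1 / p)"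

lemma pnorm_nonneg: "0 \<le> pnorm M p f"
  by (simp add: pnorm_def)

lemma pnorm_powr: "0 < p \<Longrightarrow> pnorm M p f powr p = (\<integral>x. norm (f x) powr p \<partial>M)"
  by (simp add: pnorm_def powr_powr)

lemma pnorm_le_iff: "0 < p \<Longrightarrow> 0 \<le> c \<Longrightarrow> pnorm M p f \<le> c \<longleftrightarrow> (\<integral>x. norm (f x) powr p \<partial>M) \<le> c powr p"
  by (metis less_eq_real_def pnorm_nonneg pnorm_powr powr_less_mono2 powr_mono2 not_le)

lemma pnorm_scale: "0 < p \<Longrightarrow> pnorm M p (\<lambda>x. c *\<^sub>R f x) = \<bar>c\<bar> * pnorm M p f"
  by (simp add: pnorm_def powr_mult powr_powr)

lemma pnorm_norm: "pnorm M p (\<lambda>x. norm (f x)) = pnorm M p f"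
  by (simp add: pnorm_def)

lemma pnorm_cong_AE:
  fixes f g :: "'a \<Rightarrow> 'b::{real_normed_vector, second_countable_topology}"
  assumes "f \<in> borel_measurable M" "g \<in> borel_measurable M" "AE x in M. f x = g x"
  shows "pnorm M p f = pnorm M p g"
  unfolding pnorm_def using assms by (intro arg_cong[where f = "\<lambda>t. t powr (1 / p)"] integral_cong_AE) auto

lemma pnorm_zero_AE:
  fixes f :: "'a \<Rightarrow> 'b::{real_normed_vector, second_countable_topology}"
  assumes "f \<in> borel_measurable M" "integrable M (\<lambda>x. norm (f x) powr p)" "0 < p" "pnorm M p f = 0"
  shows "AE x in M. f x = 0"
proof -
  have "(\<integral>x. norm (f x) powr p \<partial>M) = 0" using pnorm_powr[OF assms(3), of M f] assms(3,4) by simp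
  then have "AE x in M. norm (f x) powr p = 0"
    using assms(2) by (subst (asm) integral_nonneg_eq_0_iff_AE) auto
  then show ?thesis by eventually_elim simp
qed

lemma Hoelder_nonneg:
  fixes u v :: "'a \<Rightarrow> real"
  assumes pq: "1 < p" "1 < q" "1 / p + 1 / q = 1"
    and u: "u \<in> borel_measurable M" "\<And>x. 0 \<le> u x" "integrable M (\<lambda>x. u x powr p)"
    and v: "v \<in> borel_measurable M" "\<And>x. 0 \<le> v x" "integrable M (\<lambda>x. v x powr q)"
  shows "integrable M (\<lambda>x. u x * v x)" "(\<integral>x. u x * v x \<partial>M) \<le> pnorm M p u * pnorm M q v"
proof -
  have young: "u x * v x \<le> u x powr p / p + v x powr q / q" for x
    by (rule Youngs_inequality) (use pq u v in auto)
  show int: "integrable M (\<lambda>x. u x * v x)"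
  proof (rule Bochner_Integration.integrable_bound)
    show "integrable M (\<lambda>x. u x powr p / p + v x powr q / q)" using u v by simp
    show "AE x in M. norm (u x * v x) \<le> norm (u x powr p / p + v x powr q / q)"
      using young u(2) v(2) pq by (intro AE_I2) (simp add: abs_mult)
  qed (use u v in measurable)
  define a where "a = pnorm M p u"
  define b where "b = pnorm M q v"
  have ab: "0 \<le> a" "0 \<le> b" by (auto simp: a_def b_def pnorm_nonneg)
  have zero: "(\<integral>x. u x * v x \<partial>M) = 0" if "a = 0 \<or> b = 0"
  proof -
    have "AE x in M. u x * v x = 0"
      using that
    proof
      assume "a = 0"
      then have "AE x in M. u x = 0" using pnorm_zero_AE[of u M p] u pq by (simp add: a_def)
      then show ?thesis by eventually_elim simp
    next
      assume "b = 0"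
      then have "AE x in M. v x = 0" using pnorm_zero_AE[of v M q] v pq by (simp add: b_def)
      then show ?thesis by eventually_elim simp
    qed
    then show ?thesis using u v by (subst integral_cong_AE[where g = "\<lambda>_. 0"]) auto
  qed
  show "(\<integral>x. u x * v x \<partial>M) \<le> pnorm M p u * pnorm M q v"
  proof (cases "a = 0 \<or> b = 0")
    case True then show ?thesis using zero ab by (simp flip: a_def b_def)
  next
    case False
    then have pos: "0 < a" "0 < b" using ab by auto
    have au: "a powr p = (\<integral>x. u x powr p \<partial>M)" and bv: "b powr q = (\<integral>x. v x powr q \<partial>M)"
      using pnorm_powr[of p M u] pnorm_powr[of q M v] pq u v by (simp_all add: a_def b_def)
    have "(\<integral>x. (u x * v x) / (a * b) \<partial>M) \<le> (\<integral>x. u x powr p / (a powr p * p) + v x powr q / (b powr q * q) \<partial>M)"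
    proof (rule integral_mono)
      fix x
      have "(u x / a) * (v x / b) \<le> (u x / a) powr p / p + (v x / b) powr q / q"
        by (rule Youngs_inequality) (use pq u v pos in auto)
      then show "(u x * v x) / (a * b) \<le> u x powr p / (a powr p * p) + v x powr q / (b powr q * q)"
        using u(2) v(2) pos by (simp add: powr_divide)
    qed (use int u v in auto)
    also have "\<dots> = a powr p / (a powr p * p) + b powr q / (b powr q * q)"
      using u v by (simp add: au bv)
    also have "\<dots> = 1" using pos pq by simp
    finally have "(\<integral>x. u x * v x \<partial>M) / (a * b) \<le> 1" by simp
    then show ?thesis using pos by (simp add: divide_le_eq flip: a_def b_def)
  qed
qed

text \<open>The left argument is the convex combination of s / a and t / b with weights a / (a + b)
  and b / (a + b). With a and b the norms of two functions, the integral of the right-hand side is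
  1, which is Minkowski's inequality. At the end point 0 the claim reduces to c powr p \<le> c for c
  in [0, 1].\<close>

lemma convex_powr_add:
  fixes s t a b p :: real
  assumes "1 \<le> p" "0 \<le> s" "0 \<le> t" "0 < a" "0 < b"
  shows "((s + t) / (a + b)) powr p \<le> a / (a + b) * (s / a) powr p + b / (a + b) * (t / b) powr p"
proof -
  have shrink: "(t / (a + b)) powr p \<le> b / (a + b) * (t / b) powr p" if "0 < a" "0 < b" "0 \<le> t" for a b t :: real
  proof -
    have "(b / (a + b)) powr p \<le> (b / (a + b)) powr 1" using that assms(1) by (intro powr_mono') auto
    then have "(b / (a + b)) powr p * (t / b) powr p \<le> b / (a + b) * (t / b) powr p"
      using that by (intro mult_right_mono) auto
    moreover have "(b / (a + b)) powr p * (t / b) powr p = (t / (a + b)) powr p"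
      using that by (subst powr_mult[symmetric]) auto
    ultimately show ?thesis by simp
  qed
  consider "s = 0" | "t = 0" | "0 < s" "0 < t" using assms by linarith
  then show ?thesis
  proof cases
    case 1 then show ?thesis using shrink[of a b t] assms by simp
  next
    case 2 then show ?thesis using shrink[of b a s] assms by (simp add: add.commute)
  next
    case 3
    have "((1 - b / (a + b)) *\<^sub>R (s / a) + (b / (a + b)) *\<^sub>R (t / b)) powr p \<le> (1 - b / (a + b)) * (s / a) powr p + b / (a + b) * (t / b) powr p"
      by (rule convex_onD[OF powr_convex[OF assms(1)]]) (use assms 3 in auto)
    moreover have "1 - b / (a + b) = a / (a + b)" using assms by (simp add: field_simps)
    ultimately show ?thesis using assms by (simp add: add_divide_distrib)
  qed
qed

lemma powr_add_le:
  fixes s t p :: real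
  assumes "1 \<le> p" "0 \<le> s" "0 \<le> t"
  shows "(s + t) powr p \<le> 2 powr p * (s powr p + t powr p)"
proof -
  have "(s + t) powr p \<le> (2 * max s t) powr p" using assms by (intro powr_mono2) auto
  also have "\<dots> = 2 powr p * max s t powr p" using assms by (simp add: powr_mult)
  also have "max s t powr p \<le> s powr p + t powr p" by (simp add: max_def)
  finally show ?thesis by simp
qed

lemma integrable_powr_bound:
  fixes f :: "'a \<Rightarrow> 'b::{real_normed_vector, second_countable_topology}"
  assumes "f \<in> borel_measurable M" "integrable M g" "\<And>x. norm (f x) powr p \<le> (g x :: real)"
  shows "integrable M (\<lambda>x. norm (f x) powr p)"
  by (rule Bochner_Integration.integrable_bound[OF assms(2)])
    (use assms in \<open>auto intro!: AE_I2 order_trans[OF _ abs_ge_self]\<close>)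

lemma Minkowski:
  fixes f g :: "'a \<Rightarrow> 'b::{real_normed_vector, second_countable_topology}"
  assumes p: "1 \<le> p"
    and f: "f \<in> borel_measurable M" "integrable M (\<lambda>x. norm (f x) powr p)"
    and g: "g \<in> borel_measurable M" "integrable M (\<lambda>x. norm (g x) powr p)"
  shows "integrable M (\<lambda>x. norm (f x + g x) powr p)" "pnorm M p (\<lambda>x. f x + g x) \<le> pnorm M p f + pnorm M p g"
proof -
  have fg[measurable]: "(\<lambda>x. f x + g x) \<in> borel_measurable M" using f(1) g(1) by measurable
  have tri: "norm (f x + g x) powr p \<le> (norm (f x) + norm (g x)) powr p" for x
    using p by (intro powr_mono2 norm_triangle_ineq) auto
  show int: "integrable M (\<lambda>x. norm (f x + g x) powr p)"
  proof (rule integrable_powr_bound[OF fg])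
    show "integrable M (\<lambda>x. 2 powr p * (norm (f x) powr p + norm (g x) powr p))" using f g by simp
    show "norm (f x + g x) powr p \<le> 2 powr p * (norm (f x) powr p + norm (g x) powr p)" for x
      using tri[of x] powr_add_le[OF p norm_ge_zero norm_ge_zero, of "f x" "g x"] by linarith
  qed
  define a where "a = pnorm M p f"
  define b where "b = pnorm M p g"
  have ab: "0 \<le> a" "0 \<le> b" by (auto simp: a_def b_def pnorm_nonneg)
  consider "a = 0" | "b = 0" | "0 < a" "0 < b" using ab by force
  then show "pnorm M p (\<lambda>x. f x + g x) \<le> pnorm M p f + pnorm M p g"
  proof cases
    case 1
    then have "AE x in M. f x = 0" using pnorm_zero_AE[of f M p] f p by (simp add: a_def)
    then have "AE x in M. f x + g x = g x" by eventually_elim simp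
    then have "pnorm M p (\<lambda>x. f x + g x) = pnorm M p g" by (rule pnorm_cong_AE[OF fg g(1)])
    then show ?thesis by (simp add: pnorm_nonneg)
  next
    case 2
    then have "AE x in M. g x = 0" using pnorm_zero_AE[of g M p] g p by (simp add: b_def)
    then have "AE x in M. f x + g x = f x" by eventually_elim simp
    then have "pnorm M p (\<lambda>x. f x + g x) = pnorm M p f" by (rule pnorm_cong_AE[OF fg f(1)])
    then show ?thesis by (simp add: pnorm_nonneg)
  next
    case 3
    have af: "a powr p = (\<integral>x. norm (f x) powr p \<partial>M)" and bg: "b powr p = (\<integral>x. norm (g x) powr p \<partial>M)"
      using pnorm_powr[of p M f] pnorm_powr[of p M g] p by (simp_all add: a_def b_def)
    have "(\<integral>x. norm (f x + g x) powr p / (a + b) powr p \<partial>M)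
      \<le> (\<integral>x. a / (a + b) * (norm (f x) powr p / a powr p) + b / (a + b) * (norm (g x) powr p / b powr p) \<partial>M)"
    proof (rule integral_mono)
      fix x
      have "norm (f x + g x) powr p / (a + b) powr p \<le> (norm (f x) + norm (g x)) powr p / (a + b) powr p"
        using tri by (intro divide_right_mono) auto
      also have "\<dots> = ((norm (f x) + norm (g x)) / (a + b)) powr p" using ab by (simp add: powr_divide)
      also have "\<dots> \<le> a / (a + b) * (norm (f x) / a) powr p + b / (a + b) * (norm (g x) / b) powr p"
        by (rule convex_powr_add) (use p 3 in auto)
      also have "\<dots> = a / (a + b) * (norm (f x) powr p / a powr p) + b / (a + b) * (norm (g x) powr p / b powr p)"
        using ab by (simp add: powr_divide)
      finally show "norm (f x + g x) powr p / (a + b) powr p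
        \<le> a / (a + b) * (norm (f x) powr p / a powr p) + b / (a + b) * (norm (g x) powr p / b powr p)" .
    qed (use int f g in auto)
    also have "\<dots> = a / (a + b) * (a powr p / a powr p) + b / (a + b) * (b powr p / b powr p)"
      using f g by (simp add: af bg)
    also have "\<dots> = 1" using 3 by (simp flip: add_divide_distrib)
    finally have "(\<integral>x. norm (f x + g x) powr p \<partial>M) \<le> (a + b) powr p" using 3 by (simp add: divide_le_eq)
    then show ?thesis using pnorm_le_iff[of p "a + b" M "\<lambda>x. f x + g x"] p ab by (simp add: a_def b_def)
  qed
qed

section \<open>Functions in \<open>L\<^sup>p\<close>\<close>

lemma Lp_funD: "f \<in> Lp_fun M p \<Longrightarrow> f \<in> borel_measurable M" "f \<in> Lp_fun M p \<Longrightarrow> integrable M (\<lambda>x. norm (f x) powr p)"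
  by (auto simp: Lp_fun_def)

lemma Lp_fun_zero: "(\<lambda>x. 0) \<in> Lp_fun M p"
  by (simp add: Lp_fun_def)

lemma Lp_fun_add: "1 \<le> p \<Longrightarrow> f \<in> Lp_fun M p \<Longrightarrow> g \<in> Lp_fun M p \<Longrightarrow> (\<lambda>x. f x + g x) \<in> Lp_fun M p"
  using Minkowski(1)[of p f M g] by (auto simp: Lp_fun_def)

lemma Lp_fun_cmult: "f \<in> Lp_fun M p \<Longrightarrow> (\<lambda>x. c * f x) \<in> Lp_fun M p"
  by (auto simp: Lp_fun_def norm_mult powr_mult)

lemma Lp_fun_diff: "1 \<le> p \<Longrightarrow> f \<in> Lp_fun M p \<Longrightarrow> g \<in> Lp_fun M p \<Longrightarrow> (\<lambda>x. f x - g x) \<in> Lp_fun M p"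
  using Lp_fun_add[of p f M "\<lambda>x. - 1 * g x"] Lp_fun_cmult[of g M p "- 1"] by simp

lemma pnorm_cmult: "0 < p \<Longrightarrow> pnorm M p (\<lambda>x. c * f x) = norm c * pnorm M p f" for c :: complex
  by (simp add: pnorm_def norm_mult powr_mult powr_powr)

lemma pnorm_uminus: "pnorm M p (\<lambda>x. - f x) = pnorm M p f"
  by (simp add: pnorm_def)

lemma pnorm_minus_commute: "pnorm M p (\<lambda>x. f x - g x) = pnorm M p (\<lambda>x. g x - f x)"
  by (simp add: pnorm_def norm_minus_commute)

lemma pnorm_zero: "pnorm M p (\<lambda>x. 0) = 0"
  by (simp add: pnorm_def)

lemma pnorm_add: "1 \<le> p \<Longrightarrow> f \<in> Lp_fun M p \<Longrightarrow> g \<in> Lp_fun M p \<Longrightarrow> pnorm M p (\<lambda>x. f x + g x) \<le> pnorm M p f + pnorm M p g"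
  using Minkowski(2)[of p f M g] by (simp add: Lp_fun_def)

lemma pnorm_diff_triangle:
  assumes "1 \<le> p" "f \<in> Lp_fun M p" "g \<in> Lp_fun M p" "h \<in> Lp_fun M p"
  shows "pnorm M p (\<lambda>x. f x - h x) \<le> pnorm M p (\<lambda>x. f x - g x) + pnorm M p (\<lambda>x. g x - h x)"
  using pnorm_add[OF assms(1) Lp_fun_diff[OF assms(1,2,3)] Lp_fun_diff[OF assms(1,3,4)]] by simp

lemma Hoelder:
  fixes f g :: "'a \<Rightarrow> complex"
  assumes pq: "1 < p" "1 < q" "1 / p + 1 / q = 1" and f: "f \<in> Lp_fun M p" and g: "g \<in> Lp_fun M q"
  shows "integrable M (\<lambda>x. f x * g x)" "norm (\<integral>x. f x * g x \<partial>M) \<le> pnorm M p f * pnorm M q g"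
    "(\<integral>x. norm (f x) * norm (g x) \<partial>M) \<le> pnorm M p f * pnorm M q g"
proof -
  note H = Hoelder_nonneg[OF pq, of "\<lambda>x. norm (f x)" M "\<lambda>x. norm (g x)", unfolded pnorm_norm]
  have fm: "f \<in> borel_measurable M" "g \<in> borel_measurable M" using f g Lp_funD by auto
  have i: "integrable M (\<lambda>x. norm (f x) * norm (g x))"
    using H(1) f g by (auto simp: Lp_fun_def)
  show I: "integrable M (\<lambda>x. f x * g x)"
    by (rule Bochner_Integration.integrable_bound[OF i]) (use fm in \<open>auto simp: norm_mult\<close>)
  show le: "(\<integral>x. norm (f x) * norm (g x) \<partial>M) \<le> pnorm M p f * pnorm M q g"
    using H(2) f g by (auto simp: Lp_fun_def)
  have "norm (\<integral>x. f x * g x \<partial>M) \<le> (\<integral>x. norm (f x * g x) \<partial>M)" by (rule integral_norm_bound)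
  then show "norm (\<integral>x. f x * g x \<partial>M) \<le> pnorm M p f * pnorm M q g"
    using le by (simp add: norm_mult)
qed

text \<open>The tool by which bounds proved on C_c pass to pointwise limits; it also supplies
  membership of the limit in L^p.\<close>

lemma Lp_fun_Fatou:
  fixes F :: "nat \<Rightarrow> 'a \<Rightarrow> complex"
  assumes p: "0 < p" and F: "\<And>n. F n \<in> Lp_fun M p" and f: "f \<in> borel_measurable M"
    and lim: "\<And>x. x \<in> space M \<Longrightarrow> (\<lambda>n. F n x) \<longlonglongrightarrow> f x" and C: "C \<longlonglongrightarrow> c" and le: "\<And>n. pnorm M p (F n) \<le> C n"
  shows "f \<in> Lp_fun M p" "pnorm M p f \<le> c"
proof -
  have C0: "0 \<le> C n" for n using order_trans[OF pnorm_nonneg le] .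
  have c0: "0 \<le> c" using LIMSEQ_le_const[OF C] C0 by blast
  have nn: "(\<integral>\<^sup>+x. ennreal (norm (F n x) powr p) \<partial>M) \<le> ennreal (C n powr p)" for n
  proof -
    have "(\<integral>\<^sup>+x. ennreal (norm (F n x) powr p) \<partial>M) = ennreal (\<integral>x. norm (F n x) powr p \<partial>M)"
      using Lp_funD(2)[OF F] by (intro nn_integral_eq_integral) auto
    also have "\<dots> \<le> ennreal (C n powr p)"
      by (intro ennreal_leI iffD1[OF pnorm_le_iff[OF p C0] le])
    finally show ?thesis .
  qed
  have "(\<integral>\<^sup>+x. ennreal (norm (f x) powr p) \<partial>M) = (\<integral>\<^sup>+x. liminf (\<lambda>n. ennreal (norm (F n x) powr p)) \<partial>M)"
  proof (rule nn_integral_cong)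
    fix x assume x: "x \<in> space M"
    have "(\<lambda>n. ennreal (norm (F n x) powr p)) \<longlonglongrightarrow> ennreal (norm (f x) powr p)"
      by (intro tendsto_ennrealI tendsto_powr2 tendsto_norm lim[OF x] tendsto_const) (use p in auto)
    then show "ennreal (norm (f x) powr p) = liminf (\<lambda>n. ennreal (norm (F n x) powr p))"
      by (rule lim_imp_Liminf[OF sequentially_bot, symmetric])
  qed
  also have "\<dots> \<le> liminf (\<lambda>n. \<integral>\<^sup>+x. ennreal (norm (F n x) powr p) \<partial>M)"
    by (rule nn_integral_liminf) (use Lp_funD(1)[OF F] in measurable)
  also have "\<dots> \<le> liminf (\<lambda>n. ennreal (C n powr p))"
    by (rule Liminf_mono) (simp add: nn)
  also have "\<dots> = ennreal (c powr p)"
    by (intro lim_imp_Liminf[OF sequentially_bot] tendsto_ennrealI tendsto_powr2 C tendsto_const) (use p C0 in auto)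
  finally have fin: "(\<integral>\<^sup>+x. ennreal (norm (f x) powr p) \<partial>M) \<le> ennreal (c powr p)" .
  then have int: "integrable M (\<lambda>x. norm (f x) powr p)"
    using f by (intro integrableI_bounded) (auto simp: le_less_trans)
  then show "f \<in> Lp_fun M p" using f by (simp add: Lp_fun_def)
  have "(\<integral>x. norm (f x) powr p \<partial>M) \<le> c powr p"
    using fin int by (simp add: nn_integral_eq_integral)
  then show "pnorm M p f \<le> c" by (rule iffD2[OF pnorm_le_iff[OF p c0]])
qed

context unimodular_group
begin

section \<open>Convolution\<close>

text \<open>The scalar field is a parameter: the densities in Reiter's condition are real, the
  operators act on complex functions.\<close>

definition conv :: "('a \<Rightarrow> 'b::{real_normed_field, banach, second_countable_topology}) \<Rightarrow> ('a \<Rightarrow> 'b) \<Rightarrow> 'a \<Rightarrow> 'b" where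
  "conv f g x = (\<integral>y. f y * g (- y + x) \<partial>\<mu>)"

lemma convolution_eq: "convolution \<mu> f g = conv f g"
  by (simp add: fun_eq_iff convolution_def conv_def)

lemma cont_fun: "continuous_on UNIV f \<Longrightarrow> continuous_on UNIV T \<Longrightarrow> continuous_on UNIV (\<lambda>x. f (T x))"
  by (rule continuous_on_compose2[of UNIV f UNIV T]) auto

lemma conv_kernel_cc:
  fixes f g :: "'a \<Rightarrow> 'b::{real_normed_field, banach, second_countable_topology}"
  assumes "f \<in> cc" "g \<in> cc" shows "(\<lambda>y. f y * g (- y + x)) \<in> cc" 
  by (rule cc_mult_cont[OF assms(1)]) (intro cont_fun[OF cc_cont[OF assms(2)]] continuous_intros)

lemma conv_integrable:
  fixes f g :: "'a \<Rightarrow> 'b::{real_normed_field, banach, second_countable_topology}"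
  assumes "f \<in> cc" "g \<in> cc" shows "integrable \<mu> (\<lambda>y. f y * g (- y + x))"
  by (rule cc_integrable[OF conv_kernel_cc[OF assms]])

lemma conv_cc: assumes f: "f \<in> cc" and g: "g \<in> cc" shows "conv f g \<in> cc"
proof -
  obtain K where K: "compact K" "\<And>x. x \<notin> K \<Longrightarrow> f x = 0" using f by (auto simp: cc_def)
  obtain L where L: "compact L" "\<And>x. x \<notin> L \<Longrightarrow> g x = 0" using g by (auto simp: cc_def)
  show ?thesis
  proof (rule ccI[OF _ compact_sum[OF K(1) L(1)]])
    have "continuous_on UNIV (\<lambda>(x, y). f y * g (- y + x))"
      unfolding split_beta
      by (intro continuous_intros cont_fun[OF cc_cont[OF f]] cont_fun[OF cc_cont[OF g]])
    then show "continuous_on UNIV (conv f g)"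
      unfolding conv_def[abs_def] by (rule continuous_on_param_integral[OF _ K(1)]) (use K in auto)
    show "conv f g x = 0" if x: "x \<notin> {x + y | x y. x \<in> K \<and> y \<in> L}" for x
    proof -
      have "f y * g (- y + x) = 0" for y
      proof (cases "y \<in> K \<and> - y + x \<in> L")
        case True
        have "x = y + (- y + x)" by (simp flip: add.assoc)
        with True x show ?thesis by blast
      qed (use K L in auto)
      then have "(\<lambda>y. f y * g (- y + x)) = (\<lambda>y. 0)" by blast
      then show ?thesis by (simp only: conv_def) simp
    qed
  qed
qed

lemma minus_add_cancel_both: "- (a + y) + (a + x) = - y + x" for a :: 'a
  by (simp add: minus_add add.assoc del: add_uminus_conv_diff)

lemma conv_left: "conv f g (a + x) = (\<integral>y. f (a + y) * g (- y + x) \<partial>\<mu>)" if "f \<in> borel_measurable \<mu>" "g \<in> borel_measurable \<mu>"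
proof -
  have "(\<lambda>y. - y + (a + x)) \<in> measurable \<mu> \<mu>" by (intro measurable_homeo continuous_intros)
  then have "(\<lambda>y. f y * g (- y + (a + x))) \<in> borel_measurable \<mu>"
    using that by (intro borel_measurable_times) (auto intro: measurable_compose)
  from integral_left[OF this, of a] show ?thesis
    by (simp add: conv_def minus_add_cancel_both)
qed

lemma conv_add_left: "f \<in> cc \<Longrightarrow> f' \<in> cc \<Longrightarrow> g \<in> cc \<Longrightarrow> conv (\<lambda>x. f x + f' x) g x = conv f g x + conv f' g x"
  unfolding conv_def by (simp add: distrib_right conv_integrable)

lemma conv_add_right: "f \<in> cc \<Longrightarrow> g \<in> cc \<Longrightarrow> g' \<in> cc \<Longrightarrow> conv f (\<lambda>x. g x + g' x) x = conv f g x + conv f g' x"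
  unfolding conv_def by (simp add: distrib_left conv_integrable)

lemma conv_diff_left: "f \<in> cc \<Longrightarrow> f' \<in> cc \<Longrightarrow> g \<in> cc \<Longrightarrow> conv (\<lambda>x. f x - f' x) g x = conv f g x - conv f' g x"
  unfolding conv_def by (simp add: left_diff_distrib conv_integrable)

lemma conv_diff_right: "f \<in> cc \<Longrightarrow> g \<in> cc \<Longrightarrow> g' \<in> cc \<Longrightarrow> conv f (\<lambda>x. g x - g' x) x = conv f g x - conv f g' x"
  unfolding conv_def by (simp add: right_diff_distrib conv_integrable)

lemma conv_scale_left: "conv (\<lambda>x. c *\<^sub>R f x) g x = c *\<^sub>R conv f g x"
  unfolding conv_def by simp

lemma conv_scale_right: "conv f (\<lambda>x. c *\<^sub>R g x) x = c *\<^sub>R conv f g x"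
  unfolding conv_def by simp

lemma conv_cmult_right: "conv f (\<lambda>x. c * g x) x = c * conv f g x"
  unfolding conv_def by (simp add: mult.left_commute)

lemma conv_assoc:
  assumes f: "f \<in> cc" and g: "g \<in> cc" and h: "h \<in> cc"
  shows "conv (conv f g) h x = conv f (conv g h) x"
proof -
  obtain K where K: "compact K" "\<And>x. x \<notin> K \<Longrightarrow> f x = 0" using f by (auto simp: cc_def)
  obtain L where L: "compact L" "\<And>x. x \<notin> L \<Longrightarrow> g x = 0" using g by (auto simp: cc_def)
  have "conv (conv f g) h x = (\<integral>z. \<integral>y. f y * g (- y + z) * h (- z + x) \<partial>\<mu> \<partial>\<mu>)"
    unfolding conv_def by simp
  also have "\<dots> = (\<integral>y. \<integral>z. f y * g (- y + z) * h (- z + x) \<partial>\<mu> \<partial>\<mu>)"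
  proof (rule Fubini_cc[OF _ K(1) compact_sum[OF K(1) L(1)]])
    show "continuous_on UNIV (\<lambda>(y, z). f y * g (- y + z) * h (- z + x))"
      unfolding split_beta
      by (intro continuous_intros cont_fun[OF cc_cont[OF f]] cont_fun[OF cc_cont[OF g]] cont_fun[OF cc_cont[OF h]])
    show "f y * g (- y + z) * h (- z + x) = 0" if z: "z \<notin> {x + y | x y. x \<in> K \<and> y \<in> L}" for y z
    proof (cases "y \<in> K \<and> - y + z \<in> L")
      case True
      have "z = y + (- y + z)" by (simp flip: add.assoc)
      with True z show ?thesis by blast
    qed (use K L in auto)
  qed (use K in simp)
  also have "\<dots> = (\<integral>y. f y * conv g h (- y + x) \<partial>\<mu>)"
  proof (rule Bochner_Integration.integral_cong[OF refl])
    fix y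
    show "(\<integral>z. f y * g (- y + z) * h (- z + x) \<partial>\<mu>) = f y * conv g h (- y + x)"
      using conv_left[OF cc_measurable[OF g] cc_measurable[OF h], of "- y" x] by (simp add: mult.assoc)
  qed
  also have "\<dots> = conv f (conv g h) x" by (simp add: conv_def)
  finally show ?thesis .
qed

lemma integral_conv:
  assumes f: "f \<in> cc" and g: "g \<in> cc"
  shows "(\<integral>x. conv f g x \<partial>\<mu>) = integral\<^sup>L \<mu> f * integral\<^sup>L \<mu> g"
proof -
  obtain K where K: "compact K" "\<And>x. x \<notin> K \<Longrightarrow> f x = 0" using f by (auto simp: cc_def)
  obtain L where L: "compact L" "\<And>x. x \<notin> L \<Longrightarrow> g x = 0" using g by (auto simp: cc_def)
  have "(\<integral>x. conv f g x \<partial>\<mu>) = (\<integral>y. \<integral>x. f y * g (- y + x) \<partial>\<mu> \<partial>\<mu>)"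
    unfolding conv_def
  proof (rule Fubini_cc[OF _ K(1) compact_sum[OF K(1) L(1)]])
    show "continuous_on UNIV (\<lambda>(y, z). f y * g (- y + z))"
      unfolding split_beta
      by (intro continuous_intros cont_fun[OF cc_cont[OF f]] cont_fun[OF cc_cont[OF g]])
    show "f y * g (- y + z) = 0" if z: "z \<notin> {x + y | x y. x \<in> K \<and> y \<in> L}" for y z
    proof (cases "y \<in> K \<and> - y + z \<in> L")
      case True
      have "z = y + (- y + z)" by (simp flip: add.assoc)
      with True z show ?thesis by blast
    qed (use K L in auto)
  qed (use K in simp)
  also have "\<dots> = integral\<^sup>L \<mu> f * integral\<^sup>L \<mu> g"
    using cc_integrable[OF f] cc_integrable[OF cc_left[OF g]] integral_left[OF cc_measurable[OF g]] by simp
  finally show ?thesis .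
qed

section \<open>Density of continuous functions in \<open>L\<^sup>p\<close>\<close>

lemma cc_Lp: "f \<in> cc \<Longrightarrow> 0 < p \<Longrightarrow> f \<in> Lp_fun \<mu> p"
  using cc_integrable[OF cc_norm_powr[of f p]] by (simp add: Lp_fun_def cc_measurable)

definition cc_approx :: "real \<Rightarrow> ('a \<Rightarrow> complex) \<Rightarrow> bool" where
  "cc_approx p h \<longleftrightarrow> h \<in> Lp_fun \<mu> p \<and> (\<forall>\<epsilon>>0. \<exists>g\<in>cc. pnorm \<mu> p (\<lambda>x. h x - g x) < \<epsilon>)"

lemma cc_approx_add:
  assumes p: "1 \<le> p" and h: "cc_approx p h" "cc_approx p k"
  shows "cc_approx p (\<lambda>x. h x + k x)"
  unfolding cc_approx_def
proof safe
  show "(\<lambda>x. h x + k x) \<in> Lp_fun \<mu> p" using Lp_fun_add[OF p] h unfolding cc_approx_def by blast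
  fix \<epsilon> :: real assume e: "0 < \<epsilon>"
  obtain f g where fg: "f \<in> cc" "g \<in> cc" "pnorm \<mu> p (\<lambda>x. h x - f x) < \<epsilon> / 2" "pnorm \<mu> p (\<lambda>x. k x - g x) < \<epsilon> / 2"
    using h half_gt_zero[OF e] unfolding cc_approx_def by blast
  have "pnorm \<mu> p (\<lambda>x. (h x - f x) + (k x - g x)) \<le> pnorm \<mu> p (\<lambda>x. h x - f x) + pnorm \<mu> p (\<lambda>x. k x - g x)"
    using h p by (intro pnorm_add Lp_fun_diff cc_Lp[OF fg(1)] cc_Lp[OF fg(2)]) (auto simp: cc_approx_def)
  then have "pnorm \<mu> p (\<lambda>x. h x + k x - (f x + g x)) < \<epsilon>" using fg by (simp add: algebra_simps)
  then show "\<exists>g\<in>cc. pnorm \<mu> p (\<lambda>x. h x + k x - g x) < \<epsilon>" by (rule bexI[OF _ cc_add[OF fg(1,2)]])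
qed

lemma cc_approx_cmult:
  assumes p: "1 \<le> p" and h: "cc_approx p h"
  shows "cc_approx p (\<lambda>x. c * h x)"
  unfolding cc_approx_def
proof safe
  show "(\<lambda>x. c * h x) \<in> Lp_fun \<mu> p" using Lp_fun_cmult h unfolding cc_approx_def by blast
  fix \<epsilon> :: real assume e: "0 < \<epsilon>"
  have n: "0 < 1 + norm c" using norm_ge_zero[of c] by linarith
  obtain f where f: "f \<in> cc" "pnorm \<mu> p (\<lambda>x. h x - f x) < \<epsilon> / (1 + norm c)"
    using h divide_pos_pos[OF e n] unfolding cc_approx_def by blast
  have "pnorm \<mu> p (\<lambda>x. c * h x - c * f x) = norm c * pnorm \<mu> p (\<lambda>x. h x - f x)"
    using pnorm_cmult[of p \<mu> c "\<lambda>x. h x - f x"] p by (simp add: right_diff_distrib)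
  also have "\<dots> \<le> (1 + norm c) * pnorm \<mu> p (\<lambda>x. h x - f x)"
    by (intro mult_right_mono pnorm_nonneg) simp
  also have "\<dots> < \<epsilon>" using f(2) n by (simp add: field_simps)
  finally show "\<exists>g\<in>cc. pnorm \<mu> p (\<lambda>x. c * h x - g x) < \<epsilon>" by (rule bexI[OF _ cc_cmult[OF f(1)]])
qed

lemma cc_approx_sum:
  assumes p: "1 \<le> p" and h: "\<And>i. i \<in> I \<Longrightarrow> cc_approx p (h i)"
  shows "cc_approx p (\<lambda>x. \<Sum>i\<in>I. h i x)"
proof -
  have z: "cc_approx p (\<lambda>x. 0)"
    unfolding cc_approx_def using cc_zero by (auto intro!: bexI[of _ "\<lambda>x. 0"] simp: Lp_fun_zero pnorm_zero)
  show ?thesis using h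
    by (induction I rule: infinite_finite_induct) (auto simp: z cc_approx_add[OF p])
qed

lemma cc_approx_indicator:
  assumes p: "1 \<le> p" and E: "E \<in> sets \<mu>" "emeasure \<mu> E < \<infinity>"
  shows "cc_approx p (indicator E)"
  unfolding cc_approx_def
proof safe
  have eq: "norm (indicator E x :: complex) powr p = indicator E x" for x
    by (simp add: indicator_def)
  show "indicator E \<in> Lp_fun \<mu> p" unfolding Lp_fun_def mem_Collect_eq eq using E by auto
  fix \<epsilon> :: real assume e: "0 < \<epsilon>"
  \<comment> \<open>The difference of the indicator and g is at most 1 and vanishes off U - E and U
    - K. Each of these sets has measure at most \<delta>, so the p-th power integrates to at most
    (\<epsilon> / 2)^p.\<close>
  define \<delta> where "\<delta> = (\<epsilon> / 2) powr p / 2"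
  have \<delta>: "0 < \<delta>" using e by (simp add: \<delta>_def)
  have Eb: "E \<in> sets borel" using E by simp
  have "(INF U\<in>{U. open U \<and> E \<subseteq> U}. emeasure \<mu> U) < emeasure \<mu> E + ennreal \<delta>"
    unfolding outer_regular[OF Eb, symmetric] using E(2) \<delta>
    by (simp add: emeasure_eq_ennreal_measure less_top ennreal_less_iff flip: ennreal_plus)
  then obtain U where U: "open U" "E \<subseteq> U" "emeasure \<mu> U < emeasure \<mu> E + ennreal \<delta>"
    by (auto simp: INF_less_iff)
  have Ufin: "emeasure \<mu> U < \<infinity>" using U(3) E(2) by (auto simp: top_unique less_top intro: order.strict_trans)
  have "\<exists>K. compact K \<and> K \<subseteq> U \<and> emeasure \<mu> U < emeasure \<mu> K + ennreal \<delta>"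
  \<comment> \<open>Subtraction in \<open>ennreal\<close> is truncated at 0, so a set U of measure
    below \<delta> is treated apart, with the empty compact set.\<close>
  proof (cases "emeasure \<mu> U < ennreal \<delta>")
    case True then show ?thesis using \<delta> by (intro exI[of _ "{}"]) auto
  next
    case False
    have "0 < ennreal \<delta>" using \<delta> by simp
    then have "0 < emeasure \<mu> U" using False by (metis leI order.strict_trans2)
    then have "emeasure \<mu> U - ennreal \<delta> < emeasure \<mu> U"
      using Ufin \<delta> by (intro ennreal_between) auto
    also have "\<dots> = (SUP K\<in>{K. compact K \<and> K \<subseteq> U}. emeasure \<mu> K)" by (rule inner_regular[OF U(1)])
    finally obtain K where K: "compact K" "K \<subseteq> U" "emeasure \<mu> U - ennreal \<delta> < emeasure \<mu> K" by (auto simp: less_SUP_iff)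
    then show ?thesis by (intro exI[of _ K]) (use False in \<open>simp add: minus_less_iff_ennreal\<close>)
  qed
  then obtain K where K: "compact K" "K \<subseteq> U" "emeasure \<mu> U < emeasure \<mu> K + ennreal \<delta>" by blast
  obtain g :: "'a \<Rightarrow> real" where g: "g \<in> cc" "\<And>x. 0 \<le> g x" "\<And>x. g x \<le> 1" "\<And>x. x \<in> K \<Longrightarrow> g x = 1" "\<And>x. x \<notin> U \<Longrightarrow> g x = 0"
    using Urysohn_cc[OF K(1) U(1) K(2)] by blast
  have Ks: "K \<in> sets \<mu>" and Us: "U \<in> sets \<mu>" using compact_sets[OF K(1)] U(1) by auto
  have fin: "emeasure \<mu> K < \<infinity>" using compact_finite[OF K(1)] .
  have m1: "measure \<mu> (U - E) \<le> \<delta>"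
  proof -
    have "measure \<mu> (U - E) = measure \<mu> U - measure \<mu> E"
      using Ufin U(2) Us E(1) by (intro measure_Diff) auto
    moreover have "measure \<mu> U \<le> measure \<mu> E + \<delta>"
      using U(3) E(2) Ufin \<delta> by (simp add: emeasure_eq_ennreal_measure less_top ennreal_less_iff flip: ennreal_plus)
    ultimately show ?thesis by simp
  qed
  have m2: "measure \<mu> (U - K) \<le> \<delta>"
  proof -
    have "measure \<mu> (U - K) = measure \<mu> U - measure \<mu> K"
      using Ufin K(2) Us Ks by (intro measure_Diff) auto
    moreover have "measure \<mu> U \<le> measure \<mu> K + \<delta>"
      using K(3) fin Ufin \<delta> by (simp add: emeasure_eq_ennreal_measure less_top ennreal_less_iff flip: ennreal_plus)
    ultimately show ?thesis by simp
  qed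
  have sub: "emeasure \<mu> (U - E) < \<infinity>" "emeasure \<mu> (U - K) < \<infinity>"
    using Ufin Us by (auto intro: le_less_trans[OF emeasure_mono])
  have gcc: "(\<lambda>x. complex_of_real (g x)) \<in> cc"
    by (rule cc_comp[OF g(1)]) (auto intro!: continuous_intros)
  let ?d = "\<lambda>x. indicator E x - complex_of_real (g x)"
  have bd: "norm (?d x) powr p \<le> indicator (U - E) x + indicator (U - K) x" for x
  proof -
    have "norm (?d x) \<le> 1"
    proof -
      have "?d x = complex_of_real (indicator E x - g x)" by (simp add: indicator_def)
      moreover have "\<bar>indicator E x - g x\<bar> \<le> 1" using g(2,3)[of x] by (auto simp: indicator_def)
      ultimately show ?thesis by (simp only: norm_of_real)
    qed
    then have 1: "norm (?d x) powr p \<le> 1" using p by (intro powr_le1) auto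
    have "?d x = 0" if "x \<notin> U - E" "x \<notin> U - K"
      using that g(4,5)[of x] U(2) by (auto simp: indicator_def)
    then show ?thesis using 1 by (cases "x \<in> U - E \<or> x \<in> U - K") (auto simp: indicator_def)
  qed
  have i: "integrable \<mu> (\<lambda>x. indicator (U - E) x + indicator (U - K) x :: real)"
    using sub Us Ks E(1) by (intro Bochner_Integration.integrable_add integrable_real_indicator) auto
  have dm: "?d \<in> borel_measurable \<mu>" using E(1) cc_measurable[OF gcc] by (intro borel_measurable_diff) auto
  have int: "integrable \<mu> (\<lambda>x. norm (?d x) powr p)" by (rule integrable_powr_bound[OF dm i bd])
  have "(\<integral>x. norm (?d x) powr p \<partial>\<mu>) \<le> (\<integral>x. indicator (U - E) x + indicator (U - K) x \<partial>\<mu>)"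
    by (rule integral_mono[OF int i bd])
  also have "\<dots> = measure \<mu> (U - E) + measure \<mu> (U - K)"
    using sub Us Ks E(1) by (subst Bochner_Integration.integral_add) (auto intro!: integrable_real_indicator)
  also have "\<dots> \<le> (\<epsilon> / 2) powr p" using m1 m2 by (simp add: \<delta>_def)
  finally have "pnorm \<mu> p ?d \<le> \<epsilon> / 2" using pnorm_le_iff[of p "\<epsilon> / 2" \<mu> ?d] p e by simp
  then have d: "pnorm \<mu> p ?d < \<epsilon>" using e by linarith
  show "\<exists>g\<in>cc. pnorm \<mu> p (\<lambda>x. (indicator E x :: complex) - g x) < \<epsilon>"
    by (rule bexI[OF _ gcc]) (rule d)
qed

theorem cc_dense_Lp:
  assumes p: "1 \<le> p" and h: "h \<in> Lp_fun \<mu> p" shows "cc_approx p h"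
  unfolding cc_approx_def
proof (intro conjI allI impI h)
  fix \<epsilon> :: real assume e: "0 < \<epsilon>"
  obtain s where s: "\<And>i. simple_function \<mu> (s i)" "\<And>x. x \<in> space \<mu> \<Longrightarrow> (\<lambda>i. s i x) \<longlonglongrightarrow> h x"
    "\<And>i x. x \<in> space \<mu> \<Longrightarrow> dist (s i x) 0 \<le> 2 * dist (h x) 0"
    using borel_measurable_implies_sequence_metric[OF Lp_funD(1)[OF h], of 0] by metis
  have sle: "norm (s i x) \<le> 2 * norm (h x)" for i x using s(3)[of x i] by simp
  have hm: "h \<in> borel_measurable \<mu>" and hi: "integrable \<mu> (\<lambda>x. norm (h x) powr p)" using Lp_funD[OF h] by auto
  have sm: "s i \<in> borel_measurable \<mu>" for i using s(1) by (rule borel_measurable_simple_function)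
  have sLp: "s i \<in> Lp_fun \<mu> p" for i
    unfolding Lp_fun_def
  proof (intro CollectI conjI sm integrable_powr_bound[OF sm])
    show "integrable \<mu> (\<lambda>x. 2 powr p * norm (h x) powr p)" using hi by simp
    show "norm (s i x) powr p \<le> 2 powr p * norm (h x) powr p" for x
      using powr_mono2[OF _ _ sle, of p i x] p by (simp add: powr_mult)
  qed
  have "(\<lambda>i. \<integral>x. norm (h x - s i x) powr p \<partial>\<mu>) \<longlonglongrightarrow> (\<integral>x. 0 \<partial>\<mu>)"
  proof (rule integral_dominated_convergence)
    show "integrable \<mu> (\<lambda>x. 3 powr p * norm (h x) powr p)" using hi by simp
    show "AE x in \<mu>. (\<lambda>i. norm (h x - s i x) powr p) \<longlonglongrightarrow> 0"
    proof (rule AE_I2)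
      fix x assume "x \<in> space \<mu>"
      then have "(\<lambda>i. norm (h x - s i x) powr p) \<longlonglongrightarrow> norm (h x - h x) powr p"
        using p by (intro tendsto_powr2 tendsto_intros s(2)) auto
      then show "(\<lambda>i. norm (h x - s i x) powr p) \<longlonglongrightarrow> 0" by simp
    qed
    show "AE x in \<mu>. norm (norm (h x - s i x) powr p) \<le> 3 powr p * norm (h x) powr p" for i
    proof (rule AE_I2)
      fix x
      have "norm (h x - s i x) \<le> 3 * norm (h x)"
        using norm_triangle_ineq4[of "h x" "s i x"] sle[of i x] by linarith
      then show "norm (norm (h x - s i x) powr p) \<le> 3 powr p * norm (h x) powr p"
        using p powr_mono2[of p "norm (h x - s i x)" "3 * norm (h x)"] by (simp add: powr_mult)
    qed
    show "(\<lambda>x. norm (h x - s i x) powr p) \<in> borel_measurable \<mu>" for i using hm sm by measurable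
  qed simp
  then have "eventually (\<lambda>i. (\<integral>x. norm (h x - s i x) powr p \<partial>\<mu>) < (\<epsilon> / 4) powr p) sequentially"
    using e by (intro order_tendstoD(2)[where a = "(\<epsilon> / 4) powr p"]) auto
  then obtain i where i: "(\<integral>x. norm (h x - s i x) powr p \<partial>\<mu>) < (\<epsilon> / 4) powr p"
    by (meson eventually_sequentially order_refl)
  then have hs: "pnorm \<mu> p (\<lambda>x. h x - s i x) \<le> \<epsilon> / 4"
    using pnorm_le_iff[of p "\<epsilon> / 4" \<mu> "\<lambda>x. h x - s i x"] p e by simp
  have "cc_approx p (s i)"
  proof -
    have fin: "finite (s i ` space \<mu>)" using s(1)[of i] by (simp add: simple_function_def)
    \<comment> \<open>The value 0 is left out, as its level set may have infinite measure; the other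
      level sets have finite measure because s i is in L^p.\<close>
    have eq: "s i x = (\<Sum>v\<in>s i ` space \<mu> - {0}. v * indicator {y. s i y = v} x)" for x
    proof (cases "s i x = 0")
      case True
      show ?thesis unfolding True using True by (intro sum.neutral[symmetric]) (auto simp: indicator_def)
    next
      case False
      have "(\<Sum>v\<in>s i ` space \<mu> - {0}. v * indicator {y. s i y = v} x) = (\<Sum>v\<in>s i ` space \<mu> - {0}. if v = s i x then s i x else 0)"
        by (intro sum.cong) (auto simp: indicator_def)
      also have "\<dots> = s i x" using False fin by simp
      finally show ?thesis by simp
    qed
    have "cc_approx p (\<lambda>x. \<Sum>v\<in>s i ` space \<mu> - {0}. v * indicator {y. s i y = v} x)"
    proof (intro cc_approx_sum cc_approx_cmult cc_approx_indicator p)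
      fix v assume v: "v \<in> s i ` space \<mu> - {0}"
      have "s i -` {v} \<inter> space \<mu> \<in> sets \<mu>" by (rule measurable_sets[OF sm]) simp
      moreover have "s i -` {v} \<inter> space \<mu> = {y. s i y = v}" by auto
      ultimately show E: "{y. s i y = v} \<in> sets \<mu>" by simp
      have "(\<integral>\<^sup>+x. ennreal (norm v powr p) * indicator {y. s i y = v} x \<partial>\<mu>) \<le> (\<integral>\<^sup>+x. ennreal (norm (s i x) powr p) \<partial>\<mu>)"
        by (intro nn_integral_mono) (auto simp: indicator_def)
      also have "\<dots> = ennreal (\<integral>x. norm (s i x) powr p \<partial>\<mu>)"
        using Lp_funD(2)[OF sLp] by (intro nn_integral_eq_integral) auto
      also have "\<dots> < \<infinity>" by simp
      finally have "ennreal (norm v powr p) * emeasure \<mu> {y. s i y = v} < \<infinity>"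
        using E by (simp add: nn_integral_cmult_indicator)
      moreover have "norm v powr p > 0" using v by simp
      ultimately show "emeasure \<mu> {y. s i y = v} < \<infinity>"
        by (auto simp: ennreal_mult_less_top)
    qed
    also have "(\<lambda>x. \<Sum>v\<in>s i ` space \<mu> - {0}. v * indicator {y. s i y = v} x) = s i"
      by (rule ext) (rule eq[symmetric])
    finally show ?thesis .
  qed
  then obtain g where g: "g \<in> cc" "pnorm \<mu> p (\<lambda>x. s i x - g x) < \<epsilon> / 4"
    using e unfolding cc_approx_def by (metis divide_pos_pos zero_less_numeral)
  have "pnorm \<mu> p (\<lambda>x. h x - g x) \<le> pnorm \<mu> p (\<lambda>x. h x - s i x) + pnorm \<mu> p (\<lambda>x. s i x - g x)"
    using p by (intro pnorm_diff_triangle h sLp cc_Lp g) auto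
  then have "pnorm \<mu> p (\<lambda>x. h x - g x) < \<epsilon>" using g(2) hs e by linarith
  then show "\<exists>g\<in>cc. pnorm \<mu> p (\<lambda>x. h x - g x) < \<epsilon>" using g(1) by blast
qed

lemma cc_dense_seq:
  assumes p: "1 \<le> p" and h: "h \<in> Lp_fun \<mu> p"
  obtains g where "\<And>n. g n \<in> cc" "(\<lambda>n. pnorm \<mu> p (\<lambda>x. h x - g n x)) \<longlonglongrightarrow> 0"
proof -
  have "\<exists>g\<in>cc. pnorm \<mu> p (\<lambda>x. h x - g x) < 1 / Suc n" for n
    using cc_dense_Lp[OF p h] by (simp add: cc_approx_def)
  then obtain g where g: "\<And>n. g n \<in> cc" "\<And>n. pnorm \<mu> p (\<lambda>x. h x - g n x) < 1 / Suc n" by metis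
  have "(\<lambda>n. pnorm \<mu> p (\<lambda>x. h x - g n x)) \<longlonglongrightarrow> 0"
    by (rule LIMSEQ_zero_le[OF LIMSEQ_Suc[OF lim_1_over_n] pnorm_nonneg less_imp_le[OF g(2)]])
  then show ?thesis using that g by blast
qed

end

context unimodular_group
begin

section \<open>The convolution operators on \<open>L\<^sup>p\<close>\<close>

text \<open>Hoelder's inequality for the splitting of |f| into |f|^(1/q) and |f|^(1/p) bounds |f *
  h|^p pointwise by c^(p-1) (|f| * |h|^p), whose integral is known from
  \<open>integral_conv\<close>.\<close>

lemma conv_Lp_cc:
  fixes f h :: "'a \<Rightarrow> complex"
  assumes p: "1 < p" and f: "f \<in> cc" and h: "h \<in> cc"
  shows "pnorm \<mu> p (conv f h) \<le> (\<integral>x. norm (f x) \<partial>\<mu>) * pnorm \<mu> p h"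
proof -
  define q where "q = p / (p - 1)"
  have q: "1 < q" "1 / p + 1 / q = 1" "p / q = p - 1" using p by (auto simp: q_def field_simps)
  define c where "c = (\<integral>x. norm (f x) \<partial>\<mu>)"
  have c0: "0 \<le> c" by (simp add: c_def)
  define H where "H x = norm (h x) powr p" for x
  have Hcc: "H \<in> cc" unfolding H_def[abs_def] using cc_norm_powr[OF h, of p] p by simp
  have nf: "(\<lambda>x. norm (f x)) \<in> cc" by (rule cc_norm[OF f])
  have pt: "norm (conv f h x) powr p \<le> c powr (p - 1) * conv (\<lambda>x. norm (f x)) H x" for x
  proof -
    let ?u = "\<lambda>y. norm (f y) powr (1 / q)" and ?v = "\<lambda>y. norm (f y) powr (1 / p) * norm (h (- y + x))"
    have ucc: "?u \<in> cc" using q by (intro cc_norm_powr f) auto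
    have vcc: "?v \<in> cc"
      using p by (intro cc_mult_cont cc_norm_powr f continuous_intros cont_fun[OF cc_cont[OF h]]) auto
    have vp: "?v y powr p = norm (f y) * H (- y + x)" for y
      using p by (simp add: powr_mult powr_powr H_def)
    have uq: "?u y powr q = norm (f y)" for y using q by (simp add: powr_powr)
    have cf: "(\<lambda>y. norm (f y) * H (- y + x)) \<in> cc" by (rule conv_kernel_cc[OF nf Hcc])
    have "norm (conv f h x) \<le> (\<integral>y. norm (f y * h (- y + x)) \<partial>\<mu>)"
      unfolding conv_def by (rule integral_norm_bound)
    also have "\<dots> = (\<integral>y. ?u y * ?v y \<partial>\<mu>)"
    proof (rule Bochner_Integration.integral_cong[OF refl])
      fix y
      have "norm (f y) powr (1 / q) * norm (f y) powr (1 / p) = norm (f y) powr (1 / q + 1 / p)"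
        by (rule powr_add[symmetric])
      also have "\<dots> = norm (f y)" using q by (simp add: add.commute)
      finally show "norm (f y * h (- y + x)) = ?u y * ?v y" by (simp add: norm_mult)
    qed
    also have "\<dots> \<le> pnorm \<mu> q ?u * pnorm \<mu> p ?v"
    proof (rule Hoelder_nonneg(2))
      show "1 / q + 1 / p = 1" using q by simp
      show "integrable \<mu> (\<lambda>y. ?u y powr q)" unfolding uq by (rule cc_integrable[OF nf])
      show "integrable \<mu> (\<lambda>y. ?v y powr p)" unfolding vp by (rule cc_integrable[OF cf])
    qed (use p q ucc vcc in \<open>auto intro: cc_measurable\<close>)
    also have "pnorm \<mu> q ?u = c powr (1 / q)" by (simp add: pnorm_def uq c_def)
    also have "pnorm \<mu> p ?v = (conv (\<lambda>x. norm (f x)) H x) powr (1 / p)"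
    proof -
      have "norm (?v y) powr p = norm (f y) * H (- y + x)" for y using vp[of y] by (simp add: abs_mult)
      then show ?thesis by (simp add: pnorm_def conv_def)
    qed
    finally have "norm (conv f h x) powr p \<le> (c powr (1 / q) * (conv (\<lambda>x. norm (f x)) H x) powr (1 / p)) powr p"
      using p by (intro powr_mono2) auto
    moreover have "0 \<le> conv (\<lambda>x. norm (f x)) H x"
      unfolding conv_def by (rule Bochner_Integration.integral_nonneg) (simp add: H_def)
    ultimately show ?thesis using p q by (simp add: powr_mult powr_powr)
  qed
  have "(\<integral>x. norm (conv f h x) powr p \<partial>\<mu>) \<le> (\<integral>x. c powr (p - 1) * conv (\<lambda>x. norm (f x)) H x \<partial>\<mu>)"
    using p by (intro integral_mono pt integrable_mult_right cc_integrable conv_cc cc_norm_powr f h nf Hcc) auto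
  also have "\<dots> = c powr (p - 1) * (c * (\<integral>x. H x \<partial>\<mu>))"
    using integral_conv[OF nf Hcc] by (simp add: c_def)
  also have "\<dots> = c powr p * (\<integral>x. H x \<partial>\<mu>)"
  proof (cases "c = 0")
    case False
    then have "c powr (p - 1) * c powr 1 = c powr p" by (subst powr_add[symmetric]) simp
    then show ?thesis using c0 by simp
  qed simp
  also have "\<dots> = (c * pnorm \<mu> p h) powr p"
    using pnorm_powr[of p \<mu> h] p by (simp add: powr_mult H_def)
  finally show ?thesis
    using pnorm_le_iff[of p "c * pnorm \<mu> p h" \<mu> "conv f h"] p c0 by (simp add: pnorm_nonneg c_def)
qed

lemma Lp_reflect:
  assumes "h \<in> Lp_fun \<mu> p" shows "(\<lambda>y. h (- y + x)) \<in> Lp_fun \<mu> p" "pnorm \<mu> p (\<lambda>y. h (- y + x)) = pnorm \<mu> p h"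
proof -
  have m: "(\<lambda>y. - y + x) \<in> measurable \<mu> \<mu>" by (intro measurable_homeo continuous_intros)
  have hm: "h \<in> borel_measurable \<mu>" using Lp_funD[OF assms] by simp
  have nm: "(\<lambda>y. norm (h y) powr p) \<in> borel_measurable \<mu>" using hm by measurable
  have "integrable (distr \<mu> \<mu> (\<lambda>y. - y + x)) (\<lambda>y. norm (h y) powr p)"
    using Lp_funD(2)[OF assms] by (simp add: distr_reflect)
  from integrable_distr[OF m this]
  show "(\<lambda>y. h (- y + x)) \<in> Lp_fun \<mu> p"
    using measurable_compose[OF m hm] by (simp add: Lp_fun_def)
  show "pnorm \<mu> p (\<lambda>y. h (- y + x)) = pnorm \<mu> p h"
    unfolding pnorm_def using integral_reflect[OF nm, of x] by simp
qed

text \<open>The second bound makes the value at each single point x continuous in h with respect to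
  the L^p norm, so that identities for convolutions extend from C_c to L^p at every point.\<close>

lemma conv_Lp_integrable:
  assumes p: "1 < p" and f: "f \<in> cc" and h: "h \<in> Lp_fun \<mu> p"
  shows "integrable \<mu> (\<lambda>y. f y * h (- y + x))"
    and "norm (conv f h x) \<le> pnorm \<mu> (p / (p - 1)) f * pnorm \<mu> p h"
proof -
  define q where "q = p / (p - 1)"
  have q: "1 < q" "1 / q + 1 / p = 1" using p by (auto simp: q_def field_simps)
  have fq: "f \<in> Lp_fun \<mu> q" using cc_Lp[OF f] q by simp
  note H = Hoelder[OF q(1) p q(2) fq Lp_reflect(1)[OF h]]
  show "integrable \<mu> (\<lambda>y. f y * h (- y + x))" by (rule H(1))
  show "norm (conv f h x) \<le> pnorm \<mu> (p / (p - 1)) f * pnorm \<mu> p h"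
    using H(2)[of x] Lp_reflect(2)[OF h, of x] by (simp add: conv_def q_def)
qed

context
  fixes p :: real assumes p: "1 < p"
begin

lemma conv_Lp_add_right: "f \<in> cc \<Longrightarrow> h \<in> Lp_fun \<mu> p \<Longrightarrow> k \<in> Lp_fun \<mu> p \<Longrightarrow> conv f (\<lambda>x. h x + k x) x = conv f h x + conv f k x"
  unfolding conv_def by (simp add: distrib_left conv_Lp_integrable[OF p])

lemma conv_Lp_diff_right: "f \<in> cc \<Longrightarrow> h \<in> Lp_fun \<mu> p \<Longrightarrow> k \<in> Lp_fun \<mu> p \<Longrightarrow> conv f (\<lambda>x. h x - k x) x = conv f h x - conv f k x"
  unfolding conv_def by (simp add: right_diff_distrib conv_Lp_integrable[OF p])

lemma conv_Lp_add_left: "f \<in> cc \<Longrightarrow> g \<in> cc \<Longrightarrow> h \<in> Lp_fun \<mu> p \<Longrightarrow> conv (\<lambda>x. f x + g x) h x = conv f h x + conv g h x"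
  unfolding conv_def by (simp add: distrib_right conv_Lp_integrable[OF p])

lemma conv_Lp_tendsto:
  assumes f: "f \<in> cc" and h: "h \<in> Lp_fun \<mu> p" and g: "\<And>n. g n \<in> Lp_fun \<mu> p"
    and lim: "(\<lambda>n. pnorm \<mu> p (\<lambda>x. h x - g n x)) \<longlonglongrightarrow> 0"
  shows "(\<lambda>n. conv f (g n) x) \<longlonglongrightarrow> conv f h x"
proof -
  have "(\<lambda>n. conv f h x - conv f (g n) x) \<longlonglongrightarrow> 0"
  proof (rule Lim_null_comparison)
    have "norm (conv f h x - conv f (g n) x) \<le> pnorm \<mu> (p / (p - 1)) f * pnorm \<mu> p (\<lambda>x. h x - g n x)" for n
      using conv_Lp_integrable(2)[OF p f Lp_fun_diff[OF _ h g]] conv_Lp_diff_right[OF f h g] p by simp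
    then show "\<forall>\<^sub>F n in sequentially. norm (conv f h x - conv f (g n) x) \<le> pnorm \<mu> (p / (p - 1)) f * pnorm \<mu> p (\<lambda>x. h x - g n x)"
      by simp
  qed (rule tendsto_mult_right_zero[OF lim])
  from tendsto_diff[OF tendsto_const[of "conv f h x"] this] show ?thesis by simp
qed

text \<open>Fubini's theorem is at hand on C_c only. Measurability and the bound for general h
  therefore come from pointwise limits along a sequence in C_c and Fatou's lemma.\<close>

lemma conv_Lp:
  assumes f: "f \<in> cc" and h: "h \<in> Lp_fun \<mu> p"
  shows "conv f h \<in> Lp_fun \<mu> p" "pnorm \<mu> p (conv f h) \<le> (\<integral>x. norm (f x) \<partial>\<mu>) * pnorm \<mu> p h"
proof -
  obtain g where g: "\<And>n. g n \<in> cc" "(\<lambda>n. pnorm \<mu> p (\<lambda>x. h x - g n x)) \<longlonglongrightarrow> 0"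
    using cc_dense_seq[OF _ h] p by (metis less_imp_le)
  have gL: "g n \<in> Lp_fun \<mu> p" for n using cc_Lp[OF g(1)] p by simp
  have lim: "(\<lambda>n. conv f (g n) x) \<longlonglongrightarrow> conv f h x" for x by (rule conv_Lp_tendsto[OF f h gL g(2)])
  have meas: "conv f h \<in> borel_measurable \<mu>"
    by (rule borel_measurable_LIMSEQ_metric[OF cc_measurable[OF conv_cc[OF f g(1)]]]) (use lim in simp)
  define c where "c = (\<integral>x. norm (f x) \<partial>\<mu>)"
  have le: "pnorm \<mu> p (conv f (g n)) \<le> c * (pnorm \<mu> p h + pnorm \<mu> p (\<lambda>x. h x - g n x))" for n
  proof -
    have "pnorm \<mu> p (conv f (g n)) \<le> c * pnorm \<mu> p (g n)"
      unfolding c_def by (rule conv_Lp_cc[OF p f g(1)])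
    moreover have "pnorm \<mu> p (g n) \<le> pnorm \<mu> p h + pnorm \<mu> p (\<lambda>x. h x - g n x)"
      using pnorm_diff_triangle[OF _ gL h Lp_fun_zero, of n] p pnorm_minus_commute[of \<mu> p "g n" h] by simp
    ultimately show ?thesis
      using mult_left_mono[of "pnorm \<mu> p (g n)" _ c] by (fastforce simp: c_def)
  qed
  have "(\<lambda>n. c * (pnorm \<mu> p h + pnorm \<mu> p (\<lambda>x. h x - g n x))) \<longlonglongrightarrow> c * (pnorm \<mu> p h + 0)"
    by (intro tendsto_intros g(2))
  then have C: "(\<lambda>n. c * (pnorm \<mu> p h + pnorm \<mu> p (\<lambda>x. h x - g n x))) \<longlonglongrightarrow> c * pnorm \<mu> p h" by simp
  have p0: "0 < p" using p by simp
  have cL: "conv f (g n) \<in> Lp_fun \<mu> p" for n using cc_Lp[OF conv_cc[OF f g(1)]] p by simp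
  show "conv f h \<in> Lp_fun \<mu> p" by (rule Lp_fun_Fatou(1)[OF p0 cL meas lim C le])
  show "pnorm \<mu> p (conv f h) \<le> (\<integral>x. norm (f x) \<partial>\<mu>) * pnorm \<mu> p h"
    using Lp_fun_Fatou(2)[OF p0 cL meas lim C le] by (simp add: c_def)
qed

text \<open>The difference has L^p norm 0, and the pointwise bound makes its convolution vanish
  everywhere. This makes \<open>lambda_p\<close> independent of representatives.\<close>

lemma conv_Lp_cong:
  assumes f: "f \<in> cc" and h: "h \<in> Lp_fun \<mu> p" and k: "k \<in> Lp_fun \<mu> p" and eq: "AE x in \<mu>. h x = k x"
  shows "conv f h = conv f k"
proof
  fix x
  have m: "h \<in> borel_measurable \<mu>" "k \<in> borel_measurable \<mu>" using Lp_funD h k by auto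
  have "pnorm \<mu> p (\<lambda>x. h x - k x) = pnorm \<mu> p (\<lambda>x. 0 :: complex)"
    by (rule pnorm_cong_AE) (use m eq in \<open>auto elim: eventually_mono\<close>)
  then have "norm (conv f (\<lambda>x. h x - k x) x) \<le> 0"
    using conv_Lp_integrable(2)[OF p f Lp_fun_diff[OF _ h k], of x] p by (simp add: pnorm_zero)
  then show "conv f h x = conv f k x" using conv_Lp_diff_right[OF f h k] by simp
qed

lemma conv_Lp_assoc:
  assumes f: "f \<in> cc" and g: "g \<in> cc" and h: "h \<in> Lp_fun \<mu> p"
  shows "conv (conv f g) h = conv f (conv g h)"
proof
  fix x
  have p1: "1 \<le> p" using p by simp
  obtain u where u: "\<And>n. u n \<in> cc" "(\<lambda>n. pnorm \<mu> p (\<lambda>x. h x - u n x)) \<longlonglongrightarrow> 0"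
    using cc_dense_seq[OF p1 h] by metis
  have uL: "u n \<in> Lp_fun \<mu> p" for n using cc_Lp[OF u(1)] p by simp
  have "(\<lambda>n. conv (conv f g) (u n) x) \<longlonglongrightarrow> conv (conv f g) h x"
    by (rule conv_Lp_tendsto[OF conv_cc[OF f g] h uL u(2)])
  moreover have "(\<lambda>n. conv f (conv g (u n)) x) \<longlonglongrightarrow> conv f (conv g h) x"
  proof (rule conv_Lp_tendsto[OF f conv_Lp(1)[OF g h] conv_Lp(1)[OF g uL]])
    have "(\<lambda>x. conv g h x - conv g (u n) x) = conv g (\<lambda>x. h x - u n x)" for n
      using conv_Lp_diff_right[OF g h uL] by auto
    then have "pnorm \<mu> p (\<lambda>x. conv g h x - conv g (u n) x) \<le> (\<integral>x. norm (g x) \<partial>\<mu>) * pnorm \<mu> p (\<lambda>x. h x - u n x)" for n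
      using conv_Lp(2)[OF g Lp_fun_diff[OF p1 h uL]] by simp
    then show "(\<lambda>n. pnorm \<mu> p (\<lambda>x. conv g h x - conv g (u n) x)) \<longlonglongrightarrow> 0"
      by (rule LIMSEQ_zero_le[OF tendsto_mult_right_zero[OF u(2)] pnorm_nonneg])
  qed
  ultimately show "conv (conv f g) h x = conv f (conv g h) x"
    using conv_assoc[OF f g u(1)] LIMSEQ_unique by auto
qed

end

section \<open>The involution and the inner product\<close>

definition star :: "('a \<Rightarrow> complex) \<Rightarrow> 'a \<Rightarrow> complex" where "star f x = cnj (f (- x))"

definition ip :: "('a \<Rightarrow> complex) \<Rightarrow> ('a \<Rightarrow> complex) \<Rightarrow> complex" where "ip f g = (\<integral>x. f x * cnj (g x) \<partial>\<mu>)"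

lemma cc_cnj: "f \<in> cc \<Longrightarrow> (\<lambda>x. cnj (f x)) \<in> cc"
  by (rule cc_comp) (auto intro!: continuous_intros)

lemma cc_star: "f \<in> cc \<Longrightarrow> star f \<in> cc"
  unfolding star_def[abs_def] by (intro cc_cnj cc_inv)

lemma star_star: "star (star f) = f"
  by (simp add: star_def fun_eq_iff)

lemma ip_integrable: "f \<in> cc \<Longrightarrow> g \<in> cc \<Longrightarrow> integrable \<mu> (\<lambda>x. f x * cnj (g x))"
  by (intro cc_integrable cc_mult cc_cnj)

lemma ip_commute: "ip f g = cnj (ip g f)"
  unfolding ip_def by (subst Bochner_Integration.integral_cnj[symmetric]) (simp add: mult.commute)

lemma ip_star: "f \<in> cc \<Longrightarrow> g \<in> cc \<Longrightarrow> ip (star f) (star g) = ip g f"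
  unfolding ip_def star_def
  using integral_minus[of "\<lambda>x. g x * cnj (f x)"] by (simp add: cc_measurable cc_mult cc_cnj mult.commute)

lemma star_conv: assumes "f \<in> cc" "g \<in> cc" shows "star (conv f g) = conv (star g) (star f)"
proof
  fix x
  have m: "(\<lambda>y. cnj (g (- y)) * cnj (f (- x + y))) \<in> borel_measurable \<mu>"
    by (intro cont_measurable continuous_intros cont_fun[OF cc_cont[OF assms(1)]] cont_fun[OF cc_cont[OF assms(2)]])
  have "conv (star g) (star f) x = (\<integral>y. cnj (g (- y)) * cnj (f (- x + y)) \<partial>\<mu>)"
    by (simp add: conv_def star_def minus_add)
  also have "\<dots> = (\<integral>y. cnj (g (- (x + y))) * cnj (f (- x + (x + y))) \<partial>\<mu>)"
    by (rule integral_left[OF m, symmetric])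
  also have "\<dots> = (\<integral>y. cnj (f y * g (- y + - x)) \<partial>\<mu>)"
    by (simp add: minus_add mult.commute flip: add.assoc)
  also have "\<dots> = star (conv f g) x"
    unfolding star_def conv_def by (rule Bochner_Integration.integral_cnj)
  finally show "star (conv f g) x = conv (star g) (star f) x" by simp
qed

text \<open>Besides Fubini the computation uses invariance under left translation and under
  inversion; the latter brings in no modular function, so that \<open>star f\<close> gives the
  adjoint operator.\<close>

lemma ip_conv:
  assumes f: "f \<in> cc" and g: "g \<in> cc" and h: "h \<in> cc"
  shows "ip (conv f g) h = ip g (conv (star f) h)"
proof -
  obtain K where K: "compact K" "\<And>x. x \<notin> K \<Longrightarrow> f x = 0" using f by (auto simp: cc_def)
  obtain L where L: "compact L" "\<And>x. x \<notin> L \<Longrightarrow> h x = 0" using h by (auto simp: cc_def)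
  obtain J where J: "compact J" "\<And>x. x \<notin> J \<Longrightarrow> g x = 0" using g by (auto simp: cc_def)
  note cf = cont_fun[OF cc_cont[OF f]] and cg = cont_fun[OF cc_cont[OF g]] and ch = cont_fun[OF cc_cont[OF h]]
  have "ip (conv f g) h = (\<integral>x. \<integral>y. f y * g (- y + x) * cnj (h x) \<partial>\<mu> \<partial>\<mu>)"
    unfolding ip_def conv_def by simp
  also have "\<dots> = (\<integral>y. \<integral>x. f y * g (- y + x) * cnj (h x) \<partial>\<mu> \<partial>\<mu>)"
  proof (rule Fubini_cc[OF _ K(1) L(1)])
    show "continuous_on UNIV (\<lambda>(y, x). f y * g (- y + x) * cnj (h x))"
      unfolding split_beta by (intro continuous_intros cf cg ch)
  qed (use K L in auto)
  also have "\<dots> = (\<integral>y. \<integral>x. g x * (f y * cnj (h (y + x))) \<partial>\<mu> \<partial>\<mu>)"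
  proof (rule Bochner_Integration.integral_cong[OF refl])
    fix y
    have "(\<lambda>x. f y * g (- y + x) * cnj (h x)) \<in> borel_measurable \<mu>"
      by (intro cont_measurable continuous_intros cg ch)
    from integral_left[OF this, of y, symmetric]
    show "(\<integral>x. f y * g (- y + x) * cnj (h x) \<partial>\<mu>) = (\<integral>x. g x * (f y * cnj (h (y + x))) \<partial>\<mu>)"
      by (simp add: mult.left_commute mult.commute flip: add.assoc)
  qed
  also have "\<dots> = (\<integral>x. \<integral>y. g x * (f y * cnj (h (y + x))) \<partial>\<mu> \<partial>\<mu>)"
  proof (rule Fubini_cc[OF _ K(1) J(1), symmetric])
    show "continuous_on UNIV (\<lambda>(y, x). g x * (f y * cnj (h (y + x))))"
      unfolding split_beta by (intro continuous_intros cf cg ch)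
  qed (use K J in auto)
  also have "\<dots> = (\<integral>x. g x * cnj (conv (star f) h x) \<partial>\<mu>)"
  proof (rule Bochner_Integration.integral_cong[OF refl])
    fix x
    have m: "(\<lambda>y. f y * cnj (h (y + x))) \<in> borel_measurable \<mu>"
      by (intro cont_measurable continuous_intros cf ch)
    have "cnj (conv (star f) h x) = (\<integral>y. f (- y) * cnj (h (- y + x)) \<partial>\<mu>)"
      by (simp add: conv_def star_def flip: Bochner_Integration.integral_cnj)
    also have "\<dots> = (\<integral>y. f y * cnj (h (y + x)) \<partial>\<mu>)" by (rule integral_minus[OF m])
    finally show "(\<integral>y. g x * (f y * cnj (h (y + x))) \<partial>\<mu>) = g x * cnj (conv (star f) h x)" by simp
  qed
  finally show ?thesis by (simp add: ip_def)
qed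

lemma ip_self: "f \<in> cc \<Longrightarrow> ip f f = of_real ((pnorm \<mu> 2 f)\<^sup>2)"
proof -
  assume f: "f \<in> cc"
  have "(pnorm \<mu> 2 f)\<^sup>2 = (\<integral>x. (norm (f x))\<^sup>2 \<partial>\<mu>)"
    using pnorm_powr[of 2 \<mu> f] by (simp add: pnorm_nonneg)
  then show ?thesis
    by (simp add: ip_def complex_norm_square[symmetric] flip: of_real_power)
qed

end

text \<open>The Hahn-Banach theorem and \<open>hilbert_algebra\<close> are stated for types of class
  \<open>real_vector\<close>. The type is used with real values for the former and with complex
  values for the latter.\<close>

typedef (overloaded) ('a, 'b) cfun = "cc :: ('a::topological_space \<Rightarrow> 'b::real_normed_vector) set"
  using cc_zero by blast

setup_lifting type_definition_cfun

instantiation cfun :: (topological_space, real_normed_vector) real_vector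
begin

lift_definition zero_cfun :: "('a, 'b) cfun" is "\<lambda>x. 0" by (rule cc_zero)
lift_definition plus_cfun :: "('a, 'b) cfun \<Rightarrow> ('a, 'b) cfun \<Rightarrow> ('a, 'b) cfun" is "\<lambda>f g x. f x + g x" by (rule cc_add)
lift_definition uminus_cfun :: "('a, 'b) cfun \<Rightarrow> ('a, 'b) cfun" is "\<lambda>f x. - f x" by (rule cc_uminus)
lift_definition minus_cfun :: "('a, 'b) cfun \<Rightarrow> ('a, 'b) cfun \<Rightarrow> ('a, 'b) cfun" is "\<lambda>f g x. f x - g x" by (rule cc_diff)
lift_definition scaleR_cfun :: "real \<Rightarrow> ('a, 'b) cfun \<Rightarrow> ('a, 'b) cfun" is "\<lambda>c f x. c *\<^sub>R f x" by (rule cc_scaleR)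

instance
  by standard (transfer; simp add: fun_eq_iff algebra_simps)+

end

section \<open>Means\<close>

lemma Linf_norm_le: "0 \<le> B \<Longrightarrow> (\<And>x. norm (f x) \<le> B) \<Longrightarrow> Linf_norm \<mu> f \<le> B"
  unfolding Linf_norm_def by (rule cInf_lower) (auto simp: locally_AE_def intro!: bdd_belowI[of _ 0])

context unimodular_group
begin

lemma Linf_fun_continuous:
  assumes "continuous_on UNIV f" "\<And>x. norm (f x) \<le> B" shows "f \<in> Linf_fun \<mu>"
  unfolding Linf_fun_def
proof (intro CollectI conjI ballI impI)
  fix E assume "E \<in> sets \<mu>"
  then show "set_borel_measurable \<mu> E f"
    using cont_measurable[OF assms(1)] unfolding set_borel_measurable_def by (intro borel_measurable_scaleR) auto
next
  show "\<exists>C. locally_AE \<mu> (\<lambda>x. norm (f x) \<le> C)" using assms(2) by (intro exI[of _ B]) (simp add: locally_AE_def)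
qed

lemma compact_neighbourhood:
  fixes x :: 'a
  obtains U L where "open U" "compact L" "x \<in> U" "U \<subseteq> L"
  using locally_compact_space_compact_closed_compact[of "euclidean :: 'a topology"] lc Hausdorff_space_euclidean_t2[where 'a = 'a]
  by (auto simp flip: open_openin dest!: spec[of _ "{x}"])

definition translate :: "'a \<Rightarrow> ('a \<Rightarrow> 'b) \<Rightarrow> 'a \<Rightarrow> 'b" where "translate s f x = f (- s + x)"

lemma translate_cc: "f \<in> cc \<Longrightarrow> translate s f \<in> cc"
  unfolding translate_def[abs_def] by (rule cc_left)

lemma integral_translate:
  fixes f :: "'a \<Rightarrow> 'b::{banach, second_countable_topology}"
  shows "f \<in> cc \<Longrightarrow> integral\<^sup>L \<mu> (translate s f) = integral\<^sup>L \<mu> f"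
  unfolding translate_def by (rule integral_left) (rule cc_measurable)

lemma translate_conv: "f \<in> cc \<Longrightarrow> g \<in> cc \<Longrightarrow> translate s (conv f g) = conv (translate s f) g"
  by (rule ext) (use conv_left[of f g "- s"] in \<open>simp add: translate_def conv_def cc_measurable\<close>)

section \<open>The L^1 norm and continuous probability densities\<close>

definition norm1 :: "('a \<Rightarrow> real) \<Rightarrow> real" where "norm1 f = (\<integral>x. \<bar>f x\<bar> \<partial>\<mu>)"

lemma cc_abs: "f \<in> cc \<Longrightarrow> (\<lambda>x. \<bar>f x\<bar>) \<in> cc" for f :: "'a \<Rightarrow> real"
  using cc_norm[of f] by simp

lemma norm1_nonneg: "0 \<le> norm1 f"
  by (simp add: norm1_def)

lemma norm1_triangle: "f \<in> cc \<Longrightarrow> g \<in> cc \<Longrightarrow> norm1 (\<lambda>x. f x + g x) \<le> norm1 f + norm1 g"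
  unfolding norm1_def
  by (subst Bochner_Integration.integral_add[symmetric])
    (auto intro!: integral_mono cc_integrable cc_abs cc_add)

lemma norm1_scale: "norm1 (\<lambda>x. c * f x) = \<bar>c\<bar> * norm1 f"
  by (simp add: norm1_def abs_mult)

lemma norm1_conv: assumes f: "f \<in> cc" and g: "g \<in> cc" shows "norm1 (conv f g) \<le> norm1 f * norm1 g"
proof -
  have "norm1 (conv f g) \<le> (\<integral>x. conv (\<lambda>x. \<bar>f x\<bar>) (\<lambda>x. \<bar>g x\<bar>) x \<partial>\<mu>)"
    unfolding norm1_def
  proof (rule integral_mono)
    show "\<bar>conv f g x\<bar> \<le> conv (\<lambda>x. \<bar>f x\<bar>) (\<lambda>x. \<bar>g x\<bar>) x" for x
      unfolding conv_def abs_mult[symmetric] by (rule integral_abs_bound)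
  qed (auto intro!: cc_integrable cc_abs conv_cc f g)
  then show ?thesis by (simp add: integral_conv cc_abs f g norm1_def)
qed

lemma norm1_translate: "f \<in> cc \<Longrightarrow> norm1 (translate s f) = norm1 f"
  using integral_translate[OF cc_abs, of f s] by (simp add: norm1_def translate_def[abs_def])

definition densities :: "('a \<Rightarrow> real) set" where
  "densities = {\<theta> \<in> cc. (\<forall>x. 0 \<le> \<theta> x) \<and> integral\<^sup>L \<mu> \<theta> = 1}"

lemma densities_norm1: "\<theta> \<in> densities \<Longrightarrow> norm1 \<theta> = 1"
  by (simp add: densities_def norm1_def)

lemma densities_ne: "densities \<noteq> {}"
proof -
  obtain \<phi> :: "'a \<Rightarrow> real" where "\<phi> \<in> cc" "\<And>x. 0 \<le> \<phi> x" "integral\<^sup>L \<mu> \<phi> = 1" using cc_integral_pos by blast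
  then show ?thesis unfolding densities_def by blast
qed

lemma densities_translate: "\<theta> \<in> densities \<Longrightarrow> translate s \<theta> \<in> densities"
  unfolding densities_def using translate_cc[of \<theta> s] integral_translate[of \<theta> s] by (simp add: translate_def)

lemma densities_conv: "\<theta> \<in> densities \<Longrightarrow> \<eta> \<in> densities \<Longrightarrow> conv \<theta> \<eta> \<in> densities"
proof -
  assume "\<theta> \<in> densities" "\<eta> \<in> densities"
  then have "\<theta> \<in> cc" "\<eta> \<in> cc" "\<And>x. 0 \<le> \<theta> x" "\<And>x. 0 \<le> \<eta> x" "integral\<^sup>L \<mu> \<theta> = 1" "integral\<^sup>L \<mu> \<eta> = 1"
    by (auto simp: densities_def)
  moreover have "0 \<le> conv \<theta> \<eta> x" for x
    unfolding conv_def by (rule Bochner_Integration.integral_nonneg) (simp add: calculation)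
  ultimately show ?thesis using conv_cc[of \<theta> \<eta>] integral_conv[of \<theta> \<eta>] by (simp add: densities_def)
qed

text \<open>For s in a relatively compact neighbourhood of s0 all translates are supported in one
  compact set L, where uniform closeness bounds the L^1 distance.\<close>

lemma translate_norm1_continuous:
  assumes f: "f \<in> cc" and e: "0 < \<epsilon>"
  obtains U where "open U" "s0 \<in> U" "\<And>s. s \<in> U \<Longrightarrow> norm1 (\<lambda>x. translate s f x - translate s0 f x) \<le> \<epsilon>"
proof -
  obtain V N where V: "open V" "compact N" "s0 \<in> V" "V \<subseteq> N" using compact_neighbourhood by blast
  obtain K where K: "compact K" "\<And>x. x \<notin> K \<Longrightarrow> f x = 0" using f by (auto simp: cc_def)
  define L where "L = {x + y | x y. x \<in> N \<and> y \<in> K}"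
  have L: "compact L" unfolding L_def by (rule compact_sum[OF V(2) K(1)])
  have L0: "translate s f x = 0" if "s \<in> V" "x \<notin> L" for s x
  proof -
    have "x = s + (- s + x)" by (simp flip: add.assoc)
    then have "- s + x \<notin> K" using that V(4) unfolding L_def by blast
    then show ?thesis using K(2) by (simp add: translate_def)
  qed
  define \<delta> where "\<delta> = \<epsilon> / (1 + measure \<mu> L)"
  have n: "0 < 1 + measure \<mu> L" using measure_nonneg[of \<mu> L] by linarith
  have d: "0 < \<delta>" using e n by (simp add: \<delta>_def)
  have "continuous_on UNIV (\<lambda>(s, x). translate s f x)"
    unfolding translate_def split_beta by (intro cont_fun[OF cc_cont[OF f]] continuous_intros)
  from continuous_on_uniform[OF this L d, of s0]
  obtain W where W: "open W" "s0 \<in> W" "\<And>s x. s \<in> W \<Longrightarrow> x \<in> L \<Longrightarrow> dist (translate s f x) (translate s0 f x) \<le> \<delta>" by metis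
  show ?thesis
  proof
    show "open (V \<inter> W)" "s0 \<in> V \<inter> W" using V W by auto
    fix s assume s: "s \<in> V \<inter> W"
    let ?d = "\<lambda>x. translate s f x - translate s0 f x"
    have dcc: "?d \<in> cc" by (intro cc_diff translate_cc f)
    have "norm (\<integral>x. \<bar>?d x\<bar> \<partial>\<mu>) \<le> \<delta> * measure \<mu> L"
    proof (rule integrable_support(2)[OF cc_measurable[OF cc_abs[OF dcc]] L])
      show "\<bar>?d x\<bar> = 0" if "x \<notin> L" for x using L0[of s x] L0[of s0 x] that s V by simp
      then show "norm \<bar>?d x\<bar> \<le> \<delta>" for x
        using W(3)[of s x] s d by (cases "x \<in> L") (auto simp: dist_norm)
    qed
    also have "\<dots> \<le> \<delta> * (1 + measure \<mu> L)" using d by simp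
    also have "\<dots> = \<epsilon>" using n by (simp add: \<delta>_def)
    finally show "norm1 ?d \<le> \<epsilon>" by (simp add: norm1_def)
  qed
qed

section \<open>Reiter's condition\<close>

text \<open>
  Uniqueness of Haar measure for signed functionals. With \<open>\<integral>\<kappa> = 1\<close>, invariance on both sides gives
  \<open>M(h) = \<integral> M\<^sub>x(h(x) \<kappa>(y x\<^sup>-\<^sup>1)) dy = \<integral> M\<^sub>x(h(x y) \<kappa>(x\<^sup>-\<^sup>1)) dy = M\<^sub>x(\<kappa>(x\<^sup>-\<^sup>1)) \<integral>h\<close>.
\<close>

lemma invariant_functional_null:
  fixes M :: "('a \<Rightarrow> real) \<Rightarrow> real"
  assumes M_add: "\<And>f g. f \<in> cc \<Longrightarrow> g \<in> cc \<Longrightarrow> M (\<lambda>x. f x + g x) = M f + M g"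
    and M_scale: "\<And>c f. f \<in> cc \<Longrightarrow> M (\<lambda>x. c * f x) = c * M f"
    and M_bound: "\<And>f. f \<in> cc \<Longrightarrow> \<bar>M f\<bar> \<le> norm1 f"
    and M_inv: "\<And>f a. f \<in> cc \<Longrightarrow> M (\<lambda>x. f (x + a)) = M f"
    and h: "h \<in> cc" and h0: "integral\<^sup>L \<mu> h = 0"
  shows "M h = 0"
proof -
  obtain \<kappa> :: "'a \<Rightarrow> real" where \<kappa>: "\<kappa> \<in> cc" "integral\<^sup>L \<mu> \<kappa> = 1" using cc_integral_pos by blast
  obtain K where K: "compact K" "\<And>x. x \<notin> K \<Longrightarrow> h x = 0" using h by (auto simp: cc_def)
  obtain L where L: "compact L" "\<And>x. x \<notin> L \<Longrightarrow> \<kappa> x = 0" using \<kappa> by (auto simp: cc_def)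
  note ch = cont_fun[OF cc_cont[OF h]] and ck = cont_fun[OF cc_cont[OF \<kappa>(1)]]
  \<comment> \<open>The bound by \<open>norm1\<close> implies continuity in the uniform norm on
    functions with a fixed compact support, as required by
    \<open>integral_functional_swap\<close>.\<close>
  have Mb: "norm (M f) \<le> measure \<mu> J * s" if "f \<in> cc" "compact J" "\<And>x. x \<notin> J \<Longrightarrow> f x = 0" "\<And>x. norm (f x) \<le> s" for f J s
  proof -
    have "norm1 f \<le> s * measure \<mu> J"
      using integrable_support(2)[OF cc_measurable[OF cc_abs[OF that(1)]] that(2), of s] that(3,4) by (simp add: norm1_def)
    then show ?thesis using M_bound[OF that(1)] by (simp add: mult.commute)
  qed
  have "(\<integral>y. h x * \<kappa> (y - x) \<partial>\<mu>) = h x" for x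
    using integral_right[OF cc_measurable[OF \<kappa>(1)], of "- x"] \<kappa>(2) by simp
  then have "M h = M (\<lambda>x. \<integral>y. h x * \<kappa> (y - x) \<partial>\<mu>)" by presburger
  also have "\<dots> = (\<integral>y. M (\<lambda>x. h x * \<kappa> (y - x)) \<partial>\<mu>)"
  proof (rule integral_functional_swap(1)[OF _ compact_sum[OF L(1) K(1)] K(1)])
    show "continuous_on UNIV (\<lambda>(y, x). h x * \<kappa> (y - x))"
      unfolding split_beta by (intro continuous_intros ch ck)
    show "h x * \<kappa> (y - x) = 0" if y: "y \<notin> {x + y | x y. x \<in> L \<and> y \<in> K}" for y x
    proof (cases "x \<in> K \<and> y - x \<in> L")
      case True
      have "y = (y - x) + x" by simp
      with True y show ?thesis by blast
    qed (use K L in auto)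
    show "norm (M f) \<le> measure \<mu> K * s" if "f \<in> cc" "\<And>x. x \<notin> K \<Longrightarrow> f x = 0" "\<And>x. norm (f x) \<le> s" for f s
      using Mb[OF that(1) K(1)] that by blast
  qed (use K M_add M_scale in auto)
  also have "\<dots> = (\<integral>y. M (\<lambda>x. h (x + y) * \<kappa> (- x)) \<partial>\<mu>)"
  proof (rule Bochner_Integration.integral_cong[OF refl])
    fix y
    have "(\<lambda>x. h x * \<kappa> (y - x)) \<in> cc" by (intro cc_mult_cont h ck continuous_intros)
    from M_inv[OF this, of y]
    show "M (\<lambda>x. h x * \<kappa> (y - x)) = M (\<lambda>x. h (x + y) * \<kappa> (- x))"
      by (simp add: minus_add diff_conv_add_uminus del: add_uminus_conv_diff flip: add.assoc)
  qed
  also have "\<dots> = M (\<lambda>x. \<integral>y. h (x + y) * \<kappa> (- x) \<partial>\<mu>)"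
  proof (rule integral_functional_swap(1)[OF _ compact_sum[OF L(1) K(1)] compact_minus[OF L(1)], symmetric])
    show "continuous_on UNIV (\<lambda>(y, x). h (x + y) * \<kappa> (- x))"
      unfolding split_beta by (intro continuous_intros ch ck)
    show "h (x + y) * \<kappa> (- x) = 0" if x: "x \<notin> uminus ` L" for y x
    proof -
      have "- x \<notin> L" using x by force
      then show ?thesis using L by simp
    qed
    show "h (x + y) * \<kappa> (- x) = 0" if y: "y \<notin> {x + y | x y. x \<in> L \<and> y \<in> K}" for y x
    proof (cases "x + y \<in> K \<and> - x \<in> L")
      case True
      have "y = - x + (x + y)" by (simp flip: add.assoc)
      with True y show ?thesis by blast
    qed (use K L in auto)
    show "norm (M f) \<le> measure \<mu> (uminus ` L) * s" if "f \<in> cc" "\<And>x. x \<notin> uminus ` L \<Longrightarrow> f x = 0" "\<And>x. norm (f x) \<le> s" for f s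
      using Mb[OF that(1) compact_minus[OF L(1)]] that by blast
  qed (use M_add M_scale in auto)
  also have "\<dots> = M (\<lambda>x. 0)"
    using integral_left[OF cc_measurable[OF h]] h0 by simp
  also have "\<dots> = 0" using M_scale[OF cc_zero, of 0] by simp
  finally show ?thesis .
qed

end

locale amenable_unimodular_group = unimodular_group +
  assumes amen: "amenable \<mu>"
begin

text \<open>
  If the infimum of the norms of \<open>h * \<theta>\<close> were positive, Hahn-Banach would separate these functions from \<open>0\<close> by a
  functional \<open>\<Lambda>\<close>; averaging \<open>k \<mapsto> \<Lambda>(k * \<lambda>(s)\<phi>)\<close> over \<open>s\<close> with the mean gives an invariant functional
  that is nonzero at \<open>h\<close>.
\<close>

lemma Reiter_single:
  assumes h: "h \<in> cc" and h0: "integral\<^sup>L \<mu> h = 0" and e: "0 < \<epsilon>"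
  obtains \<theta> where "\<theta> \<in> densities" "norm1 (conv h \<theta>) \<le> \<epsilon>"
proof (rule ccontr)
  assume no: "\<not> thesis"
  note thesisI = that
  have big: "\<epsilon> \<le> norm1 (conv h \<theta>)" if "\<theta> \<in> densities" for \<theta>
    using thesisI[OF that] no by (meson linear)
  define q :: "('a, real) cfun \<Rightarrow> real" where "q z = norm1 (Rep_cfun z)" for z
  define C where "C = (\<lambda>\<theta>. Abs_cfun (conv h \<theta>)) ` densities"
  have Rep: "Rep_cfun (Abs_cfun f) = f" if "f \<in> cc" for f :: "'a \<Rightarrow> real" using that by (simp add: Abs_cfun_inverse)
  have Repcc: "Rep_cfun z \<in> cc" for z :: "('a, real) cfun" by (rule Rep_cfun)
  have Abs_add: "Abs_cfun (\<lambda>x. f x + g x) = Abs_cfun f + Abs_cfun g" if "f \<in> cc" "g \<in> cc" for f g :: "'a \<Rightarrow> real"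
    using that by (simp add: plus_cfun.abs_eq eq_onp_def cc_add)
  have Abs_scale: "Abs_cfun (\<lambda>x. c * f x) = c *\<^sub>R Abs_cfun f" if "f \<in> cc" for f :: "'a \<Rightarrow> real" and c
    using that by (simp add: scaleR_cfun.abs_eq eq_onp_def)
  have q: "sublinear q"
    unfolding sublinear_def q_def plus_cfun.rep_eq scaleR_cfun.rep_eq
    using norm1_triangle[OF Repcc Repcc] by (auto simp: norm1_scale)
  have dens_cc: "\<theta> \<in> cc" if "\<theta> \<in> densities" for \<theta> using that by (simp add: densities_def)
  have "convex C"
  proof (rule convexI)
    fix x y :: "('a, real) cfun" and u v :: real
    assume "x \<in> C" "y \<in> C" and uv: "0 \<le> u" "0 \<le> v" "u + v = 1"
    then obtain \<theta> \<eta> where t: "\<theta> \<in> densities" "\<eta> \<in> densities" "x = Abs_cfun (conv h \<theta>)" "y = Abs_cfun (conv h \<eta>)"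
      by (auto simp: C_def)
    define \<zeta> where "\<zeta> x = u * \<theta> x + v * \<eta> x" for x
    have "\<zeta> \<in> densities"
      using t(1,2) uv unfolding densities_def \<zeta>_def
      by (auto intro!: cc_add cc_cmult simp: cc_integrable)
    moreover have "u *\<^sub>R x + v *\<^sub>R y = Abs_cfun (conv h \<zeta>)"
    proof -
      have eq: "conv h \<zeta> = (\<lambda>x. u * conv h \<theta> x + v * conv h \<eta> x)"
        unfolding \<zeta>_def using conv_add_right[OF h cc_cmult[OF dens_cc[OF t(1)]] cc_cmult[OF dens_cc[OF t(2)]]]
        by (auto simp: conv_cmult_right fun_eq_iff)
      show ?thesis
        unfolding eq t(3,4)
        by (simp add: Abs_add Abs_scale cc_cmult conv_cc[OF h] dens_cc t)
    qed
    ultimately show "u *\<^sub>R x + v *\<^sub>R y \<in> C" by (auto simp: C_def)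
  qed
  moreover have "C \<noteq> {}" using densities_ne by (simp add: C_def)
  moreover have "\<epsilon> \<le> q c" if "c \<in> C" for c
    using that big by (auto simp: C_def q_def Rep conv_cc[OF h] dens_cc)
  ultimately obtain L where L: "linear L" "\<And>x. L x \<le> q x" "\<And>c. c \<in> C \<Longrightarrow> \<epsilon> \<le> L c"
    using Hahn_Banach_separation[OF q] by blast
  define \<Lambda> where "\<Lambda> f = L (Abs_cfun f)" for f
  have L_add: "\<Lambda> (\<lambda>x. f x + g x) = \<Lambda> f + \<Lambda> g" if "f \<in> cc" "g \<in> cc" for f g
    using that by (simp add: \<Lambda>_def Abs_add linear_add[OF L(1)])
  have L_scale: "\<Lambda> (\<lambda>x. c * f x) = c * \<Lambda> f" if "f \<in> cc" for f c
    using that by (simp add: \<Lambda>_def Abs_scale linear_scale[OF L(1)])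
  have L_le: "\<bar>\<Lambda> f\<bar> \<le> norm1 f" if "f \<in> cc" for f
  proof -
    have 1: "\<Lambda> g \<le> norm1 g" if "g \<in> cc" for g using L(2)[of "Abs_cfun g"] that by (simp add: \<Lambda>_def q_def Rep)
    have "- \<Lambda> f \<le> norm1 f" using 1[OF cc_cmult[OF that, of "-1"]] L_scale[OF that, of "-1"] norm1_scale[of "-1" f] by simp
    then show ?thesis using 1[OF that] by linarith
  qed
  have L_diff: "\<Lambda> (\<lambda>x. f x - g x) = \<Lambda> f - \<Lambda> g" if "f \<in> cc" "g \<in> cc" for f g
    using L_add[OF that(1) cc_cmult[OF that(2), of "-1"]] L_scale[OF that(2), of "-1"] by simp
  obtain \<phi> where \<phi>: "\<phi> \<in> densities" using densities_ne by blast
  then have \<phi>cc: "\<phi> \<in> cc" by (rule dens_cc)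
  obtain m where m: "left_invariant_mean \<mu> m" using amen by (auto simp: amenable_def)
  note m = m[unfolded left_invariant_mean_def]
  have m_add: "m (\<lambda>x. f x + g x) = m f + m g" if "f \<in> Linf_fun \<mu>" "g \<in> Linf_fun \<mu>" for f g
    using m that by simp
  have m_cmult: "m (\<lambda>x. c * f x) = c * m f" if "f \<in> Linf_fun \<mu>" for c f
    using m that by simp
  have m_inv: "m (\<lambda>x. f (- a + x)) = m f" if "f \<in> Linf_fun \<mu>" for a f
    using m that by simp
  define F where "F k s = \<Lambda> (conv k (translate s \<phi>))" for k s
  have Fb: "\<bar>F k s\<bar> \<le> norm1 k" if "k \<in> cc" for k s
    unfolding F_def using L_le[OF conv_cc[OF that translate_cc[OF \<phi>cc]], of s]
      norm1_conv[OF that translate_cc[OF \<phi>cc], of s] by (simp add: norm1_translate \<phi>cc densities_norm1[OF \<phi>])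
  have Fc: "continuous_on UNIV (F k)" if k: "k \<in> cc" for k
  proof (rule continuous_on_UNIV_metricI)
    fix s0 and e :: real assume e: "0 < e"
    have n: "0 < 1 + norm1 k" using norm1_nonneg[of k] by linarith
    obtain U where U: "open U" "s0 \<in> U" "\<And>s. s \<in> U \<Longrightarrow> norm1 (\<lambda>x. translate s \<phi> x - translate s0 \<phi> x) \<le> e / (1 + norm1 k)"
      by (rule translate_norm1_continuous[OF \<phi>cc divide_pos_pos[OF e n], of s0]) blast
    have "dist (F k s) (F k s0) \<le> e" if "s \<in> U" for s
    proof -
      have eq: "(\<lambda>x. conv k (translate s \<phi>) x - conv k (translate s0 \<phi>) x) = conv k (\<lambda>x. translate s \<phi> x - translate s0 \<phi> x)"
        by (rule ext) (simp add: conv_diff_right k translate_cc \<phi>cc)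
      have "\<bar>F k s - F k s0\<bar> \<le> norm1 k * norm1 (\<lambda>x. translate s \<phi> x - translate s0 \<phi> x)"
        unfolding F_def L_diff[OF conv_cc[OF k translate_cc[OF \<phi>cc]] conv_cc[OF k translate_cc[OF \<phi>cc]], symmetric] eq
        by (rule order_trans[OF L_le norm1_conv]) (intro conv_cc cc_diff translate_cc k \<phi>cc)+
      also have "\<dots> \<le> norm1 k * (e / (1 + norm1 k))" by (intro mult_left_mono U(3) that norm1_nonneg)
      also have "\<dots> \<le> e" using e n by (simp add: field_simps)
      finally show ?thesis by (simp add: dist_real_def)
    qed
    with U show "\<exists>U. open U \<and> s0 \<in> U \<and> (\<forall>s\<in>U. dist (F k s) (F k s0) \<le> e)" by blast
  qed
  have Finf: "(\<lambda>s. complex_of_real (F k s)) \<in> Linf_fun \<mu>" if "k \<in> cc" for k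
    by (rule Linf_fun_continuous[where B = "norm1 k"]) (use Fb[OF that] Fc[OF that] in \<open>auto intro!: continuous_intros\<close>)
  define M where "M k = Re (m (\<lambda>s. complex_of_real (F k s)))" for k
  have M_add: "M (\<lambda>x. f x + g x) = M f + M g" if "f \<in> cc" "g \<in> cc" for f g
  proof -
    have "F (\<lambda>x. f x + g x) s = F f s + F g s" for s
    proof -
      have "conv (\<lambda>x. f x + g x) (translate s \<phi>) = (\<lambda>x. conv f (translate s \<phi>) x + conv g (translate s \<phi>) x)"
        by (rule ext) (rule conv_add_left[OF that translate_cc[OF \<phi>cc]])
      then show ?thesis by (simp add: F_def L_add conv_cc that translate_cc \<phi>cc)
    qed
    then show ?thesis using m Finf that by (simp add: M_def)
  qed
  have M_scale: "M (\<lambda>x. c * f x) = c * M f" if "f \<in> cc" for f c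
  proof -
    have "F (\<lambda>x. c * f x) s = c * F f s" for s
    proof -
      have "conv (\<lambda>x. c * f x) (translate s \<phi>) = (\<lambda>x. c * conv f (translate s \<phi>) x)"
        using conv_scale_left[of c f "translate s \<phi>"] by auto
      then show ?thesis by (simp add: F_def L_scale conv_cc that translate_cc \<phi>cc)
    qed
    then show ?thesis using m Finf[OF that] by (simp add: M_def)
  qed
  have m_le: "norm (m f) \<le> B" if "f \<in> Linf_fun \<mu>" "0 \<le> B" "\<And>x. norm (f x) \<le> B" for f B
    using m that Linf_norm_le[of B f \<mu>] by (meson order_trans)
  have M_bound: "\<bar>M f\<bar> \<le> norm1 f" if "f \<in> cc" for f
  proof -
    have "norm (m (\<lambda>s. complex_of_real (F f s))) \<le> norm1 f"
      by (rule m_le[OF Finf[OF that] norm1_nonneg]) (use Fb[OF that] in simp)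
    then show ?thesis unfolding M_def using abs_Re_le_cmod order_trans by blast
  qed
  have M_inv: "M (\<lambda>x. f (x + a)) = M f" if "f \<in> cc" for f a
  proof -
    \<comment> \<open>A right translation of the first factor of a convolution becomes a left
      translation of the second, that is, a left translation in the parameter s over which the mean
      is taken.\<close>
    have "F (\<lambda>x. f (x + a)) s = F f (- a + s)" for s
    proof -
      have "conv f (translate (- a + s) \<phi>) x = conv (\<lambda>x. f (x + a)) (translate s \<phi>) x" for x
      proof -
        have "(\<lambda>y. f y * \<phi> (- s + (a + (- y + x)))) \<in> borel_measurable \<mu>"
          by (intro cont_measurable continuous_intros cc_cont[OF that] cont_fun[OF cc_cont[OF \<phi>cc]])
        from integral_right[OF this, of a, symmetric]
        show ?thesis by (simp add: conv_def translate_def minus_add diff_conv_add_uminus add.assoc del: add_uminus_conv_diff)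
      qed
      then have "conv f (translate (- a + s) \<phi>) = conv (\<lambda>x. f (x + a)) (translate s \<phi>)" by auto
      then show ?thesis by (simp add: F_def)
    qed
    moreover have "m (\<lambda>s. complex_of_real (F f (- a + s))) = m (\<lambda>s. complex_of_real (F f s))"
      by (rule m_inv[OF Finf[OF that]])
    ultimately show ?thesis by (simp add: M_def)
  qed
  have "M h = 0" by (rule invariant_functional_null[OF M_add M_scale M_bound M_inv h h0])
  moreover have "\<epsilon> \<le> M h"
  proof -
    \<comment> \<open>The mean is given by its norm and its value at 1, so positivity has to be
      extracted: all values of \<open>F h\<close> lie in [\<epsilon>, B], and applying the norm
      bound after subtracting the midpoint c keeps the mean in that interval.\<close>
    define B where "B = max (norm1 h) \<epsilon>"
    define c where "c = (B + \<epsilon>) / 2"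
    have Fge: "\<epsilon> \<le> F h s" for s
      unfolding F_def \<Lambda>_def using densities_translate[OF \<phi>] by (intro L(3)) (auto simp: C_def)
    have one: "(\<lambda>s. 1) \<in> Linf_fun \<mu>" by (rule Linf_fun_continuous[where B = 1]) auto
    have cst: "(\<lambda>s. complex_of_real (- c) * 1) \<in> Linf_fun \<mu>"
      by (rule Linf_fun_continuous[where B = "\<bar>c\<bar>"]) auto
    have "m (\<lambda>s. complex_of_real (- c) * 1) = complex_of_real (- c) * m (\<lambda>s. 1)"
      by (rule m_cmult[OF one])
    then have mc: "m (\<lambda>s. complex_of_real (- c) * 1) = complex_of_real (- c)" using m by simp
    let ?f = "\<lambda>s. complex_of_real (F h s) + complex_of_real (- c) * 1"
    have "m ?f = m (\<lambda>s. complex_of_real (F h s)) + m (\<lambda>s. complex_of_real (- c) * 1)"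
      by (rule m_add[OF Finf[OF h] cst])
    then have eq: "m ?f = m (\<lambda>s. complex_of_real (F h s)) - complex_of_real c" using mc by simp
    have "norm (m ?f) \<le> (B - \<epsilon>) / 2"
    proof (rule m_le)
      show "?f \<in> Linf_fun \<mu>"
        by (rule Linf_fun_continuous[where B = "norm1 h + \<bar>c\<bar>"])
          (use Fc[OF h] Fb[OF h] in \<open>auto intro!: continuous_intros order_trans[OF norm_triangle_ineq4] add_mono\<close>)
      show "norm (?f s) \<le> (B - \<epsilon>) / 2" for s
      proof -
        have "?f s = complex_of_real (F h s - c)" by simp
        moreover have "\<bar>F h s - c\<bar> \<le> (B - \<epsilon>) / 2"
          using Fge[of s] Fb[OF h, of s] by (auto simp: c_def B_def abs_le_iff field_simps)
        ultimately show ?thesis by (simp only: norm_of_real)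
      qed
    qed (simp add: B_def)
    moreover have "Re (m ?f) = M h - c" unfolding eq M_def by simp
    ultimately have "\<bar>M h - c\<bar> \<le> (B - \<epsilon>) / 2" using abs_Re_le_cmod[of "m ?f"] by linarith
    then show ?thesis by (simp add: c_def abs_le_iff field_simps)
  qed
  ultimately show False using e by simp
qed

text \<open>If \<theta> works for H, choose \<eta> for h * \<theta>, which again has integral 0.
  Convolution with \<eta> on the right does not increase the L^1 norms already made small, so
  \<theta> * \<eta> works for all.\<close>

lemma Reiter_finite:
  assumes "finite H" "\<And>h. h \<in> H \<Longrightarrow> h \<in> cc" "\<And>h. h \<in> H \<Longrightarrow> integral\<^sup>L \<mu> h = 0" and e: "0 < \<epsilon>"
  shows "\<exists>\<theta>\<in>densities. \<forall>h\<in>H. norm1 (conv h \<theta>) \<le> \<epsilon>"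
  using assms(1-3)
proof (induction H rule: finite_induct)
  case empty
  then show ?case using densities_ne by auto
next
  case (insert h H)
  then obtain \<theta> where t: "\<theta> \<in> densities" "\<And>k. k \<in> H \<Longrightarrow> norm1 (conv k \<theta>) \<le> \<epsilon>" by auto
  then have tcc: "\<theta> \<in> cc" by (simp add: densities_def)
  have hcc: "h \<in> cc" using insert.prems by simp
  have "integral\<^sup>L \<mu> (conv h \<theta>) = 0" using integral_conv[OF hcc tcc] insert.prems by simp
  then obtain \<eta> where n: "\<eta> \<in> densities" "norm1 (conv (conv h \<theta>) \<eta>) \<le> \<epsilon>"
    using Reiter_single[OF conv_cc[OF hcc tcc] _ e] by blast
  then have ncc: "\<eta> \<in> cc" by (simp add: densities_def)
  have assoc: "conv k (conv \<theta> \<eta>) = conv (conv k \<theta>) \<eta>" if "k \<in> cc" for k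
    using conv_assoc[OF that tcc ncc] by auto
  have "norm1 (conv k (conv \<theta> \<eta>)) \<le> \<epsilon>" if "k \<in> insert h H" for k
  proof (cases "k = h")
    case True then show ?thesis using n(2) assoc[OF hcc] by simp
  next
    case False
    then have k: "k \<in> H" "k \<in> cc" using that insert.prems by auto
    have "norm1 (conv (conv k \<theta>) \<eta>) \<le> norm1 (conv k \<theta>) * norm1 \<eta>" by (rule norm1_conv[OF conv_cc[OF k(2) tcc] ncc])
    then show ?thesis using t(2)[OF k(1)] by (simp add: densities_norm1[OF n(1)] assoc[OF k(2)])
  qed
  then show ?case using densities_conv[OF t(1) n(1)] by blast
qed

text \<open>The density is \<phi> * \<theta>. Continuity of translation reduces K to finitely many
  r, and \<theta> makes the differences of \<open>translate r \<phi>\<close> and \<phi>, which have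
  integral 0, small at once; each part costs \<epsilon> / 2.\<close>

theorem Reiter:
  assumes K: "compact K" and e: "0 < \<epsilon>"
  obtains \<psi> where "\<psi> \<in> densities" "\<And>s. s \<in> K \<Longrightarrow> norm1 (\<lambda>x. translate s \<psi> x - \<psi> x) \<le> \<epsilon>"
proof -
  obtain \<phi> where \<phi>: "\<phi> \<in> densities" using densities_ne by blast
  then have \<phi>cc: "\<phi> \<in> cc" by (simp add: densities_def)
  have "\<exists>U. open U \<and> s0 \<in> U \<and> (\<forall>s\<in>U. norm1 (\<lambda>x. translate s \<phi> x - translate s0 \<phi> x) \<le> \<epsilon> / 2)" for s0
    by (rule translate_norm1_continuous[OF \<phi>cc, of "\<epsilon> / 2" s0]) (use e in auto)
  then obtain U where U: "\<And>s0. open (U s0)" "\<And>s0. s0 \<in> U s0" 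
    "\<And>s0 s. s \<in> U s0 \<Longrightarrow> norm1 (\<lambda>x. translate s \<phi> x - translate s0 \<phi> x) \<le> \<epsilon> / 2" by metis
  obtain R where R: "R \<subseteq> K" "finite R" "K \<subseteq> (\<Union>r\<in>R. U r)"
    by (rule compactE_image[OF K, of K U]) (use U in blast)+
  define H where "H = (\<lambda>r x. translate r \<phi> x - \<phi> x) ` R"
  have "\<exists>\<theta>\<in>densities. \<forall>h\<in>H. norm1 (conv h \<theta>) \<le> \<epsilon> / 2"
    by (rule Reiter_finite) (use R e in \<open>auto simp: H_def cc_diff translate_cc \<phi>cc cc_integrable integral_translate\<close>)
  then obtain \<theta> where t: "\<theta> \<in> densities" "\<And>h. h \<in> H \<Longrightarrow> norm1 (conv h \<theta>) \<le> \<epsilon> / 2" by blast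
  then have tcc: "\<theta> \<in> cc" by (simp add: densities_def)
  show ?thesis
  proof
    show "conv \<phi> \<theta> \<in> densities" by (rule densities_conv[OF \<phi> t(1)])
    fix s assume "s \<in> K"
    then obtain r where r: "r \<in> R" "s \<in> U r" using R by blast
    let ?d = "\<lambda>x. translate s \<phi> x - translate r \<phi> x" and ?h = "\<lambda>x. translate r \<phi> x - \<phi> x"
    have dcc: "?d \<in> cc" and hcc: "?h \<in> cc" by (intro cc_diff translate_cc \<phi>cc)+
    have eq: "(\<lambda>x. translate s (conv \<phi> \<theta>) x - conv \<phi> \<theta> x) = (\<lambda>x. conv ?d \<theta> x + conv ?h \<theta> x)"
      by (rule ext) (simp add: translate_conv \<phi>cc tcc conv_diff_left translate_cc)
    have "norm1 (conv ?d \<theta>) \<le> \<epsilon> / 2"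
      using norm1_conv[OF dcc tcc] U(3)[OF r(2)] by (simp add: densities_norm1[OF t(1)])
    moreover have "norm1 (conv ?h \<theta>) \<le> \<epsilon> / 2" using t(2) r(1) by (auto simp: H_def)
    ultimately show "norm1 (\<lambda>x. translate s (conv \<phi> \<theta>) x - conv \<phi> \<theta> x) \<le> \<epsilon>"
      unfolding eq using norm1_triangle[OF conv_cc[OF dcc tcc] conv_cc[OF hcc tcc]] by linarith
  qed
qed

end

section \<open>Khintchine's inequality\<close>

text \<open>Choices of signs are indexed by subsets, so that expectations over independent random
  signs are finite sums over \<open>Pow I\<close> divided by \<open>2 ^ card I\<close>.\<close>

definition rad :: "'i set \<Rightarrow> 'i \<Rightarrow> real" where "rad S i = (if i \<in> S then 1 else - 1)"

lemma rad_sq: "rad S i * rad S i = 1"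
  by (simp add: rad_def)

text \<open>For distinct i and j the sum over all subsets is the expansion of the product of the
  factors 1 + g k, where g is -1 at i and j; these factors vanish.\<close>

lemma rad_orthogonal:
  assumes "finite I" "i \<in> I" "j \<in> I"
  shows "(\<Sum>S\<in>Pow I. rad S i * rad S j) = (if i = j then 2 ^ card I else 0)"
proof (cases "i = j")
  case True then show ?thesis using assms by (simp add: rad_sq card_Pow)
next
  case False
  define g where "g k = (if k = i \<or> k = j then - 1 else 1 :: real)" for k
  have "(\<Prod>k\<in>I - S. g k) = rad S i * rad S j" if S: "S \<in> Pow I" for S
  proof -
    have "(\<Prod>k\<in>I - S. g k) = (\<Prod>k\<in>(I - S) \<inter> {i, j}. g k)"
      using assms(1) by (intro prod.mono_neutral_right) (auto simp: g_def)
    also have "\<dots> = (\<Prod>k\<in>{i, j}. if k \<in> I - S then g k else 1)"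
      by (subst Int_commute, subst prod.inter_restrict) auto
    also have "\<dots> = rad S i * rad S j"
      using False assms by (simp add: rad_def g_def)
    finally show ?thesis .
  qed
  then have "(\<Sum>S\<in>Pow I. rad S i * rad S j) = (\<Sum>S\<in>Pow I. (\<Prod>k\<in>S. 1) * (\<Prod>k\<in>I - S. g k))"
    by (intro sum.cong) auto
  also have "\<dots> = (\<Prod>k\<in>I. 1 + g k)" by (rule prod_add[OF assms(1), symmetric])
  also have "\<dots> = 0" using assms by (intro prod_zero) (auto simp: g_def)
  finally show ?thesis using False by simp
qed

text \<open>Both exponentials are compared with quadratic polynomials, by exp c \<le> 1 + c + c^2
  and exp (- c) \<le> 1 / (1 + c) \<le> 1 - c + c^2 for c in [0, 1].\<close>

lemma exp_pm_le: "exp c + exp (- c) \<le> 2 * exp (c\<^sup>2)" if "\<bar>c\<bar> \<le> 1" for c :: real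
proof -
  have *: "exp c + exp (- c) \<le> 2 * exp (c\<^sup>2)" if c: "0 \<le> c" "c \<le> 1" for c :: real
  proof -
    have 1: "exp c \<le> 1 + c + c\<^sup>2" by (rule exp_bound) (use c in auto)
    have "1 + c \<le> exp c" by (rule exp_ge_add_one_self)
    then have "exp (- c) \<le> 1 / (1 + c)" using c by (simp add: exp_minus field_simps)
    also have "\<dots> \<le> 1 - c + c\<^sup>2"
    proof -
      have "1 \<le> (1 - c + c\<^sup>2) * (1 + c)" using c by (simp add: algebra_simps power2_eq_square)
      then show ?thesis using c by (simp add: divide_le_eq)
    qed
    finally have "exp c + exp (- c) \<le> 2 * (1 + c\<^sup>2)" using 1 by simp
    also have "\<dots> \<le> 2 * exp (c\<^sup>2)" by (intro mult_left_mono exp_ge_add_one_self) simp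
    finally show ?thesis .
  qed
  show ?thesis
  proof (cases "0 \<le> c")
    case True then show ?thesis using *[of c] that by simp
  next
    case False then show ?thesis using *[of "- c"] that by (simp add: add.commute)
  qed
qed

text \<open>The exponential of the sum is a product, and summing over all signs gives the product of
  the factors exp (c i) + exp (- c i). The square sum being at most 1 puts each c i in the range of
  \<open>exp_pm_le\<close>.\<close>

lemma rad_exp_moment:
  fixes c :: "'i \<Rightarrow> real"
  assumes I: "finite I" and c: "(\<Sum>i\<in>I. (c i)\<^sup>2) \<le> 1"
  shows "(\<Sum>S\<in>Pow I. exp (\<Sum>i\<in>I. rad S i * c i)) \<le> 2 ^ card I * exp 1"
proof -
  have ci: "\<bar>c i\<bar> \<le> 1" if "i \<in> I" for i
  proof -
    have "(c i)\<^sup>2 \<le> (\<Sum>i\<in>I. (c i)\<^sup>2)" using that I by (intro member_le_sum) auto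
    then have "(c i)\<^sup>2 \<le> 1" using c by (rule order_trans)
    then show ?thesis by (rule iffD1[OF abs_square_le_1])
  qed
  have "exp (\<Sum>i\<in>I. rad S i * c i) = (\<Prod>i\<in>S. exp (c i)) * (\<Prod>i\<in>I - S. exp (- c i))" if S: "S \<in> Pow I" for S
  proof -
    have fS: "finite S" using S I finite_subset by auto
    have "(\<Sum>i\<in>I. rad S i * c i) = (\<Sum>i\<in>I - S. rad S i * c i) + (\<Sum>i\<in>S. rad S i * c i)"
      using S I by (intro sum.subset_diff) auto
    also have "\<dots> = (\<Sum>i\<in>I - S. - c i) + (\<Sum>i\<in>S. c i)"
      by (intro arg_cong2[where f = "(+)"] sum.cong) (auto simp: rad_def)
    finally show ?thesis using fS I by (simp add: exp_add exp_sum del: sum_negf)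
  qed
  then have "(\<Sum>S\<in>Pow I. exp (\<Sum>i\<in>I. rad S i * c i)) = (\<Sum>S\<in>Pow I. (\<Prod>i\<in>S. exp (c i)) * (\<Prod>i\<in>I - S. exp (- c i)))"
    by (intro sum.cong) auto
  also have "\<dots> = (\<Prod>i\<in>I. exp (c i) + exp (- c i))" by (rule prod_add[OF I, symmetric])
  also have "\<dots> \<le> (\<Prod>i\<in>I. 2 * exp ((c i)\<^sup>2))"
    using exp_pm_le[OF ci] by (intro prod_mono) (auto simp: add_nonneg_nonneg)
  also have "\<dots> = 2 ^ card I * exp (\<Sum>i\<in>I. (c i)\<^sup>2)" using I by (simp add: prod.distrib exp_sum)
  also have "\<dots> \<le> 2 ^ card I * exp 1" using c by simp
  finally show ?thesis .
qed

text \<open>This is u \<le> exp u at u = |t| / q, raised to the power q; it is the origin of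
  \<open>q powr q\<close> in Khintchine's constant.\<close>

lemma abs_powr_le_exp: "\<bar>t\<bar> powr q \<le> q powr q * (exp t + exp (- t))" if "0 < q" for t q :: real
proof -
  have "\<bar>t\<bar> / q \<le> exp (\<bar>t\<bar> / q)" using exp_ge_add_one_self[of "\<bar>t\<bar> / q"] by linarith
  then have "\<bar>t\<bar> \<le> q * exp (\<bar>t\<bar> / q)" using that by (simp add: field_simps)
  then have "\<bar>t\<bar> powr q \<le> (q * exp (\<bar>t\<bar> / q)) powr q" using that by (intro powr_mono2) auto
  also have "\<dots> = q powr q * exp \<bar>t\<bar>" using that by (simp add: powr_mult exp_powr_real)
  also have "exp \<bar>t\<bar> \<le> exp t + exp (- t)" by (simp add: abs_if)
  finally show ?thesis using that by simp
qed

text \<open>After scaling the square sum to 1, moments are dominated by exponential moments. The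
  factor 2 counts the two exponentials, of t and of - t.\<close>

lemma Khintchine_real:
  fixes c :: "'i \<Rightarrow> real"
  assumes I: "finite I" and q: "0 < q"
  shows "(\<Sum>S\<in>Pow I. \<bar>\<Sum>i\<in>I. rad S i * c i\<bar> powr q) \<le> 2 ^ card I * (2 * exp 1 * q powr q) * (\<Sum>i\<in>I. (c i)\<^sup>2) powr (q / 2)"
proof (cases "(\<Sum>i\<in>I. (c i)\<^sup>2) = 0")
  case True
  then have "c i = 0" if "i \<in> I" for i using that I by (simp add: sum_nonneg_eq_0_iff)
  then show ?thesis by simp
next
  case False
  define \<sigma> where "\<sigma> = (\<Sum>i\<in>I. (c i)\<^sup>2)"
  have s: "0 < \<sigma>" using False sum_nonneg[of I "\<lambda>i. (c i)\<^sup>2"] by (simp add: \<sigma>_def)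
  define d where "d i = c i / sqrt \<sigma>" for i
  have d1: "(\<Sum>i\<in>I. (d i)\<^sup>2) \<le> 1"
    using s by (simp add: d_def power_divide \<sigma>_def flip: sum_divide_distrib)
  have cd: "(\<Sum>i\<in>I. rad S i * c i) = sqrt \<sigma> * (\<Sum>i\<in>I. rad S i * d i)" for S
    using s by (simp add: d_def sum_distrib_left)
  have "(\<Sum>S\<in>Pow I. \<bar>\<Sum>i\<in>I. rad S i * d i\<bar> powr q)
    \<le> (\<Sum>S\<in>Pow I. q powr q * (exp (\<Sum>i\<in>I. rad S i * d i) + exp (\<Sum>i\<in>I. rad S i * (- d i))))"
    by (intro sum_mono) (use abs_powr_le_exp[OF q] in \<open>simp add: sum_negf\<close>)
  also have "\<dots> \<le> q powr q * (2 ^ card I * exp 1 + 2 ^ card I * exp 1)"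
    unfolding sum_distrib_left[symmetric] sum.distrib
    using rad_exp_moment[OF I d1] rad_exp_moment[OF I, of "\<lambda>i. - d i"] d1
    by (intro mult_left_mono add_mono) auto
  finally have *: "(\<Sum>S\<in>Pow I. \<bar>\<Sum>i\<in>I. rad S i * d i\<bar> powr q) \<le> 2 ^ card I * (2 * exp 1 * q powr q)"
    by (simp add: algebra_simps)
  have "(\<Sum>S\<in>Pow I. \<bar>\<Sum>i\<in>I. rad S i * c i\<bar> powr q) = \<sigma> powr (q / 2) * (\<Sum>S\<in>Pow I. \<bar>\<Sum>i\<in>I. rad S i * d i\<bar> powr q)"
  proof -
    have "sqrt \<sigma> powr q = \<sigma> powr (q / 2)" using s powr_powr[of \<sigma> "1 / 2" q] by (simp add: powr_half_sqrt)
    then have "\<bar>\<Sum>i\<in>I. rad S i * c i\<bar> powr q = \<sigma> powr (q / 2) * \<bar>\<Sum>i\<in>I. rad S i * d i\<bar> powr q" for S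
      unfolding cd abs_mult powr_mult using s by simp
    then show ?thesis by (simp only: sum_distrib_left)
  qed
  also have "\<dots> \<le> \<sigma> powr (q / 2) * (2 ^ card I * (2 * exp 1 * q powr q))"
    by (intro mult_left_mono *) simp
  finally show ?thesis by (simp add: \<sigma>_def mult.commute)
qed

text \<open>The constant of the real case times \<open>2 powr q * 2\<close>, the price of separating
  real and imaginary parts.\<close>

definition Khintchine_const :: "real \<Rightarrow> real" where
  "Khintchine_const q = 2 powr q * 2 * (2 * exp 1 * q powr q)"

lemma Khintchine_const_nonneg: "0 \<le> Khintchine_const q"
  by (simp add: Khintchine_const_def)

lemma Khintchine:
  fixes z :: "'i \<Rightarrow> complex"
  assumes I: "finite I" and q: "1 \<le> q"
  shows "(\<Sum>S\<in>Pow I. norm (\<Sum>i\<in>I. rad S i *\<^sub>R z i) powr q)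
    \<le> 2 ^ card I * Khintchine_const q * (\<Sum>i\<in>I. (norm (z i))\<^sup>2) powr (q / 2)"
proof -
  define B where "B = 2 ^ card I * (2 * exp 1 * q powr q)"
  define \<sigma> where "\<sigma> = (\<Sum>i\<in>I. (norm (z i))\<^sup>2)"
  have B0: "0 \<le> B" by (simp add: B_def)
  have part: "(\<Sum>S\<in>Pow I. \<bar>\<Sum>i\<in>I. rad S i * g (z i)\<bar> powr q) \<le> B * \<sigma> powr (q / 2)"
    if g: "\<And>w. (g w)\<^sup>2 \<le> (norm w)\<^sup>2" for g :: "complex \<Rightarrow> real"
  proof -
    have "(\<Sum>i\<in>I. (g (z i))\<^sup>2) powr (q / 2) \<le> \<sigma> powr (q / 2)"
      using q g unfolding \<sigma>_def by (intro powr_mono2 sum_mono sum_nonneg) auto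
    then have "B * (\<Sum>i\<in>I. (g (z i))\<^sup>2) powr (q / 2) \<le> B * \<sigma> powr (q / 2)" using B0 by (rule mult_left_mono)
    then show ?thesis using Khintchine_real[OF I, of q "\<lambda>i. g (z i)"] q unfolding B_def by linarith
  qed
  have "norm (\<Sum>i\<in>I. rad S i *\<^sub>R z i) powr q
    \<le> 2 powr q * (\<bar>\<Sum>i\<in>I. rad S i * Re (z i)\<bar> powr q + \<bar>\<Sum>i\<in>I. rad S i * Im (z i)\<bar> powr q)" for S
  proof -
    let ?w = "\<Sum>i\<in>I. rad S i *\<^sub>R z i"
    have "norm ?w powr q \<le> (\<bar>Re ?w\<bar> + \<bar>Im ?w\<bar>) powr q" using q by (intro powr_mono2 cmod_le) auto
    also have "\<dots> \<le> 2 powr q * (\<bar>Re ?w\<bar> powr q + \<bar>Im ?w\<bar> powr q)" by (rule powr_add_le[OF q]) auto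
    finally show ?thesis by simp
  qed
  then have "(\<Sum>S\<in>Pow I. norm (\<Sum>i\<in>I. rad S i *\<^sub>R z i) powr q)
    \<le> (\<Sum>S\<in>Pow I. 2 powr q * (\<bar>\<Sum>i\<in>I. rad S i * Re (z i)\<bar> powr q + \<bar>\<Sum>i\<in>I. rad S i * Im (z i)\<bar> powr q))"
    by (rule sum_mono)
  also have "\<dots> \<le> 2 powr q * (B * \<sigma> powr (q / 2) + B * \<sigma> powr (q / 2))"
    unfolding sum_distrib_left[symmetric] sum.distrib
    by (intro mult_left_mono add_mono part) (auto simp: cmod_power2)
  also have "\<dots> = 2 ^ card I * Khintchine_const q * \<sigma> powr (q / 2)"
    by (simp add: B_def Khintchine_const_def)
  finally show ?thesis by (simp add: \<sigma>_def)
qed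

section \<open>Herz's comparison of convolution norms\<close>

context unimodular_group
begin

text \<open>Vectors are tested in C_c only, where Fubini and the randomisation apply. Explicit
  bounds can be added and multiplied before an infimum is taken in \<open>conv_norm\<close>.\<close>

definition conv_bound :: "real \<Rightarrow> real \<Rightarrow> ('a \<Rightarrow> complex) \<Rightarrow> bool" where
  "conv_bound p \<Lambda> f \<longleftrightarrow> 0 \<le> \<Lambda> \<and> (\<forall>h\<in>cc. pnorm \<mu> p (conv f h) \<le> \<Lambda> * pnorm \<mu> p h)"

lemma conv_sum_right:
  fixes f :: "'a \<Rightarrow> 'b::{real_normed_field, banach, second_countable_topology}"
  assumes "f \<in> cc" "\<And>i. i \<in> I \<Longrightarrow> u i \<in> cc"
  shows "conv f (\<lambda>x. \<Sum>i\<in>I. u i x) x = (\<Sum>i\<in>I. conv f (u i) x)"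
  unfolding conv_def sum_distrib_left
  by (rule Bochner_Integration.integral_sum) (use assms conv_integrable in blast)

text \<open>Pairing the random sums of the u i and of the v i and averaging over the signs leaves
  the diagonal terms, by orthogonality. Each pairing is controlled by \<Lambda>, and Khintchine's
  inequality replaces the averaged p-th and q-th powers by square functions.\<close>

lemma randomized_bound:
  fixes u v :: "'i \<Rightarrow> 'a \<Rightarrow> complex"
  assumes pq: "1 < p" "1 < q" "1 / p + 1 / q = 1"
    and f: "f \<in> cc" and \<Lambda>: "conv_bound p \<Lambda> f"
    and I: "finite I" and u: "\<And>i. i \<in> I \<Longrightarrow> u i \<in> cc" and v: "\<And>i. i \<in> I \<Longrightarrow> v i \<in> cc"
    and U: "\<And>x. (\<Sum>i\<in>I. (norm (u i x))\<^sup>2) powr (p / 2) \<le> g x" and V: "\<And>x. (\<Sum>i\<in>I. (norm (v i x))\<^sup>2) powr (q / 2) \<le> h x"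
    and g: "integrable \<mu> g" and h: "integrable \<mu> h"
  shows "norm (\<Sum>i\<in>I. \<integral>x. conv f (u i) x * v i x \<partial>\<mu>)
    \<le> \<Lambda> * (Khintchine_const p * integral\<^sup>L \<mu> g + Khintchine_const q * integral\<^sup>L \<mu> h)"
proof -
  define W where "W (w :: 'i \<Rightarrow> 'a \<Rightarrow> complex) S x = (\<Sum>i\<in>I. rad S i *\<^sub>R w i x)" for w S x
  have Wcc: "W w S \<in> cc" if "\<And>i. i \<in> I \<Longrightarrow> w i \<in> cc" for w S
    unfolding W_def by (intro cc_sum cc_scaleR that)
  define B where "B i j = (\<integral>x. conv f (u i) x * v j x \<partial>\<mu>)" for i j
  have int: "integrable \<mu> (\<lambda>x. conv f (u i) x * v j x)" if "i \<in> I" "j \<in> I" for i j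
    using that by (intro cc_integrable cc_mult conv_cc f u v)
  have \<Lambda>0: "0 \<le> \<Lambda>" and \<Lambda>b: "\<And>h. h \<in> cc \<Longrightarrow> pnorm \<mu> p (conv f h) \<le> \<Lambda> * pnorm \<mu> p h"
    using \<Lambda> by (auto simp: conv_bound_def)
  have expand: "(\<integral>x. conv f (W u S) x * W v S x \<partial>\<mu>) = (\<Sum>i\<in>I. \<Sum>j\<in>I. (rad S i * rad S j) *\<^sub>R B i j)" for S
  proof -
    have "conv f (W u S) x * W v S x = (\<Sum>i\<in>I. \<Sum>j\<in>I. (rad S i * rad S j) *\<^sub>R (conv f (u i) x * v j x))" for x
    proof -
      have "conv f (W u S) x = (\<Sum>i\<in>I. rad S i *\<^sub>R conv f (u i) x)"
        unfolding W_def by (subst conv_sum_right) (auto simp: f cc_scaleR u conv_scale_right)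
      then have "conv f (W u S) x * W v S x = (\<Sum>i\<in>I. rad S i *\<^sub>R conv f (u i) x) * (\<Sum>j\<in>I. rad S j *\<^sub>R v j x)"
        by (simp only: W_def)
      also have "\<dots> = (\<Sum>i\<in>I. \<Sum>j\<in>I. (rad S i * rad S j) *\<^sub>R (conv f (u i) x * v j x))"
        unfolding sum_product by (intro sum.cong refl) simp
      finally show ?thesis .
    qed
    then show ?thesis
      by (simp add: B_def Bochner_Integration.integral_sum int)
  qed
  have "(\<Sum>S\<in>Pow I. \<integral>x. conv f (W u S) x * W v S x \<partial>\<mu>) = (\<Sum>i\<in>I. \<Sum>j\<in>I. (\<Sum>S\<in>Pow I. rad S i * rad S j) *\<^sub>R B i j)"
    unfolding expand by (subst sum.swap, intro sum.cong refl, subst sum.swap) (simp add: scaleR_sum_left)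
  also have "\<dots> = (\<Sum>i\<in>I. \<Sum>j\<in>I. if i = j then (2 ^ card I) *\<^sub>R B i i else 0)"
    by (intro sum.cong refl) (simp add: rad_orthogonal[OF I])
  also have "\<dots> = (2 ^ card I) *\<^sub>R (\<Sum>i\<in>I. B i i)"
    using I by (simp add: scaleR_sum_right)
  finally have eq: "(\<Sum>S\<in>Pow I. \<integral>x. conv f (W u S) x * W v S x \<partial>\<mu>) = (2 ^ card I) *\<^sub>R (\<Sum>i\<in>I. B i i)" .
  have term_le: "norm (\<integral>x. conv f (W u S) x * W v S x \<partial>\<mu>)
    \<le> \<Lambda> * ((\<integral>x. norm (W u S x) powr p \<partial>\<mu>) + (\<integral>x. norm (W v S x) powr q \<partial>\<mu>))" for S
  proof -
    let ?a = "pnorm \<mu> p (W u S)" and ?b = "pnorm \<mu> q (W v S)"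
    have ucc: "W u S \<in> cc" and vcc: "W v S \<in> cc" using Wcc u v by auto
    have "norm (\<integral>x. conv f (W u S) x * W v S x \<partial>\<mu>) \<le> pnorm \<mu> p (conv f (W u S)) * ?b"
      using pq by (intro Hoelder(2) cc_Lp conv_cc f ucc vcc) auto
    also have "\<dots> \<le> (\<Lambda> * ?a) * ?b" by (intro mult_right_mono \<Lambda>b ucc pnorm_nonneg)
    \<comment> \<open>Young's inequality turns the product of norms into a sum of powers, which can
      be averaged over S term by term.\<close>
    also have "\<dots> \<le> \<Lambda> * (?a powr p + ?b powr q)"
    proof -
      have "?a * ?b \<le> ?a powr p / p + ?b powr q / q" by (rule Youngs_inequality) (use pq pnorm_nonneg in auto)
      also have "\<dots> \<le> ?a powr p + ?b powr q"
      proof (rule add_mono)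
        have *: "t / r \<le> t" if "1 < r" "0 \<le> t" for t r :: real using that mult_left_mono[of 1 r t] by (simp add: divide_le_eq)
        show "?a powr p / p \<le> ?a powr p" "?b powr q / q \<le> ?b powr q" using pq by (auto intro: *)
      qed
      finally show ?thesis using \<Lambda>0 by (simp add: mult.assoc mult_left_mono)
    qed
    finally show ?thesis using pq by (simp add: pnorm_powr)
  qed
  have sums: "(\<Sum>S\<in>Pow I. \<integral>x. norm (W w S x) powr r \<partial>\<mu>) \<le> 2 ^ card I * (Khintchine_const r * integral\<^sup>L \<mu> k)"
    if w: "\<And>i. i \<in> I \<Longrightarrow> w i \<in> cc" and r: "1 < r" and k: "integrable \<mu> k"
      and le: "\<And>x. (\<Sum>i\<in>I. (norm (w i x))\<^sup>2) powr (r / 2) \<le> k x" for w r k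
  proof -
    have i: "integrable \<mu> (\<lambda>x. norm (W w S x) powr r)" for S
      using r by (intro cc_integrable cc_norm_powr Wcc w) auto
    have "(\<Sum>S\<in>Pow I. \<integral>x. norm (W w S x) powr r \<partial>\<mu>) = (\<integral>x. (\<Sum>S\<in>Pow I. norm (W w S x) powr r) \<partial>\<mu>)"
      by (rule Bochner_Integration.integral_sum[symmetric]) (rule i)
    also have "\<dots> \<le> (\<integral>x. 2 ^ card I * Khintchine_const r * k x \<partial>\<mu>)"
    proof (rule integral_mono)
      fix x
      have "(\<Sum>S\<in>Pow I. norm (W w S x) powr r) \<le> 2 ^ card I * Khintchine_const r * (\<Sum>i\<in>I. (norm (w i x))\<^sup>2) powr (r / 2)"
        unfolding W_def using r by (intro Khintchine I) auto
      also have "\<dots> \<le> 2 ^ card I * Khintchine_const r * k x"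
        by (intro mult_left_mono le) (simp add: Khintchine_const_nonneg)
      finally show "(\<Sum>S\<in>Pow I. norm (W w S x) powr r) \<le> 2 ^ card I * Khintchine_const r * k x" .
    qed (use i k in auto)
    finally show ?thesis by (simp add: mult.assoc)
  qed
  have "2 ^ card I * norm (\<Sum>i\<in>I. B i i) = norm (\<Sum>S\<in>Pow I. \<integral>x. conv f (W u S) x * W v S x \<partial>\<mu>)"
    unfolding eq by simp
  also have "\<dots> \<le> (\<Sum>S\<in>Pow I. \<Lambda> * ((\<integral>x. norm (W u S x) powr p \<partial>\<mu>) + (\<integral>x. norm (W v S x) powr q \<partial>\<mu>)))"
    by (rule sum_norm_le) (rule term_le)
  also have "\<dots> \<le> \<Lambda> * (2 ^ card I * (Khintchine_const p * integral\<^sup>L \<mu> g) + 2 ^ card I * (Khintchine_const q * integral\<^sup>L \<mu> h))"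
    unfolding sum_distrib_left[symmetric] sum.distrib
    by (intro mult_left_mono add_mono sums u v U V g h pq \<Lambda>0)
  also have "\<dots> = 2 ^ card I * (\<Lambda> * (Khintchine_const p * integral\<^sup>L \<mu> g + Khintchine_const q * integral\<^sup>L \<mu> h))"
    by (simp add: algebra_simps)
  finally show ?thesis by (simp add: B_def)
qed

lemma integral_conv_mult:
  fixes f u v :: "'a \<Rightarrow> complex"
  assumes f: "f \<in> cc" and u: "u \<in> cc" and v: "v \<in> cc"
  shows "(\<integral>t. conv f u t * v t \<partial>\<mu>) = (\<integral>x. f x * (\<integral>t. u (- x + t) * v t \<partial>\<mu>) \<partial>\<mu>)"
proof -
  obtain K where K: "compact K" "\<And>x. x \<notin> K \<Longrightarrow> f x = 0" using f by (auto simp: cc_def)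
  obtain L where L: "compact L" "\<And>x. x \<notin> L \<Longrightarrow> v x = 0" using v by (auto simp: cc_def)
  have "(\<integral>t. conv f u t * v t \<partial>\<mu>) = (\<integral>t. \<integral>x. f x * (u (- x + t) * v t) \<partial>\<mu> \<partial>\<mu>)"
    unfolding conv_def by (simp flip: mult.assoc)
  also have "\<dots> = (\<integral>x. \<integral>t. f x * (u (- x + t) * v t) \<partial>\<mu> \<partial>\<mu>)"
  proof (rule Fubini_cc[OF _ K(1) L(1)])
    show "continuous_on UNIV (\<lambda>(x, t). f x * (u (- x + t) * v t))"
      unfolding split_beta
      by (intro continuous_intros cont_fun[OF cc_cont[OF f]] cont_fun[OF cc_cont[OF u]] cont_fun[OF cc_cont[OF v]])
  qed (use K L in auto)
  finally show ?thesis by simp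
qed

text \<open>The exponents are p and its conjugate p / (p - 1). The powers of 2 arise because the
  discretised square sums are bounded by 2 instead of 1.\<close>

definition Herz_const :: "real \<Rightarrow> real" where
  "Herz_const p = Khintchine_const p * 2 powr (p / 2) + Khintchine_const (p / (p - 1)) * 2 powr (p / (p - 1) / 2)"

lemma Herz_const_nonneg: "0 \<le> Herz_const p"
  by (simp add: Herz_const_def Khintchine_const_nonneg)

text \<open>
  The coefficient \<open>x \<mapsto> \<integral>u(x\<^sup>-\<^sup>1s)v(s)ds\<close> of the regular representation is, for every \<open>t\<close>, the integral over \<open>r\<close> of
  \<open>u(x\<^sup>-\<^sup>1tr)v(tr)\<close>. Replacing this integral by a Riemann sum turns the pairing with \<open>f\<close> into a sum of the form
  treated in \<open>randomized_bound\<close>.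
\<close>

lemma coefficient_bound:
  fixes f u v :: "'a \<Rightarrow> complex"
  assumes p: "1 < p" and f: "f \<in> cc" and \<Lambda>: "conv_bound p \<Lambda> f"
    and u: "u \<in> cc" "pnorm \<mu> 2 u \<le> 1" and v: "v \<in> cc" "pnorm \<mu> 2 v \<le> 1" and \<psi>: "\<psi> \<in> densities"
  shows "norm (\<integral>x. f x * ((\<integral>s. u (- x + s) * v s \<partial>\<mu>) * complex_of_real (\<integral>t. \<psi> (- x + t) powr (1 / p) * \<psi> t powr (1 - 1 / p) \<partial>\<mu>)) \<partial>\<mu>)
    \<le> \<Lambda> * Herz_const p"
proof -
  define q where "q = p / (p - 1)"
  have q: "1 < q" "1 / p + 1 / q = 1" "1 - 1 / p = 1 / q" using p by (auto simp: q_def field_simps)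
  have \<psi>': "\<psi> \<in> cc" "\<And>x. 0 \<le> \<psi> x" "integral\<^sup>L \<mu> \<psi> = 1" using \<psi> by (auto simp: densities_def)
  define \<psi>1 where "\<psi>1 t = \<psi> t powr (1 / p)" for t
  define \<psi>2 where "\<psi>2 t = \<psi> t powr (1 / q)" for t
  have p1: "\<psi>1 \<in> cc" unfolding \<psi>1_def[abs_def] using cc_norm_powr[OF \<psi>'(1), of "1 / p"] p \<psi>'(2) by simp
  have p2: "\<psi>2 \<in> cc" unfolding \<psi>2_def[abs_def] using cc_norm_powr[OF \<psi>'(1), of "1 / q"] q \<psi>'(2) by simp
  have p1_nn: "0 \<le> \<psi>1 t" and p2_nn: "0 \<le> \<psi>2 t" for t by (simp_all add: \<psi>1_def \<psi>2_def)
  have c_cc: "(\<lambda>t. complex_of_real (k t)) \<in> cc" if "k \<in> cc" for k :: "'a \<Rightarrow> real"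
    by (rule cc_comp[OF that]) (auto intro!: continuous_intros)
  obtain Kf where Kf: "compact Kf" "\<And>x. x \<notin> Kf \<Longrightarrow> f x = 0" using f by (auto simp: cc_def)
  obtain Ku where Ku: "compact Ku" "\<And>x. x \<notin> Ku \<Longrightarrow> u x = 0" using u by (auto simp: cc_def)
  obtain Kv where Kv: "compact Kv" "\<And>x. x \<notin> Kv \<Longrightarrow> v x = 0" using v by (auto simp: cc_def)
  obtain Kp where Kp: "compact Kp" "\<And>x. x \<notin> Kp \<Longrightarrow> \<psi> x = 0" using \<psi>' by (auto simp: cc_def)
  \<comment> \<open>For t in the support of \<psi>, the functions of r given by u (t + r) and v (t +
    r) vanish off this one compact set.\<close>
  define K where "K = {x + y | x y. x \<in> uminus ` Kp \<and> y \<in> Ku \<union> Kv}"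
  have K: "compact K" unfolding K_def by (intro compact_sum compact_minus compact_Un Kp Ku Kv)
  have K0: "u (t + r) = 0" "v (t + r) = 0" if "t \<in> Kp" "r \<notin> K" for t r
  proof -
    have "r = - t + (t + r)" by (simp flip: add.assoc)
    then have "t + r \<notin> Ku \<union> Kv" using that unfolding K_def by blast
    then show "u (t + r) = 0" "v (t + r) = 0" using Ku Kv by auto
  qed
  note cu = cont_fun[OF cc_cont[OF u(1)]] and cv = cont_fun[OF cc_cont[OF v(1)]]
  define \<phi> where "\<phi> x = (\<integral>s. u (- x + s) * v s \<partial>\<mu>)" for x
  define w where "w x = (\<integral>t. \<psi>1 (- x + t) * \<psi>2 t \<partial>\<mu>)" for x
  define c0 where "c0 = (\<integral>x. norm (f x) * w x \<partial>\<mu>)"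
  have kernel_cc: "(\<lambda>t. \<psi>1 (- x + t) * \<psi>2 t) \<in> cc" for x by (intro cc_mult cc_left p1 p2)
  have w_nn: "0 \<le> w x" for x unfolding w_def by (rule Bochner_Integration.integral_nonneg) (simp add: p1_nn p2_nn)
  obtain Kp2 where Kp2: "compact Kp2" "\<And>x. x \<notin> Kp2 \<Longrightarrow> \<psi>2 x = 0" using p2 by (auto simp: cc_def)
  have w_cont: "continuous_on UNIV w"
    unfolding w_def[abs_def]
  proof (rule continuous_on_param_integral[OF _ Kp2(1)])
    show "continuous_on UNIV (\<lambda>(x, t). \<psi>1 (- x + t) * \<psi>2 t)"
      unfolding split_beta by (intro continuous_intros cont_fun[OF cc_cont[OF p1]] cont_fun[OF cc_cont[OF p2]])
  qed (use Kp2 in simp)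
  have \<phi>_cont: "continuous_on UNIV \<phi>"
    unfolding \<phi>_def[abs_def]
  proof (rule continuous_on_param_integral[OF _ Kv(1)])
    show "continuous_on UNIV (\<lambda>(x, t). u (- x + t) * v t)"
      unfolding split_beta by (intro continuous_intros cu cv)
  qed (use Kv in simp)
  have fw: "integrable \<mu> (\<lambda>x. norm (f x) * w x)" by (intro cc_integrable cc_mult_cont cc_norm f w_cont)
  have fpw_cc: "(\<lambda>x. f x * (\<phi> x * complex_of_real (w x))) \<in> cc"
    by (intro cc_mult_cont f continuous_intros \<phi>_cont w_cont)
  define I where "I = (\<integral>x. f x * (\<phi> x * complex_of_real (w x)) \<partial>\<mu>)"
  have main: "norm I \<le> \<Lambda> * Herz_const p + \<delta> * measure \<mu> K * c0" if \<delta>: "0 < \<delta>" "\<delta> * measure \<mu> K \<le> 1" for \<delta>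
  proof -
    \<comment> \<open>The three components are bundled so that one partition in r serves both for
      the coefficient and for the squared norms of u and v.\<close>
    define F where "F r xt = (case xt of (x, t) \<Rightarrow> (u (- x + t + r) * v (t + r), (norm (u (t + r)))\<^sup>2, (norm (v (t + r)))\<^sup>2))" for r xt
    have Fcont: "continuous_on UNIV (\<lambda>(r, xt). F r xt)"
      unfolding F_def split_beta by (intro continuous_intros cu cv)
    have "\<exists>U. open U \<and> r0 \<in> U \<and> (\<forall>r\<in>U. \<forall>xt\<in>Kf \<times> Kp. dist (F r xt) (F r0 xt) \<le> \<delta>)" for r0
      by (rule continuous_on_uniform[OF Fcont compact_Times[OF Kf(1) Kp(1)] \<delta>(1), of r0]) blast
    then obtain U where U: "\<And>r0. open (U r0) \<and> r0 \<in> U r0"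
      "\<And>r0 r xt. r \<in> U r0 \<Longrightarrow> xt \<in> Kf \<times> Kp \<Longrightarrow> dist (F r xt) (F r0 xt) \<le> \<delta>" by metis
    obtain R E where R: "finite R" "R \<subseteq> K" "\<And>r. r \<in> R \<Longrightarrow> E r \<in> sets borel" "\<And>r. r \<in> R \<Longrightarrow> E r \<subseteq> U r"
      "disjoint_family_on E R" "(\<Union>r\<in>R. E r) = K"
      using compact_partition[OF K, of U] U(1) by metis
    define a where "a r = measure \<mu> (E r)" for r
    have a0: "0 \<le> a r" for r by (simp add: a_def)
    have close: "dist (F r xt) (F \<rho> xt) \<le> \<delta>" if "\<rho> \<in> R" "r \<in> E \<rho>" "xt \<in> Kf \<times> Kp" for r \<rho> xt
      using U(2) R(4) that by blast
    have phi_approx: "norm (\<phi> x - (\<Sum>r\<in>R. a r *\<^sub>R (u (- x + t + r) * v (t + r)))) \<le> \<delta> * measure \<mu> K"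
      if xt: "x \<in> Kf" "t \<in> Kp" for x t
    proof -
      have m: "(\<lambda>s. u (- x + s) * v s) \<in> borel_measurable \<mu>" by (intro cont_measurable continuous_intros cu cv)
      have "\<phi> x = (\<integral>r. u (- x + t + r) * v (t + r) \<partial>\<mu>)"
        unfolding \<phi>_def using integral_left[OF m, of t] by (simp add: add.assoc)
      moreover have "norm ((\<integral>r. u (- x + t + r) * v (t + r) \<partial>\<mu>) - (\<Sum>r\<in>R. a r *\<^sub>R (u (- x + t + r) * v (t + r)))) \<le> \<delta> * measure \<mu> K"
        unfolding a_def
      proof (rule integral_simple_approx[OF _ K _ R(1,3,5,6)])
        show "(\<lambda>r. u (- x + t + r) * v (t + r)) \<in> borel_measurable \<mu>" by (intro cont_measurable continuous_intros cu cv)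
        show "norm (u (- x + t + r) * v (t + r) - u (- x + t + \<rho>) * v (t + \<rho>)) \<le> \<delta>" if "\<rho> \<in> R" "r \<in> E \<rho>" for \<rho> r
          using order_trans[OF dist_fst_le close[OF that, of "(x, t)"]] xt by (simp add: F_def dist_norm)
      qed (use K0(2)[OF xt(2)] \<delta> in auto)
      ultimately show ?thesis by simp
    qed
    \<comment> \<open>The bound 2 is the squared L^2 norm, at most 1, plus the error of the Riemann
      sum, at most \<open>\<delta> * measure \<mu> K \<le> 1\<close>.\<close>
    have sq_le: "(\<Sum>r\<in>R. a r * (norm (k (t + r)))\<^sup>2) \<le> 2"
      if k: "k \<in> cc" "pnorm \<mu> 2 k \<le> 1" "\<And>r. r \<notin> K \<Longrightarrow> k (t + r) = 0"
        "\<And>\<rho> r. \<rho> \<in> R \<Longrightarrow> r \<in> E \<rho> \<Longrightarrow> dist ((norm (k (t + r)))\<^sup>2) ((norm (k (t + \<rho>)))\<^sup>2) \<le> \<delta>" for k :: "'a \<Rightarrow> complex" and t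
    proof -
      have ksq: "(\<lambda>s. (norm (k s))\<^sup>2) \<in> cc" by (rule cc_comp[OF cc_norm[OF k(1)]]) (auto intro!: continuous_intros)
      have "norm ((\<integral>r. (norm (k (t + r)))\<^sup>2 \<partial>\<mu>) - (\<Sum>r\<in>R. a r *\<^sub>R (norm (k (t + r)))\<^sup>2)) \<le> \<delta> * measure \<mu> K"
        unfolding a_def
        by (rule integral_simple_approx[OF cc_measurable[OF cc_left[OF ksq]] K _ R(1,3,5,6)])
          (use k(3,4) \<delta> in \<open>auto simp: dist_norm\<close>)
      moreover have "(\<integral>r. (norm (k (t + r)))\<^sup>2 \<partial>\<mu>) = (pnorm \<mu> 2 k)\<^sup>2"
        using integral_left[OF cc_measurable[OF ksq], of t] pnorm_powr[of 2 \<mu> k] by (simp add: pnorm_nonneg)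
      moreover have "(pnorm \<mu> 2 k)\<^sup>2 \<le> 1" using k(2) pnorm_nonneg[of \<mu> 2 k] by (simp add: power_le_one)
      ultimately show ?thesis using \<delta>(2) by (simp add: abs_le_iff)
    qed
    \<comment> \<open>The weight \<open>a r\<close> of a cell is shared equally between the two
      factors, while \<psi> is split as \<psi>^(1/p) \<psi>^(1/q): the square functions are then
      bounded by multiples of \<psi> after raising to the powers p and q.\<close>
    define ur where "ur r t = complex_of_real (sqrt (a r)) * (u (t + r) * complex_of_real (\<psi>1 t))" for r t
    define vr where "vr r t = complex_of_real (sqrt (a r)) * (v (t + r) * complex_of_real (\<psi>2 t))" for r t
    have ur_cc: "ur r \<in> cc" for r unfolding ur_def[abs_def] by (intro cc_cmult cc_mult cc_right u c_cc p1)
    have vr_cc: "vr r \<in> cc" for r unfolding vr_def[abs_def] by (intro cc_cmult cc_mult cc_right v c_cc p2)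
    have square_fun: "(\<Sum>r\<in>R. (norm (complex_of_real (sqrt (a r)) * (k (t + r) * complex_of_real (\<psi> t powr (1 / e)))))\<^sup>2) powr (e / 2) \<le> 2 powr (e / 2) * \<psi> t"
      if e: "1 < e" and k: "k \<in> cc" "pnorm \<mu> 2 k \<le> 1" "\<And>r. t \<in> Kp \<Longrightarrow> r \<notin> K \<Longrightarrow> k (t + r) = 0"
        "\<And>\<rho> r. t \<in> Kp \<Longrightarrow> \<rho> \<in> R \<Longrightarrow> r \<in> E \<rho> \<Longrightarrow> dist ((norm (k (t + r)))\<^sup>2) ((norm (k (t + \<rho>)))\<^sup>2) \<le> \<delta>" for k :: "'a \<Rightarrow> complex" and t e
    proof (cases "t \<in> Kp")
      case True
      have "(\<Sum>r\<in>R. (norm (complex_of_real (sqrt (a r)) * (k (t + r) * complex_of_real (\<psi> t powr (1 / e)))))\<^sup>2)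
        = (\<Sum>r\<in>R. a r * (norm (k (t + r)))\<^sup>2) * (\<psi> t powr (1 / e))\<^sup>2"
        by (simp add: norm_mult power_mult_distrib a0 sum_distrib_right mult.assoc)
      also have "\<dots> \<le> 2 * (\<psi> t powr (1 / e))\<^sup>2" by (intro mult_right_mono sq_le[OF k(1,2)] k(3,4) True) auto
      finally have "(\<Sum>r\<in>R. (norm (complex_of_real (sqrt (a r)) * (k (t + r) * complex_of_real (\<psi> t powr (1 / e)))))\<^sup>2) powr (e / 2)
        \<le> (2 * (\<psi> t powr (1 / e))\<^sup>2) powr (e / 2)"
        using e by (intro powr_mono2 sum_nonneg) auto
      also have "\<dots> = 2 powr (e / 2) * \<psi> t"
      proof -
        have "(\<psi> t powr (1 / e))\<^sup>2 = \<psi> t powr (2 / e)" using powr_powr[of "\<psi> t" "1 / e" 2] by simp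
        then show ?thesis using e \<psi>'(2)[of t] by (simp add: powr_mult powr_powr)
      qed
      finally show ?thesis .
    next
      case False then show ?thesis using Kp(2) e by simp
    qed
    have in_R: "(x, t) \<in> Kf \<times> Kp \<Longrightarrow> \<rho> \<in> R \<Longrightarrow> r \<in> E \<rho> \<Longrightarrow> dist (snd (F r (x, t))) (snd (F \<rho> (x, t))) \<le> \<delta>" for x t \<rho> r
      using order_trans[OF dist_snd_le close] by blast
    have "norm (\<Sum>r\<in>R. \<integral>t. conv f (ur r) t * vr r t \<partial>\<mu>) \<le> \<Lambda> * Herz_const p"
    \<comment> \<open>The closeness estimates are stated for pairs (x, t), so bounding the square
      functions takes some x0 in \<open>Kf\<close>.\<close>
    proof (cases "Kf = {}")
      case True
      then have "f = (\<lambda>x. 0)" using Kf by auto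
      then show ?thesis using \<Lambda> Herz_const_nonneg[of p] by (simp add: conv_def conv_bound_def)
    next
      case False
      then obtain x0 where x0: "x0 \<in> Kf" by blast
      have "norm (\<Sum>r\<in>R. \<integral>t. conv f (ur r) t * vr r t \<partial>\<mu>)
        \<le> \<Lambda> * (Khintchine_const p * (\<integral>t. 2 powr (p / 2) * \<psi> t \<partial>\<mu>) + Khintchine_const q * (\<integral>t. 2 powr (q / 2) * \<psi> t \<partial>\<mu>))"
      proof (rule randomized_bound[OF p q(1,2) f \<Lambda> R(1) ur_cc vr_cc])
        show "(\<Sum>r\<in>R. (norm (ur r t))\<^sup>2) powr (p / 2) \<le> 2 powr (p / 2) * \<psi> t" for t
          unfolding ur_def \<psi>1_def
        proof (rule square_fun[OF p u])
          show "dist ((norm (u (t + r)))\<^sup>2) ((norm (u (t + \<rho>)))\<^sup>2) \<le> \<delta>" if "t \<in> Kp" "\<rho> \<in> R" "r \<in> E \<rho>" for \<rho> r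
            using order_trans[OF dist_fst_le in_R[of x0 t \<rho> r]] that x0 by (simp add: F_def)
        qed (use K0 in auto)
        show "(\<Sum>r\<in>R. (norm (vr r t))\<^sup>2) powr (q / 2) \<le> 2 powr (q / 2) * \<psi> t" for t
          unfolding vr_def \<psi>2_def
        proof (rule square_fun[OF q(1) v])
          show "dist ((norm (v (t + r)))\<^sup>2) ((norm (v (t + \<rho>)))\<^sup>2) \<le> \<delta>" if "t \<in> Kp" "\<rho> \<in> R" "r \<in> E \<rho>" for \<rho> r
            using order_trans[OF dist_snd_le in_R[of x0 t \<rho> r]] that x0 by (simp add: F_def)
        qed (use K0 in auto)
      qed (use \<psi>' in \<open>auto simp: cc_integrable\<close>)
      then show ?thesis using \<psi>' by (simp add: Herz_const_def q_def)
    qed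
    moreover have "norm (I - (\<Sum>r\<in>R. \<integral>t. conv f (ur r) t * vr r t \<partial>\<mu>)) \<le> \<delta> * measure \<mu> K * c0"
    proof -
      \<comment> \<open>The coefficient that belongs to the discretised sum. It differs from
        \<open>\<phi> x * w x\<close> by an integral against the kernel of \<open>w x\<close>, in
        which \<open>phi_approx\<close> bounds the other factor.\<close>
      define G where "G x = (\<Sum>r\<in>R. \<integral>t. ur r (- x + t) * vr r t \<partial>\<mu>)" for x
      have ker_int: "integrable \<mu> (\<lambda>t. ur r (- x + t) * vr r t)" for r x by (intro cc_integrable cc_mult cc_left ur_cc vr_cc)
      have G_cont: "continuous_on UNIV (\<lambda>x. \<integral>t. ur r (- x + t) * vr r t \<partial>\<mu>)" for r
      proof -
        obtain J where J: "compact J" "\<And>x. x \<notin> J \<Longrightarrow> vr r x = 0" using vr_cc[of r] by (auto simp: cc_def)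
        show ?thesis
        proof (rule continuous_on_param_integral[OF _ J(1)])
          show "continuous_on UNIV (\<lambda>(x, t). ur r (- x + t) * vr r t)"
            unfolding split_beta by (intro continuous_intros cont_fun[OF cc_cont[OF ur_cc]] cont_fun[OF cc_cont[OF vr_cc]])
        qed (use J in simp)
      qed
      have fG_int: "integrable \<mu> (\<lambda>x. f x * (\<integral>t. ur r (- x + t) * vr r t \<partial>\<mu>))" for r
        by (intro cc_integrable cc_mult_cont f G_cont)
      have "(\<Sum>r\<in>R. \<integral>t. conv f (ur r) t * vr r t \<partial>\<mu>) = (\<integral>x. f x * G x \<partial>\<mu>)"
        by (simp add: integral_conv_mult[OF f ur_cc vr_cc] G_def sum_distrib_left Bochner_Integration.integral_sum fG_int)
      moreover have "integrable \<mu> (\<lambda>x. f x * G x)"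
        unfolding G_def sum_distrib_left by (intro Bochner_Integration.integrable_sum fG_int)
      ultimately have "I - (\<Sum>r\<in>R. \<integral>t. conv f (ur r) t * vr r t \<partial>\<mu>) = (\<integral>x. f x * (\<phi> x * complex_of_real (w x)) - f x * G x \<partial>\<mu>)"
        unfolding I_def using cc_integrable[OF fpw_cc] by simp
      then have "norm (I - (\<Sum>r\<in>R. \<integral>t. conv f (ur r) t * vr r t \<partial>\<mu>)) \<le> (\<integral>x. norm (f x * (\<phi> x * complex_of_real (w x)) - f x * G x) \<partial>\<mu>)"
        by (simp only: integral_norm_bound)
      also have "\<dots> \<le> (\<integral>x. \<delta> * measure \<mu> K * (norm (f x) * w x) \<partial>\<mu>)"
      proof (rule integral_mono)
        show "integrable \<mu> (\<lambda>x. norm (f x * (\<phi> x * complex_of_real (w x)) - f x * G x))"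
          using cc_integrable[OF fpw_cc] \<open>integrable \<mu> (\<lambda>x. f x * G x)\<close> by simp
        show "integrable \<mu> (\<lambda>x. \<delta> * measure \<mu> K * (norm (f x) * w x))" using fw by simp
        fix x
        show "norm (f x * (\<phi> x * complex_of_real (w x)) - f x * G x) \<le> \<delta> * measure \<mu> K * (norm (f x) * w x)"
        proof (cases "x \<in> Kf")
          case False then show ?thesis using Kf by simp
        next
          case True
          let ?k = "\<lambda>t. complex_of_real (\<psi>1 (- x + t) * \<psi>2 t)"
          let ?d = "\<lambda>t. \<phi> x - (\<Sum>r\<in>R. a r *\<^sub>R (u (- x + t + r) * v (t + r)))"
          have eqG: "G x = (\<integral>t. (\<Sum>r\<in>R. a r *\<^sub>R (u (- x + t + r) * v (t + r))) * ?k t \<partial>\<mu>)"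
          proof -
            have "G x = (\<integral>t. (\<Sum>r\<in>R. ur r (- x + t) * vr r t) \<partial>\<mu>)"
              unfolding G_def by (rule Bochner_Integration.integral_sum[symmetric]) (rule ker_int)
            moreover have "(\<Sum>r\<in>R. ur r (- x + t) * vr r t) = (\<Sum>r\<in>R. a r *\<^sub>R (u (- x + t + r) * v (t + r))) * ?k t" for t
              unfolding sum_distrib_right
            proof (rule sum.cong[OF refl])
              fix r
              have "complex_of_real (sqrt (a r)) * complex_of_real (sqrt (a r)) = complex_of_real (a r)"
                using a0[of r] by (simp flip: of_real_mult)
              then have "ur r (- x + t) * vr r t = complex_of_real (a r) * (u (- x + t + r) * v (t + r)) * ?k t"
                unfolding ur_def vr_def by (simp add: mult_ac)
              then show "ur r (- x + t) * vr r t = a r *\<^sub>R (u (- x + t + r) * v (t + r)) * ?k t"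
                by (simp add: scaleR_conv_of_real)
            qed
            ultimately show ?thesis by simp
          qed
          have k_cc: "?k \<in> cc" by (rule c_cc[OF kernel_cc])
          have s_cont: "continuous_on UNIV (\<lambda>t. \<Sum>r\<in>R. a r *\<^sub>R (u (- x + t + r) * v (t + r)))"
            by (intro continuous_intros cu cv)
          have i1: "integrable \<mu> (\<lambda>t. \<phi> x * ?k t)" by (intro cc_integrable cc_cmult k_cc)
          have i2: "integrable \<mu> (\<lambda>t. (\<Sum>r\<in>R. a r *\<^sub>R (u (- x + t + r) * v (t + r))) * ?k t)"
            by (intro cc_integrable cc_mult_cont(2)[OF k_cc s_cont])
          have "complex_of_real (w x) = (\<integral>t. ?k t \<partial>\<mu>)" unfolding w_def by (rule integral_complex_of_real[symmetric])
          then have "\<phi> x * complex_of_real (w x) - G x = (\<integral>t. ?d t * ?k t \<partial>\<mu>)"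
            using i1 i2 by (simp add: eqG left_diff_distrib)
          then have "norm (\<phi> x * complex_of_real (w x) - G x) \<le> (\<integral>t. norm (?d t * ?k t) \<partial>\<mu>)"
            by (simp only: integral_norm_bound)
          also have "\<dots> \<le> (\<integral>t. \<delta> * measure \<mu> K * (\<psi>1 (- x + t) * \<psi>2 t) \<partial>\<mu>)"
          proof (rule integral_mono)
            show "integrable \<mu> (\<lambda>t. norm (?d t * ?k t))"
              unfolding left_diff_distrib by (intro integrable_norm Bochner_Integration.integrable_diff i1 i2)
            show "integrable \<mu> (\<lambda>t. \<delta> * measure \<mu> K * (\<psi>1 (- x + t) * \<psi>2 t))"
              by (rule integrable_mult_right) (rule cc_integrable[OF kernel_cc])
            show "norm (?d t * ?k t) \<le> \<delta> * measure \<mu> K * (\<psi>1 (- x + t) * \<psi>2 t)" for t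
            proof (cases "t \<in> Kp")
              case True
              have k_nn: "0 \<le> \<psi>1 (- x + t) * \<psi>2 t" by (intro mult_nonneg_nonneg p1_nn p2_nn)
              have "norm (?d t * ?k t) = norm (?d t) * norm (?k t)" by (rule norm_mult)
              also have "norm (?k t) = \<psi>1 (- x + t) * \<psi>2 t"
                unfolding norm_of_real by (rule abs_of_nonneg[OF k_nn])
              also have "norm (?d t) * (\<psi>1 (- x + t) * \<psi>2 t) \<le> \<delta> * measure \<mu> K * (\<psi>1 (- x + t) * \<psi>2 t)"
                by (rule mult_right_mono[OF phi_approx[OF \<open>x \<in> Kf\<close> True] k_nn])
              finally show ?thesis .
            next
              case False then show ?thesis using Kp(2) q by (simp add: \<psi>2_def)
            qed
          qed
          also have "\<dots> = \<delta> * measure \<mu> K * w x" by (simp add: w_def)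
          finally have "norm (\<phi> x * complex_of_real (w x) - G x) \<le> \<delta> * measure \<mu> K * w x" .
          then have le: "norm (f x) * norm (\<phi> x * complex_of_real (w x) - G x) \<le> norm (f x) * (\<delta> * measure \<mu> K * w x)"
            by (rule mult_left_mono) simp
          have "norm (f x * (\<phi> x * complex_of_real (w x)) - f x * G x) = norm (f x) * norm (\<phi> x * complex_of_real (w x) - G x)"
            by (simp only: right_diff_distrib[symmetric] norm_mult)
          with le show ?thesis by (simp only: mult.left_commute mult.assoc)
        qed
      qed
      also have "\<dots> = \<delta> * measure \<mu> K * c0" by (simp add: c0_def)
      finally show ?thesis .
    qed
    ultimately show ?thesis
      using norm_triangle_sub[of I "\<Sum>r\<in>R. \<integral>t. conv f (ur r) t * vr r t \<partial>\<mu>"] by linarith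
  qed
  have c0_nn: "0 \<le> c0" unfolding c0_def by (rule Bochner_Integration.integral_nonneg) (simp add: w_nn)
  have "norm I \<le> \<Lambda> * Herz_const p"
  proof (rule field_le_epsilon)
    fix e :: real assume e: "0 < e"
    define k where "k = measure \<mu> K"
    have k0: "0 \<le> k" by (simp add: k_def)
    define \<delta> where "\<delta> = min (1 / (1 + k)) (e / (1 + k * c0))"
    have kc: "0 \<le> k * c0" using k0 c0_nn by simp
    have d0: "0 < \<delta>" using k0 kc e by (simp add: \<delta>_def)
    have "\<delta> * k \<le> (1 / (1 + k)) * k" using k0 by (intro mult_right_mono) (auto simp: \<delta>_def)
    also have "\<dots> \<le> 1" using k0 by (simp add: field_simps)
    finally have d1: "\<delta> * k \<le> 1" .
    have "\<delta> * (k * c0) \<le> (e / (1 + k * c0)) * (k * c0)" using kc by (intro mult_right_mono) (auto simp: \<delta>_def)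
    also have "\<dots> \<le> e" using kc e by (simp add: field_simps)
    finally have "\<delta> * k * c0 \<le> e" by (simp add: mult.assoc)
    then show "norm I \<le> \<Lambda> * Herz_const p + e" using main[OF d0] d1 by (simp add: k_def)
  qed
  then show ?thesis by (simp add: I_def \<phi>_def w_def \<psi>1_def \<psi>2_def q)
qed

end

section \<open>Almost invariant densities and the comparison with L^2\<close>

lemma powr_superadditive:
  fixes a b p :: real
  assumes "1 \<le> p" "0 \<le> a" "0 \<le> b" shows "a powr p + b powr p \<le> (a + b) powr p"
proof (cases "a + b = 0")
  case True then show ?thesis using assms by (simp add: add_nonneg_eq_0_iff)
next
  case False
  then have pos: "0 < a + b" using assms by simp
  have *: "t powr p \<le> (a + b) powr p * (t / (a + b))" if "0 \<le> t" "t \<le> a + b" for t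
  proof -
    have "(t / (a + b)) powr p \<le> (t / (a + b)) powr 1" using that pos assms by (intro powr_mono') auto
    then have "(a + b) powr p * (t / (a + b)) powr p \<le> (a + b) powr p * (t / (a + b))"
      using that pos by (intro mult_left_mono) auto
    then show ?thesis using pos by (simp add: powr_divide)
  qed
  have "a powr p + b powr p \<le> (a + b) powr p * (a / (a + b)) + (a + b) powr p * (b / (a + b))"
    using assms by (intro add_mono *) auto
  also have "\<dots> = (a + b) powr p" using pos by (simp flip: distrib_left add_divide_distrib)
  finally show ?thesis .
qed

text \<open>Superadditivity of the p-th power applied to the smaller root and the difference of the
  roots. It turns almost invariance of \<psi> in L^1 into almost invariance of \<psi>^(1/p) in
  L^p.\<close>

lemma powr_root_diff_le:
  fixes s t p :: real
  assumes p: "1 \<le> p" and "0 \<le> s" "0 \<le> t" shows "\<bar>s powr (1 / p) - t powr (1 / p)\<bar> powr p \<le> \<bar>s - t\<bar>"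
proof -
  have *: "(s powr (1 / p) - t powr (1 / p)) powr p \<le> s - t" if "0 \<le> t" "t \<le> s" for s t :: real
  proof -
    have le: "t powr (1 / p) \<le> s powr (1 / p)" using that p by (intro powr_mono2) auto
    have "(t powr (1 / p)) powr p + (s powr (1 / p) - t powr (1 / p)) powr p \<le> (t powr (1 / p) + (s powr (1 / p) - t powr (1 / p))) powr p"
      by (rule powr_superadditive[OF p]) (use le in auto)
    then show ?thesis using that p by (simp add: powr_powr)
  qed
  show ?thesis
  proof (cases "t \<le> s")
    case True
    then have "t powr (1 / p) \<le> s powr (1 / p)" using assms by (intro powr_mono2) auto
    then show ?thesis using *[of t s] True assms by simp
  next
    case False
    then have "s powr (1 / p) \<le> t powr (1 / p)" using assms by (intro powr_mono2) auto
    then show ?thesis using *[of s t] False assms by (simp add: abs_minus_commute)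
  qed
qed

context amenable_unimodular_group
begin

text \<open>The number 1 is the integral of \<psi>^(1/p) \<psi>^(1/q). Hoelder's inequality bounds
  the difference by the L^p norm of \<psi>^(1/p) minus its translate, whose p-th power is at most
  the L^1 distance; hence \<open>\<epsilon> powr p\<close> in the hypothesis.\<close>

lemma almost_invariant_coefficient:
  assumes p: "1 < p" and \<psi>: "\<psi> \<in> densities" and e: "0 \<le> \<epsilon>" and inv: "norm1 (\<lambda>t. translate x \<psi> t - \<psi> t) \<le> \<epsilon> powr p"
  shows "\<bar>1 - (\<integral>t. \<psi> (- x + t) powr (1 / p) * \<psi> t powr (1 - 1 / p) \<partial>\<mu>)\<bar> \<le> \<epsilon>"
proof -
  define q where "q = p / (p - 1)"
  have q: "1 < q" "1 / p + 1 / q = 1" "1 - 1 / p = 1 / q" using p by (auto simp: q_def field_simps)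
  have \<psi>': "\<psi> \<in> cc" "\<And>x. 0 \<le> \<psi> x" "integral\<^sup>L \<mu> \<psi> = 1" using \<psi> by (auto simp: densities_def)
  define \<psi>1 where "\<psi>1 t = \<psi> t powr (1 / p)" for t
  define \<psi>2 where "\<psi>2 t = \<psi> t powr (1 / q)" for t
  have p1: "\<psi>1 \<in> cc" unfolding \<psi>1_def[abs_def] using cc_norm_powr[OF \<psi>'(1), of "1 / p"] p \<psi>'(2) by simp
  have p2: "\<psi>2 \<in> cc" unfolding \<psi>2_def[abs_def] using cc_norm_powr[OF \<psi>'(1), of "1 / q"] q \<psi>'(2) by simp
  have prod: "\<psi>1 t * \<psi>2 t = \<psi> t" for t
    unfolding \<psi>1_def \<psi>2_def powr_add[symmetric] q(2) using \<psi>'(2)[of t] by simp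
  let ?d = "\<lambda>t. \<bar>\<psi>1 t - \<psi>1 (- x + t)\<bar>"
  have dcc: "?d \<in> cc" by (intro cc_abs cc_diff cc_left p1)
  have d_p: "?d t powr p \<le> \<bar>translate x \<psi> t - \<psi> t\<bar>" for t
    using powr_root_diff_le[of p "\<psi> t" "\<psi> (- x + t)"] \<psi>'(2) p by (simp add: \<psi>1_def translate_def abs_minus_commute)
  have d_int: "integrable \<mu> (\<lambda>t. ?d t powr p)"
    using cc_integrable[OF cc_norm_powr[OF dcc, of p]] p by simp
  have tr_int: "integrable \<mu> (\<lambda>t. \<bar>translate x \<psi> t - \<psi> t\<bar>)"
    by (intro cc_integrable cc_abs cc_diff translate_cc \<psi>')
  have "(\<integral>t. ?d t powr p \<partial>\<mu>) \<le> \<epsilon> powr p"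
    using integral_mono[OF d_int tr_int d_p] inv by (simp add: norm1_def)
  then have dn: "pnorm \<mu> p ?d \<le> \<epsilon>" using pnorm_le_iff[of p \<epsilon> \<mu> ?d] p e by simp
  have \<psi>2q: "\<psi>2 t powr q = \<psi> t" for t using q \<psi>'(2)[of t] by (simp add: \<psi>2_def powr_powr)
  have \<psi>2_nn: "0 \<le> \<psi>2 t" for t by (simp add: \<psi>2_def)
  then have n2: "pnorm \<mu> q \<psi>2 = 1" by (simp add: pnorm_def \<psi>2q \<psi>')
  have i1: "integrable \<mu> (\<lambda>t. \<psi>1 (- x + t) * \<psi>2 t)" by (intro cc_integrable cc_mult cc_left p1 p2)
  have i2: "integrable \<mu> (\<lambda>t. \<psi>1 t * \<psi>2 t)" by (intro cc_integrable cc_mult p1 p2)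
  have "1 - (\<integral>t. \<psi>1 (- x + t) * \<psi>2 t \<partial>\<mu>) = (\<integral>t. (\<psi>1 t - \<psi>1 (- x + t)) * \<psi>2 t \<partial>\<mu>)"
    using i1 i2 \<psi>'(3) by (simp add: left_diff_distrib prod)
  then have "\<bar>1 - (\<integral>t. \<psi>1 (- x + t) * \<psi>2 t \<partial>\<mu>)\<bar> \<le> (\<integral>t. \<bar>(\<psi>1 t - \<psi>1 (- x + t)) * \<psi>2 t\<bar> \<partial>\<mu>)"
    by (simp only: integral_abs_bound)
  also have "\<dots> = (\<integral>t. ?d t * \<psi>2 t \<partial>\<mu>)" by (simp add: abs_mult \<psi>2_def)
  also have "\<dots> \<le> pnorm \<mu> p ?d * pnorm \<mu> q \<psi>2"
  proof (rule Hoelder_nonneg(2)[OF p q(1,2)])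
    show "integrable \<mu> (\<lambda>x. \<psi>2 x powr q)" by (simp add: \<psi>2q cc_integrable \<psi>')
  qed (use d_int cc_measurable[OF dcc] cc_measurable[OF p2] \<psi>2_nn in auto)
  also have "\<dots> \<le> \<epsilon>" using dn n2 by simp
  finally show ?thesis by (simp add: \<psi>1_def \<psi>2_def q)
qed

text \<open>By Reiter's condition the multiplier in \<open>coefficient_bound\<close> is within
  \<epsilon> of 1 on the support of f, at the cost of an error \<epsilon> c with c independent of
  \<epsilon>.\<close>

lemma pairing_bound:
  assumes p: "1 < p" and f: "f \<in> cc" and \<Lambda>: "conv_bound p \<Lambda> f"
    and u: "u \<in> cc" "pnorm \<mu> 2 u \<le> 1" and v: "v \<in> cc" "pnorm \<mu> 2 v \<le> 1"
  shows "norm (\<integral>t. conv f u t * v t \<partial>\<mu>) \<le> \<Lambda> * Herz_const p"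
proof -
  obtain K where K: "compact K" "\<And>x. x \<notin> K \<Longrightarrow> f x = 0" using f by (auto simp: cc_def)
  define \<phi> where "\<phi> x = (\<integral>s. u (- x + s) * v s \<partial>\<mu>)" for x
  note cu = cont_fun[OF cc_cont[OF u(1)]] and cv = cont_fun[OF cc_cont[OF v(1)]]
  have \<phi>_cont: "continuous_on UNIV \<phi>"
  proof -
    obtain Kv where Kv: "compact Kv" "\<And>x. x \<notin> Kv \<Longrightarrow> v x = 0" using v by (auto simp: cc_def)
    show ?thesis
      unfolding \<phi>_def[abs_def]
    proof (rule continuous_on_param_integral[OF _ Kv(1)])
      show "continuous_on UNIV (\<lambda>(x, t). u (- x + t) * v t)"
        unfolding split_beta by (intro continuous_intros cu cv)
    qed (use Kv in simp)
  qed
  have f\<phi>: "(\<lambda>x. f x * \<phi> x) \<in> cc" by (intro cc_mult_cont f \<phi>_cont)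
  define c where "c = (\<integral>x. norm (f x * \<phi> x) \<partial>\<mu>)"
  have c0: "0 \<le> c" by (simp add: c_def)
  define I where "I = (\<integral>x. f x * \<phi> x \<partial>\<mu>)"
  have main: "norm I \<le> \<Lambda> * Herz_const p + \<epsilon> * c" if e: "0 < \<epsilon>" for \<epsilon>
  proof -
    obtain \<psi> where \<psi>: "\<psi> \<in> densities" "\<And>s. s \<in> K \<Longrightarrow> norm1 (\<lambda>x. translate s \<psi> x - \<psi> x) \<le> \<epsilon> powr p"
      using Reiter[OF K(1), of "\<epsilon> powr p"] e by auto
    define w where "w x = (\<integral>t. \<psi> (- x + t) powr (1 / p) * \<psi> t powr (1 - 1 / p) \<partial>\<mu>)" for x
    have w1: "\<bar>1 - w x\<bar> \<le> \<epsilon>" if "x \<in> K" for x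
      unfolding w_def by (rule almost_invariant_coefficient[OF p \<psi>(1) less_imp_le[OF e] \<psi>(2)[OF that]])
    have bound: "norm (\<integral>x. f x * (\<phi> x * complex_of_real (w x)) \<partial>\<mu>) \<le> \<Lambda> * Herz_const p"
      unfolding w_def \<phi>_def by (rule coefficient_bound[OF p f \<Lambda> u v \<psi>(1)])
    have w_cont: "continuous_on UNIV w"
    proof -
      have \<psi>': "\<psi> \<in> cc" "\<And>x. 0 \<le> \<psi> x" using \<psi> by (auto simp: densities_def)
      define \<psi>1 where "\<psi>1 t = \<psi> t powr (1 / p)" for t
      define \<psi>2 where "\<psi>2 t = \<psi> t powr (1 - 1 / p)" for t
      have p1: "\<psi>1 \<in> cc" unfolding \<psi>1_def[abs_def] using cc_norm_powr[OF \<psi>'(1), of "1 / p"] p \<psi>'(2) by simp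
      have p2: "\<psi>2 \<in> cc" unfolding \<psi>2_def[abs_def] using cc_norm_powr[OF \<psi>'(1), of "1 - 1 / p"] p \<psi>'(2) by simp
      obtain J where J: "compact J" "\<And>x. x \<notin> J \<Longrightarrow> \<psi>2 x = 0" using p2 by (auto simp: cc_def)
      have "continuous_on UNIV (\<lambda>x. \<integral>t. \<psi>1 (- x + t) * \<psi>2 t \<partial>\<mu>)"
      proof (rule continuous_on_param_integral[OF _ J(1)])
        show "continuous_on UNIV (\<lambda>(x, t). \<psi>1 (- x + t) * \<psi>2 t)"
          unfolding split_beta by (intro continuous_intros cont_fun[OF cc_cont[OF p1]] cont_fun[OF cc_cont[OF p2]])
      qed (use J in simp)
      then show ?thesis by (simp add: w_def[abs_def] \<psi>1_def \<psi>2_def)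
    qed
    have fw: "(\<lambda>x. f x * (\<phi> x * complex_of_real (w x))) \<in> cc"
      by (intro cc_mult_cont f continuous_intros \<phi>_cont w_cont)
    have "I - (\<integral>x. f x * (\<phi> x * complex_of_real (w x)) \<partial>\<mu>) = (\<integral>x. f x * \<phi> x - f x * (\<phi> x * complex_of_real (w x)) \<partial>\<mu>)"
      unfolding I_def using cc_integrable[OF f\<phi>] cc_integrable[OF fw] by simp
    then have "norm (I - (\<integral>x. f x * (\<phi> x * complex_of_real (w x)) \<partial>\<mu>)) \<le> (\<integral>x. norm (f x * \<phi> x - f x * (\<phi> x * complex_of_real (w x))) \<partial>\<mu>)"
      by (simp only: integral_norm_bound)
    also have "\<dots> \<le> (\<integral>x. \<epsilon> * norm (f x * \<phi> x) \<partial>\<mu>)"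
    proof (rule integral_mono)
      show "integrable \<mu> (\<lambda>x. norm (f x * \<phi> x - f x * (\<phi> x * complex_of_real (w x))))"
        by (intro integrable_norm Bochner_Integration.integrable_diff cc_integrable f\<phi> fw)
      show "integrable \<mu> (\<lambda>x. \<epsilon> * norm (f x * \<phi> x))"
        by (intro integrable_mult_right integrable_norm cc_integrable f\<phi>)
      fix x
      show "norm (f x * \<phi> x - f x * (\<phi> x * complex_of_real (w x))) \<le> \<epsilon> * norm (f x * \<phi> x)"
      proof (cases "x \<in> K")
        case True
        have "f x * \<phi> x - f x * (\<phi> x * complex_of_real (w x)) = (f x * \<phi> x) * complex_of_real (1 - w x)"
          by (simp add: algebra_simps)
        then have "norm (f x * \<phi> x - f x * (\<phi> x * complex_of_real (w x))) = norm (f x * \<phi> x) * \<bar>1 - w x\<bar>"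
          by (simp only: norm_mult norm_of_real)
        then show ?thesis using w1[OF True] mult_left_mono[of "\<bar>1 - w x\<bar>" \<epsilon> "norm (f x * \<phi> x)"] by (simp add: mult.commute)
      next
        case False then show ?thesis using K(2) by simp
      qed
    qed
    also have "\<dots> = \<epsilon> * c" by (simp add: c_def)
    finally show ?thesis
      using bound norm_triangle_sub[of I "\<integral>x. f x * (\<phi> x * complex_of_real (w x)) \<partial>\<mu>"] by linarith
  qed
  have "norm I \<le> \<Lambda> * Herz_const p"
  proof (rule field_le_epsilon)
    fix e :: real assume e: "0 < e"
    have "e / (1 + c) * c \<le> e" using e c0 by (simp add: field_simps)
    then show "norm I \<le> \<Lambda> * Herz_const p + e" using main[of "e / (1 + c)"] e c0 by simp
  qed
  then show ?thesis by (simp add: integral_conv_mult[OF f u(1) v(1)] I_def \<phi>_def)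
qed

theorem Herz:
  assumes p: "1 < p" and f: "f \<in> cc" and \<Lambda>: "conv_bound p \<Lambda> f" and u: "u \<in> cc"
  shows "pnorm \<mu> 2 (conv f u) \<le> \<Lambda> * Herz_const p * pnorm \<mu> 2 u"
proof -
  define C where "C = \<Lambda> * Herz_const p"
  have C0: "0 \<le> C" using \<Lambda> Herz_const_nonneg by (simp add: C_def conv_bound_def)
  have unit: "pnorm \<mu> 2 (conv f u) \<le> C" if u: "u \<in> cc" "pnorm \<mu> 2 u \<le> 1" for u
  proof (cases "pnorm \<mu> 2 (conv f u) = 0")
    case True then show ?thesis using C0 by simp
  next
    case False
    define n where "n = pnorm \<mu> 2 (conv f u)"
    have n: "0 < n" using False pnorm_nonneg[of \<mu> 2 "conv f u"] by (simp add: n_def)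
    \<comment> \<open>The pairing is bilinear, so testing against the normalised complex conjugate
      of f * u returns the L^2 norm of f * u.\<close>
    define v where "v x = complex_of_real (1 / n) * cnj (conv f u x)" for x
    have ccc: "conv f u \<in> cc" by (rule conv_cc[OF f u(1)])
    have vcc: "v \<in> cc" unfolding v_def[abs_def] by (intro cc_cmult cc_cnj ccc)
    have "pnorm \<mu> 2 v = (1 / n) * n"
    proof -
      have "pnorm \<mu> 2 (\<lambda>x. cnj (conv f u x)) = n" by (simp add: pnorm_def n_def)
      then show ?thesis unfolding v_def[abs_def] pnorm_cmult[OF zero_less_numeral] norm_of_real using n by simp
    qed
    then have v1: "pnorm \<mu> 2 v \<le> 1" using n by simp
    have "(\<integral>t. conv f u t * v t \<partial>\<mu>) = complex_of_real (1 / n) * ip (conv f u) (conv f u)"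
      unfolding ip_def v_def by (subst integral_mult_right_zero[symmetric]) (simp add: mult_ac)
    also have "\<dots> = complex_of_real ((1 / n) * n\<^sup>2)" by (simp only: ip_self[OF ccc] n_def of_real_mult)
    also have "(1 / n) * n\<^sup>2 = n" using n by (simp add: power2_eq_square)
    finally have "norm (complex_of_real n) \<le> C"
      using pairing_bound[OF p f \<Lambda> u vcc v1] by (simp add: C_def)
    then show ?thesis using n by (simp add: n_def)
  qed
  \<comment> \<open>Dividing by the norm plus \<delta> allows scaling also when the norm of u is
    0.\<close>
  have "pnorm \<mu> 2 (conv f u) \<le> C * (pnorm \<mu> 2 u + \<delta>)" if d: "0 < \<delta>" for \<delta>
  proof -
    define s where "s = pnorm \<mu> 2 u + \<delta>"
    have s: "0 < s" "pnorm \<mu> 2 u \<le> s" using d pnorm_nonneg[of \<mu> 2 u] by (auto simp: s_def)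
    have "pnorm \<mu> 2 (\<lambda>x. (1 / s) *\<^sub>R u x) \<le> 1" using s by (simp add: pnorm_scale divide_le_eq)
    then have "pnorm \<mu> 2 (conv f (\<lambda>x. (1 / s) *\<^sub>R u x)) \<le> C" by (rule unit[OF cc_scaleR[OF u]])
    moreover have "conv f (\<lambda>x. (1 / s) *\<^sub>R u x) = (\<lambda>x. (1 / s) *\<^sub>R conv f u x)" by (rule ext) (rule conv_scale_right)
    ultimately have "(1 / s) * pnorm \<mu> 2 (conv f u) \<le> C" using s pnorm_scale[of 2 \<mu> "1 / s" "conv f u"] by simp
    then have "pnorm \<mu> 2 (conv f u) \<le> C * s" using s by (simp add: field_simps)
    then show ?thesis by (simp only: s_def)
  qed
  note close = this
  have "pnorm \<mu> 2 (conv f u) \<le> C * pnorm \<mu> 2 u"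
  proof (rule field_le_epsilon)
    fix e :: real assume e: "0 < e"
    have "C * (e / (1 + C)) \<le> e" using e C0 by (simp add: field_simps)
    then show "pnorm \<mu> 2 (conv f u) \<le> C * pnorm \<mu> 2 u + e"
      using close[of "e / (1 + C)"] e C0 by (simp add: distrib_left)
  qed
  then show ?thesis by (simp add: C_def)
qed

section \<open>The Hilbert algebra of the group\<close>

definition conv_norm :: "real \<Rightarrow> ('a \<Rightarrow> complex) \<Rightarrow> real" where
  "conv_norm p f = Inf {\<Lambda>. conv_bound p \<Lambda> f}"

lemma conv_norm_bound:
  assumes p: "1 < p" and f: "f \<in> cc" shows "conv_bound p (conv_norm p f) f"
proof -
  have ne: "{\<Lambda>. conv_bound p \<Lambda> f} \<noteq> {}"
    using conv_Lp_cc[OF p f] by (auto simp: conv_bound_def intro!: exI[of _ "\<integral>x. norm (f x) \<partial>\<mu>"])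
  have "pnorm \<mu> p (conv f h) \<le> conv_norm p f * pnorm \<mu> p h" if h: "h \<in> cc" for h
  proof (cases "pnorm \<mu> p h = 0")
    case True
    obtain \<Lambda> where "conv_bound p \<Lambda> f" using ne by blast
    then show ?thesis using h True by (auto simp: conv_bound_def)
  next
    case False
    then have pos: "0 < pnorm \<mu> p h" using pnorm_nonneg[of \<mu> p h] by simp
    have "pnorm \<mu> p (conv f h) / pnorm \<mu> p h \<le> conv_norm p f"
      unfolding conv_norm_def by (rule cInf_greatest[OF ne]) (use h pos in \<open>auto simp: conv_bound_def divide_le_eq\<close>)
    then show ?thesis using pos by (simp add: divide_le_eq)
  qed
  moreover have "0 \<le> conv_norm p f"
    unfolding conv_norm_def by (rule cInf_greatest[OF ne]) (auto simp: conv_bound_def)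
  ultimately show ?thesis by (simp add: conv_bound_def)
qed

lemma conv_norm_le: "conv_bound p \<Lambda> f \<Longrightarrow> conv_norm p f \<le> \<Lambda>"
  unfolding conv_norm_def by (rule cInf_lower) (auto simp: conv_bound_def intro!: bdd_belowI[of _ 0])

lemma conv_bound_add:
  assumes p: "1 \<le> p" and fg: "f \<in> cc" "g \<in> cc" and b: "conv_bound p \<Lambda> f" "conv_bound p \<Gamma> g"
  shows "conv_bound p (\<Lambda> + \<Gamma>) (\<lambda>x. f x + g x)"
  unfolding conv_bound_def
proof (intro conjI ballI)
  show "0 \<le> \<Lambda> + \<Gamma>" using b by (simp add: conv_bound_def)
  fix h :: "'a \<Rightarrow> complex" assume h: "h \<in> cc"
  have eq: "conv (\<lambda>x. f x + g x) h = (\<lambda>x. conv f h x + conv g h x)"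
    by (rule ext) (rule conv_add_left[OF fg h])
  have "pnorm \<mu> p (conv (\<lambda>x. f x + g x) h) \<le> pnorm \<mu> p (conv f h) + pnorm \<mu> p (conv g h)"
    unfolding eq using p by (intro pnorm_add cc_Lp conv_cc fg h) auto
  also have "\<dots> \<le> \<Lambda> * pnorm \<mu> p h + \<Gamma> * pnorm \<mu> p h"
    using b h by (intro add_mono) (auto simp: conv_bound_def)
  finally show "pnorm \<mu> p (conv (\<lambda>x. f x + g x) h) \<le> (\<Lambda> + \<Gamma>) * pnorm \<mu> p h" by (simp add: distrib_right)
qed

lemma conv_bound_uminus: "conv_bound p \<Lambda> f \<Longrightarrow> conv_bound p \<Lambda> (\<lambda>x. - f x)"
proof -
  have "conv (\<lambda>x. - f x) h = (\<lambda>x. - conv f h x)" for h by (rule ext) (simp add: conv_def)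
  then show "conv_bound p \<Lambda> f \<Longrightarrow> conv_bound p \<Lambda> (\<lambda>x. - f x)" by (simp add: conv_bound_def pnorm_uminus)
qed

lemma conv_bound_conv:
  assumes fg: "f \<in> cc" "g \<in> cc" and b: "conv_bound p \<Lambda> f" "conv_bound p \<Gamma> g"
  shows "conv_bound p (\<Lambda> * \<Gamma>) (conv f g)"
  unfolding conv_bound_def
proof (intro conjI ballI)
  show "0 \<le> \<Lambda> * \<Gamma>" using b by (simp add: conv_bound_def)
  fix h :: "'a \<Rightarrow> complex" assume h: "h \<in> cc"
  have eq: "conv (conv f g) h = conv f (conv g h)" by (rule ext) (rule conv_assoc[OF fg h])
  have "pnorm \<mu> p (conv f (conv g h)) \<le> \<Lambda> * pnorm \<mu> p (conv g h)"
    using b conv_cc[OF fg(2) h] by (simp add: conv_bound_def)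
  also have "\<dots> \<le> \<Lambda> * (\<Gamma> * pnorm \<mu> p h)" using b h by (intro mult_left_mono) (auto simp: conv_bound_def)
  finally show "pnorm \<mu> p (conv (conv f g) h) \<le> \<Lambda> * \<Gamma> * pnorm \<mu> p h" by (simp add: eq mult.assoc)
qed

definition cf_mult :: "('a, complex) cfun \<Rightarrow> ('a, complex) cfun \<Rightarrow> ('a, complex) cfun" where
  "cf_mult x y = Abs_cfun (conv (Rep_cfun x) (Rep_cfun y))"

definition cf_star :: "('a, complex) cfun \<Rightarrow> ('a, complex) cfun" where
  "cf_star x = Abs_cfun (star (Rep_cfun x))"

definition cf_ip :: "('a, complex) cfun \<Rightarrow> ('a, complex) cfun \<Rightarrow> real" where
  "cf_ip x y = Re (ip (Rep_cfun x) (Rep_cfun y))"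

text \<open>The factor \<open>Herz_const p\<close> makes this dominate the operator norm on L^2, by
  \<open>Herz\<close>; the maximum with 1 keeps it submultiplicative.\<close>

definition cf_norm :: "real \<Rightarrow> ('a, complex) cfun \<Rightarrow> real" where
  "cf_norm p x = max 1 (Herz_const p) * conv_norm p (Rep_cfun x)"

lemma Rep_cc: "Rep_cfun x \<in> cc"
  by (rule Rep_cfun)

lemma Rep_mult: "Rep_cfun (cf_mult x y) = conv (Rep_cfun x) (Rep_cfun y)"
  by (simp add: cf_mult_def Abs_cfun_inverse conv_cc Rep_cc)

lemma Rep_star: "Rep_cfun (cf_star x) = star (Rep_cfun x)"
  by (simp add: cf_star_def Abs_cfun_inverse cc_star Rep_cc)

lemma cf_ip_self: "sqrt (cf_ip x x) = pnorm \<mu> 2 (Rep_cfun x)"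
  by (simp add: cf_ip_def ip_self Rep_cc pnorm_nonneg)

lemma cf_ip_star: "cf_ip (cf_star x) (cf_star y) = cf_ip x y"
  unfolding cf_ip_def Rep_star ip_star[OF Rep_cc Rep_cc] by (subst ip_commute) simp

lemma cf_star_mult: "cf_star (cf_mult x y) = cf_mult (cf_star y) (cf_star x)"
  by (simp add: Rep_cfun_inject[symmetric] Rep_mult Rep_star star_conv Rep_cc)

lemma cf_ip_mult: "cf_ip (cf_mult x y) z = cf_ip y (cf_mult (cf_star x) z)"
  by (simp add: cf_ip_def Rep_mult Rep_star ip_conv Rep_cc)

lemma cf_bound_left:
  assumes p: "1 < p" shows "sqrt (cf_ip (cf_mult x y) (cf_mult x y)) \<le> cf_norm p x * sqrt (cf_ip y y)"
proof -
  let ?n = "conv_norm p (Rep_cfun x)"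
  have b: "conv_bound p ?n (Rep_cfun x)" by (rule conv_norm_bound[OF p Rep_cc])
  then have n0: "0 \<le> ?n" by (simp add: conv_bound_def)
  have "pnorm \<mu> 2 (conv (Rep_cfun x) (Rep_cfun y)) \<le> ?n * Herz_const p * pnorm \<mu> 2 (Rep_cfun y)"
    by (rule Herz[OF p Rep_cc b Rep_cc])
  also have "\<dots> \<le> (max 1 (Herz_const p) * ?n) * pnorm \<mu> 2 (Rep_cfun y)"
    using n0 by (intro mult_right_mono pnorm_nonneg) (simp add: mult.commute mult_right_mono)
  finally show ?thesis by (simp add: cf_ip_self Rep_mult cf_norm_def)
qed

lemma cf_ip_le: "cf_ip x y \<le> sqrt (cf_ip x x) * sqrt (cf_ip y y)"
proof -
  have "norm (ip (Rep_cfun x) (Rep_cfun y)) \<le> pnorm \<mu> 2 (Rep_cfun x) * pnorm \<mu> 2 (\<lambda>t. cnj (Rep_cfun y t))"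
    unfolding ip_def by (rule Hoelder(2)) (auto intro!: cc_Lp cc_cnj Rep_cc)
  moreover have "pnorm \<mu> 2 (\<lambda>t. cnj (Rep_cfun y t)) = pnorm \<mu> 2 (Rep_cfun y)" by (simp add: pnorm_def)
  moreover have "cf_ip x y \<le> norm (ip (Rep_cfun x) (Rep_cfun y))" unfolding cf_ip_def by (rule complex_Re_le_cmod)
  ultimately show ?thesis by (simp add: cf_ip_self)
qed

text \<open>The involution changes right multiplication by y into left multiplication by y^*. For w
  = y^* z one has |w|^2 = <z, y w>, which is at most |z| times the left bound for y, and one factor
  |w| cancels.\<close>

lemma cf_bound_right:
  assumes p: "1 < p" shows "sqrt (cf_ip (cf_mult x y) (cf_mult x y)) \<le> cf_norm p y * sqrt (cf_ip x x)"
proof -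
  define z where "z = cf_star x"
  define w where "w = cf_mult (cf_star y) z"
  have self: "0 \<le> cf_ip t t" for t by (simp add: cf_ip_def ip_self Rep_cc)
  have star2: "cf_star (cf_star t) = t" for t by (simp add: Rep_cfun_inject[symmetric] Rep_star star_star)
  have "cf_ip w w = cf_ip z (cf_mult y w)" unfolding w_def by (simp add: cf_ip_mult star2)
  also have "\<dots> \<le> sqrt (cf_ip z z) * sqrt (cf_ip (cf_mult y w) (cf_mult y w))" by (rule cf_ip_le)
  also have "\<dots> \<le> sqrt (cf_ip z z) * (cf_norm p y * sqrt (cf_ip w w))"
    by (intro mult_left_mono cf_bound_left p) (simp add: self)
  finally have le: "sqrt (cf_ip w w) * sqrt (cf_ip w w) \<le> (cf_norm p y * sqrt (cf_ip z z)) * sqrt (cf_ip w w)"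
    using self[of w] by (simp add: mult_ac)
  have N0: "0 \<le> cf_norm p y"
    using conv_norm_bound[OF p Rep_cc[of y]] by (simp add: cf_norm_def conv_bound_def)
  have "sqrt (cf_ip w w) \<le> cf_norm p y * sqrt (cf_ip z z)"
  proof (cases "sqrt (cf_ip w w) = 0")
    case True then show ?thesis using N0 self[of z] by (metis mult_nonneg_nonneg real_sqrt_ge_zero)
  next
    case False
    then have "0 < sqrt (cf_ip w w)" using self[of w] by (simp add: less_le)
    with le show ?thesis by (rule mult_right_le_imp_le)
  qed
  moreover have "cf_ip w w = cf_ip (cf_mult x y) (cf_mult x y)"
    unfolding w_def z_def cf_star_mult[symmetric] by (rule cf_ip_star)
  moreover have "cf_ip z z = cf_ip x x" unfolding z_def by (rule cf_ip_star)
  ultimately show ?thesis by simp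
qed

lemma hilbert_algebra_cfun:
  assumes p: "1 < p" shows "hilbert_algebra cf_mult cf_star cf_ip (cf_norm p)"
proof
  have inj: "x = y" if "Rep_cfun x = Rep_cfun y" for x y :: "('a, complex) cfun" using that by (simp add: Rep_cfun_inject)
  have one: "1 \<le> max 1 (Herz_const p)" by simp
  fix x y z :: "('a, complex) cfun" and c :: real
  show "cf_mult (cf_mult x y) z = cf_mult x (cf_mult y z)"
    by (rule inj, rule ext) (simp add: Rep_mult conv_assoc Rep_cc)
  show "cf_mult (x + y) z = cf_mult x z + cf_mult y z"
    by (rule inj, rule ext) (simp add: Rep_mult plus_cfun.rep_eq conv_add_left Rep_cc)
  show "cf_mult x (y + z) = cf_mult x y + cf_mult x z"
    by (rule inj, rule ext) (simp add: Rep_mult plus_cfun.rep_eq conv_add_right Rep_cc)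
  show "cf_mult (c *\<^sub>R x) y = c *\<^sub>R cf_mult x y"
    by (rule inj, rule ext) (simp only: Rep_mult scaleR_cfun.rep_eq conv_scale_left)
  show "cf_mult x (c *\<^sub>R y) = c *\<^sub>R cf_mult x y"
    by (rule inj, rule ext) (simp only: Rep_mult scaleR_cfun.rep_eq conv_scale_right)
  show "cf_star (cf_mult x y) = cf_mult (cf_star y) (cf_star x)" by (rule cf_star_mult)
  show "cf_star (cf_star x) = x" by (rule inj) (simp add: Rep_star star_star)
  show "cf_ip x y = cf_ip y x" unfolding cf_ip_def by (subst ip_commute) simp
  show "cf_ip (x + y) z = cf_ip x z + cf_ip y z"
    unfolding cf_ip_def ip_def plus_cfun.rep_eq distrib_right
    by (subst Bochner_Integration.integral_add) (auto intro!: ip_integrable Rep_cc)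
  show "cf_ip (c *\<^sub>R x) z = c * cf_ip x z"
    unfolding cf_ip_def ip_def scaleR_cfun.rep_eq by simp
  show "0 \<le> cf_ip x x" by (simp add: cf_ip_def ip_self Rep_cc)
  show "cf_ip (cf_mult x y) z = cf_ip y (cf_mult (cf_star x) z)" by (rule cf_ip_mult)
  show "cf_ip (cf_star x) (cf_star y) = cf_ip x y" by (rule cf_ip_star)
  have b: "conv_bound p (conv_norm p (Rep_cfun t)) (Rep_cfun t)" for t :: "('a, complex) cfun"
    by (rule conv_norm_bound[OF p Rep_cc])
  then have n0: "0 \<le> conv_norm p (Rep_cfun t)" for t :: "('a, complex) cfun" by (simp add: conv_bound_def)
  show "0 \<le> cf_norm p x" using n0 by (simp add: cf_norm_def)
  have "conv_norm p (Rep_cfun (x + y)) \<le> conv_norm p (Rep_cfun x) + conv_norm p (Rep_cfun y)"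
    unfolding plus_cfun.rep_eq using p by (intro conv_norm_le conv_bound_add b Rep_cc) auto
  then show "cf_norm p (x + y) \<le> cf_norm p x + cf_norm p y"
    unfolding cf_norm_def distrib_left[symmetric] by (rule mult_left_mono) simp
  have le: "conv_norm p (Rep_cfun (- t)) \<le> conv_norm p (Rep_cfun t)" for t :: "('a, complex) cfun"
    unfolding uminus_cfun.rep_eq by (intro conv_norm_le conv_bound_uminus b)
  show "cf_norm p (- x) = cf_norm p x" using le[of x] le[of "- x"] by (simp add: cf_norm_def)
  have "conv_norm p (Rep_cfun (cf_mult x y)) \<le> conv_norm p (Rep_cfun x) * conv_norm p (Rep_cfun y)"
    unfolding Rep_mult by (intro conv_norm_le conv_bound_conv b Rep_cc)
  then have "max 1 (Herz_const p) * conv_norm p (Rep_cfun (cf_mult x y))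
    \<le> max 1 (Herz_const p) * (conv_norm p (Rep_cfun x) * conv_norm p (Rep_cfun y))" by (intro mult_left_mono) auto
  also have "\<dots> \<le> max 1 (Herz_const p) * (max 1 (Herz_const p) * (conv_norm p (Rep_cfun x) * conv_norm p (Rep_cfun y)))"
    using mult_right_mono[OF one, of "conv_norm p (Rep_cfun x) * conv_norm p (Rep_cfun y)"] n0
    by (intro mult_left_mono) auto
  finally show "cf_norm p (cf_mult x y) \<le> cf_norm p x * cf_norm p y" by (simp add: cf_norm_def mult_ac)
  show "sqrt (cf_ip (cf_mult x y) (cf_mult x y)) \<le> cf_norm p x * sqrt (cf_ip y y)" by (rule cf_bound_left[OF p])
  show "sqrt (cf_ip (cf_mult x y) (cf_mult x y)) \<le> cf_norm p y * sqrt (cf_ip x x)" by (rule cf_bound_right[OF p])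
qed

end

section \<open>Classes of \<open>L\<^sup>p\<close>-functions\<close>

lemma Lp_rel_iff: "(f, g) \<in> Lp_rel M p \<longleftrightarrow> f \<in> Lp_fun M p \<and> g \<in> Lp_fun M p \<and> (AE x in M. f x = g x)"
  by (simp add: Lp_rel_def)

lemma Lp_equiv: "equiv (Lp_fun M p) (Lp_rel M p)"
proof (rule equivI)
  show "Lp_rel M p \<subseteq> Lp_fun M p \<times> Lp_fun M p" by (auto simp: Lp_rel_def)
  show "refl_on (Lp_fun M p) (Lp_rel M p)" by (rule refl_onI) (simp add: Lp_rel_iff)
  show "sym (Lp_rel M p)"
    by (rule symI) (auto simp: Lp_rel_iff elim: eventually_mono)
  show "trans (Lp_rel M p)"
  proof (rule transI)
    fix f g h assume "(f, g) \<in> Lp_rel M p" "(g, h) \<in> Lp_rel M p"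
    then have fh: "f \<in> Lp_fun M p" "h \<in> Lp_fun M p" and ae: "AE x in M. f x = g x" "AE x in M. g x = h x"
      by (auto simp: Lp_rel_iff)
    from ae have "AE x in M. f x = h x" by eventually_elim simp
    with fh show "(f, h) \<in> Lp_rel M p" by (simp add: Lp_rel_iff)
  qed
qed

lemma Lp_class_in: "f \<in> Lp_fun M p \<Longrightarrow> Lp_class M p f \<in> Lp M p"
  unfolding Lp_def by (rule quotientI)

lemma LpE: assumes "F \<in> Lp M p" obtains f where "f \<in> Lp_fun M p" "F = Lp_class M p f"
  using assms unfolding Lp_def by (rule quotientE) blast

lemma Lp_ball: "(\<forall>F\<in>Lp M p. Q F) \<longleftrightarrow> (\<forall>f\<in>Lp_fun M p. Q (Lp_class M p f))"
proof
  assume *: "\<forall>f\<in>Lp_fun M p. Q (Lp_class M p f)"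
  show "\<forall>F\<in>Lp M p. Q F"
  proof
    fix F assume "F \<in> Lp M p"
    then show "Q F" by (rule LpE) (use * in simp)
  qed
qed (use Lp_class_in in blast)

lemma Lp_class_eq_iff: "f \<in> Lp_fun M p \<Longrightarrow> g \<in> Lp_fun M p \<Longrightarrow> Lp_class M p f = Lp_class M p g \<longleftrightarrow> (AE x in M. f x = g x)"
  by (simp add: eq_equiv_class_iff[OF Lp_equiv] Lp_rel_iff)

lemma mem_Lp_class: "g \<in> Lp_class M p f \<longleftrightarrow> f \<in> Lp_fun M p \<and> g \<in> Lp_fun M p \<and> (AE x in M. f x = g x)"
  by (simp add: Lp_rel_iff)

lemma Lp_class_self: "f \<in> Lp_fun M p \<Longrightarrow> f \<in> Lp_class M p f"
  by (simp add: Lp_rel_iff)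

lemma Lp_norm_class: assumes "f \<in> Lp_fun M p" shows "Lp_norm M p (Lp_class M p f) = pnorm M p f"
proof -
  have "(\<lambda>f. (LINT x|M. norm (f x) powr p) powr (1 / p)) ` Lp_class M p f = {pnorm M p f}"
  proof (rule subset_antisym; rule subsetI)
    fix t assume "t \<in> (\<lambda>f. (LINT x|M. norm (f x) powr p) powr (1 / p)) ` Lp_class M p f"
    then obtain g where g: "g \<in> Lp_class M p f" "t = pnorm M p g" by (auto simp: pnorm_def)
    then have "pnorm M p f = pnorm M p g"
      using Lp_funD(1) unfolding mem_Lp_class by (intro pnorm_cong_AE) auto
    then show "t \<in> {pnorm M p f}" using g by simp
  next
    fix t assume "t \<in> {pnorm M p f}"
    then show "t \<in> (\<lambda>f. (LINT x|M. norm (f x) powr p) powr (1 / p)) ` Lp_class M p f"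
      using Lp_class_self[OF assms] by (auto simp: pnorm_def intro!: image_eqI[of _ _ f])
  qed
  then show ?thesis by (simp add: Lp_norm_def)
qed

context
  fixes M :: "'a measure" and p :: real assumes p: "1 \<le> p"
begin

lemma Lp_add_class:
  assumes f: "f \<in> Lp_fun M p" and g: "g \<in> Lp_fun M p"
  shows "Lp_add M p (Lp_class M p f) (Lp_class M p g) = Lp_class M p (\<lambda>x. f x + g x)"
proof -
  have "Lp_class M p (\<lambda>x. f' x + g' x) = Lp_class M p (\<lambda>x. f x + g x)"
    if "f' \<in> Lp_class M p f" "g' \<in> Lp_class M p g" for f' g'
  proof (rule iffD2[OF Lp_class_eq_iff])
    have fg': "f' \<in> Lp_fun M p" "g' \<in> Lp_fun M p" and ae: "AE x in M. f x = f' x" "AE x in M. g x = g' x"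
      using that unfolding mem_Lp_class by auto
    show "(\<lambda>x. f' x + g' x) \<in> Lp_fun M p" "(\<lambda>x. f x + g x) \<in> Lp_fun M p" by (intro Lp_fun_add p f g fg')+
    from ae show "AE x in M. f' x + g' x = f x + g x" by eventually_elim simp
  qed
  then show ?thesis
    unfolding Lp_add_def using Lp_class_self[OF f] Lp_class_self[OF g] by blast
qed

lemma Lp_scale_class:
  assumes f: "f \<in> Lp_fun M p"
  shows "Lp_scale M p c (Lp_class M p f) = Lp_class M p (\<lambda>x. c * f x)"
proof -
  have "Lp_class M p (\<lambda>x. c * f' x) = Lp_class M p (\<lambda>x. c * f x)" if "f' \<in> Lp_class M p f" for f'
  proof (rule iffD2[OF Lp_class_eq_iff])
    have f': "f' \<in> Lp_fun M p" and ae: "AE x in M. f x = f' x" using that unfolding mem_Lp_class by auto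
    show "(\<lambda>x. c * f' x) \<in> Lp_fun M p" "(\<lambda>x. c * f x) \<in> Lp_fun M p" by (intro Lp_fun_cmult f f')+
    from ae show "AE x in M. c * f' x = c * f x" by eventually_elim simp
  qed
  then show ?thesis unfolding Lp_scale_def using Lp_class_self[OF f] by blast
qed

section \<open>Operators on classes and the maps on functions that represent them\<close>

definition neg_op :: "(('a \<Rightarrow> complex) set \<Rightarrow> ('a \<Rightarrow> complex) set) \<Rightarrow> ('a \<Rightarrow> complex) set \<Rightarrow> ('a \<Rightarrow> complex) set" where
  "neg_op T = (\<lambda>F\<in>Lp M p. Lp_scale M p (- 1) (T F))"

definition add_op :: "(('a \<Rightarrow> complex) set \<Rightarrow> ('a \<Rightarrow> complex) set) \<Rightarrow> (('a \<Rightarrow> complex) set \<Rightarrow> ('a \<Rightarrow> complex) set) \<Rightarrow> ('a \<Rightarrow> complex) set \<Rightarrow> ('a \<Rightarrow> complex) set" where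
  "add_op S T = (\<lambda>F\<in>Lp M p. Lp_add M p (S F) (T F))"

text \<open>A bounded operator is described by any function \<open>A\<close> that picks representatives of the values.\<close>

definition represents :: "(('a \<Rightarrow> complex) set \<Rightarrow> ('a \<Rightarrow> complex) set) \<Rightarrow> (('a \<Rightarrow> complex) \<Rightarrow> 'a \<Rightarrow> complex) \<Rightarrow> bool" where
  "represents T A \<longleftrightarrow> T \<in> extensional (Lp M p) \<and> (\<forall>f\<in>Lp_fun M p. A f \<in> Lp_fun M p \<and> T (Lp_class M p f) = Lp_class M p (A f))"

lemma representsD:
  assumes "represents T A" "f \<in> Lp_fun M p"
  shows "A f \<in> Lp_fun M p" "T (Lp_class M p f) = Lp_class M p (A f)"
  using assms by (auto simp: represents_def)

lemma represents_exists:
  assumes "T \<in> Lp M p \<rightarrow>\<^sub>E Lp M p" obtains A where "represents T A"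
proof -
  have "\<forall>f\<in>Lp_fun M p. \<exists>g. g \<in> Lp_fun M p \<and> T (Lp_class M p f) = Lp_class M p g"
  proof
    fix f assume "f \<in> Lp_fun M p"
    then have "T (Lp_class M p f) \<in> Lp M p" using PiE_mem[OF assms] Lp_class_in by blast
    then show "\<exists>g. g \<in> Lp_fun M p \<and> T (Lp_class M p f) = Lp_class M p g" by (rule LpE) blast
  qed
  from bchoice[OF this] obtain A where A: "\<forall>f\<in>Lp_fun M p. A f \<in> Lp_fun M p \<and> T (Lp_class M p f) = Lp_class M p (A f)" by blast
  have "T \<in> extensional (Lp M p)" using assms unfolding PiE_def by blast
  with A have "represents T A" unfolding represents_def by blast
  then show ?thesis by (rule that)
qed

lemma represents_eqI:
  assumes "represents S A" "represents T B" "\<And>f. f \<in> Lp_fun M p \<Longrightarrow> AE x in M. A f x = B f x"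
  shows "S = T"
proof (rule extensionalityI)
  show "S \<in> extensional (Lp M p)" "T \<in> extensional (Lp M p)" using assms by (auto simp: represents_def)
  fix F assume "F \<in> Lp M p"
  then obtain f where f: "f \<in> Lp_fun M p" "F = Lp_class M p f" by (rule LpE)
  then show "S F = T F"
    using representsD[OF assms(1) f(1)] representsD[OF assms(2) f(1)] assms(3)[OF f(1)] by (simp add: Lp_class_eq_iff)
qed

lemma representsI:
  assumes "T \<in> extensional (Lp M p)" "\<And>f. f \<in> Lp_fun M p \<Longrightarrow> A f \<in> Lp_fun M p"
    "\<And>f. f \<in> Lp_fun M p \<Longrightarrow> T (Lp_class M p f) = Lp_class M p (A f)"
  shows "represents T A"
  using assms by (simp add: represents_def)

lemma represents_neg:
  assumes "represents T A" shows "represents (neg_op T) (\<lambda>f x. - A f x)"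
proof (rule representsI)
  fix f assume f: "f \<in> Lp_fun M p"
  note A = representsD[OF assms f]
  show "(\<lambda>x. - A f x) \<in> Lp_fun M p" using Lp_fun_cmult[OF A(1), of "- 1"] by simp
  show "neg_op T (Lp_class M p f) = Lp_class M p (\<lambda>x. - A f x)"
    using Lp_scale_class[OF A(1), of "- 1"] by (simp add: neg_op_def Lp_class_in f A(2))
qed (simp add: neg_op_def)

lemma represents_add:
  assumes "represents S A" "represents T B" shows "represents (add_op S T) (\<lambda>f x. A f x + B f x)"
proof (rule representsI)
  fix f assume f: "f \<in> Lp_fun M p"
  note A = representsD[OF assms(1) f] and B = representsD[OF assms(2) f]
  show "(\<lambda>x. A f x + B f x) \<in> Lp_fun M p" by (rule Lp_fun_add[OF p A(1) B(1)])
  show "add_op S T (Lp_class M p f) = Lp_class M p (\<lambda>x. A f x + B f x)"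
    using Lp_add_class[OF A(1) B(1)] by (simp add: add_op_def Lp_class_in f A(2) B(2))
qed (simp add: add_op_def)

lemma represents_compose:
  assumes "represents S A" "represents T B" shows "represents (compose (Lp M p) S T) (\<lambda>f. A (B f))"
proof (rule representsI)
  fix f assume f: "f \<in> Lp_fun M p"
  note B = representsD[OF assms(2) f]
  note A = representsD[OF assms(1) B(1)]
  show "A (B f) \<in> Lp_fun M p" by (rule A(1))
  show "compose (Lp M p) S T (Lp_class M p f) = Lp_class M p (A (B f))"
    by (simp add: compose_eq Lp_class_in f A(2) B(2))
qed simp

lemma represents_zero: "represents (\<lambda>F\<in>Lp M p. Lp_class M p (\<lambda>x. 0)) (\<lambda>f x. 0)"
  by (rule representsI) (simp_all add: Lp_class_in Lp_fun_zero)

lemma represents_PiE: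
  assumes "represents T A" shows "T \<in> Lp M p \<rightarrow>\<^sub>E Lp M p"
proof (rule PiE_I)
  show "T F \<in> Lp M p" if "F \<in> Lp M p" for F
    using that by (rule LpE) (simp add: representsD[OF assms] Lp_class_in)
  show "T F = undefined" if "F \<notin> Lp M p" for F
    using assms that by (simp add: represents_def extensional_def)
qed

text \<open>Equalities of classes become equalities almost everywhere, and the bound is kept as a
  nonnegative parameter, so that bounds of sums and compositions can be tracked explicitly.\<close>

definition linear_rep :: "(('a \<Rightarrow> complex) \<Rightarrow> 'a \<Rightarrow> complex) \<Rightarrow> real \<Rightarrow> bool" where
  "linear_rep A C \<longleftrightarrow> 0 \<le> C \<and>
    (\<forall>f\<in>Lp_fun M p. \<forall>g\<in>Lp_fun M p. AE x in M. A (\<lambda>x. f x + g x) x = A f x + A g x) \<and>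
    (\<forall>c. \<forall>f\<in>Lp_fun M p. AE x in M. A (\<lambda>x. c * f x) x = c * A f x) \<and>
    (\<forall>f\<in>Lp_fun M p. pnorm M p (A f) \<le> C * pnorm M p f)"

lemma linear_repD:
  assumes "linear_rep A C"
  shows "0 \<le> C" "f \<in> Lp_fun M p \<Longrightarrow> g \<in> Lp_fun M p \<Longrightarrow> AE x in M. A (\<lambda>x. f x + g x) x = A f x + A g x"
    "f \<in> Lp_fun M p \<Longrightarrow> AE x in M. A (\<lambda>x. c * f x) x = c * A f x"
    "f \<in> Lp_fun M p \<Longrightarrow> pnorm M p (A f) \<le> C * pnorm M p f"
  using assms by (simp_all add: linear_rep_def)

lemma bounded_op_iff:
  assumes "represents T A" shows "Lp_bounded_op M p T \<longleftrightarrow> (\<exists>C. linear_rep A C)"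
proof -
  note A = representsD[OF assms]
  have add: "T (Lp_add M p (Lp_class M p f) (Lp_class M p g)) = Lp_add M p (T (Lp_class M p f)) (T (Lp_class M p g))
      \<longleftrightarrow> (AE x in M. A (\<lambda>x. f x + g x) x = A f x + A g x)" if "f \<in> Lp_fun M p" "g \<in> Lp_fun M p" for f g
    using that by (simp add: A Lp_add_class Lp_fun_add p Lp_class_eq_iff)
  have scale: "T (Lp_scale M p c (Lp_class M p f)) = Lp_scale M p c (T (Lp_class M p f))
      \<longleftrightarrow> (AE x in M. A (\<lambda>x. c * f x) x = c * A f x)" if "f \<in> Lp_fun M p" for f c
    using that by (simp add: A Lp_scale_class Lp_fun_cmult Lp_class_eq_iff)
  have norm: "Lp_norm M p (T (Lp_class M p f)) \<le> C * Lp_norm M p (Lp_class M p f) \<longleftrightarrow> pnorm M p (A f) \<le> C * pnorm M p f"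
    if "f \<in> Lp_fun M p" for f C using that by (simp add: A Lp_norm_class)
  have "Lp_bounded_op M p T \<longleftrightarrow>
    (\<forall>f\<in>Lp_fun M p. \<forall>g\<in>Lp_fun M p. AE x in M. A (\<lambda>x. f x + g x) x = A f x + A g x) \<and>
    (\<forall>c. \<forall>f\<in>Lp_fun M p. AE x in M. A (\<lambda>x. c * f x) x = c * A f x) \<and>
    (\<exists>C. \<forall>f\<in>Lp_fun M p. pnorm M p (A f) \<le> C * pnorm M p f)"
    unfolding Lp_bounded_op_def Lp_ball using represents_PiE[OF assms] by (simp add: add scale norm)
  moreover have "(\<exists>C. \<forall>f\<in>Lp_fun M p. pnorm M p (A f) \<le> C * pnorm M p f) \<longleftrightarrow>
    (\<exists>C\<ge>0. \<forall>f\<in>Lp_fun M p. pnorm M p (A f) \<le> C * pnorm M p f)"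
  proof
    assume "\<exists>C. \<forall>f\<in>Lp_fun M p. pnorm M p (A f) \<le> C * pnorm M p f"
    then obtain C where C: "\<And>f. f \<in> Lp_fun M p \<Longrightarrow> pnorm M p (A f) \<le> C * pnorm M p f" by blast
    have "pnorm M p (A f) \<le> max C 0 * pnorm M p f" if "f \<in> Lp_fun M p" for f
      using C[OF that] mult_right_mono[OF max.cobounded1[of C 0] pnorm_nonneg[of M p f]] by linarith
    then show "\<exists>C\<ge>0. \<forall>f\<in>Lp_fun M p. pnorm M p (A f) \<le> C * pnorm M p f" by (intro exI[of _ "max C 0"]) auto
  qed blast
  ultimately show ?thesis unfolding linear_rep_def by auto
qed

lemma linear_rep_diff:
  assumes A: "linear_rep A C" "\<And>f. f \<in> Lp_fun M p \<Longrightarrow> A f \<in> Lp_fun M p" and f: "f \<in> Lp_fun M p" and g: "g \<in> Lp_fun M p"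
  shows "AE x in M. A (\<lambda>x. f x - g x) x = A f x - A g x" "pnorm M p (\<lambda>x. A f x - A g x) \<le> C * pnorm M p (\<lambda>x. f x - g x)"
proof -
  have d: "(\<lambda>x. f x - g x) \<in> Lp_fun M p" by (rule Lp_fun_diff[OF p f g])
  have "AE x in M. A (\<lambda>x. (f x - g x) + g x) x = A (\<lambda>x. f x - g x) x + A g x"
    by (rule linear_repD(2)[OF A(1) d g])
  then show ae: "AE x in M. A (\<lambda>x. f x - g x) x = A f x - A g x" by eventually_elim (simp add: algebra_simps)
  have "pnorm M p (A (\<lambda>x. f x - g x)) = pnorm M p (\<lambda>x. A f x - A g x)"
    using ae by (intro pnorm_cong_AE Lp_funD(1)[of _ M p] A(2) d Lp_fun_diff p f g)
  then show "pnorm M p (\<lambda>x. A f x - A g x) \<le> C * pnorm M p (\<lambda>x. f x - g x)"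
    using linear_repD(4)[OF A(1) d] by simp
qed

lemma linear_rep_neg:
  assumes A: "linear_rep A C" shows "linear_rep (\<lambda>f x. - A f x) C"
  unfolding linear_rep_def
proof (intro conjI ballI allI)
  show "0 \<le> C" by (rule linear_repD(1)[OF A])
  fix f assume f: "f \<in> Lp_fun M p"
  show "AE x in M. - A (\<lambda>x. f x + g x) x = - A f x + - A g x" if "g \<in> Lp_fun M p" for g
    using linear_repD(2)[OF A f that] by eventually_elim simp
  show "AE x in M. - A (\<lambda>x. c * f x) x = c * - A f x" for c
    using linear_repD(3)[OF A f] by eventually_elim simp
  show "pnorm M p (\<lambda>x. - A f x) \<le> C * pnorm M p f"
    using linear_repD(4)[OF A f] by (simp add: pnorm_uminus)
qed

lemma linear_rep_add:
  assumes A: "linear_rep A C" "\<And>f. f \<in> Lp_fun M p \<Longrightarrow> A f \<in> Lp_fun M p"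
    and B: "linear_rep B D" "\<And>f. f \<in> Lp_fun M p \<Longrightarrow> B f \<in> Lp_fun M p"
  shows "linear_rep (\<lambda>f x. A f x + B f x) (C + D)"
  unfolding linear_rep_def
proof (intro conjI ballI allI)
  show "0 \<le> C + D" using A B by (simp add: linear_rep_def)
  fix f assume f: "f \<in> Lp_fun M p"
  show "AE x in M. A (\<lambda>x. f x + g x) x + B (\<lambda>x. f x + g x) x = A f x + B f x + (A g x + B g x)" if g: "g \<in> Lp_fun M p" for g
  proof -
    note linear_repD(2)[OF A(1) f g] linear_repD(2)[OF B(1) f g]
    then show ?thesis by eventually_elim simp
  qed
  show "AE x in M. A (\<lambda>x. c * f x) x + B (\<lambda>x. c * f x) x = c * (A f x + B f x)" for c
  proof -
    note linear_repD(3)[OF A(1) f, of c] linear_repD(3)[OF B(1) f, of c]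
    then show ?thesis by eventually_elim (simp add: distrib_left)
  qed
  note linear_repD(4)[OF A(1) f] linear_repD(4)[OF B(1) f]
  then show "pnorm M p (\<lambda>x. A f x + B f x) \<le> (C + D) * pnorm M p f"
    using pnorm_add[OF p A(2)[OF f] B(2)[OF f]] by (simp add: distrib_right)
qed

text \<open>\<open>B\<close> is linear only up to null sets, so \<open>A\<close> must respect
  equality almost everywhere; \<open>represents_cong\<close> supplies this.\<close>

lemma linear_rep_compose:
  assumes A: "linear_rep A C" "\<And>f. f \<in> Lp_fun M p \<Longrightarrow> A f \<in> Lp_fun M p"
    and A_cong: "\<And>f g. f \<in> Lp_fun M p \<Longrightarrow> g \<in> Lp_fun M p \<Longrightarrow> AE x in M. f x = g x \<Longrightarrow> AE x in M. A f x = A g x"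
    and B: "linear_rep B D" "\<And>f. f \<in> Lp_fun M p \<Longrightarrow> B f \<in> Lp_fun M p"
  shows "linear_rep (\<lambda>f. A (B f)) (C * D)"
  unfolding linear_rep_def
proof (intro conjI ballI allI)
  show "0 \<le> C * D" using A B by (simp add: linear_rep_def)
  fix f assume f: "f \<in> Lp_fun M p"
  show "AE x in M. A (B (\<lambda>x. f x + g x)) x = A (B f) x + A (B g) x" if g: "g \<in> Lp_fun M p" for g
  proof -
    note linear_repD(2)[OF B(1) f g]
    then have "AE x in M. A (B (\<lambda>x. f x + g x)) x = A (\<lambda>x. B f x + B g x) x"
      by (intro A_cong Lp_fun_add B(2) p f g)
    moreover have "AE x in M. A (\<lambda>x. B f x + B g x) x = A (B f) x + A (B g) x"
      by (rule linear_repD(2)[OF A(1) B(2)[OF f] B(2)[OF g]])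
    ultimately show ?thesis by eventually_elim simp
  qed
  show "AE x in M. A (B (\<lambda>x. c * f x)) x = c * A (B f) x" for c
  proof -
    note linear_repD(3)[OF B(1) f, of c]
    then have "AE x in M. A (B (\<lambda>x. c * f x)) x = A (\<lambda>x. c * B f x) x"
      by (intro A_cong Lp_fun_cmult B(2) f)
    moreover have "AE x in M. A (\<lambda>x. c * B f x) x = c * A (B f) x"
      by (rule linear_repD(3)[OF A(1) B(2)[OF f]])
    ultimately show ?thesis by eventually_elim simp
  qed
  note linear_repD(4)[OF A(1) B(2)[OF f]] linear_repD(4)[OF B(1) f]
  moreover have "0 \<le> C" using A(1) by (simp add: linear_rep_def)
  ultimately show "pnorm M p (A (B f)) \<le> C * D * pnorm M p f"
    using mult_left_mono[of "pnorm M p (B f)" "D * pnorm M p f" C] by (simp add: mult.assoc)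
qed

lemma represents_cong:
  assumes T: "represents T A" and f: "f \<in> Lp_fun M p" and g: "g \<in> Lp_fun M p" and eq: "AE x in M. f x = g x"
  shows "AE x in M. A f x = A g x"
proof -
  have "Lp_class M p f = Lp_class M p g" by (rule iffD2[OF Lp_class_eq_iff[OF f g] eq])
  then have "Lp_class M p (A f) = Lp_class M p (A g)"
    unfolding representsD(2)[OF T f, symmetric] representsD(2)[OF T g, symmetric] by (rule arg_cong)
  then show ?thesis by (rule iffD1[OF Lp_class_eq_iff[OF representsD(1)[OF T f] representsD(1)[OF T g]]])
qed

lemma represents_bound_iff:
  assumes "represents T A"
  shows "(\<forall>F\<in>Lp M p. Lp_norm M p (T F) \<le> C * Lp_norm M p F) \<longleftrightarrow> (\<forall>f\<in>Lp_fun M p. pnorm M p (A f) \<le> C * pnorm M p f)"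
  unfolding Lp_ball by (rule ball_cong[OF refl]) (simp add: representsD[OF assms] Lp_norm_class)

lemma op_norm_le:
  assumes T: "represents T A" and C: "0 \<le> C" "\<And>f. f \<in> Lp_fun M p \<Longrightarrow> pnorm M p (A f) \<le> C * pnorm M p f"
  shows "op_norm M p T \<le> C"
  unfolding op_norm_def represents_bound_iff[OF T]
  by (rule cInf_lower) (use C in \<open>auto intro!: bdd_belowI[of _ 0]\<close>)

lemma op_norm_less:
  assumes T: "represents T A" "linear_rep A C" and less: "op_norm M p T < \<epsilon>" and f: "f \<in> Lp_fun M p"
  shows "pnorm M p (A f) \<le> \<epsilon> * pnorm M p f"
proof -
  have "C \<in> {C. 0 \<le> C \<and> (\<forall>f\<in>Lp_fun M p. pnorm M p (A f) \<le> C * pnorm M p f)}"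
    using T(2) unfolding linear_rep_def by blast
  then obtain D where D: "D < \<epsilon>" "\<forall>f\<in>Lp_fun M p. pnorm M p (A f) \<le> D * pnorm M p f"
    using cInf_lessD[OF _ less[unfolded op_norm_def represents_bound_iff[OF T(1)]]] by blast
  then have "pnorm M p (A f) \<le> D * pnorm M p f" using f by blast
  also have "\<dots> \<le> \<epsilon> * pnorm M p f" using D(1) by (intro mult_right_mono pnorm_nonneg) auto
  finally show ?thesis .
qed

text \<open>
  The additive inverse in a record is the unique inverse within its carrier, so that it is computed in the
  same way in the algebra of bounded operators and in its subalgebras.
\<close>

lemma a_inv_neg_op:
  fixes R :: "((('a \<Rightarrow> complex) set \<Rightarrow> ('a \<Rightarrow> complex) set), 'm) ring_scheme"
  assumes add: "add R = add_op" and zero: "zero R = (\<lambda>F\<in>Lp M p. Lp_class M p (\<lambda>x. 0))"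
    and carrier: "carrier R \<subseteq> {T. Lp_bounded_op M p T}" and T: "T \<in> carrier R" and neg: "neg_op T \<in> carrier R"
  shows "\<ominus>\<^bsub>R\<^esub> T = neg_op T"
proof -
  have rep: "\<exists>A. represents S A" if "S \<in> carrier R" for S
  proof -
    have "Lp_bounded_op M p S" using that carrier by blast
    then have "S \<in> Lp M p \<rightarrow>\<^sub>E Lp M p" unfolding Lp_bounded_op_def by blast
    then show ?thesis by (rule represents_exists) blast
  qed
  obtain A where A: "represents T A" using rep[OF T] by blast
  have z1: "add_op T (neg_op T) = (\<lambda>F\<in>Lp M p. Lp_class M p (\<lambda>x. 0))"
    by (rule represents_eqI[OF represents_add[OF A represents_neg[OF A]] represents_zero]) simp
  have z2: "add_op (neg_op T) T = (\<lambda>F\<in>Lp M p. Lp_class M p (\<lambda>x. 0))"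
    by (rule represents_eqI[OF represents_add[OF represents_neg[OF A] A] represents_zero]) simp
  have uniq: "y = neg_op T" if y: "y \<in> carrier R" "add_op T y = (\<lambda>F\<in>Lp M p. Lp_class M p (\<lambda>x. 0))" for y
  proof -
    obtain B where B: "represents y B" using rep[OF y(1)] by blast
    have rz: "represents (add_op T y) (\<lambda>f x. 0)" unfolding y(2) by (rule represents_zero)
    show ?thesis
    proof (rule represents_eqI[OF B represents_neg[OF A]])
      fix f assume f: "f \<in> Lp_fun M p"
      have "Lp_class M p (\<lambda>x. A f x + B f x) = Lp_class M p (\<lambda>x. 0)"
        using representsD(2)[OF represents_add[OF A B] f] representsD(2)[OF rz f] by simp
      then have "AE x in M. A f x + B f x = 0"
        using representsD(1)[OF represents_add[OF A B] f] by (simp add: Lp_class_eq_iff Lp_fun_zero)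
      then show "AE x in M. B f x = - A f x" by eventually_elim (simp add: eq_neg_iff_add_eq_0 add.commute)
    qed
  qed
  have "(THE y. y \<in> carrier R \<and> add_op T y = (\<lambda>F\<in>Lp M p. Lp_class M p (\<lambda>x. 0)) \<and> add_op y T = (\<lambda>F\<in>Lp M p. Lp_class M p (\<lambda>x. 0))) = neg_op T"
    by (rule the_equality) (use neg z1 z2 uniq in blast)+
  then show ?thesis by (simp add: a_inv_def m_inv_def add zero)
qed

end

section \<open>Direct finiteness of the algebra of pseudofunctions\<close>

locale pseudofunctions = amenable_unimodular_group +
  fixes p :: real
  assumes p: "1 < p"
begin

lemma p1: "1 \<le> p"
  using p by simp

lemma represents_lambda: assumes f: "f \<in> cc" shows "represents \<mu> p (lambda_p \<mu> p f) (conv f)"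
proof (rule representsI[OF p1])
  show "lambda_p \<mu> p f \<in> extensional (Lp \<mu> p)" by (simp add: lambda_p_def)
  fix h assume h: "h \<in> Lp_fun \<mu> p"
  show "conv f h \<in> Lp_fun \<mu> p" by (rule conv_Lp(1)[OF p f h])
  have "Lp_class \<mu> p (convolution \<mu> f h') = Lp_class \<mu> p (conv f h)" if "h' \<in> Lp_class \<mu> p h" for h'
    using that conv_Lp_cong[OF p f, of h h'] unfolding mem_Lp_class convolution_eq by simp
  then have "(\<Union>h'\<in>Lp_class \<mu> p h. Lp_class \<mu> p (convolution \<mu> f h')) = Lp_class \<mu> p (conv f h)"
    using Lp_class_self[OF h] by blast
  then show "lambda_p \<mu> p f (Lp_class \<mu> p h) = Lp_class \<mu> p (conv f h)"
    by (simp add: lambda_p_def Lp_class_in h)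
qed

lemma linear_rep_conv: assumes f: "f \<in> cc" shows "linear_rep \<mu> p (conv f) (\<integral>x. norm (f x) \<partial>\<mu>)"
  unfolding linear_rep_def[OF p1]
proof (intro conjI ballI allI AE_I2)
  fix h assume h: "h \<in> Lp_fun \<mu> p"
  show "conv f (\<lambda>x. h x + k x) x = conv f h x + conv f k x" if "k \<in> Lp_fun \<mu> p" for k x
    by (rule conv_Lp_add_right[OF p f h that])
  show "conv f (\<lambda>x. c * h x) x = c * conv f h x" for c x by (rule conv_cmult_right)
  show "pnorm \<mu> p (conv f h) \<le> (\<integral>x. norm (f x) \<partial>\<mu>) * pnorm \<mu> p h" by (rule conv_Lp(2)[OF p f h])
qed simp

lemma bounded_lambda: "f \<in> cc \<Longrightarrow> Lp_bounded_op \<mu> p (lambda_p \<mu> p f)"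
  using bounded_op_iff[OF p1 represents_lambda] linear_rep_conv by blast

section \<open>Approximation of operators by convolutions\<close>

abbreviation approximates :: "(('a \<Rightarrow> complex) \<Rightarrow> 'a \<Rightarrow> complex) \<Rightarrow> real \<Rightarrow> ('a \<Rightarrow> complex) \<Rightarrow> bool" where
  "approximates A \<epsilon> f \<equiv> (\<forall>h\<in>Lp_fun \<mu> p. pnorm \<mu> p (\<lambda>x. A h x - conv f h x) \<le> \<epsilon> * pnorm \<mu> p h)"

lemma minus_lambda:
  assumes f: "f \<in> cc"
  shows "T \<ominus>\<^bsub>bounded_ops \<mu> p\<^esub> lambda_p \<mu> p f = add_op \<mu> p T (neg_op \<mu> p (lambda_p \<mu> p f))"
proof -
  note L = represents_lambda[OF f]
  have "Lp_bounded_op \<mu> p (neg_op \<mu> p (lambda_p \<mu> p f))"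
    using bounded_op_iff[OF p1 represents_neg[OF p1 L]] linear_rep_neg[OF p1 linear_rep_conv[OF f]] by blast
  then have "\<ominus>\<^bsub>bounded_ops \<mu> p\<^esub> lambda_p \<mu> p f = neg_op \<mu> p (lambda_p \<mu> p f)"
    using bounded_lambda[OF f]
    by (intro a_inv_neg_op[OF p1]) (auto simp: bounded_ops_def add_op_def[OF p1] fun_eq_iff)
  then show ?thesis by (simp add: a_minus_def bounded_ops_def add_op_def[OF p1])
qed

lemma PF_iff:
  assumes T: "represents \<mu> p T A"
  shows "T \<in> carrier (PF \<mu> p) \<longleftrightarrow> (\<exists>C. linear_rep \<mu> p A C) \<and> (\<forall>\<epsilon>>0. \<exists>f\<in>cc. approximates A \<epsilon> f)"
proof -
  have carrier: "T \<in> carrier (PF \<mu> p) \<longleftrightarrow> (\<exists>C. linear_rep \<mu> p A C) \<and>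
      (\<forall>\<epsilon>>0. \<exists>f\<in>cc. op_norm \<mu> p (add_op \<mu> p T (neg_op \<mu> p (lambda_p \<mu> p f))) < \<epsilon>)"
    using minus_lambda by (simp add: PF_def bounded_ops_def Cc_eq_cc bounded_op_iff[OF p1 T])
  have rep: "represents \<mu> p (add_op \<mu> p T (neg_op \<mu> p (lambda_p \<mu> p f))) (\<lambda>h x. A h x + - conv f h x)" if "f \<in> cc" for f
    by (intro represents_add[OF p1] represents_neg[OF p1] T represents_lambda that)
  have AL: "A h \<in> Lp_fun \<mu> p" if "h \<in> Lp_fun \<mu> p" for h by (rule representsD(1)[OF p1 T that])
  have "approximates A \<epsilon> f" if C: "linear_rep \<mu> p A C" and f: "f \<in> cc"
      and less: "op_norm \<mu> p (add_op \<mu> p T (neg_op \<mu> p (lambda_p \<mu> p f))) < \<epsilon>" for C f \<epsilon>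
  proof -
    have "linear_rep \<mu> p (\<lambda>h x. A h x + - conv f h x) (C + (\<integral>x. norm (f x) \<partial>\<mu>))"
    proof (rule linear_rep_add[OF p1 C AL linear_rep_neg[OF p1 linear_rep_conv[OF f]]])
      show "(\<lambda>x. - conv f h x) \<in> Lp_fun \<mu> p" if "h \<in> Lp_fun \<mu> p" for h
        using Lp_fun_cmult[OF conv_Lp(1)[OF p f that], of "- 1"] by simp
    qed
    from op_norm_less[OF p1 rep[OF f] this less] show ?thesis by simp
  qed
  moreover have "op_norm \<mu> p (add_op \<mu> p T (neg_op \<mu> p (lambda_p \<mu> p f))) < \<epsilon>"
    if "0 < \<epsilon>" and f: "f \<in> cc" and "approximates A (\<epsilon> / 2) f" for f \<epsilon>
  proof -
    have "op_norm \<mu> p (add_op \<mu> p T (neg_op \<mu> p (lambda_p \<mu> p f))) \<le> \<epsilon> / 2"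
      by (rule op_norm_le[OF p1 rep[OF f]]) (use that in auto)
    then show ?thesis using that by linarith
  qed
  ultimately show ?thesis unfolding carrier by (meson half_gt_zero)
qed

lemma PF_represents:
  assumes "T \<in> carrier (PF \<mu> p)" obtains A C where "represents \<mu> p T A" "linear_rep \<mu> p A C" "\<And>\<epsilon>. 0 < \<epsilon> \<Longrightarrow> \<exists>f\<in>cc. approximates A \<epsilon> f"
proof -
  have "Lp_bounded_op \<mu> p T" using assms by (simp add: PF_def bounded_ops_def)
  then have "T \<in> Lp \<mu> p \<rightarrow>\<^sub>E Lp \<mu> p" by (simp add: Lp_bounded_op_def)
  then obtain A where A: "represents \<mu> p T A" by (rule represents_exists[OF p1])
  with PF_iff[OF A] assms that show ?thesis by blast
qed

lemma PF_neg:
  assumes "T \<in> carrier (PF \<mu> p)" shows "neg_op \<mu> p T \<in> carrier (PF \<mu> p)"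
proof -
  obtain A C where A: "represents \<mu> p T A" "linear_rep \<mu> p A C" "\<And>\<epsilon>. 0 < \<epsilon> \<Longrightarrow> \<exists>f\<in>cc. approximates A \<epsilon> f"
    using PF_represents[OF assms] by blast
  have "\<exists>f\<in>cc. approximates (\<lambda>h x. - A h x) \<epsilon> f" if e: "0 < \<epsilon>" for \<epsilon>
  proof -
    obtain f where f: "f \<in> cc" "approximates A \<epsilon> f" using A(3)[OF e] by blast
    have "pnorm \<mu> p (\<lambda>x. - A h x - conv (\<lambda>x. - f x) h x) = pnorm \<mu> p (\<lambda>x. A h x - conv f h x)" for h
    proof -
      have "conv (\<lambda>x. - f x) h x = - conv f h x" for x by (simp add: conv_def)
      then show ?thesis using pnorm_minus_commute[of \<mu> p "A h" "conv f h"] by simp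
    qed
    then show ?thesis using f by (intro bexI[OF _ cc_uminus[OF f(1)]]) simp
  qed
  then show ?thesis
    using PF_iff[OF represents_neg[OF p1 A(1)]] linear_rep_neg[OF p1 A(2)] by blast
qed

text \<open>The splitting is A B - f g = (A - f) B + f (B - g), with f and g acting by
  convolution.\<close>

lemma approximates_compose:
  assumes A: "represents \<mu> p S A" and f: "f \<in> cc" "approximates A \<epsilon> f"
    and B: "represents \<mu> p T B" "linear_rep \<mu> p B D" and g: "g \<in> cc" "approximates B \<delta> g" and e: "0 \<le> \<epsilon>"
  shows "approximates (\<lambda>h. A (B h)) (\<epsilon> * D + (\<integral>x. norm (f x) \<partial>\<mu>) * \<delta>) (conv f g)"
proof
  fix h assume h: "h \<in> Lp_fun \<mu> p"
  note Bh = representsD(1)[OF p1 B(1) h]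
  note ABh = representsD(1)[OF p1 A Bh]
  note gh = conv_Lp(1)[OF p g(1) h]
  have "pnorm \<mu> p (\<lambda>x. A (B h) x - conv f (conv g h) x)
    \<le> pnorm \<mu> p (\<lambda>x. A (B h) x - conv f (B h) x) + pnorm \<mu> p (\<lambda>x. conv f (B h) x - conv f (conv g h) x)"
    by (rule pnorm_diff_triangle[OF p1 ABh conv_Lp(1)[OF p f(1) Bh] conv_Lp(1)[OF p f(1) gh]])
  also have "pnorm \<mu> p (\<lambda>x. A (B h) x - conv f (B h) x) \<le> \<epsilon> * pnorm \<mu> p (B h)" using f(2) Bh by blast
  also have "\<epsilon> * pnorm \<mu> p (B h) \<le> \<epsilon> * (D * pnorm \<mu> p h)"
    by (rule mult_left_mono[OF linear_repD(4)[OF p1 B(2) h] e])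
  also have "pnorm \<mu> p (\<lambda>x. conv f (B h) x - conv f (conv g h) x) \<le> (\<integral>x. norm (f x) \<partial>\<mu>) * (\<delta> * pnorm \<mu> p h)"
  proof -
    have "(\<lambda>x. conv f (B h) x - conv f (conv g h) x) = conv f (\<lambda>x. B h x - conv g h x)"
      by (rule ext) (rule conv_Lp_diff_right[OF p f(1) Bh gh, symmetric])
    then have "pnorm \<mu> p (\<lambda>x. conv f (B h) x - conv f (conv g h) x) \<le> (\<integral>x. norm (f x) \<partial>\<mu>) * pnorm \<mu> p (\<lambda>x. B h x - conv g h x)"
      using conv_Lp(2)[OF p f(1) Lp_fun_diff[OF p1 Bh gh]] by simp
    also have "\<dots> \<le> (\<integral>x. norm (f x) \<partial>\<mu>) * (\<delta> * pnorm \<mu> p h)"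
      using g(2) h by (intro mult_left_mono) auto
    finally show ?thesis .
  qed
  finally show "pnorm \<mu> p (\<lambda>x. A (B h) x - conv (conv f g) h x) \<le> (\<epsilon> * D + (\<integral>x. norm (f x) \<partial>\<mu>) * \<delta>) * pnorm \<mu> p h"
    by (simp add: conv_Lp_assoc[OF p f(1) g(1) h] algebra_simps)
qed

text \<open>The additive inverse of a product inside \<open>PF\<close> is characterised within the
  carrier, so evaluating \<open>bullet\<close> presupposes that products stay in it.\<close>

lemma PF_compose:
  assumes "S \<in> carrier (PF \<mu> p)" "T \<in> carrier (PF \<mu> p)" shows "compose (Lp \<mu> p) S T \<in> carrier (PF \<mu> p)"
proof -
  obtain A C where A: "represents \<mu> p S A" "linear_rep \<mu> p A C" "\<And>\<epsilon>. 0 < \<epsilon> \<Longrightarrow> \<exists>f\<in>cc. approximates A \<epsilon> f"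
    using PF_represents[OF assms(1)] by blast
  obtain B D where B: "represents \<mu> p T B" "linear_rep \<mu> p B D" "\<And>\<epsilon>. 0 < \<epsilon> \<Longrightarrow> \<exists>f\<in>cc. approximates B \<epsilon> f"
    using PF_represents[OF assms(2)] by blast
  have D0: "0 \<le> D" by (rule linear_repD(1)[OF p1 B(2)])
  have lin: "linear_rep \<mu> p (\<lambda>h. A (B h)) (C * D)"
    by (rule linear_rep_compose[OF p1 A(2) representsD(1)[OF p1 A(1)] represents_cong[OF p1 A(1)] B(2) representsD(1)[OF p1 B(1)]])
  have "\<exists>f\<in>cc. approximates (\<lambda>h. A (B h)) \<epsilon> f" if e: "0 < \<epsilon>" for \<epsilon>
  proof -
    define \<epsilon>1 where "\<epsilon>1 = \<epsilon> / 2 / (1 + D)"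
    have e1: "0 < \<epsilon>1" "\<epsilon>1 * D \<le> \<epsilon> / 2" using e D0 by (auto simp: \<epsilon>1_def field_simps)
    obtain f where f: "f \<in> cc" "approximates A \<epsilon>1 f" using A(3)[OF e1(1)] by blast
    define c where "c = (\<integral>x. norm (f x) \<partial>\<mu>)"
    have c0: "0 \<le> c" by (simp add: c_def)
    \<comment> \<open>The second tolerance is chosen after f, since the error of g is multiplied by
      the L^1 norm of f.\<close>
    define \<epsilon>2 where "\<epsilon>2 = \<epsilon> / 2 / (1 + c)"
    have e2: "0 < \<epsilon>2" "c * \<epsilon>2 \<le> \<epsilon> / 2" using e c0 by (auto simp: \<epsilon>2_def field_simps)
    obtain g where g: "g \<in> cc" "approximates B \<epsilon>2 g" using B(3)[OF e2(1)] by blast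
    have ap: "approximates (\<lambda>h. A (B h)) (\<epsilon>1 * D + c * \<epsilon>2) (conv f g)"
      unfolding c_def by (rule approximates_compose[OF A(1) f B(1,2) g less_imp_le[OF e1(1)]])
    have "approximates (\<lambda>h. A (B h)) \<epsilon> (conv f g)"
    proof
      fix h assume "h \<in> Lp_fun \<mu> p"
      then have "pnorm \<mu> p (\<lambda>x. A (B h) x - conv (conv f g) h x) \<le> (\<epsilon>1 * D + c * \<epsilon>2) * pnorm \<mu> p h" using ap by blast
      also have "\<dots> \<le> \<epsilon> * pnorm \<mu> p h" using e1 e2 by (intro mult_right_mono pnorm_nonneg) linarith
      finally show "pnorm \<mu> p (\<lambda>x. A (B h) x - conv (conv f g) h x) \<le> \<epsilon> * pnorm \<mu> p h" .
    qed
    then show ?thesis using conv_cc[OF f(1) g(1)] by blast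
  qed
  then show ?thesis using PF_iff[OF represents_compose[OF p1 A(1) B(1)]] lin by blast
qed

lemma bullet_PF:
  assumes a: "a \<in> carrier (PF \<mu> p)" and b: "b \<in> carrier (PF \<mu> p)"
  shows "bullet (PF \<mu> p) a b = add_op \<mu> p (add_op \<mu> p a b) (neg_op \<mu> p (compose (Lp \<mu> p) a b))"
proof -
  have add: "add (PF \<mu> p) = add_op \<mu> p" and mult: "mult (PF \<mu> p) = compose (Lp \<mu> p)"
    by (auto simp: PF_def bounded_ops_def add_op_def[OF p1] fun_eq_iff)
  have "\<ominus>\<^bsub>PF \<mu> p\<^esub> (compose (Lp \<mu> p) a b) = neg_op \<mu> p (compose (Lp \<mu> p) a b)"
  proof (rule a_inv_neg_op[OF p1 add])
    show "zero (PF \<mu> p) = (\<lambda>F\<in>Lp \<mu> p. Lp_class \<mu> p (\<lambda>x. 0))" by (simp add: PF_def bounded_ops_def)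
    show "carrier (PF \<mu> p) \<subseteq> {T. Lp_bounded_op \<mu> p T}" by (auto simp: PF_def bounded_ops_def)
    show "compose (Lp \<mu> p) a b \<in> carrier (PF \<mu> p)" by (rule PF_compose[OF a b])
    then show "neg_op \<mu> p (compose (Lp \<mu> p) a b) \<in> carrier (PF \<mu> p)" by (rule PF_neg)
  qed
  then show ?thesis by (simp add: bullet_def a_minus_def add mult)
qed

lemma bullet_represents:
  assumes "represents \<mu> p S A" "represents \<mu> p T B"
  shows "represents \<mu> p (add_op \<mu> p (add_op \<mu> p S T) (neg_op \<mu> p (compose (Lp \<mu> p) S T))) (\<lambda>h x. (A h x + B h x) + - A (B h) x)"
  by (intro represents_add[OF p1] represents_neg[OF p1] represents_compose[OF p1] assms)

definition circ :: "('a \<Rightarrow> complex) \<Rightarrow> ('a \<Rightarrow> complex) \<Rightarrow> 'a \<Rightarrow> complex" where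
  "circ f g x = (f x + g x) + - conv f g x"

lemma circ_cc: "f \<in> cc \<Longrightarrow> g \<in> cc \<Longrightarrow> circ f g \<in> cc"
  unfolding circ_def[abs_def] by (intro cc_add cc_uminus conv_cc)

text \<open>The sum contributes 2 \<epsilon>. The product is split as (A - f) g + A (B - g),
  contributing \<epsilon> (1 + D) + C \<epsilon>; here \<epsilon> \<le> 1 bounds the operator of g
  by D + 1.\<close>

lemma approximates_bullet:
  assumes A: "represents \<mu> p S A" "linear_rep \<mu> p A C" and f: "f \<in> cc" "approximates A \<epsilon> f"
    and B: "represents \<mu> p T B" "linear_rep \<mu> p B D" and g: "g \<in> cc" "approximates B \<epsilon> g" and e: "0 \<le> \<epsilon>" "\<epsilon> \<le> 1"
  shows "approximates (\<lambda>h x. (A h x + B h x) + - A (B h) x) (\<epsilon> * (3 + C + D)) (circ f g)"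
proof
  fix h assume h: "h \<in> Lp_fun \<mu> p"
  note Ah = representsD(1)[OF p1 A(1) h] and Bh = representsD(1)[OF p1 B(1) h]
  note fh = conv_Lp(1)[OF p f(1) h] and gh = conv_Lp(1)[OF p g(1) h]
  note ABh = representsD(1)[OF p1 A(1) Bh] and Agh = representsD(1)[OF p1 A(1) gh] and fgh = conv_Lp(1)[OF p f(1) gh]
  let ?h = "pnorm \<mu> p h"
  have C0: "0 \<le> C" by (rule linear_repD(1)[OF p1 A(2)])
  have 1: "pnorm \<mu> p (\<lambda>x. A h x - conv f h x) \<le> \<epsilon> * ?h" and 2: "pnorm \<mu> p (\<lambda>x. B h x - conv g h x) \<le> \<epsilon> * ?h"
    using f g h by blast+
  have gle: "pnorm \<mu> p (conv g h) \<le> (1 + D) * ?h"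
  proof -
    have "pnorm \<mu> p (conv g h) \<le> pnorm \<mu> p (\<lambda>x. conv g h x - B h x) + pnorm \<mu> p (B h)"
      using pnorm_diff_triangle[OF p1 gh Bh Lp_fun_zero] by simp
    also have "\<dots> \<le> \<epsilon> * ?h + D * ?h"
      using 2 linear_repD(4)[OF p1 B(2) h] by (intro add_mono) (auto simp: pnorm_minus_commute)
    also have "\<dots> \<le> 1 * ?h + D * ?h" using e by (intro add_mono mult_right_mono pnorm_nonneg) auto
    finally show ?thesis by (simp add: distrib_right)
  qed
  have 3: "pnorm \<mu> p (\<lambda>x. conv f (conv g h) x - A (B h) x) \<le> \<epsilon> * (1 + D) * ?h + C * \<epsilon> * ?h"
  proof -
    have "pnorm \<mu> p (\<lambda>x. conv f (conv g h) x - A (B h) x) \<le> pnorm \<mu> p (\<lambda>x. conv f (conv g h) x - A (conv g h) x) + pnorm \<mu> p (\<lambda>x. A (conv g h) x - A (B h) x)"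
      by (rule pnorm_diff_triangle[OF p1 fgh Agh ABh])
    also have "pnorm \<mu> p (\<lambda>x. conv f (conv g h) x - A (conv g h) x) \<le> \<epsilon> * pnorm \<mu> p (conv g h)"
      using f(2) gh by (subst pnorm_minus_commute) blast
    also have "\<epsilon> * pnorm \<mu> p (conv g h) \<le> \<epsilon> * ((1 + D) * ?h)" by (rule mult_left_mono[OF gle e(1)])
    also have "pnorm \<mu> p (\<lambda>x. A (conv g h) x - A (B h) x) \<le> C * pnorm \<mu> p (\<lambda>x. conv g h x - B h x)"
      by (rule linear_rep_diff(2)[OF p1 A(2) representsD(1)[OF p1 A(1)] gh Bh])
    also have "C * pnorm \<mu> p (\<lambda>x. conv g h x - B h x) \<le> C * (\<epsilon> * ?h)"
      using 2 C0 by (intro mult_left_mono) (auto simp: pnorm_minus_commute)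
    finally show ?thesis by (simp add: mult.assoc)
  qed
  have eq: "conv (circ f g) h x = (conv f h x + conv g h x) + - conv f (conv g h) x" for x
  proof -
    have fg: "conv f g \<in> cc" by (rule conv_cc[OF f(1) g(1)])
    have "conv (circ f g) h x = conv (\<lambda>x. f x + g x) h x + conv (\<lambda>x. - conv f g x) h x"
      unfolding circ_def[abs_def] by (rule conv_Lp_add_left[OF p cc_add[OF f(1) g(1)] cc_uminus[OF fg] h])
    also have "conv (\<lambda>x. f x + g x) h x = conv f h x + conv g h x" by (rule conv_Lp_add_left[OF p f(1) g(1) h])
    also have "conv (\<lambda>x. - conv f g x) h x = - conv (conv f g) h x" by (simp add: conv_def)
    finally show ?thesis by (simp add: conv_Lp_assoc[OF p f(1) g(1) h])
  qed
  have "pnorm \<mu> p (\<lambda>x. ((A h x + B h x) + - A (B h) x) - conv (circ f g) h x)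
    = pnorm \<mu> p (\<lambda>x. ((A h x - conv f h x) + (B h x - conv g h x)) + (conv f (conv g h) x - A (B h) x))"
    by (simp add: eq algebra_simps)
  also have "\<dots> \<le> pnorm \<mu> p (\<lambda>x. (A h x - conv f h x) + (B h x - conv g h x)) + pnorm \<mu> p (\<lambda>x. conv f (conv g h) x - A (B h) x)"
    by (intro pnorm_add Lp_fun_add Lp_fun_diff p1 Ah fh Bh gh fgh ABh)
  also have "pnorm \<mu> p (\<lambda>x. (A h x - conv f h x) + (B h x - conv g h x)) \<le> pnorm \<mu> p (\<lambda>x. A h x - conv f h x) + pnorm \<mu> p (\<lambda>x. B h x - conv g h x)"
    by (intro pnorm_add Lp_fun_diff p1 Ah fh Bh gh)
  finally show "pnorm \<mu> p (\<lambda>x. ((A h x + B h x) + - A (B h) x) - conv (circ f g) h x) \<le> \<epsilon> * (3 + C + D) * ?h"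
    using 1 2 3 by (simp add: algebra_simps)
qed

lemma approximates_conv_bound:
  assumes A: "represents \<mu> p S A" "linear_rep \<mu> p A C" and f: "f \<in> cc" "approximates A \<epsilon> f" and e: "0 \<le> \<epsilon>"
  shows "conv_bound p (C + \<epsilon>) f"
  unfolding conv_bound_def
proof (intro conjI ballI)
  show "0 \<le> C + \<epsilon>" using linear_repD(1)[OF p1 A(2)] e by simp
  fix h :: "'a \<Rightarrow> complex" assume "h \<in> cc"
  then have h: "h \<in> Lp_fun \<mu> p" using cc_Lp p by simp
  have "pnorm \<mu> p (conv f h) \<le> pnorm \<mu> p (\<lambda>x. conv f h x - A h x) + pnorm \<mu> p (A h)"
    using pnorm_diff_triangle[OF p1 conv_Lp(1)[OF p f(1) h] representsD(1)[OF p1 A(1) h] Lp_fun_zero] by simp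
  also have "\<dots> \<le> \<epsilon> * pnorm \<mu> p h + C * pnorm \<mu> p h"
    using f(2) h linear_repD(4)[OF p1 A(2) h] by (intro add_mono) (auto simp: pnorm_minus_commute)
  finally show "pnorm \<mu> p (conv f h) \<le> (C + \<epsilon>) * pnorm \<mu> p h" by (simp add: distrib_right)
qed

lemma conv_bound_diff:
  assumes A: "represents \<mu> p S A" and f: "f \<in> cc" "approximates A \<epsilon> f" and g: "g \<in> cc" "approximates A \<delta> g"
    and e: "0 \<le> \<epsilon>" "0 \<le> \<delta>"
  shows "conv_bound p (\<epsilon> + \<delta>) (\<lambda>x. f x - g x)"
  unfolding conv_bound_def
proof (intro conjI ballI)
  show "0 \<le> \<epsilon> + \<delta>" using e by simp
  fix h :: "'a \<Rightarrow> complex" assume hcc: "h \<in> cc"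
  then have h: "h \<in> Lp_fun \<mu> p" using cc_Lp p by simp
  have "conv (\<lambda>x. f x - g x) h = (\<lambda>x. conv f h x - conv g h x)" by (rule ext) (rule conv_diff_left[OF f(1) g(1) hcc])
  then have "pnorm \<mu> p (conv (\<lambda>x. f x - g x) h) \<le> pnorm \<mu> p (\<lambda>x. conv f h x - A h x) + pnorm \<mu> p (\<lambda>x. A h x - conv g h x)"
    using pnorm_diff_triangle[OF p1 conv_Lp(1)[OF p f(1) h] representsD(1)[OF p1 A h] conv_Lp(1)[OF p g(1) h]] by simp
  also have "\<dots> \<le> \<epsilon> * pnorm \<mu> p h + \<delta> * pnorm \<mu> p h"
    using f(2) g(2) h by (intro add_mono) (auto simp: pnorm_minus_commute)
  finally show "pnorm \<mu> p (conv (\<lambda>x. f x - g x) h) \<le> (\<epsilon> + \<delta>) * pnorm \<mu> p h" by (simp add: distrib_right)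
qed

section \<open>The passage from L^2 back to L^p\<close>

lemma pnorm_tendsto_AE_subseq:
  assumes r: "0 < r" and F: "\<And>n. F n \<in> Lp_fun \<mu> r" and lim: "(\<lambda>n. pnorm \<mu> r (F n)) \<longlonglongrightarrow> 0"
  obtains s :: "nat \<Rightarrow> nat" where "strict_mono s" "AE x in \<mu>. (\<lambda>n. F (s n) x) \<longlonglongrightarrow> 0"
proof -
  have "(\<lambda>n. pnorm \<mu> r (F n) powr r) \<longlonglongrightarrow> 0 powr r"
    by (intro tendsto_powr2 lim tendsto_const always_eventually allI pnorm_nonneg r)
  then have "(\<lambda>n. \<integral>x. norm (norm (F n x) powr r) \<partial>\<mu>) \<longlonglongrightarrow> 0" using r by (simp add: pnorm_powr)
  moreover have "integrable \<mu> (\<lambda>x. norm (F n x) powr r)" for n by (rule Lp_funD(2)[OF F])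
  ultimately obtain s :: "nat \<Rightarrow> nat" where s: "strict_mono s" "AE x in \<mu>. (\<lambda>n. norm (F (s n) x) powr r) \<longlonglongrightarrow> 0"
    using tendsto_L1_AE_subseq[of \<mu> "\<lambda>n x. norm (F n x) powr r"] by blast
  from s(2) have "AE x in \<mu>. (\<lambda>n. F (s n) x) \<longlonglongrightarrow> 0"
  proof eventually_elim
    case (elim x)
    have "(\<lambda>n. (norm (F (s n) x) powr r) powr (1 / r)) \<longlonglongrightarrow> 0 powr (1 / r)"
      by (rule tendsto_powr2[OF elim tendsto_const]) (use r in auto)
    then have "(\<lambda>n. norm (F (s n) x)) \<longlonglongrightarrow> 0" using r by (simp add: powr_powr)
    then show ?case by (rule tendsto_norm_zero_cancel)
  qed
  with s(1) show ?thesis by (rule that)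
qed

text \<open>A subsequence converges almost everywhere to k, and a further one to 0. This converts
  the Hilbert space conclusion into one about the operator on L^p.\<close>

lemma limits_agree:
  assumes k: "k \<in> Lp_fun \<mu> p" and F: "\<And>n. F n \<in> cc"
    and limp: "(\<lambda>n. pnorm \<mu> p (\<lambda>x. k x - F n x)) \<longlonglongrightarrow> 0" and lim2: "(\<lambda>n. pnorm \<mu> 2 (F n)) \<longlonglongrightarrow> 0"
  shows "AE x in \<mu>. k x = 0"
proof -
  have FL: "F n \<in> Lp_fun \<mu> p" "F n \<in> Lp_fun \<mu> 2" for n using cc_Lp[OF F] p by auto
  obtain s :: "nat \<Rightarrow> nat" where s: "strict_mono s" "AE x in \<mu>. (\<lambda>n. k x - F (s n) x) \<longlonglongrightarrow> 0"
    using pnorm_tendsto_AE_subseq[of p "\<lambda>n x. k x - F n x"] p Lp_fun_diff[OF p1 k FL(1)] limp by auto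
  have "(\<lambda>n. pnorm \<mu> 2 (F (s n))) \<longlonglongrightarrow> 0" using LIMSEQ_subseq_LIMSEQ[OF lim2 s(1)] by (simp add: o_def)
  then obtain t :: "nat \<Rightarrow> nat" where t: "strict_mono t" "AE x in \<mu>. (\<lambda>n. F (s (t n)) x) \<longlonglongrightarrow> 0"
    using pnorm_tendsto_AE_subseq[of 2 "\<lambda>n. F (s n)"] FL(2) by auto
  from s(2) t(2) show ?thesis
  proof eventually_elim
    case (elim x)
    have "(\<lambda>n. k x - F (s (t n)) x) \<longlonglongrightarrow> 0" using LIMSEQ_subseq_LIMSEQ[OF elim(1) t(1)] by (simp add: o_def)
    from tendsto_add[OF this elim(2)] have "(\<lambda>n. k x) \<longlonglongrightarrow> 0" by simp
    then show ?case by (simp add: LIMSEQ_const_iff)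
  qed
qed

theorem PF_directly_finite: "directly_finite (PF \<mu> p)"
  unfolding directly_finite_def
proof (intro ballI impI)
  fix a b assume a: "a \<in> carrier (PF \<mu> p)" and b: "b \<in> carrier (PF \<mu> p)" and ab: "bullet (PF \<mu> p) a b = \<zero>\<^bsub>PF \<mu> p\<^esub>"
  have zero: "\<zero>\<^bsub>PF \<mu> p\<^esub> = (\<lambda>F\<in>Lp \<mu> p. Lp_class \<mu> p (\<lambda>x. 0))" by (simp add: PF_def bounded_ops_def)
  obtain A C where A: "represents \<mu> p a A" "linear_rep \<mu> p A C" "\<And>\<epsilon>. 0 < \<epsilon> \<Longrightarrow> \<exists>f\<in>cc. approximates A \<epsilon> f"
    using PF_represents[OF a] by blast
  obtain B D where B: "represents \<mu> p b B" "linear_rep \<mu> p B D" "\<And>\<epsilon>. 0 < \<epsilon> \<Longrightarrow> \<exists>f\<in>cc. approximates B \<epsilon> f"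
    using PF_represents[OF b] by blast
  define \<epsilon> where "\<epsilon> n = 1 / real (Suc n)" for n
  have e: "0 < \<epsilon> n" "\<epsilon> n \<le> 1" for n by (auto simp: \<epsilon>_def)
  have e_lim: "\<epsilon> \<longlonglongrightarrow> 0" unfolding \<epsilon>_def[abs_def] by (rule LIMSEQ_Suc[OF lim_1_over_n])
  define f where "f n = (SOME f. f \<in> cc \<and> approximates A (\<epsilon> n) f)" for n
  define g where "g n = (SOME g. g \<in> cc \<and> approximates B (\<epsilon> n) g)" for n
  have f': "f n \<in> cc \<and> approximates A (\<epsilon> n) (f n)" for n
    unfolding f_def by (rule someI_ex[OF A(3)[OF e(1), unfolded Bex_def]])
  have g': "g n \<in> cc \<and> approximates B (\<epsilon> n) (g n)" for n
    unfolding g_def by (rule someI_ex[OF B(3)[OF e(1), unfolded Bex_def]])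
  note f = f'[THEN conjunct1] f'[THEN conjunct2] and g = g'[THEN conjunct1] g'[THEN conjunct2]
  define K where "K = 3 + C + D"
  have K0: "0 \<le> K" using linear_repD(1)[OF p1 A(2)] linear_repD(1)[OF p1 B(2)] by (simp add: K_def)
  define E1 where "E1 h x = (A h x + B h x) + - A (B h) x" for h x
  define E2 where "E2 h x = (B h x + A h x) + - B (A h) x" for h x
  have ap1: "approximates E1 (\<epsilon> n * K) (circ (f n) (g n))" for n
    unfolding E1_def[abs_def] K_def
    by (rule approximates_bullet[OF A(1,2) f(1,2) B(1,2) g(1,2) less_imp_le[OF e(1)] e(2)])
  have ap2: "approximates E2 (\<epsilon> n * K) (circ (g n) (f n))" for n
    unfolding E2_def[abs_def] K_def
    using approximates_bullet[OF B(1,2) g(1,2)[of n] A(1,2) f(1,2)[of n] less_imp_le[OF e(1)] e(2)]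
    by (simp add: add.assoc add.commute[of C D])
  have rep1: "represents \<mu> p (bullet (PF \<mu> p) a b) E1" unfolding bullet_PF[OF a b] E1_def[abs_def] by (rule bullet_represents[OF A(1) B(1)])
  have rep2: "represents \<mu> p (bullet (PF \<mu> p) b a) E2" unfolding bullet_PF[OF b a] E2_def[abs_def] by (rule bullet_represents[OF B(1) A(1)])
  have E1_zero: "pnorm \<mu> p (E1 h) = 0" if h: "h \<in> Lp_fun \<mu> p" for h
  proof -
    have "Lp_class \<mu> p (E1 h) = Lp_class \<mu> p (\<lambda>x. 0)"
      using representsD(2)[OF p1 rep1 h] by (simp add: ab zero Lp_class_in h)
    then have "AE x in \<mu>. E1 h x = 0"
      using Lp_class_eq_iff[OF representsD(1)[OF p1 rep1 h] Lp_fun_zero] by simp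
    then have "pnorm \<mu> p (E1 h) = pnorm \<mu> p (\<lambda>x. 0 :: complex)"
      by (intro pnorm_cong_AE Lp_funD(1)[OF representsD(1)[OF p1 rep1 h]]) auto
    then show ?thesis by (simp add: pnorm_zero)
  qed
  \<comment> \<open>The map vanishes almost everywhere at each argument, so it is a representative
    with bound 0. Then \<open>approximates_conv_bound\<close> bounds the operator norms of the
    functions \<open>circ (f n) (g n)\<close> by a null sequence.\<close>
  have lin_zero: "linear_rep \<mu> p E1 0"
    unfolding linear_rep_def[OF p1]
  proof (intro conjI ballI allI)
    have ae: "AE x in \<mu>. E1 h x = 0" if "h \<in> Lp_fun \<mu> p" for h
      using pnorm_zero_AE[OF Lp_funD(1,2)[OF representsD(1)[OF p1 rep1 that]] _ E1_zero[OF that]] p by simp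
    fix h assume h: "h \<in> Lp_fun \<mu> p"
    show "AE x in \<mu>. E1 (\<lambda>x. h x + k x) x = E1 h x + E1 k x" if k: "k \<in> Lp_fun \<mu> p" for k
      using ae[OF h] ae[OF k] ae[OF Lp_fun_add[OF p1 h k]] by eventually_elim simp
    show "AE x in \<mu>. E1 (\<lambda>x. c * h x) x = c * E1 h x" for c
      using ae[OF h] ae[OF Lp_fun_cmult[OF h, of c]] by eventually_elim simp
    show "pnorm \<mu> p (E1 h) \<le> 0 * pnorm \<mu> p h" using E1_zero[OF h] by simp
  qed simp
  interpret H: hilbert_algebra cf_mult cf_star cf_ip "cf_norm p" by (rule hilbert_algebra_cfun[OF p])
  define x where "x n = Abs_cfun (f n)" for n
  define y where "y n = Abs_cfun (g n)" for n
  have Rx: "Rep_cfun (x n) = f n" and Ry: "Rep_cfun (y n) = g n" for n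
    using f(1) g(1) by (simp_all add: x_def y_def Abs_cfun_inverse)
  have R_circ: "Rep_cfun (x n + y n - cf_mult (x n) (y n)) = circ (f n) (g n)" "Rep_cfun (x n + y n - cf_mult (y n) (x n)) = circ (g n) (f n)" for n
    by (simp_all add: fun_eq_iff plus_cfun.rep_eq minus_cfun.rep_eq Rep_mult Rx Ry circ_def)
  define N where "N = max 1 (Herz_const p)"
  have N0: "0 < N" by (simp add: N_def)
  have cf_le: "cf_norm p z \<le> N * c" if "conv_bound p c (Rep_cfun z)" for z c
    unfolding cf_norm_def N_def[symmetric] using conv_norm_le[OF that] N0 by simp
  have null: "(\<lambda>n. H.nrm (cf_mult (x n + y n - cf_mult (y n) (x n)) z)) \<longlonglongrightarrow> 0" for z
  proof (rule H.bullet_swap)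
    fix \<eta> :: real assume \<eta>: "0 < \<eta>"
    have "eventually (\<lambda>n. \<epsilon> n < \<eta> / (2 * N)) sequentially"
      using \<eta> N0 by (intro order_tendstoD(2)[OF e_lim]) simp
    then obtain n0 where n0: "\<And>n. n \<ge> n0 \<Longrightarrow> \<epsilon> n < \<eta> / (2 * N)" by (auto simp: eventually_sequentially)
    have "cf_norm p (x m - x n) \<le> \<eta>" if "m \<ge> n0" "n \<ge> n0" for m n
    proof -
      have "conv_bound p (\<epsilon> m + \<epsilon> n) (Rep_cfun (x m - x n))"
        unfolding minus_cfun.rep_eq Rx by (rule conv_bound_diff[OF A(1) f(1,2) f(1,2) less_imp_le[OF e(1)] less_imp_le[OF e(1)]])
      then have "cf_norm p (x m - x n) \<le> N * (\<epsilon> m + \<epsilon> n)" by (rule cf_le)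
      also have "\<dots> \<le> N * (\<eta> / (2 * N) + \<eta> / (2 * N))"
        using n0[OF that(1)] n0[OF that(2)] N0 by (intro mult_left_mono add_mono) auto
      also have "\<dots> = \<eta>" using N0 by (simp add: field_simps)
      finally show ?thesis .
    qed
    then show "\<exists>n0. \<forall>m\<ge>n0. \<forall>n\<ge>n0. cf_norm p (x m - x n) \<le> \<eta>" by blast
  next
    fix n
    have "conv_bound p (D + \<epsilon> n) (Rep_cfun (y n))"
      unfolding Ry by (rule approximates_conv_bound[OF B(1,2) g(1,2) less_imp_le[OF e(1)]])
    then have "cf_norm p (y n) \<le> N * (D + \<epsilon> n)" by (rule cf_le)
    also have "\<dots> \<le> N * (D + 1)" using e(2)[of n] N0 by simp
    finally show "cf_norm p (y n) \<le> N * (D + 1)" .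
  next
    have "cf_norm p (x n + y n - cf_mult (x n) (y n)) \<le> N * (0 + \<epsilon> n * K)" for n
    proof (rule cf_le)
      show "conv_bound p (0 + \<epsilon> n * K) (Rep_cfun (x n + y n - cf_mult (x n) (y n)))"
        unfolding R_circ
        by (rule approximates_conv_bound[OF rep1 lin_zero circ_cc[OF f(1) g(1)] ap1]) (use e(1)[of n] K0 in simp)
    qed
    moreover have "(\<lambda>n. N * (0 + \<epsilon> n * K)) \<longlonglongrightarrow> N * (0 + 0 * K)" by (intro tendsto_intros e_lim)
    then have "(\<lambda>n. N * (0 + \<epsilon> n * K)) \<longlonglongrightarrow> 0" by simp
    ultimately show "(\<lambda>n. cf_norm p (x n + y n - cf_mult (x n) (y n))) \<longlonglongrightarrow> 0"
      by (rule LIMSEQ_zero_le[OF _ H.N_nonneg, rotated])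
  qed
  \<comment> \<open>For h in C_c the convolutions of \<open>circ (g n) (f n)\<close> with h tend to
    \<open>E2 h\<close> in L^p by approximation, and to 0 in L^2 by \<open>null\<close>.\<close>
  have E2_cc: "pnorm \<mu> p (E2 h) = 0" if h: "h \<in> cc" for h
  proof -
    have hL: "h \<in> Lp_fun \<mu> p" using cc_Lp[OF h] p by simp
    note E2L = representsD(1)[OF p1 rep2 hL]
    have "AE x in \<mu>. E2 h x = 0"
    proof (rule limits_agree[OF E2L])
      show "conv (circ (g n) (f n)) h \<in> cc" for n by (intro conv_cc circ_cc f g h)
      have "(\<lambda>n. \<epsilon> n * K * pnorm \<mu> p h) \<longlonglongrightarrow> 0 * K * pnorm \<mu> p h" by (intro tendsto_intros e_lim)
      then have "(\<lambda>n. \<epsilon> n * K * pnorm \<mu> p h) \<longlonglongrightarrow> 0" by simp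
      then show "(\<lambda>n. pnorm \<mu> p (\<lambda>x. E2 h x - conv (circ (g n) (f n)) h x)) \<longlonglongrightarrow> 0"
        by (rule LIMSEQ_zero_le[OF _ pnorm_nonneg]) (use ap2 hL in blast)
      have "H.nrm (cf_mult (x n + y n - cf_mult (y n) (x n)) (Abs_cfun h)) = pnorm \<mu> 2 (conv (circ (g n) (f n)) h)" for n
        unfolding H.nrm_def cf_ip_self Rep_mult R_circ by (simp add: Abs_cfun_inverse h)
      then show "(\<lambda>n. pnorm \<mu> 2 (conv (circ (g n) (f n)) h)) \<longlonglongrightarrow> 0" using null[of "Abs_cfun h"] by simp
    qed
    then have "pnorm \<mu> p (E2 h) = pnorm \<mu> p (\<lambda>x. 0 :: complex)"
      by (intro pnorm_cong_AE Lp_funD(1)[OF E2L]) auto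
    then show ?thesis by (simp add: pnorm_zero)
  qed
  have "\<exists>L. linear_rep \<mu> p E2 L"
  proof -
    have BA: "linear_rep \<mu> p (\<lambda>h. B (A h)) (D * C)"
      by (rule linear_rep_compose[OF p1 B(2) representsD(1)[OF p1 B(1)] represents_cong[OF p1 B(1)] A(2) representsD(1)[OF p1 A(1)]])
    note reps = representsD(1)[OF p1 represents_add[OF p1 B(1) A(1)]] representsD(1)[OF p1 represents_neg[OF p1 represents_compose[OF p1 B(1) A(1)]]]
    show ?thesis
      unfolding E2_def[abs_def]
      using linear_rep_add[OF p1 linear_rep_add[OF p1 B(2) representsD(1)[OF p1 B(1)] A(2) representsD(1)[OF p1 A(1)]] reps(1)
        linear_rep_neg[OF p1 BA] reps(2)] by blast
  qed
  then obtain L where L: "linear_rep \<mu> p E2 L" by blast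
  \<comment> \<open>Boundedness of \<open>E2\<close> carries the result from the dense subspace C_c
    to all of L^p.\<close>
  have "AE x in \<mu>. E2 h x = 0" if h: "h \<in> Lp_fun \<mu> p" for h
  proof -
    obtain k where k: "\<And>n. k n \<in> cc" "(\<lambda>n. pnorm \<mu> p (\<lambda>x. h x - k n x)) \<longlonglongrightarrow> 0"
      using cc_dense_seq[OF p1 h] by blast
    have kL: "k n \<in> Lp_fun \<mu> p" for n using cc_Lp[OF k(1)] p by simp
    have le: "pnorm \<mu> p (E2 h) \<le> L * pnorm \<mu> p (\<lambda>x. h x - k n x)" for n
    proof -
      have "pnorm \<mu> p (E2 h) \<le> pnorm \<mu> p (\<lambda>x. E2 h x - E2 (k n) x) + pnorm \<mu> p (E2 (k n))"
        using pnorm_diff_triangle[OF p1 representsD(1)[OF p1 rep2 h] representsD(1)[OF p1 rep2 kL] Lp_fun_zero] by simp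
      also have "\<dots> \<le> L * pnorm \<mu> p (\<lambda>x. h x - k n x) + 0"
        using linear_rep_diff(2)[OF p1 L representsD(1)[OF p1 rep2] h kL] E2_cc[OF k(1)] by (intro add_mono) auto
      finally show ?thesis by simp
    qed
    have "(\<lambda>n. L * pnorm \<mu> p (\<lambda>x. h x - k n x)) \<longlonglongrightarrow> L * 0" by (intro tendsto_intros k(2))
    then have "pnorm \<mu> p (E2 h) \<le> L * 0" by (rule LIMSEQ_le_const) (use le in blast)
    then have "pnorm \<mu> p (E2 h) = 0" using pnorm_nonneg[of \<mu> p "E2 h"] by simp
    then show ?thesis
      using pnorm_zero_AE[OF Lp_funD(1,2)[OF representsD(1)[OF p1 rep2 h]]] p by simp
  qed
  then show "bullet (PF \<mu> p) b a = \<zero>\<^bsub>PF \<mu> p\<^esub>"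
    unfolding zero by (rule represents_eqI[OF p1 rep2 represents_zero[OF p1]])
qed

end

theorem theorem1p4:
  fixes \<mu> :: "'a::{topological_group_add, t2_space} measure" and p :: real
  assumes "locally_compact_space (euclidean :: 'a topology)"
    and "left_haar_measure \<mu>"
    and "unimodular \<mu>"
    and "amenable \<mu>"
    and "1 < p"
  shows "directly_finite (PF \<mu> p)"
proof -
  interpret pseudofunctions \<mu> p by unfold_locales (use assms in auto)
  show ?thesis by (rule PF_directly_finite)
qed

end
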